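(* Let $m,n\ge 1$ be integers and $T>0$. Let $A(t,D_x)=\sum_{k=1}^n A_k(t)D_{x_k}$ and $B(t)$, where the entries of the $m\times m$ matrices $A_1(t),\dots,A_n(t)$ and $B(t)$ are of class $C^{m-1}$ on $[0,T]$. Assume that for all $t\in[0,T]$ and $\xi\in\mathbb{R}^n$ the matrix $A(t,\xi)=\sum_{k=1}^n\xi_kA_k(t)$ has $m$ real eigenvalues (counted with multiplicity), ordered as $\lambda_1(t,\xi)\le\dots\le\lambda_m(t,\xi)$. Assume that, for some $0<\alpha\le 1$, the eigenvalues are of H\"older class $C^\alpha$ with respect to $t$ (Lipschitz if $\alpha=1$), i.e. there is a constant $M>0$ such that $$|\lambda_j(t,\xi)-\lambda_j(t',\xi)|\le M|\xi|\,|t-t'|^\alpha\quad\text{for all } 1\le j\le m,\ t,t'\in[0,T],\ \xi\in\mathbb{R}^n.$$ Assume moreover that there is a constant $c>0$ such that $$|\lambda_i(t,\xi)-\lambda_j(t,\xi)|\le c\,|\lambda_k(t,\xi)-\lambda_{k-1}(t,\xi)|$$ for all $1\le i,j\le m$, $2\le k\le m$, $t\in[0,T]$ and $\xi\in\mathbb{R}^n$. Let $$1<s\le 1+\min\Bigl\{\alpha,\frac{1}{m-1}\Bigr\}$$ and let $g_0\in(\mathcal{E}'_{(s)}(\mathbb{R}^n))^m$. Then the Cauchy problem $$D_tu-A(t,D_x)u-B(t)u=0,\quad x\in\mathbb{R}^n,\ t\in[0,T],\qquad u|_{t=0}=g_0,$$ has a unique solution $u\in C^1([0,T],(\mathcal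{D}'_{(s)}(\mathbb{R}^n))^m)$.
   Context: Notation: $D_t=-\mathrm{i}\,\partial_t$ and $D_{x_k}=-\mathrm{i}\,\partial_{x_k}$; $u$ and $g_0$ are column vectors with $m$ entries. The coefficients are complex valued and depend only on $t$. For $m=1$, $\frac{1}{m-1}$ is read as $+\infty$. For $1<s<\infty$, the Gevrey-Beurling space $\gamma^{(s)}(\mathbb{R}^n)$ is the space of all $f\in C^\infty(\mathbb{R}^n)$ such that for every compact set $K\subset\mathbb{R}^n$ and every constant $A>0$ there exists a constant $C_{A,K}>0$ such that for all $\beta\in\mathbb{N}_0^n$ $$\sup_{x\in K}|\partial^\beta f(x)|\le C_{A,K}A^{|\beta|}(\beta!)^s,$$ equipped with its usual locally convex topology. $\gamma^{(s)}_c(\mathbb{R}^n)$ denotes the space of compactly supported functions in $\gamma^{(s)}(\mathbb{R}^n)$, with its usual locally convex topology. $\mathcal{D}'_{(s)}(\mathbb{R}^n):=(\gamma^{(s)}_c(\mathbb{R}^n))'$ is the topological dual of $\gamma^{(s)}_c(\mathbb{R}^n)$, and $\mathcal{E}'_{(s)}(\mathbb{R}^n)$ is the topological dual of $\gamma^{(s)}(\mathbb{R}^n)$ (regarded as a subspace of $\mathcal{D}'_{(s)}(\mathbb{R}^n)$ by restriction). A superscript $m$ denotes $m$-vectors with entries in the given space. Derivatives in $x$ act on ultradistributions by duality. *)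

theory Defs
  imports "HOL-Analysis.Analysis" "HOL-Computational_Algebra.Polynomial"
begin

section \<open>Locally convex topologies on spaces of complex-valued functions\<close>

text \<open>
  Vectors are complex-valued functions, with pointwise operations, and a space is a set \<open>V\<close> of
  such functions.  This covers the test functions on \<open>\<real>\<^sup>n\<close> as well as the functionals on them.
\<close>

definition lc_topology ::
  "('a \<Rightarrow> complex) set \<Rightarrow> (('a \<Rightarrow> complex) \<Rightarrow> real) set \<Rightarrow> ('a \<Rightarrow> complex) topology"
  where
  "lc_topology V P = topology (\<lambda>U. U \<subseteq> V \<and>
     (\<forall>f\<in>U. \<exists>F e. finite F \<and> F \<subseteq> P \<and> 0 < e \<and>
        {g \<in> V. \<forall>p\<in>F. p (\<lambda>x. g x - f x) < e} \<subseteq> U))"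

lemma openin_lc_topology:
  "openin (lc_topology V P) U \<longleftrightarrow> U \<subseteq> V \<and>
     (\<forall>f\<in>U. \<exists>F e. finite F \<and> F \<subseteq> P \<and> 0 < e \<and>
        {g \<in> V. \<forall>p\<in>F. p (\<lambda>x. g x - f x) < e} \<subseteq> U)"
proof -
  let ?N = "\<lambda>f F e. {g \<in> V. \<forall>p\<in>F. p (\<lambda>x. g x - f x) < (e::real)}"
  let ?L = "\<lambda>U. U \<subseteq> V \<and> (\<forall>f\<in>U. \<exists>F e. finite F \<and> F \<subseteq> P \<and> 0 < e \<and> ?N f F e \<subseteq> U)"
  have "istopology ?L"
    unfolding istopology_def
  proof (intro conjI allI impI)
    fix S T assume S: "?L S" and T: "?L T"
    show "S \<inter> T \<subseteq> V" using S by blast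
    show "\<forall>f\<in>S \<inter> T. \<exists>F e. finite F \<and> F \<subseteq> P \<and> 0 < e \<and> ?N f F e \<subseteq> S \<inter> T"
    proof
      fix f assume f: "f \<in> S \<inter> T"
      obtain F1 e1 where 1: "finite F1" "F1 \<subseteq> P" "0 < e1" "?N f F1 e1 \<subseteq> S"
        using S f by blast
      obtain F2 e2 where 2: "finite F2" "F2 \<subseteq> P" "0 < e2" "?N f F2 e2 \<subseteq> T"
        using T f by blast
      have "?N f (F1 \<union> F2) (min e1 e2) \<subseteq> ?N f F1 e1 \<inter> ?N f F2 e2" by auto
      then have "?N f (F1 \<union> F2) (min e1 e2) \<subseteq> S \<inter> T"
        using 1(4) 2(4) by (meson Int_mono order_trans)
      moreover have "finite (F1 \<union> F2)" "F1 \<union> F2 \<subseteq> P" "0 < min e1 e2"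
        using 1 2 by simp_all
      ultimately show "\<exists>F e. finite F \<and> F \<subseteq> P \<and> 0 < e \<and> ?N f F e \<subseteq> S \<inter> T" by (intro exI conjI)
    qed
  next
    fix \<K> assume K: "\<forall>U\<in>\<K>. ?L U"
    show "\<Union>\<K> \<subseteq> V" using K by blast
    show "\<forall>f\<in>\<Union>\<K>. \<exists>F e. finite F \<and> F \<subseteq> P \<and> 0 < e \<and> ?N f F e \<subseteq> \<Union>\<K>"
    proof
      fix f assume "f \<in> \<Union>\<K>"
      then obtain U where U: "U \<in> \<K>" "f \<in> U" by (rule UnionE)
      have "?L U" using K U(1) by (rule bspec)
      then have "\<exists>F e. finite F \<and> F \<subseteq> P \<and> 0 < e \<and> ?N f F e \<subseteq> U"
        using U(2) by (rule bspec[OF conjunct2])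
      then obtain F e where Fe: "finite F" "F \<subseteq> P" "0 < e" "?N f F e \<subseteq> U" by (elim exE conjE)
      have "?N f F e \<subseteq> \<Union>\<K>" using Fe(4) Union_upper[OF U(1)] by (rule order_trans)
      with Fe(1-3) show "\<exists>F e. finite F \<and> F \<subseteq> P \<and> 0 < e \<and> ?N f F e \<subseteq> \<Union>\<K>"
        by (intro exI conjI)
    qed
  qed
  then show ?thesis
    unfolding lc_topology_def by (simp only: topology_inverse')
qed

lemma topspace_lc_topology: "topspace (lc_topology V P) = V"
proof
  show "topspace (lc_topology V P) \<subseteq> V"
    using openin_topspace[of "lc_topology V P"] unfolding openin_lc_topology by (rule conjunct1)
  have "openin (lc_topology V P) V"
    unfolding openin_lc_topology
    by (intro conjI ballI exI[of _ "{}"] exI[of _ 1]) auto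
  then show "V \<subseteq> topspace (lc_topology V P)"
    by (rule openin_subset)
qed

definition is_seminorm_on :: "('a \<Rightarrow> complex) set \<Rightarrow> (('a \<Rightarrow> complex) \<Rightarrow> real) \<Rightarrow> bool" where
  "is_seminorm_on V q \<longleftrightarrow>
     (\<forall>f\<in>V. 0 \<le> q f) \<and>
     (\<forall>f\<in>V. \<forall>g\<in>V. q (\<lambda>x. f x + g x) \<le> q f + q g) \<and>
     (\<forall>c. \<forall>f\<in>V. q (\<lambda>x. c * f x) = norm c * q f)"

definition is_linear_on :: "('a \<Rightarrow> complex) set \<Rightarrow> (('a \<Rightarrow> complex) \<Rightarrow> complex) \<Rightarrow> bool" where
  "is_linear_on V u \<longleftrightarrow>
     (\<forall>f\<in>V. \<forall>g\<in>V. u (\<lambda>x. f x + g x) = u f + u g) \<and>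
     (\<forall>c. \<forall>f\<in>V. u (\<lambda>x. c * f x) = c * u f)"

text \<open>
  Functionals are total HOL functions; they are normalised to be \<open>0\<close> off the space, so that
  equality of functionals is equality on the space and pointwise linear combinations of
  functionals stay normalised.
\<close>

definition restrict_functional ::
  "('a \<Rightarrow> complex) set \<Rightarrow> (('a \<Rightarrow> complex) \<Rightarrow> complex) \<Rightarrow> ('a \<Rightarrow> complex) \<Rightarrow> complex" where
  "restrict_functional V u = (\<lambda>f. if f \<in> V then u f else 0)"

definition dual_space :: "('a \<Rightarrow> complex) topology \<Rightarrow> (('a \<Rightarrow> complex) \<Rightarrow> complex) set" where
  "dual_space X = {u. is_linear_on (topspace X) u \<and> continuous_map X euclidean u \<and>
     (\<forall>f. f \<notin> topspace X \<longrightarrow> u f = 0)}"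

definition vn_bounded :: "('a \<Rightarrow> complex) topology \<Rightarrow> ('a \<Rightarrow> complex) set \<Rightarrow> bool" where
  "vn_bounded X B \<longleftrightarrow> B \<subseteq> topspace X \<and>
     (\<forall>U. openin X U \<and> (\<lambda>x. 0) \<in> U \<longrightarrow>
        (\<exists>r>0. \<forall>t>r. \<forall>f\<in>B. (\<lambda>x. f x / complex_of_real t) \<in> U))"

text \<open>
  The strong topology (uniform convergence on bounded sets).  Nonemptiness of \<open>B\<close> is required
  because the supremum of the empty set of reals is an unspecified number.
\<close>

definition strong_dual :: "('a \<Rightarrow> complex) topology \<Rightarrow> (('a \<Rightarrow> complex) \<Rightarrow> complex) topology"
  where
  "strong_dual X = lc_topology (dual_space X)
     {\<lambda>u. (SUP f\<in>B. norm (u f)) | B. vn_bounded X B \<and> B \<noteq> {}}"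


section \<open>Gevrey-Beurling spaces and ultradistributions\<close>

definition partial_deriv :: "'n \<Rightarrow> (real ^ 'n \<Rightarrow> complex) \<Rightarrow> real ^ 'n::finite \<Rightarrow> complex" where
  "partial_deriv k f x = frechet_derivative f (at x) (axis k 1)"

definition C_infinity :: "(real ^ 'n::finite \<Rightarrow> complex) \<Rightarrow> bool" where
  "C_infinity f \<longleftrightarrow> (\<forall>ks x. (foldr partial_deriv ks f) differentiable (at x))"

text \<open>
  The list lists every \<open>k\<close> exactly \<open>\<beta> k\<close> times.  The order of differentiation is immaterial for
  smooth functions, the only ones this is applied to.
\<close>

definition multi_deriv ::
  "('n \<Rightarrow> nat) \<Rightarrow> (real ^ 'n \<Rightarrow> complex) \<Rightarrow> real ^ 'n::finite \<Rightarrow> complex" where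
  "multi_deriv \<beta> f = foldr partial_deriv (SOME ks. \<forall>k. count_list ks k = \<beta> k) f"

definition multi_abs :: "('n::finite \<Rightarrow> nat) \<Rightarrow> nat" where
  "multi_abs \<beta> = (\<Sum>k\<in>UNIV. \<beta> k)"

definition multi_fact :: "('n::finite \<Rightarrow> nat) \<Rightarrow> real" where
  "multi_fact \<beta> = (\<Prod>k\<in>UNIV. fact (\<beta> k))"

definition gevrey :: "real \<Rightarrow> (real ^ 'n::finite \<Rightarrow> complex) set" where
  "gevrey s = {f. C_infinity f \<and>
     (\<forall>K A. compact K \<and> 0 < A \<longrightarrow>
        (\<exists>C>0. \<forall>\<beta>. \<forall>x\<in>K.
           norm (multi_deriv \<beta> f x) \<le> C * A ^ multi_abs \<beta> * multi_fact \<beta> powr s))}"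

definition gevrey_seminorm ::
  "real \<Rightarrow> (real ^ 'n::finite) set \<Rightarrow> real \<Rightarrow> (real ^ 'n \<Rightarrow> complex) \<Rightarrow> real" where
  "gevrey_seminorm s K A f =
     (SUP (\<beta>, x)\<in>UNIV \<times> K. norm (multi_deriv \<beta> f x) / (A ^ multi_abs \<beta> * multi_fact \<beta> powr s))"

definition gevrey_top :: "real \<Rightarrow> (real ^ 'n::finite \<Rightarrow> complex) topology" where
  "gevrey_top s = lc_topology (gevrey s)
     {gevrey_seminorm s K A | K A. compact K \<and> K \<noteq> {} \<and> 0 < A}"

definition gevrey_in :: "real \<Rightarrow> (real ^ 'n::finite) set \<Rightarrow> (real ^ 'n \<Rightarrow> complex) set" where
  "gevrey_in s K = {f \<in> gevrey s. closure {x. f x \<noteq> 0} \<subseteq> K}"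

definition gevrey_c :: "real \<Rightarrow> (real ^ 'n::finite \<Rightarrow> complex) set" where
  "gevrey_c s = {f \<in> gevrey s. compact (closure {x. f x \<noteq> 0})}"

text \<open>
  The locally convex inductive limit, over compact \<open>K\<close>, of the spaces of functions supported
  in \<open>K\<close> (with the topology induced by \<^const>\<open>gevrey_top\<close>): its continuous seminorms are exactly the
  seminorms whose restriction to each of these spaces is continuous.
\<close>

definition gevrey_c_top :: "real \<Rightarrow> (real ^ 'n::finite \<Rightarrow> complex) topology" where
  "gevrey_c_top s = lc_topology (gevrey_c s)
     {q. is_seminorm_on (gevrey_c s) q \<and>
        (\<forall>K. compact K \<longrightarrow>
           continuous_map (subtopology (gevrey_top s) (gevrey_in s K)) euclidean q)}"

type_synonym 'n functional = "(real ^ 'n \<Rightarrow> complex) \<Rightarrow> complex"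

text \<open>The spaces written \<open>\<D>'\<^bsub>(s)\<^esub>\<close> (with its strong topology) and \<open>\<E>'\<^bsub>(s)\<^esub>\<close>.\<close>

definition ultradistr_top :: "real \<Rightarrow> 'n::finite functional topology" where
  "ultradistr_top s = strong_dual (gevrey_c_top s)"

definition ultradistr_compact :: "real \<Rightarrow> 'n::finite functional set" where
  "ultradistr_compact s = dual_space (gevrey_top s)"

text \<open>\<open>D\<^bsub>x\<^sub>k\<^esub> = -\<i> \<partial>\<^sub>k\<close>, where \<open>(\<partial>\<^sub>k u)(\<phi>) = - u (\<partial>\<^sub>k \<phi>)\<close>.\<close>

definition Dx :: "real \<Rightarrow> 'n \<Rightarrow> 'n::finite functional \<Rightarrow> 'n functional" where
  "Dx s k u = restrict_functional (gevrey_c s) (\<lambda>\<phi>. - \<i> * (- u (partial_deriv k \<phi>)))"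


section \<open>Differentiability in time\<close>

text \<open>Derivatives at the end points of the interval \<open>S\<close> are one-sided.\<close>

primrec C_k_on :: "nat \<Rightarrow> real set \<Rightarrow> (real \<Rightarrow> complex) \<Rightarrow> bool" where
  "C_k_on 0 S f \<longleftrightarrow> continuous_on S f"
| "C_k_on (Suc k) S f \<longleftrightarrow>
     (\<exists>f'. (\<forall>t\<in>S. (f has_vector_derivative f' t) (at t within S)) \<and> C_k_on k S f')"

text \<open>\<open>u\<close> is of class \<open>C\<^sup>1\<close> on \<open>S\<close> with values in \<open>X\<close>, and its derivative is \<open>u'\<close>.\<close>

definition C1_with_deriv ::
  "('a \<Rightarrow> complex) topology \<Rightarrow> real set \<Rightarrow> (real \<Rightarrow> 'a \<Rightarrow> complex) \<Rightarrow> (real \<Rightarrow> 'a \<Rightarrow> complex) \<Rightarrow> bool"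
  where
  "C1_with_deriv X S u u' \<longleftrightarrow>
     (\<forall>t\<in>S. u t \<in> topspace X) \<and>
     (\<forall>t\<in>S. limitin X (\<lambda>r \<phi>. (u r \<phi> - u t \<phi>) / complex_of_real (r - t)) (u' t) (at t within S)) \<and>
     continuous_map (top_of_set S) X u'"


section \<open>The system\<close>

definition charpoly :: "complex ^ 'm ^ 'm \<Rightarrow> complex poly" where
  "charpoly M = det (\<chi> i j. (if i = j then [:0, 1:] else 0) - [:M $ i $ j:])"

definition symbol ::
  "('n \<Rightarrow> real \<Rightarrow> complex ^ 'm ^ 'm) \<Rightarrow> real \<Rightarrow> real ^ 'n::finite \<Rightarrow> complex ^ 'm ^ 'm" where
  "symbol A t \<xi> = (\<Sum>k\<in>UNIV. (\<xi> $ k) *\<^sub>R A k t)"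

definition solves_cauchy_problem ::
  "real \<Rightarrow> real \<Rightarrow> ('n \<Rightarrow> real \<Rightarrow> complex ^ 'm ^ 'm) \<Rightarrow> (real \<Rightarrow> complex ^ 'm ^ 'm) \<Rightarrow>
   'n::finite functional ^ 'm \<Rightarrow> (real \<Rightarrow> 'n functional ^ 'm) \<Rightarrow> bool" where
  "solves_cauchy_problem s T A B g u \<longleftrightarrow>
     (\<exists>u'. (\<forall>i. C1_with_deriv (ultradistr_top s) {0..T} (\<lambda>t. u t $ i) (\<lambda>t. u' t $ i)) \<and>
        (\<forall>t\<in>{0..T}. \<forall>i. \<forall>\<phi>\<in>gevrey_c s.
           - \<i> * (u' t $ i) \<phi>
           - (\<Sum>k\<in>UNIV. \<Sum>j\<in>UNIV. A k t $ i $ j * Dx s k (u t $ j) \<phi>)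
           - (\<Sum>j\<in>UNIV. B t $ i $ j * (u t $ j) \<phi>) = 0)) \<and>
     (\<forall>i. u 0 $ i = restrict_functional (gevrey_c s) (g $ i))"

end

theory Submission
  imports Defs "HOL-Probability.Characteristic_Functions" "HOL-Probability.Sinc_Integral"
    "HOL-Complex_Analysis.Cauchy_Integral_Theorem" "HOL-Real_Asymp.Real_Asymp"
begin

text \<open>
  Let \<open>E \<zeta> t \<tau>\<close> be the evolution matrix of the ordinary differential system obtained by a Fourier
  transform in \<open>x\<close>.  For real frequencies it grows at most like \<open>exp (C * (1 + norm \<xi> powr (1 / s)))\<close>,
  and for complex ones it is entire of exponential type, uniformly in \<open>t\<close> and \<open>\<tau>\<close>.  The first bound makes
  \<open>E\<close> a multiplier on test functions, whose Fourier transforms decay like \<open>exp (- N * norm \<xi> powr (1 / s))\<close>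
  for every \<open>N\<close>; the second one, by a Paley-Wiener argument, makes the multiplied test functions compactly
  supported, with a support that is uniform in time (finite speed of propagation).  Hence
  \<open>u\<^sub>i(t)(\<phi>) = (\<Sum>j. g\<^sub>j (\<F>\<inverse> (E \<xi> t 0 $ i $ j * \<F> \<phi>)))\<close> is a solution.  It is the only one, because
  \<open>\<Sum>j. u\<^sub>j(\<tau>) (\<F>\<inverse> (E \<xi> t \<tau> $ i $ j * \<F> \<phi>))\<close> does not depend on \<open>\<tau>\<close>.

  For the growth bound, put \<open>\<epsilon> = norm \<xi> powr (- 1 / s)\<close> and separate the eigenvalues \<open>\<nu>\<^sub>j\<close> of the normalised
  symbol \<open>a(t)\<close> by passing to \<open>\<mu>\<^sub>j = \<nu>\<^sub>j + j * \<epsilon> powr (s - 1)\<close>.  On a time interval of length \<open>\<epsilon>\<close> starting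
  at \<open>t\<^sub>1\<close>, the energy is the sum of the squares of \<open>l\<^sub>j(a(t)) V(t)\<close>, where \<open>l\<^sub>j\<close> are the Lagrange polynomials
  of the nodes \<open>\<mu>\<^sub>j(t\<^sub>1)\<close>.  By the Cayley-Hamilton theorem \<open>a(t)\<close> acts on \<open>l\<^sub>j(a(t)) V(t)\<close> as \<open>\<mu>\<^sub>j(t\<^sub>1)\<close>, which
  is real, up to an error that the separation of the eigenvalues controls, so that the energy grows by a
  bounded factor; there are about \<open>1 / \<epsilon>\<close> such intervals.
\<close>

section \<open>Matrix polynomials\<close>

text \<open>The eigenvalues are only Hoelder continuous in time, so a diagonaliser made from them
  cannot be differentiated. In the energy the nodes are therefore frozen on each time step and only
  the matrix is differentiated; the price is a change of nodes between steps. The separation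
  hypothesis makes every gap comparable to the diameter of the spectrum, so that this change, a
  matter of quotients of products of gaps, costs a bounded factor.

  On a step of length \<epsilon> an error rate of order 1 / \<epsilon> is harmless, and \<epsilon>
  is chosen to bring two errors to this size. With h = \<open>\<epsilon> powr (s - 1)\<close>, the
  eigenvalues move by O(h) during a step, as s - 1 \<le> \<alpha>, and norm \<xi> * h = 1 /
  \<epsilon>. The derivative of a Lagrange polynomial carries the inverse of a product of m - 1
  gaps, each at least a multiple of h, and this is O(1 / \<epsilon>) as (s - 1) * (m - 1) \<le>
  1.\<close>

lemma matrix_vector_mult_norm_le:
  fixes M :: "complex ^ 'n::finite ^ 'm::finite"
  shows "norm (M *v x) \<le> norm M * norm x"
proof -
  have "norm ((M *v x) $ i) \<le> norm (M $ i) * norm x" for i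
  proof -
    have "norm ((M *v x) $ i) \<le> (\<Sum>j\<in>UNIV. norm (M $ i $ j) * norm (x $ j))"
      by (auto simp: matrix_vector_mult_def norm_mult intro!: sum_norm_le)
    also have "\<dots> \<le> norm (M $ i) * norm x"
      using L2_set_mult_ineq[of "\<lambda>j. norm (M $ i $ j)" "\<lambda>j. norm (x $ j)" UNIV]
      by (simp add: norm_vec_def)
    finally show ?thesis .
  qed
  then have "norm (M *v x) \<le> L2_set (\<lambda>i. norm (M $ i) * norm x) UNIV"
    unfolding norm_vec_def[of "M *v x"] by (intro L2_set_mono) auto
  also have "\<dots> = norm M * norm x"
    by (simp add: norm_vec_def[of M] L2_set_left_distrib)
  finally show ?thesis .
qed

text \<open>Cauchy-Schwarz row by row: the norm of the matrix type is the Frobenius norm. The norm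
  of \<open>mat 1\<close> is then the square root of the dimension, which is why a constant
  \<open>N\<close> appears in the energy estimates.\<close>

lemma matrix_matrix_mult_norm_le:
  fixes M :: "complex ^ 'n::finite ^ 'm::finite" and N :: "complex ^ 'k::finite ^ 'n"
  shows "norm (M ** N) \<le> norm M * norm N"
proof -
  have "norm ((M ** N) $ i) \<le> norm (M $ i) * norm N" for i
  proof -
    have "(M ** N) $ i = (\<Sum>j\<in>UNIV. M $ i $ j *s N $ j)"
      by (simp add: vec_eq_iff matrix_matrix_mult_def)
    then have "norm ((M ** N) $ i) \<le> (\<Sum>j\<in>UNIV. norm (M $ i $ j *s N $ j))"
      by (auto intro!: sum_norm_le)
    also have "\<dots> = (\<Sum>j\<in>UNIV. norm (M $ i $ j) * norm (N $ j))"
      by (simp add: norm_vec_def norm_mult L2_set_right_distrib)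
    also have "\<dots> \<le> norm (M $ i) * norm N"
      using L2_set_mult_ineq[of "\<lambda>j. norm (M $ i $ j)" "\<lambda>j. norm (N $ j)" UNIV]
      by (simp add: norm_vec_def)
    finally show ?thesis .
  qed
  then have "norm (M ** N) \<le> L2_set (\<lambda>i. norm (M $ i) * norm N) UNIV"
    unfolding norm_vec_def[of "M ** N"] by (intro L2_set_mono) auto
  also have "\<dots> = norm M * norm N"
    by (simp add: norm_vec_def[of M] L2_set_left_distrib)
  finally show ?thesis .
qed

lemma bounded_bilinear_matrix_mult:
  "bounded_bilinear ((**) :: complex ^ 'n::finite ^ 'm::finite \<Rightarrow> complex ^ 'k::finite ^ 'n \<Rightarrow> _)"
proof
  fix A A' :: "complex ^ 'n ^ 'm" and B B' :: "complex ^ 'k ^ 'n" and r :: real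
  show "(A + A') ** B = A ** B + A' ** B"
    by (simp add: vec_eq_iff matrix_matrix_mult_def distrib_right sum.distrib)
  show "A ** (B + B') = A ** B + A ** B'"
    by (rule matrix_add_ldistrib)
  show "(r *\<^sub>R A) ** B = r *\<^sub>R (A ** B)" "A ** (r *\<^sub>R B) = r *\<^sub>R (A ** B)"
    by (simp_all add: vec_eq_iff matrix_matrix_mult_def scaleR_sum_right)
  show "\<exists>K. \<forall>(a :: complex ^ 'n ^ 'm) (b :: complex ^ 'k ^ 'n). norm (a ** b) \<le> norm a * norm b * K"
    by (intro exI[of _ 1]) (simp add: matrix_matrix_mult_norm_le)
qed

lemma bounded_bilinear_matrix_vector_mult:
  "bounded_bilinear ((*v) :: complex ^ 'n::finite ^ 'm::finite \<Rightarrow> _)"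
proof
  fix A A' :: "complex ^ 'n ^ 'm" and B B' :: "complex ^ 'n" and r :: real
  show "(A + A') *v B = A *v B + A' *v B"
    by (simp add: vec_eq_iff matrix_vector_mult_def distrib_right sum.distrib)
  show "A *v (B + B') = A *v B + A *v B'"
    by (rule matrix_vector_right_distrib)
  show "(r *\<^sub>R A) *v B = r *\<^sub>R (A *v B)" "A *v (r *\<^sub>R B) = r *\<^sub>R (A *v B)"
    by (simp_all add: vec_eq_iff matrix_vector_mult_def scaleR_sum_right)
  show "\<exists>K. \<forall>(a :: complex ^ 'n ^ 'm) b. norm (a *v b) \<le> norm a * norm b * K"
    by (intro exI[of _ 1]) (simp add: matrix_vector_mult_norm_le)
qed

lemma mat_mult_nth: "((mat c :: complex ^ 'm::finite ^ 'm) ** X) $ i $ j = c * X $ i $ j"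
  by (simp add: matrix_matrix_mult_def mat_def if_distrib[where f="\<lambda>u. u * _"] cong: if_cong)

lemma mult_mat_nth: "(X ** (mat c :: complex ^ 'm::finite ^ 'm)) $ i $ j = c * X $ i $ j"
  by (simp add: matrix_matrix_mult_def mat_def if_distrib[where f="\<lambda>u. _ * u"] cong: if_cong)

lemma mat_mult_commute: "(mat c :: complex ^ 'm::finite ^ 'm) ** X = X ** mat c"
  by (simp add: vec_eq_iff mat_mult_nth mult_mat_nth)

lemma mat_vector_mult: "(mat c :: complex ^ 'm::finite ^ 'm) *v x = c *s x"
  by (simp add: vec_eq_iff matrix_vector_mult_def mat_def if_distrib[where f="\<lambda>u. u * _"] cong: if_cong)

lemma mat_add: "(mat (a + b) :: complex ^ 'm::finite ^ 'm) = mat a + mat b"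
  by (simp add: vec_eq_iff mat_def)

lemma mat_mult: "(mat (a * b) :: complex ^ 'm::finite ^ 'm) = mat a ** mat b"
  by (simp add: vec_eq_iff mat_mult_nth, simp add: mat_def)

text \<open>Horner's scheme with the matrix product \<open>**\<close>; the multiplication
  \<open>*\<close> of the vector type is entrywise.\<close>

definition mpoly :: "complex ^ 'm::finite ^ 'm \<Rightarrow> complex poly \<Rightarrow> complex ^ 'm ^ 'm" where
  "mpoly M p = fold_coeffs (\<lambda>c X. mat c + M ** X) p 0"

lemma mpoly_0 [simp]: "mpoly M 0 = 0"
  by (simp add: mpoly_def)

lemma mpoly_pCons: "mpoly M (pCons c p) = mat c + M ** mpoly M p"
proof (cases "c = 0 \<and> p = 0")
  case True
  then show ?thesis by (simp add: vec_eq_iff mat_def matrix_matrix_mult_def)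
next
  case False
  then show ?thesis by (auto simp: mpoly_def fold_coeffs_pCons_coeff_not_0_eq fold_coeffs_pCons_not_0_0_eq)
qed

lemma mpoly_1: "mpoly M 1 = mat 1"
  by (simp add: one_pCons mpoly_pCons vec_eq_iff matrix_matrix_mult_def)

lemma mpoly_add: "mpoly M (p + q) = mpoly M p + mpoly M q"
  by (induction p q rule: poly_induct2)
     (auto simp: mpoly_pCons matrix_add_ldistrib mat_add algebra_simps)

lemma mpoly_smult: "mpoly M (smult c p) = mat c ** mpoly M p"
proof (induction p)
  case (pCons a p)
  have "M ** (mat c ** mpoly M p) = mat c ** (M ** mpoly M p)"
    by (metis mat_mult_commute matrix_mul_assoc)
  then show ?case
    by (simp add: mpoly_pCons pCons matrix_add_ldistrib mat_mult)
qed (simp add: matrix_matrix_mult_def vec_eq_iff)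

lemma mpoly_mult: "mpoly M (p * q) = mpoly M p ** mpoly M q"
proof (induction p)
  case (pCons a p)
  have "mpoly M (pCons a p * q) = mpoly M (smult a q) + mpoly M (pCons 0 (p * q))"
    by (simp add: mult_pCons_left mpoly_add)
  also have "\<dots> = mat a ** mpoly M q + M ** (mpoly M p ** mpoly M q)"
    by (simp only: mpoly_smult mpoly_pCons pCons(2)) (simp add: vec_eq_iff mat_def)
  also have "\<dots> = mpoly M (pCons a p) ** mpoly M q"
    by (simp add: mpoly_pCons matrix_mul_assoc bounded_bilinear.add_left[OF bounded_bilinear_matrix_mult])
  finally show ?case .
qed (simp add: matrix_matrix_mult_def vec_eq_iff)

lemma mpoly_sum: "mpoly M (sum f I) = (\<Sum>i\<in>I. mpoly M (f i))"
  by (induction I rule: infinite_finite_induct) (auto simp: mpoly_add)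

lemma mpoly_linear_factor: "mpoly M [:- c, 1:] = M - mat c"
proof -
  have "mpoly M [:- c, 1:] = mat (- c) + M ** mat 1"
    by (simp add: mpoly_pCons)
  then have "mpoly M [:- c, 1:] = mat (- c) + M" by simp
  then show ?thesis by (simp add: vec_eq_iff mat_def)
qed

lemma mpoly_smult_vec: "mpoly M (smult c p) *v x = c *s (mpoly M p *v x)"
  by (simp add: mpoly_smult mat_vector_mult flip: matrix_vector_mul_assoc)

text \<open>The entry at \<open>j\<close>, \<open>l\<close> is Cramer's determinant, in which row
  \<open>l\<close> is replaced by the unit vector of index \<open>j\<close>. Commutative rings are
  allowed because it is applied to x - M, whose entries are polynomials.\<close>

definition adjugate :: "'a::comm_ring_1 ^ 'm ^ 'm \<Rightarrow> 'a ^ 'm::finite ^ 'm" where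
  "adjugate M = (\<chi> j l. det (\<chi> k. if k = l then axis j 1 else M $ k))"

text \<open>By linearity of the determinant in row \<open>l\<close>, the sum is the determinant of
  \<open>M\<close> with row \<open>l\<close> replaced by row \<open>k\<close>. This is
  \<open>M\<close> itself for \<open>k = l\<close> and has two equal rows otherwise.\<close>

lemma matrix_mult_adjugate:
  fixes M :: "'a::comm_ring_1 ^ 'm::finite ^ 'm"
  shows "(\<Sum>j\<in>UNIV. M $ k $ j * adjugate M $ j $ l) = (if k = l then det M else 0)"
proof -
  have "(\<Sum>j\<in>UNIV. M $ k $ j * adjugate M $ j $ l)
      = (\<Sum>j\<in>UNIV. det (\<chi> i. if i = l then M $ k $ j *s axis j 1 else M $ i))"
    by (simp add: adjugate_def det_row_mul)
  also have "\<dots> = det (\<chi> i. if i = l then (\<Sum>j\<in>UNIV. M $ k $ j *s axis j 1) else M $ i)"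
    by (rule det_linear_row_sum[symmetric]) simp
  also have "(\<Sum>j\<in>UNIV. M $ k $ j *s axis j 1) = M $ k"
    by (simp add: vec_eq_iff axis_def if_distrib[where f="\<lambda>u. _ * u"] cong: if_cong)
  also have "det (\<chi> i. if i = l then M $ k else M $ i) = (if k = l then det M else 0)"
  proof (cases "k = l")
    case True
    have "(\<chi> i. if i = l then M $ k else M $ i) = M"
      using True by (simp add: vec_eq_iff)
    then show ?thesis using True by simp
  next
    case False
    then have "det (\<chi> i. if i = l then M $ k else M $ i) = 0"
      by (intro det_identical_rows[OF False]) (simp add: row_def vec_eq_iff)
    then show ?thesis using False by simp
  qed
  finally show ?thesis .
qed

text \<open>
  The polynomials act on vectors through \<open>M\<close>, and the rows of the transpose of \<open>x - M\<close> annihilate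
  the family of basis vectors; multiplying by the adjugate gives the theorem.
\<close>

theorem cayley_hamilton: "mpoly M (charpoly M) = 0"
  for M :: "complex ^ 'm::finite ^ 'm"
proof -
  define C where "C = (\<chi> i j. (if i = j then [:0, 1:] else 0) - [:M $ i $ j:] :: complex poly ^ 'm ^ 'm)"
  define e where "e = (\<lambda>i::'m. axis i (1::complex))"
  have base: "(\<Sum>i\<in>UNIV. mpoly M (C $ i $ j) *v e i) = 0" for j
  proof -
    have "mpoly M (C $ i $ j) *v e i = (if i = j then M *v e j else 0) - M $ i $ j *s e i" for i
    proof -
      have 1: "mpoly M [:- (M $ i $ j):] = mat (- (M $ i $ j))"
        by (simp add: mpoly_pCons)
      have 2: "mpoly M [:0, 1:] = M"
        using mpoly_linear_factor[of M 0] by (simp add: vec_eq_iff mat_def)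
      have 3: "C $ i $ j = (if i = j then [:0, 1:] else 0) + [:- (M $ i $ j):]"
        by (simp add: C_def)
      show ?thesis unfolding 3 mpoly_add 1
        by (auto simp: mat_vector_mult matrix_vector_mult_add_rdistrib 2 vector_smult_lneg)
    qed
    then have "(\<Sum>i\<in>UNIV. mpoly M (C $ i $ j) *v e i) = M *v e j - (\<Sum>i\<in>UNIV. M $ i $ j *s e i)"
      by (simp add: sum_subtractf)
    also have "(\<Sum>i\<in>UNIV. M $ i $ j *s e i) = M *v e j"
      by (simp add: vec_eq_iff e_def matrix_vector_mult_def axis_def if_distrib[where f="\<lambda>u. _ * u"] cong: if_cong)
    finally show ?thesis by simp
  qed
  have "mpoly M (charpoly M) *v e l = 0" for l
  proof -
    \<comment> \<open>Polynomials in \<open>M\<close> multiply as in the commutative ring of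
      polynomials. So the identities \<open>base\<close> can be combined with the entries of the
      adjugate, and the sum over \<open>j\<close> is evaluated in that ring.\<close>
    have "0 = (\<Sum>j\<in>UNIV. mpoly M (adjugate C $ j $ l) *v (\<Sum>i\<in>UNIV. mpoly M (C $ i $ j) *v e i))"
      by (simp add: base)
    also have "\<dots> = (\<Sum>j\<in>UNIV. \<Sum>i\<in>UNIV. mpoly M (C $ i $ j * adjugate C $ j $ l) *v e i)"
      by (simp add: bounded_bilinear.sum_right[OF bounded_bilinear_matrix_vector_mult] matrix_vector_mul_assoc mult.commute[of "C $ _ $ _"] flip: mpoly_mult)
    also have "\<dots> = (\<Sum>i\<in>UNIV. \<Sum>j\<in>UNIV. mpoly M (C $ i $ j * adjugate C $ j $ l) *v e i)"
      by (rule sum.swap)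
    also have "\<dots> = (\<Sum>i\<in>UNIV. mpoly M (\<Sum>j\<in>UNIV. C $ i $ j * adjugate C $ j $ l) *v e i)"
      by (simp add: mpoly_sum bounded_bilinear.sum_left[OF bounded_bilinear_matrix_vector_mult])
    also have "\<dots> = (\<Sum>i\<in>UNIV. if i = l then mpoly M (det C) *v e l else 0)"
      by (intro sum.cong) (auto simp: matrix_mult_adjugate)
    also have "\<dots> = mpoly M (charpoly M) *v e l"
      by (simp add: charpoly_def C_def)
    finally show ?thesis by simp
  qed
  then have "mpoly M (charpoly M) $ i $ l = 0" for i l
    by (simp add: e_def vec_eq_iff matrix_vector_mult_def axis_def if_distrib[where f="\<lambda>u. _ * u"] cong: if_cong)
  then show ?thesis by (simp add: vec_eq_iff)
qed

section \<open>Eigenvalue bounds and Lagrange interpolation\<close>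

lemma poly_charpoly: "poly (charpoly M) z = det (mat z - M)"
  for M :: "complex ^ 'm::finite ^ 'm"
  unfolding charpoly_def det_def
  by (simp add: poly_sum poly_prod mat_def if_distrib[where f="\<lambda>p. poly p z"] cong: if_cong)

text \<open>A root has an eigenvector, and the Frobenius norm dominates the operator norm. This
  bounds the nodes in terms of the coefficients alone.\<close>

lemma charpoly_root_norm_le:
  fixes M :: "complex ^ 'm::finite ^ 'm"
  assumes "poly (charpoly M) z = 0"
  shows "norm z \<le> norm M"
proof -
  have "\<not> invertible (mat z - M)"
    using assms by (simp add: poly_charpoly invertible_det_nz)
  then have "\<exists>x. (mat z - M) *v x = 0 \<and> x \<noteq> 0"
    using invertible_left_inverse matrix_left_invertible_ker by blast
  then obtain x where x: "(mat z - M) *v x = 0" "x \<noteq> 0" by blast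
  then have "M *v x = z *s x"
    by (simp add: bounded_bilinear.diff_left[OF bounded_bilinear_matrix_vector_mult] mat_vector_mult)
  then have "norm (z *s x) \<le> norm M * norm x"
    by (metis matrix_vector_mult_norm_le)
  moreover have "norm (z *s x) = norm z * norm x"
    by (simp add: norm_vec_def norm_mult L2_set_right_distrib)
  ultimately show ?thesis using x(2) by simp
qed

definition lagrange :: "'i set \<Rightarrow> ('i \<Rightarrow> complex) \<Rightarrow> 'i \<Rightarrow> complex poly" where
  "lagrange I \<mu> j = smult (1 / (\<Prod>i\<in>I - {j}. \<mu> j - \<mu> i)) (\<Prod>i\<in>I - {j}. [:- \<mu> i, 1:])"

lemma poly_lagrange:
  assumes "finite I" "inj_on \<mu> I" "j \<in> I" "k \<in> I"
  shows "poly (lagrange I \<mu> j) (\<mu> k) = (if j = k then 1 else 0)"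
proof -
  have "(\<Prod>i\<in>I - {j}. \<mu> j - \<mu> i) \<noteq> 0"
    using assms by (auto simp: inj_on_def)
  then show ?thesis
    using assms by (auto simp: lagrange_def poly_prod)
qed

lemma degree_prod_linear_factors:
  "finite I \<Longrightarrow> degree (\<Prod>i\<in>I. [:- \<mu> i, 1 :: complex:]) = card I"
  by (subst degree_prod_eq_sum_degree) auto

lemma lagrange_interpolation:
  assumes "finite I" "inj_on \<mu> I" "degree p < card I"
  shows "p = (\<Sum>k\<in>I. smult (poly p (\<mu> k)) (lagrange I \<mu> k))"
proof (rule poly_eqI_degree[where A="\<mu> ` I"])
  have "degree (lagrange I \<mu> k) \<le> card I - 1" if "k \<in> I" for k
    using that assms(1) degree_prod_linear_factors[of "I - {k}" \<mu>]
    by (simp add: lagrange_def)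
  then have "degree (\<Sum>k\<in>I. smult (poly p (\<mu> k)) (lagrange I \<mu> k)) \<le> card I - 1"
    by (intro degree_sum_le) (auto intro: order_trans[OF degree_smult_le] assms)
  then show "degree (\<Sum>k\<in>I. smult (poly p (\<mu> k)) (lagrange I \<mu> k)) < card (\<mu> ` I)"
    using assms by (simp add: card_image)
  show "degree p < card (\<mu> ` I)"
    using assms by (simp add: card_image)
  fix x assume "x \<in> \<mu> ` I"
  then obtain k where k: "k \<in> I" "x = \<mu> k" by blast
  have "poly (\<Sum>k\<in>I. smult (poly p (\<mu> k)) (lagrange I \<mu> k)) x = (\<Sum>j\<in>I. poly p (\<mu> j) * (if j = k then 1 else 0))"
    using assms k by (simp add: poly_sum poly_lagrange)
  also have "\<dots> = poly p x"
    using assms k by (simp add: if_distrib[where f="\<lambda>u. _ * u"] cong: if_cong)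
  finally show "poly p x = poly (\<Sum>k\<in>I. smult (poly p (\<mu> k)) (lagrange I \<mu> k)) x" by simp
qed

section \<open>Growth of the solutions of hyperbolic systems\<close>

text \<open>\<open>W\<close> divided by \<open>exp (K * (t - a))\<close> is decreasing. No sign is
  imposed on \<open>W\<close> or \<open>K\<close>.\<close>

lemma gronwall_decreasing:
  fixes W W' :: "real \<Rightarrow> real"
  assumes "a \<le> b"
    and W: "\<And>t. t \<in> {a..b} \<Longrightarrow> (W has_real_derivative W' t) (at t within {a..b})"
    and le: "\<And>t. t \<in> {a..b} \<Longrightarrow> W' t \<le> K * W t"
  shows "W b \<le> exp (K * (b - a)) * W a"
proof -
  define G where "G t = W t * exp (- K * (t - a))" for t
  have G: "(G has_real_derivative (W' t - K * W t) * exp (- K * (t - a))) (at t within {a..b})"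
    if "t \<in> {a..b}" for t
    unfolding G_def using W[OF that]
    by (auto intro!: derivative_eq_intros simp: algebra_simps)
  have "G a \<ge> G b"
  proof (rule DERIV_nonpos_imp_decreasing_open[OF \<open>a \<le> b\<close>])
    fix t assume t: "a < t" "t < b"
    then have "(G has_real_derivative (W' t - K * W t) * exp (- K * (t - a))) (at t)"
      using G[of t] by (simp add: at_within_Icc_at)
    moreover have "(W' t - K * W t) * exp (- K * (t - a)) \<le> 0"
      using le[of t] t by (simp add: mult_le_0_iff)
    ultimately show "\<exists>y. (G has_real_derivative y) (at t) \<and> y \<le> 0" by blast
  next
    show "continuous_on {a..b} G"
      using G DERIV_continuous by (fastforce simp: continuous_on_eq_continuous_within)
  qed
  then have "exp (K * (b - a)) * G b \<le> exp (K * (b - a)) * G a" by simp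
  moreover have "exp (K * (b - a)) * G b = W b"
    by (simp add: G_def exp_minus)
  moreover have "G a = W a" by (simp add: G_def)
  ultimately show ?thesis by simp
qed

text \<open>The inner product is the real part of the Hermitian one. The reality of the nodes enters
  here: it removes the term of size \<open>norm \<xi>\<close> from the derivative of the
  energy.\<close>

lemma inner_ii_scaleR_self: "x \<bullet> ((\<i> * complex_of_real r) *s x) = 0"
  for x :: "complex ^ 'm::finite"
  by (simp add: inner_vec_def inner_complex_def)

lemma has_vector_derivative_norm_square:
  fixes y :: "real \<Rightarrow> 'a::real_inner"
  assumes "(y has_vector_derivative y') (at t within S)"
  shows "((\<lambda>t. (norm (y t))\<^sup>2) has_real_derivative 2 * (y t \<bullet> y')) (at t within S)"
proof -
  have "((\<lambda>t. y t \<bullet> y t) has_vector_derivative (y t \<bullet> y' + y' \<bullet> y t)) (at t within S)"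
    by (rule bounded_bilinear.has_vector_derivative[OF bounded_bilinear_inner assms assms])
  then show ?thesis
    by (simp add: power2_norm_eq_inner has_real_derivative_iff_has_vector_derivative inner_commute)
qed

lemma norm_smult_vec: "norm (z *s x) = norm z * norm x"
  for x :: "complex ^ 'm::finite"
  by (simp add: norm_vec_def norm_mult L2_set_right_distrib)

lemma norm_mat_mult: "norm (mat z ** X) = norm z * norm X"
  for X :: "complex ^ 'm::finite ^ 'm"
proof -
  have "(mat z ** X) $ i = z *s X $ i" for i
    by (simp add: vec_eq_iff mat_mult_nth)
  then show ?thesis
    by (simp add: norm_vec_def[of "mat z ** X"] norm_smult_vec norm_vec_def[of X] L2_set_right_distrib)
qed

lemma degree_diff_monic_less:
  fixes p q :: "complex poly"
  assumes "degree p = n" "degree q = n" "lead_coeff p = 1" "lead_coeff q = 1" "0 < n"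
  shows "degree (p - q) < n"
proof (rule ccontr)
  assume "\<not> ?thesis"
  then have "degree (p - q) = n"
    using degree_diff_le[of p n q] assms by simp
  moreover have "coeff (p - q) n = 0"
    using assms by simp
  ultimately have "p - q = 0"
    by (metis leading_coeff_0_iff)
  then show False using \<open>degree (p - q) = n\<close> \<open>0 < n\<close> by simp
qed

text \<open>Multiplying a Lagrange polynomial by its missing linear factor gives the node polynomial
  divided by the denominator. The characteristic polynomial vanishes at \<open>a\<close>, so the
  node polynomial may be replaced by its difference from it. This difference has lower degree and is
  interpolated at the same nodes, where the node polynomial vanishes and the products of the
  \<open>\<mu> k - \<nu> i\<close> remain.\<close>

lemma mpoly_lagrange_mult:
  fixes a :: "complex ^ 'm::finite ^ 'm" and \<mu> \<nu> :: "'i \<Rightarrow> complex"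
  assumes I: "finite I" "card I = CARD('m)" "j \<in> I" and inj: "inj_on \<mu> I"
    and cp: "charpoly a = (\<Prod>i\<in>I. [:- \<nu> i, 1:])"
  shows "mpoly a (lagrange I \<mu> j) *v (a *v x) = \<mu> j *s (mpoly a (lagrange I \<mu> j) *v x)
     - (1 / (\<Prod>i\<in>I - {j}. \<mu> j - \<mu> i)) *s
       (\<Sum>k\<in>I. (\<Prod>i\<in>I. \<mu> k - \<nu> i) *s (mpoly a (lagrange I \<mu> k) *v x))"
proof -
  let ?P = "\<lambda>\<mu>. \<Prod>i\<in>I. [:- \<mu> i, 1 :: complex:]"
  let ?d = "\<Prod>i\<in>I - {j}. \<mu> j - \<mu> i"
  have deg: "degree (?P \<mu>) = card I" "lead_coeff (?P \<mu>) = 1" for \<mu>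
    using I(1) by (rule degree_prod_linear_factors) (simp add: lead_coeff_prod)
  have "degree (?P \<mu> - ?P \<nu>) < card I"
    using I card_gt_0_iff[of I] by (intro degree_diff_monic_less deg) auto
  then have "?P \<mu> - ?P \<nu> = (\<Sum>k\<in>I. smult (poly (?P \<mu> - ?P \<nu>) (\<mu> k)) (lagrange I \<mu> k))"
    by (intro lagrange_interpolation I inj)
  also have "\<dots> = (\<Sum>k\<in>I. smult (- (\<Prod>i\<in>I. \<mu> k - \<nu> i)) (lagrange I \<mu> k))"
  proof (rule sum.cong)
    fix k assume k: "k \<in> I"
    have "(\<Prod>i\<in>I. \<mu> k - \<mu> i) = 0"
      using I(1) k by (intro prod_zero) auto
    then have "poly (?P \<mu> - ?P \<nu>) (\<mu> k) = - (\<Prod>i\<in>I. \<mu> k - \<nu> i)"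
      by (simp add: poly_prod)
    then show "smult (poly (?P \<mu> - ?P \<nu>) (\<mu> k)) (lagrange I \<mu> k) = smult (- (\<Prod>i\<in>I. \<mu> k - \<nu> i)) (lagrange I \<mu> k)"
      by simp
  qed simp
  finally have eq: "?P \<mu> = ?P \<nu> + (\<Sum>k\<in>I. smult (- (\<Prod>i\<in>I. \<mu> k - \<nu> i)) (lagrange I \<mu> k))"
    by (simp add: algebra_simps)
  have "mpoly a (?P \<nu>) = 0"
    using cayley_hamilton[of a] cp by simp
  then have "mpoly a (?P \<mu>) = (\<Sum>k\<in>I. mpoly a (smult (- (\<Prod>i\<in>I. \<mu> k - \<nu> i)) (lagrange I \<mu> k)))"
    by (subst eq) (simp add: mpoly_add mpoly_sum)
  then have 1: "mpoly a (?P \<mu>) *v x = - (\<Sum>k\<in>I. (\<Prod>i\<in>I. \<mu> k - \<nu> i) *s (mpoly a (lagrange I \<mu> k) *v x))"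
    by (simp add: bounded_bilinear.sum_left[OF bounded_bilinear_matrix_vector_mult] mpoly_smult_vec
        sum_negf vector_smult_lneg del: smult_minus_left)
  have "lagrange I \<mu> j * [:- \<mu> j, 1:] = smult (1 / ?d) (?P \<mu>)"
    unfolding lagrange_def using prod.remove[OF I(1,3), of "\<lambda>i. [:- \<mu> i, 1:]"]
    by (simp only: mult_smult_left mult.commute[of "prod _ _" "[:_, _:]"])
  then have "mpoly a (lagrange I \<mu> j) ** (a - mat (\<mu> j)) = mpoly a (smult (1 / ?d) (?P \<mu>))"
    by (metis mpoly_mult mpoly_linear_factor)
  then have "mpoly a (lagrange I \<mu> j) *v ((a - mat (\<mu> j)) *v x) = (1 / ?d) *s (mpoly a (?P \<mu>) *v x)"
    by (simp add: matrix_vector_mul_assoc mpoly_smult_vec)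
  also have "(a - mat (\<mu> j)) *v x = a *v x - \<mu> j *s x"
    by (simp add: bounded_bilinear.diff_left[OF bounded_bilinear_matrix_vector_mult] mat_vector_mult)
  finally show ?thesis
    by (simp add: bounded_bilinear.diff_right[OF bounded_bilinear_matrix_vector_mult] 1
      vector_scalar_commute algebra_simps)
qed

text \<open>Induction over the factors with the product rule. The derivative of \<open>a\<close> is
  demanded only if there are factors, which covers \<open>m = 1\<close> with merely continuous
  coefficients; \<open>1 \<le> R\<close> lets all summands carry the same power of
  \<open>R\<close>.\<close>

lemma mpoly_prod_linear_derivative:
  fixes a :: "real \<Rightarrow> complex ^ 'm::finite ^ 'm"
  assumes J: "finite J" and R: "1 \<le> R" "0 \<le> D"
    and le: "\<And>i. i \<in> J \<Longrightarrow> norm (a t - mat (\<mu> i)) \<le> R"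
    and a': "J \<noteq> {} \<Longrightarrow> (a has_vector_derivative a') (at t within S)" "norm a' \<le> D"
  shows "norm (mpoly (a t) (\<Prod>i\<in>J. [:- \<mu> i, 1:])) \<le> norm (mat 1 :: complex ^ 'm ^ 'm) * R ^ card J"
    and "\<exists>Q'. ((\<lambda>t. mpoly (a t) (\<Prod>i\<in>J. [:- \<mu> i, 1:])) has_vector_derivative Q') (at t within S)
      \<and> norm Q' \<le> norm (mat 1 :: complex ^ 'm ^ 'm) * card J * D * R ^ card J"
proof -
  let ?n = "norm (mat 1 :: complex ^ 'm ^ 'm)"
  let ?Q = "\<lambda>J t. mpoly (a t) (\<Prod>i\<in>J. [:- \<mu> i, 1:])"
  have step: "?Q (insert i J) t = (a t - mat (\<mu> i)) ** ?Q J t" if "finite J" "i \<notin> J" for i J t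
    by (simp only: prod.insert[OF that] mpoly_mult mpoly_linear_factor)
  have bound: "norm (?Q J t) \<le> ?n * R ^ card J"
    if "finite J" "\<And>i. i \<in> J \<Longrightarrow> norm (a t - mat (\<mu> i)) \<le> R" for J
    using that
  proof (induction J rule: finite_induct)
    case (insert i J)
    have "norm (?Q (insert i J) t) \<le> norm (a t - mat (\<mu> i)) * norm (?Q J t)"
      unfolding step[OF insert(1,2)] by (rule matrix_matrix_mult_norm_le)
    also have "\<dots> \<le> R * (?n * R ^ card J)"
      using insert R by (intro mult_mono) auto
    finally show ?case using insert by (simp add: mult_ac)
  qed (simp add: mpoly_1)
  show "norm (?Q J t) \<le> ?n * R ^ card J" using J le by (rule bound)
  show "\<exists>Q'. (?Q J has_vector_derivative Q') (at t within S) \<and> norm Q' \<le> ?n * card J * D * R ^ card J"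
    using J le a'
  proof (induction J rule: finite_induct)
    case (insert i J)
    then obtain Q' where Q': "(?Q J has_vector_derivative Q') (at t within S)" "norm Q' \<le> ?n * card J * D * R ^ card J"
      by blast
    have der: "((\<lambda>t. a t - mat (\<mu> i)) has_vector_derivative a') (at t within S)"
      using insert.prems(2) by (auto intro!: derivative_eq_intros)
    have "(?Q (insert i J) has_vector_derivative ((a t - mat (\<mu> i)) ** Q' + a' ** ?Q J t)) (at t within S)"
      unfolding step[OF insert(1,2)]
      by (rule bounded_bilinear.has_vector_derivative[OF bounded_bilinear_matrix_mult der Q'(1)])
    moreover have "norm ((a t - mat (\<mu> i)) ** Q' + a' ** ?Q J t) \<le> ?n * card (insert i J) * D * R ^ card (insert i J)"
    proof -
      have "norm ((a t - mat (\<mu> i)) ** Q' + a' ** ?Q J t) \<le> norm (a t - mat (\<mu> i)) * norm Q' + norm a' * norm (?Q J t)"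
        by (intro norm_triangle_le add_mono matrix_matrix_mult_norm_le)
      also have "\<dots> \<le> R * (?n * card J * D * R ^ card J) + D * (?n * R ^ card J)"
        using insert.prems insert.hyps Q'(2) R bound[of J] by (intro add_mono mult_mono) auto
      also have "\<dots> \<le> R * (?n * card J * D * R ^ card J) + D * (?n * R ^ card J) * R"
        using R mult_left_mono[of 1 R "D * (?n * R ^ card J)"] by simp
      also have "\<dots> = ?n * card (insert i J) * D * R ^ card (insert i J)"
        using insert.hyps by (simp add: algebra_simps)
      finally show ?thesis .
    qed
    ultimately show ?case by blast
  qed (auto simp: mpoly_1 R)
qed

text \<open>The system on one ray: \<open>a\<close> stands for the symbol in a unit direction,
  \<open>\<rho>\<close> for the size of the frequency and \<open>\<epsilon>\<close> for the length
  of a time step. The relations \<open>rho_eps\<close> and \<open>eps_m\<close> are what makes the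
  two errors at most of order \<open>1 / \<epsilon>\<close>. The numbers \<open>D\<close>,
  \<open>M\<close>, \<open>c\<close>, \<open>N\<close> and \<open>m\<close> will be the same for all
  rays, so every constant built from them is uniform in the frequency.\<close>

locale hyperbolic_path =
  fixes a :: "real \<Rightarrow> complex ^ 'm::finite ^ 'm" and B :: "real \<Rightarrow> complex ^ 'm ^ 'm"
    and \<nu> :: "nat \<Rightarrow> real \<Rightarrow> real" and T \<alpha> \<epsilon> \<rho> D M c N :: real and m :: nat
  assumes m_def: "m = CARD('m)" and N_def: "N = norm (mat 1 :: complex ^ 'm ^ 'm)"
    and T: "0 < T" and alpha: "0 < \<alpha>" and eps: "0 < \<epsilon>" "\<epsilon> \<le> 1" and rho: "0 < \<rho>"
    and rho_eps: "\<rho> * \<epsilon> powr \<alpha> \<le> 1 / \<epsilon>"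
    and eps_m: "\<epsilon> \<le> (\<epsilon> powr \<alpha>) ^ (m - 1)"
    and D: "0 \<le> D" and M: "0 \<le> M" and c: "1 \<le> c"
    and a_deriv: "m \<noteq> 1 \<Longrightarrow> t \<in> {0..T} \<Longrightarrow>
      \<exists>a'. (a has_vector_derivative a') (at t within {0..T}) \<and> norm a' \<le> D"
    and a_le: "t \<in> {0..T} \<Longrightarrow> norm (a t) \<le> D"
    and B_le: "t \<in> {0..T} \<Longrightarrow> norm (B t) \<le> D"
    and charpoly_a: "t \<in> {0..T} \<Longrightarrow>
      charpoly (a t) = (\<Prod>j\<in>{1..m}. [:- complex_of_real (\<nu> j t), 1:])"
    and ordered: "t \<in> {0..T} \<Longrightarrow> 1 \<le> i \<Longrightarrow> i \<le> j \<Longrightarrow> j \<le> m \<Longrightarrow> \<nu> i t \<le> \<nu> j t"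
    and hoelder: "j \<in> {1..m} \<Longrightarrow> t \<in> {0..T} \<Longrightarrow> t' \<in> {0..T} \<Longrightarrow>
      \<bar>\<nu> j t - \<nu> j t'\<bar> \<le> M * \<bar>t - t'\<bar> powr \<alpha>"
    and separation: "i \<in> {1..m} \<Longrightarrow> j \<in> {1..m} \<Longrightarrow> k \<in> {2..m} \<Longrightarrow>
      t \<in> {0..T} \<Longrightarrow> \<bar>\<nu> i t - \<nu> j t\<bar> \<le> c * \<bar>\<nu> k t - \<nu> (k - 1) t\<bar>"
begin

abbreviation "I \<equiv> {1..m}"

definition "h = \<epsilon> powr \<alpha>"
definition "\<mu> t j = \<nu> j t + real j * h"
text \<open>The diameter of the spectrum, kept away from 0 by the spacing \<open>h\<close>. All gaps
  between nodes lie between fixed multiples of it.\<close>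

definition "\<delta> t = \<nu> m t - \<nu> 1 t + h"
definition "l t j = lagrange I (\<lambda>i. complex_of_real (\<mu> t i)) j"
definition "d t j = (\<Prod>i\<in>I - {j}. complex_of_real (\<mu> t j) - complex_of_real (\<mu> t i))"
text \<open>Collects the spread \<open>m * \<delta>\<close> of the nodes, their shift by at most
  \<open>m * h\<close> and their motion by at most \<open>M * h\<close>, where
  \<open>h \<le> \<delta>\<close>; see \<open>far\<close>.\<close>

definition "K = 2 * real m + M"
text \<open>Bounds every factor \<open>a t - mat \<mu>\<close>, as the nodes are at most
  \<open>D + m\<close> in size; the summand 1 gives \<open>1 \<le> R\<close>.\<close>

definition "R = 1 + D + N * (D + real m)"

lemma m_pos: "1 \<le> m"
  by (simp add: m_def Suc_leI)

lemma h: "0 < h" "h \<le> 1"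
  using eps alpha by (auto simp: h_def powr_le1)

lemma delta_ge: "t \<in> {0..T} \<Longrightarrow> h \<le> \<delta> t"
  using ordered[of t 1 m] m_pos by (simp add: \<delta>_def)

lemma K_ge: "1 \<le> K" "real m + M \<le> K" "real m \<le> K"
  using M m_pos by (auto simp: K_def)

text \<open>The gap between \<open>i\<close> and \<open>j\<close> includes the consecutive gap from
  \<open>j - 1\<close> to \<open>j\<close>, which controls the whole diameter by the separation
  hypothesis. The shift contributes at least one further \<open>h\<close>.\<close>

lemma mu_gap_less:
  assumes t: "t \<in> {0..T}" and ij: "i \<in> I" "j \<in> I" "i < j"
  shows "\<delta> t / c \<le> \<mu> t j - \<mu> t i"
proof -
  have "\<bar>\<nu> m t - \<nu> 1 t\<bar> \<le> c * \<bar>\<nu> j t - \<nu> (j - 1) t\<bar>"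
    using ij m_pos by (intro separation t) auto
  moreover have "\<nu> 1 t \<le> \<nu> m t" "\<nu> (j - 1) t \<le> \<nu> j t" "\<nu> i t \<le> \<nu> (j - 1) t"
    using ij m_pos by (auto intro!: ordered t)
  ultimately have "\<nu> m t - \<nu> 1 t \<le> c * (\<nu> j t - \<nu> i t)"
    using c by (smt (verit) mult_left_mono)
  moreover have "h \<le> c * ((real j - real i) * h)"
    using mult_mono[of 1 c 1 "real j - real i"] c ij h by (simp add: mult.assoc[symmetric])
  ultimately have "\<delta> t \<le> c * (\<mu> t j - \<mu> t i)"
    by (simp add: \<delta>_def \<mu>_def algebra_simps)
  then show ?thesis using c by (simp add: divide_le_eq mult.commute)
qed

lemma mu_gap:
  assumes "t \<in> {0..T}" "i \<in> I" "j \<in> I" "i \<noteq> j"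
  shows "\<delta> t / c \<le> \<bar>\<mu> t j - \<mu> t i\<bar>"
  using mu_gap_less[of t i j] mu_gap_less[of t j i] assms by (cases "i < j") auto

lemma mu_diff_le:
  assumes t: "t \<in> {0..T}" and ij: "i \<in> I" "j \<in> I"
  shows "\<bar>\<mu> t j - \<mu> t i\<bar> \<le> m * \<delta> t"
proof -
  have *: "\<mu> t j - \<mu> t i \<le> m * \<delta> t" if ij: "i \<in> I" "j \<in> I" for i j
  proof -
    have "\<nu> j t \<le> \<nu> m t" "\<nu> 1 t \<le> \<nu> i t"
      using ij by (auto intro!: ordered t)
    moreover have "(real j - real i) * h \<le> real m * h"
      using ij h by (intro mult_right_mono) auto
    moreover have "\<nu> m t - \<nu> 1 t \<le> real m * (\<nu> m t - \<nu> 1 t)"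
      using mult_right_mono[of 1 "real m" "\<nu> m t - \<nu> 1 t"] m_pos ordered[OF t, of 1 m] by simp
    ultimately show ?thesis by (simp add: \<mu>_def \<delta>_def algebra_simps)
  qed
  show ?thesis using *[OF ij] *[OF ij(2,1)] by linarith
qed

lemma nu_mu_close:
  assumes t: "t1 \<in> {0..T}" "t \<in> {0..T}" "\<bar>t - t1\<bar> \<le> \<epsilon>" and j: "j \<in> I"
  shows "\<bar>\<mu> t1 j - \<nu> j t\<bar> \<le> K * h" "\<bar>\<mu> t1 j - \<mu> t j\<bar> \<le> M * h"
proof -
  have "\<bar>\<nu> j t1 - \<nu> j t\<bar> \<le> M * \<bar>t1 - t\<bar> powr \<alpha>"
    by (intro hoelder t j)
  also have "\<dots> \<le> M * h"
    unfolding h_def using t alpha M by (intro mult_left_mono powr_mono2) auto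
  finally have 1: "\<bar>\<nu> j t1 - \<nu> j t\<bar> \<le> M * h" .
  then show "\<bar>\<mu> t1 j - \<mu> t j\<bar> \<le> M * h" by (simp add: \<mu>_def)
  have "0 \<le> real j * h" using h by simp
  then have "\<bar>\<mu> t1 j - \<nu> j t\<bar> \<le> M * h + real j * h"
    using 1 unfolding \<mu>_def by linarith
  also have "\<dots> \<le> M * h + real m * h"
    using j h by (intro add_left_mono mult_right_mono) auto
  also have "\<dots> \<le> K * h"
    using K_ge h by (simp add: distrib_right[symmetric] add.commute)
  finally show "\<bar>\<mu> t1 j - \<nu> j t\<bar> \<le> K * h" .
qed

lemma far:
  assumes t: "t1 \<in> {0..T}" "t \<in> {0..T}" "\<bar>t - t1\<bar> \<le> \<epsilon>" and ij: "i \<in> I" "j \<in> I"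
  shows "\<bar>\<mu> t1 j - \<nu> i t\<bar> \<le> K * \<delta> t1" "\<bar>\<mu> t j - \<mu> t1 i\<bar> \<le> K * \<delta> t1"
proof -
  have "(m + M) * h \<le> (m + M) * \<delta> t1" "M * h \<le> M * \<delta> t1" "0 \<le> real m * \<delta> t1"
    using delta_ge[OF t(1)] M h by (auto intro!: mult_left_mono)
  moreover have "\<bar>\<mu> t1 i - \<nu> i t\<bar> \<le> (m + M) * h"
  proof -
    have "\<bar>\<mu> t1 i - \<mu> t i\<bar> \<le> M * h" using nu_mu_close[OF t ij(1)] by simp
    moreover have "\<bar>\<mu> t i - \<nu> i t\<bar> \<le> m * h" using ij h by (simp add: \<mu>_def)
    ultimately show ?thesis by (simp add: algebra_simps)
  qed
  ultimately show "\<bar>\<mu> t1 j - \<nu> i t\<bar> \<le> K * \<delta> t1" "\<bar>\<mu> t j - \<mu> t1 i\<bar> \<le> K * \<delta> t1"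
    using mu_diff_le[OF t(1) ij] nu_mu_close(2)[OF t ij(2)]
    by (simp_all add: K_def algebra_simps)
qed

lemma inj_mu: "t \<in> {0..T} \<Longrightarrow> inj_on (\<lambda>i. complex_of_real (\<mu> t i)) I"
proof (rule inj_onI, rule ccontr)
  fix i j assume t: "t \<in> {0..T}" and ij: "i \<in> I" "j \<in> I" "complex_of_real (\<mu> t i) = complex_of_real (\<mu> t j)" "i \<noteq> j"
  then have "\<delta> t / c \<le> 0" using mu_gap[OF t ij(1,2,4)] by simp
  then show False using delta_ge[OF t] h c by (simp add: divide_le_0_iff)
qed

lemma d_ge:
  assumes t: "t \<in> {0..T}" "j \<in> I"
  shows "(\<delta> t / c) ^ (m - 1) \<le> norm (d t j)"
proof -
  have "(\<delta> t / c) ^ (m - 1) = (\<Prod>i\<in>I - {j}. \<delta> t / c)"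
    using t by simp
  also have "\<dots> \<le> (\<Prod>i\<in>I - {j}. \<bar>\<mu> t j - \<mu> t i\<bar>)"
    using mu_gap[OF t(1)] t delta_ge[OF t(1)] h c by (intro prod_mono) auto
  also have "\<dots> = norm (d t j)"
    by (simp add: d_def prod_norm[symmetric] norm_of_real del: of_real_diff flip: of_real_diff)
  finally show ?thesis .
qed

lemma d_pos: "t \<in> {0..T} \<Longrightarrow> j \<in> I \<Longrightarrow> 0 < norm (d t j)"
  using d_ge[of t j] delta_ge[of t] h c by (smt (verit) zero_less_divide_iff zero_less_power)

text \<open>The denominator has \<open>m - 1\<close> factors, each at least \<open>h / c\<close>,
  and \<open>eps_m\<close> compares the power of \<open>h\<close> with \<open>\<epsilon>\<close>.
  Hence a derivative of the coefficients in time costs no more than the inverse length of a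
  step.\<close>

lemma inverse_d_le:
  assumes t: "t \<in> {0..T}" "j \<in> I"
  shows "1 / norm (d t j) \<le> c ^ m / \<epsilon>"
proof -
  have "\<epsilon> \<le> \<delta> t ^ (m - 1)"
    using eps_m power_mono[OF delta_ge[OF t(1)], of "m - 1"] h by (simp add: h_def)
  also have "\<dots> = c ^ (m - 1) * (\<delta> t / c) ^ (m - 1)"
    using c by (simp add: power_divide)
  also have "\<dots> \<le> c ^ m * norm (d t j)"
    using d_ge[OF t] c delta_ge[OF t(1)] h by (intro mult_mono power_increasing) auto
  finally show ?thesis
    using d_pos[OF t] eps by (simp add: field_simps)
qed

text \<open>There are \<open>m - 1\<close> differences of size at most \<open>K * \<delta>\<close>
  in the numerator and as many gaps of size at least \<open>\<delta> / c\<close> in the denominator.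
  The scale \<open>\<delta>\<close> cancels, so the bound does not see the frequency.\<close>

lemma product_quotient_le:
  assumes t: "t \<in> {0..T}" "j \<in> I" and x: "0 \<le> x" "x \<le> (K * \<delta> t) ^ (m - 1)"
  shows "x / norm (d t j) \<le> (K * c) ^ m"
proof -
  have "x \<le> (K * c) ^ (m - 1) * (\<delta> t / c) ^ (m - 1)"
    using x c by (simp add: power_mult_distrib power_divide)
  also have "\<dots> \<le> (K * c) ^ m * norm (d t j)"
    using d_ge[OF t] c K_ge delta_ge[OF t(1)] h mult_mono[of 1 K 1 c]
    by (intro mult_mono power_increasing) auto
  finally show ?thesis using d_pos[OF t] by (simp add: field_simps)
qed

text \<open>Interpolation of the constant 1 gives a partition of unity. Through it the energy
  controls the norm of the solution.\<close>

lemma sum_lagrange: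
  assumes "t \<in> {0..T}"
  shows "(\<Sum>k\<in>I. mpoly A (l t k) *v x) = x"
proof -
  have "(1::complex poly) = (\<Sum>k\<in>I. smult (poly 1 (complex_of_real (\<mu> t k))) (l t k))"
    unfolding l_def using inj_mu[OF assms] m_pos by (intro lagrange_interpolation) auto
  then have "mpoly A 1 = (\<Sum>k\<in>I. mpoly A (l t k))"
    by (metis (no_types, lifting) mpoly_sum poly_1 smult_1_left sum.cong)
  then show ?thesis
    by (metis (no_types) mpoly_1 matrix_vector_mul_lid bounded_bilinear.sum_left[OF bounded_bilinear_matrix_vector_mult])
qed

lemma mpoly_l: "mpoly A (l t j) = mat (1 / d t j) ** mpoly A (\<Prod>i\<in>I - {j}. [:- complex_of_real (\<mu> t i), 1:])"
  unfolding l_def lagrange_def d_def mpoly_smult ..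

lemma mu_le:
  assumes t: "t \<in> {0..T}" and j: "j \<in> I"
  shows "\<bar>\<mu> t j\<bar> \<le> D + real m"
proof -
  have "poly (charpoly (a t)) (complex_of_real (\<nu> j t)) = 0"
    using j by (auto simp: charpoly_a[OF t] poly_prod intro!: prod_zero)
  then have "\<bar>\<nu> j t\<bar> \<le> D"
    using charpoly_root_norm_le[of "a t" "complex_of_real (\<nu> j t)"] a_le[OF t] by simp
  moreover have "real j * h \<le> real m * 1" "0 \<le> real j * h"
    using j h by (auto intro!: mult_mono simp del: mult_1_right)
  ultimately show ?thesis by (simp add: \<mu>_def)
qed

lemma N_nonneg: "0 \<le> N"
  by (simp add: N_def)

lemma R_ge: "1 \<le> R"
  using D N_nonneg by (simp add: R_def)

lemma factor_norm_le:
  assumes t: "t1 \<in> {0..T}" "t \<in> {0..T}" and j: "j \<in> I"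
  shows "norm (a t - mat (complex_of_real (\<mu> t1 j))) \<le> R"
proof -
  have "norm (a t - mat (complex_of_real (\<mu> t1 j))) \<le> norm (a t) + norm (mat (complex_of_real (\<mu> t1 j)) :: complex ^ 'm ^ 'm)"
    by (rule norm_triangle_ineq4)
  also have "norm (mat (complex_of_real (\<mu> t1 j)) :: complex ^ 'm ^ 'm) = \<bar>\<mu> t1 j\<bar> * N"
    using norm_mat_mult[of "complex_of_real (\<mu> t1 j)" "mat 1 :: complex ^ 'm ^ 'm"] by (simp add: N_def)
  also have "norm (a t) + \<bar>\<mu> t1 j\<bar> * N \<le> D + (D + real m) * N"
    using a_le[OF t(2)] mu_le[OF t(1) j] N_nonneg by (intro add_mono mult_right_mono) auto
  finally show ?thesis by (simp add: R_def mult.commute)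
qed

lemma mpoly_l_bound:
  assumes t: "t1 \<in> {0..T}" "t \<in> {0..T}" and j: "j \<in> I"
  shows "norm (mpoly (a t) (l t1 j)) \<le> N * R ^ m * c ^ m / \<epsilon>"
    and "\<exists>L'. ((\<lambda>t. mpoly (a t) (l t1 j)) has_vector_derivative L') (at t within {0..T})
      \<and> norm L' \<le> N * m * D * R ^ m * c ^ m / \<epsilon>"
proof -
  let ?J = "I - {j}"
  let ?Q = "\<lambda>t. mpoly (a t) (\<Prod>i\<in>?J. [:- complex_of_real (\<mu> t1 i), 1:])"
  \<comment> \<open>With a single node the product over \<open>?J\<close> is empty and no derivative
    of \<open>a\<close> enters; 0 is then a placeholder for \<open>a'\<close>.\<close>
  have "\<exists>a'. (?J \<noteq> {} \<longrightarrow> (a has_vector_derivative a') (at t within {0..T})) \<and> norm a' \<le> D"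
  proof (cases "?J = {}")
    case True
    then show ?thesis using D by (intro exI[of _ 0]) auto
  next
    case False
    have "I - {j} = {}" if "m = 1" using j unfolding that by auto
    with False have "m \<noteq> 1" by blast
    then show ?thesis using a_deriv[OF _ t(2)] by blast
  qed
  then obtain a' where a': "?J \<noteq> {} \<Longrightarrow> (a has_vector_derivative a') (at t within {0..T})" "norm a' \<le> D"
    by blast
  have fac: "norm (a t - mat (complex_of_real (\<mu> t1 i))) \<le> R" if "i \<in> ?J" for i
    using factor_norm_le[OF t] that by blast
  note Q = mpoly_prod_linear_derivative[where J="?J" and a=a and t=t and R=R and D=D and S="{0..T}" and a'=a'
      and \<mu>="\<lambda>i. complex_of_real (\<mu> t1 i)", OF _ R_ge D fac a', unfolded N_def[symmetric]]
  obtain Q' where Q': "(?Q has_vector_derivative Q') (at t within {0..T})"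
    "norm Q' \<le> N * card ?J * D * R ^ card ?J" using Q(2) by auto
  have card: "card ?J \<le> m" by (metis card_Diff1_le card_atLeastAtMost diff_Suc_1 finite_atLeastAtMost)
  have inv: "norm (1 / d t1 j) \<le> c ^ m / \<epsilon>"
    using inverse_d_le[OF t(1) j] by (simp add: norm_divide)
  have pw: "R ^ card ?J \<le> R ^ m" using card R_ge by (intro power_increasing) auto
  have Q1: "norm (?Q t) \<le> N * R ^ m"
    by (rule order_trans[OF Q(1) mult_left_mono[OF pw N_nonneg]]) auto
  have "norm (mpoly (a t) (l t1 j)) = norm (1 / d t1 j) * norm (?Q t)"
    unfolding mpoly_l norm_mat_mult ..
  also have "\<dots> \<le> c ^ m / \<epsilon> * (N * R ^ m)"
    by (rule mult_mono[OF inv Q1]) (use c eps in auto)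
  finally show "norm (mpoly (a t) (l t1 j)) \<le> N * R ^ m * c ^ m / \<epsilon>" by (simp add: mult_ac)
  have "N * card ?J * D * R ^ card ?J \<le> N * m * D * R ^ m"
    using card N_nonneg R_ge D by (intro mult_mono pw mult_right_mono mult_left_mono) simp_all
  with Q'(2) have Q2: "norm Q' \<le> N * m * D * R ^ m" by linarith
  have "norm (mat (1 / d t1 j) ** Q') \<le> c ^ m / \<epsilon> * (N * m * D * R ^ m)"
    unfolding norm_mat_mult by (rule mult_mono[OF inv Q2]) (use c eps in auto)
  moreover have "((\<lambda>t. mpoly (a t) (l t1 j)) has_vector_derivative (mat (1 / d t1 j) ** Q')) (at t within {0..T})"
    unfolding mpoly_l
    by (rule bounded_linear.has_vector_derivative[OF bounded_bilinear.bounded_linear_right[OF bounded_bilinear_matrix_mult] Q'(1)])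
  ultimately show "\<exists>L'. ((\<lambda>t. mpoly (a t) (l t1 j)) has_vector_derivative L') (at t within {0..T})
      \<and> norm L' \<le> N * m * D * R ^ m * c ^ m / \<epsilon>"
    by (intro exI conjI) (auto simp: mult_ac)
qed

section \<open>The energy with frozen nodes\<close>

definition "solution V \<longleftrightarrow> (\<forall>t\<in>{0..T}. (V has_vector_derivative
   ((\<i> * complex_of_real \<rho>) *s (a t *v V t) + \<i> *s (B t *v V t))) (at t within {0..T}))"

text \<open>The nodes belong to time \<open>t1\<close>, the matrix and the vector to time
  \<open>t\<close>; so no eigenvalue is differentiated.\<close>

definition "W V t1 t = (\<Sum>j\<in>I. (norm (mpoly (a t) (l t1 j) *v V t))\<^sup>2)"

text \<open>The first summand is the interpolation error of \<open>mpoly_lagrange_mult\<close>. The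
  second one counts the same bound twice, for the zero order term \<open>B\<close> and for the time
  derivative of the Lagrange polynomials at \<open>a t\<close>.\<close>

definition "C1 = (K * c) ^ m * K + 2 * N * m * D * R ^ m * c ^ m"

text \<open>Each component \<open>y j\<close> has the derivative
  \<open>\<i> * \<rho> * \<mu> t1 j\<close> times itself plus an error \<open>r\<close> of size at
  most \<open>C1 / \<epsilon> * S\<close>. The first term is orthogonal to \<open>y j\<close> and
  drops out; the error is estimated with Cauchy-Schwarz.\<close>

lemma energy_derivative:
  assumes V: "solution V" and t: "t1 \<in> {0..T}" "t \<in> {0..T}" "\<bar>t - t1\<bar> \<le> \<epsilon>"
  shows "\<exists>W'. (W V t1 has_real_derivative W') (at t within {0..T}) \<and> W' \<le> 2 * m * C1 / \<epsilon> * W V t1 t"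
proof -
  define y where "y j = mpoly (a t) (l t1 j) *v V t" for j
  define S where "S = (\<Sum>k\<in>I. norm (y k))"
  have V_S: "norm (V t) \<le> S"
    using norm_sum[of y I] sum_lagrange[OF t(1), of "a t" "V t"] unfolding S_def y_def by metis
  have S0: "0 \<le> S" unfolding S_def by (intro sum_nonneg) auto
  have ex: "\<exists>r. ((\<lambda>t. mpoly (a t) (l t1 j) *v V t) has_vector_derivative
      (\<i> * complex_of_real (\<rho> * \<mu> t1 j)) *s y j + r) (at t within {0..T}) \<and> norm r \<le> C1 / \<epsilon> * S"
    if j: "j \<in> I" for j
  proof -
    obtain L' where L': "((\<lambda>t. mpoly (a t) (l t1 j)) has_vector_derivative L') (at t within {0..T})"
      "norm L' \<le> N * m * D * R ^ m * c ^ m / \<epsilon>" using mpoly_l_bound(2)[OF t(1,2) j] by blast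
    let ?L = "mpoly (a t) (l t1 j)"
    let ?V' = "(\<i> * complex_of_real \<rho>) *s (a t *v V t) + \<i> *s (B t *v V t)"
    let ?E = "(1 / d t1 j) *s (\<Sum>k\<in>I. (\<Prod>i\<in>I. complex_of_real (\<mu> t1 k) - complex_of_real (\<nu> i t)) *s y k)"
    define r where "r = - ((\<i> * complex_of_real \<rho>) *s ?E) + \<i> *s (?L *v (B t *v V t)) + L' *v V t"
    have "((\<lambda>t. mpoly (a t) (l t1 j) *v V t) has_vector_derivative (?L *v ?V' + L' *v V t)) (at t within {0..T})"
      using V t by (intro bounded_bilinear.has_vector_derivative[OF bounded_bilinear_matrix_vector_mult L'(1)])
        (auto simp: solution_def)
    moreover have "?L *v ?V' + L' *v V t = (\<i> * complex_of_real (\<rho> * \<mu> t1 j)) *s y j + r"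
    proof -
      have "?L *v (a t *v V t) = complex_of_real (\<mu> t1 j) *s y j - ?E"
        unfolding y_def l_def d_def
        using charpoly_a[OF t(2)] j m_def inj_mu[OF t(1)] by (intro mpoly_lagrange_mult) auto
      moreover have "?L *v ?V' = (\<i> * complex_of_real \<rho>) *s (?L *v (a t *v V t)) + \<i> *s (?L *v (B t *v V t))"
        by (simp only: matrix_vector_right_distrib vector_scalar_commute)
      ultimately have "?L *v ?V' = (\<i> * complex_of_real \<rho>) *s (complex_of_real (\<mu> t1 j) *s y j - ?E) + \<i> *s (?L *v (B t *v V t))"
        by (simp only:)
      then show ?thesis
        by (simp only: r_def vector_ssub_ldistrib vector_smult_assoc of_real_mult mult.assoc) simp
    qed
    moreover have "norm r \<le> C1 / \<epsilon> * S"
    proof -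
      \<comment> \<open>The factor with \<open>i = k\<close> compares an eigenvalue with its own
        shifted and frozen copy, hence it is of size \<open>h\<close>. The other
        \<open>m - 1\<close> factors are balanced by the denominator.\<close>
      have "norm (\<Prod>i\<in>I. complex_of_real (\<mu> t1 k) - complex_of_real (\<nu> i t)) / norm (d t1 j) \<le> (K * c) ^ m * K * h"
        if k: "k \<in> I" for k
      proof -
        have "norm (\<Prod>i\<in>I. complex_of_real (\<mu> t1 k) - complex_of_real (\<nu> i t)) = (\<Prod>i\<in>I. \<bar>\<mu> t1 k - \<nu> i t\<bar>)"
          by (simp add: prod_norm[symmetric] norm_of_real del: of_real_diff flip: of_real_diff)
        also have "\<dots> = \<bar>\<mu> t1 k - \<nu> k t\<bar> * (\<Prod>i\<in>I - {k}. \<bar>\<mu> t1 k - \<nu> i t\<bar>)"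
          using k by (subst prod.remove[of I k]) auto
        finally have eq: "norm (\<Prod>i\<in>I. complex_of_real (\<mu> t1 k) - complex_of_real (\<nu> i t)) = \<dots>" .
        have "(\<Prod>i\<in>I - {k}. \<bar>\<mu> t1 k - \<nu> i t\<bar>) \<le> (\<Prod>i\<in>I - {k}. K * \<delta> t1)"
          using far(1)[OF t _ k] by (intro prod_mono) auto
        then have "(\<Prod>i\<in>I - {k}. \<bar>\<mu> t1 k - \<nu> i t\<bar>) \<le> (K * \<delta> t1) ^ (m - 1)"
          using k by simp
        then have "(\<Prod>i\<in>I - {k}. \<bar>\<mu> t1 k - \<nu> i t\<bar>) / norm (d t1 j) \<le> (K * c) ^ m"
          by (intro product_quotient_le[OF t(1) j] prod_nonneg) auto
        then have "\<bar>\<mu> t1 k - \<nu> k t\<bar> * ((\<Prod>i\<in>I - {k}. \<bar>\<mu> t1 k - \<nu> i t\<bar>) / norm (d t1 j)) \<le> (K * h) * (K * c) ^ m"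
          using nu_mu_close(1)[OF t k] by (intro mult_mono) (auto intro!: divide_nonneg_nonneg prod_nonneg)
        then show ?thesis unfolding eq by (simp add: mult_ac)
      qed
      then have coef: "norm (1 / d t1 j) * norm (\<Prod>i\<in>I. complex_of_real (\<mu> t1 k) - complex_of_real (\<nu> i t)) \<le> (K * c) ^ m * K * h"
        if "k \<in> I" for k using that by (simp add: norm_divide)
      have "norm ?E \<le> (\<Sum>k\<in>I. norm (1 / d t1 j) * norm (\<Prod>i\<in>I. complex_of_real (\<mu> t1 k) - complex_of_real (\<nu> i t)) * norm (y k))"
        unfolding norm_smult_vec mult.assoc sum_distrib_left[symmetric]
        by (intro mult_left_mono order_trans[OF norm_sum]) (simp_all only: norm_smult_vec norm_ge_zero order_refl)
      also have "\<dots> \<le> (\<Sum>k\<in>I. (K * c) ^ m * K * h * norm (y k))"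
        using coef by (intro sum_mono mult_right_mono) auto
      finally have E: "norm ?E \<le> (K * c) ^ m * K * h * S" by (simp add: S_def sum_distrib_left)
      have "norm (\<i> * complex_of_real \<rho>) = \<rho>" using rho by (simp add: norm_mult)
      then have n\<rho>: "norm ((\<i> * complex_of_real \<rho>) *s ?E) = \<rho> * norm ?E"
        by (simp only: norm_smult_vec)
      have "\<rho> * norm ?E \<le> \<rho> * ((K * c) ^ m * K * h * S)"
        using E rho by (intro mult_left_mono) auto
      also have "\<dots> = (K * c) ^ m * K * (\<rho> * h) * S" by (simp only: mult_ac)
      \<comment> \<open>The factor \<open>h\<close> gained above pays for the frequency:
        \<open>\<rho> * h \<le> 1 / \<epsilon>\<close> is \<open>rho_eps\<close>.\<close>
      also have "\<dots> \<le> (K * c) ^ m * K * (1 / \<epsilon>) * S"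
        using rho_eps S0 K_ge c unfolding h_def by (intro mult_right_mono mult_left_mono) auto
      also have "\<dots> = (K * c) ^ m * K / \<epsilon> * S" by simp
      finally have 1: "norm ((\<i> * complex_of_real \<rho>) *s ?E) \<le> (K * c) ^ m * K / \<epsilon> * S"
        by (simp only: n\<rho>)
      have X0: "0 \<le> N * R ^ m * c ^ m / \<epsilon>"
        by (rule order_trans[OF norm_ge_zero mpoly_l_bound(1)[OF t(1,2) j]])
      have "norm (?L *v (B t *v V t)) \<le> norm ?L * (norm (B t) * norm (V t))"
        by (intro order_trans[OF matrix_vector_mult_norm_le] mult_left_mono matrix_vector_mult_norm_le) auto
      also have "\<dots> \<le> (N * R ^ m * c ^ m / \<epsilon>) * (D * S)"
        by (rule mult_mono[OF mpoly_l_bound(1)[OF t(1,2) j] mult_mono[OF B_le[OF t(2)] V_S D norm_ge_zero] X0]) simp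
      \<comment> \<open>The factor \<open>m\<close> is inserted so that this error and the next one
        have the same bound.\<close>
      also have "\<dots> \<le> real m * (N * R ^ m * c ^ m / \<epsilon> * (D * S))"
        using mult_right_mono[of 1 "real m" "N * R ^ m * c ^ m / \<epsilon> * (D * S)"] m_pos
          mult_nonneg_nonneg[OF X0 mult_nonneg_nonneg[OF D S0]] by simp
      also have "\<dots> = N * m * D * R ^ m * c ^ m / \<epsilon> * S" by simp
      finally have 2: "norm (\<i> *s (?L *v (B t *v V t))) \<le> N * m * D * R ^ m * c ^ m / \<epsilon> * S"
        by (simp only: norm_smult_vec norm_ii mult_1_left)
      have "norm (L' *v V t) \<le> norm L' * norm (V t)" by (rule matrix_vector_mult_norm_le)
      also have "\<dots> \<le> N * m * D * R ^ m * c ^ m / \<epsilon> * S"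
        by (rule mult_mono[OF L'(2) V_S order_trans[OF norm_ge_zero L'(2)] norm_ge_zero])
      finally have 3: "norm (L' *v V t) \<le> N * m * D * R ^ m * c ^ m / \<epsilon> * S" .
      have "norm r \<le> (K * c) ^ m * K / \<epsilon> * S + N * m * D * R ^ m * c ^ m / \<epsilon> * S + N * m * D * R ^ m * c ^ m / \<epsilon> * S"
        unfolding r_def
        by (intro norm_triangle_le add_mono) (simp_all only: norm_minus_cancel 1 2 3)
      also have "\<dots> = C1 / \<epsilon> * S"
        using eps by (simp add: C1_def field_simps)
      finally show ?thesis .
    qed
    ultimately show ?thesis by (intro exI[of _ r] conjI) (simp_all only:)
  qed
  have "\<forall>j\<in>I. \<exists>r. ((\<lambda>t. mpoly (a t) (l t1 j) *v V t) has_vector_derivative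
      (\<i> * complex_of_real (\<rho> * \<mu> t1 j)) *s y j + r) (at t within {0..T}) \<and> norm r \<le> C1 / \<epsilon> * S"
    by (rule ballI, rule ex)
  from bchoice[OF this] obtain r where r': "\<forall>j\<in>I. ((\<lambda>t. mpoly (a t) (l t1 j) *v V t) has_vector_derivative
      (\<i> * complex_of_real (\<rho> * \<mu> t1 j)) *s y j + r j) (at t within {0..T}) \<and> norm (r j) \<le> C1 / \<epsilon> * S"
    by (elim exE)
  have r: "\<And>j. j \<in> I \<Longrightarrow> ((\<lambda>t. mpoly (a t) (l t1 j) *v V t) has_vector_derivative
      (\<i> * complex_of_real (\<rho> * \<mu> t1 j)) *s y j + r j) (at t within {0..T})"
    "\<And>j. j \<in> I \<Longrightarrow> norm (r j) \<le> C1 / \<epsilon> * S"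
    using r' by simp_all
  define W' where "W' = (\<Sum>j\<in>I. 2 * (y j \<bullet> r j))"
  have "((\<lambda>t. (norm (mpoly (a t) (l t1 j) *v V t))\<^sup>2) has_real_derivative 2 * (y j \<bullet> r j)) (at t within {0..T})"
    if "j \<in> I" for j
    using has_vector_derivative_norm_square[OF r(1)[OF that]]
    by (simp only: y_def[symmetric] inner_add_right inner_ii_scaleR_self add_0)
  then have "(W V t1 has_real_derivative W') (at t within {0..T})"
    unfolding W_def W'_def by (intro DERIV_sum)
  moreover have "W' \<le> 2 * m * C1 / \<epsilon> * W V t1 t"
  proof -
    have C1: "0 \<le> C1" using K_ge c N_nonneg R_ge D by (simp add: C1_def)
    have "W' \<le> (\<Sum>j\<in>I. 2 * (norm (y j) * (C1 / \<epsilon> * S)))"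
      unfolding W'_def using r(2)
      by (intro sum_mono mult_left_mono order_trans[OF norm_cauchy_schwarz]) auto
    also have "\<dots> = 2 * C1 / \<epsilon> * S\<^sup>2"
      unfolding S_def by (simp add: sum_distrib_left sum_distrib_right power2_eq_square mult_ac)
    also have "\<dots> \<le> 2 * C1 / \<epsilon> * (real m * (\<Sum>k\<in>I. (norm (y k))\<^sup>2))"
      using sum_squared_le_sum_of_squares[of "\<lambda>k. norm (y k)" I] C1 eps
      by (intro mult_left_mono) (auto simp: S_def mult.commute)
    finally show ?thesis by (simp add: W_def y_def mult_ac)
  qed
  ultimately show ?thesis by blast
qed

text \<open>The rate \<open>2 * m * C1 / \<epsilon>\<close> acts for a time of at most
  \<open>\<epsilon>\<close>.\<close>

lemma W_step:
  assumes V: "solution V" and t: "t1 \<in> {0..T}" "t2 \<in> {0..T}" "t1 \<le> t2" "t2 - t1 \<le> \<epsilon>"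
  shows "W V t1 t2 \<le> exp (2 * m * C1) * W V t1 t1"
proof -
  have "\<exists>W'. (W V t1 has_real_derivative W') (at t within {t1..t2}) \<and> W' \<le> 2 * m * C1 / \<epsilon> * W V t1 t"
    if tt: "t \<in> {t1..t2}" for t
  proof -
    obtain W' where W': "(W V t1 has_real_derivative W') (at t within {0..T})" "W' \<le> 2 * m * C1 / \<epsilon> * W V t1 t"
      using energy_derivative[OF V t(1), of t] tt t by auto
    have "{t1..t2} \<subseteq> {0..T}" using t by auto
    then show ?thesis using DERIV_subset[OF W'(1)] W'(2) by blast
  qed
  then obtain W' where W': "\<And>t. t \<in> {t1..t2} \<Longrightarrow> (W V t1 has_real_derivative W' t) (at t within {t1..t2})"
    "\<And>t. t \<in> {t1..t2} \<Longrightarrow> W' t \<le> 2 * m * C1 / \<epsilon> * W V t1 t" by metis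
  have "W V t1 t2 \<le> exp (2 * m * C1 / \<epsilon> * (t2 - t1)) * W V t1 t1"
    using t(3) W' by (rule gronwall_decreasing)
  also have "\<dots> \<le> exp (2 * m * C1) * W V t1 t1"
  proof (intro mult_right_mono)
    have C1: "0 \<le> C1" using K_ge c N_nonneg R_ge D by (simp add: C1_def)
    have "2 * m * C1 / \<epsilon> * (t2 - t1) \<le> 2 * m * C1 / \<epsilon> * \<epsilon>"
      using C1 eps t by (intro mult_left_mono) auto
    then show "exp (2 * m * C1 / \<epsilon> * (t2 - t1)) \<le> exp (2 * m * C1)" using eps by simp
  qed (auto simp: W_def intro: sum_nonneg)
  finally show ?thesis .
qed

text \<open>The Lagrange polynomials for the nodes at \<open>t2\<close> are expanded in those for
  the nodes at \<open>t1\<close>. The coefficients are their values at the old nodes, that is,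
  quotients of products of node differences as in \<open>product_quotient_le\<close>.\<close>

lemma W_rebase:
  assumes t: "t1 \<in> {0..T}" "t2 \<in> {0..T}" "\<bar>t1 - t2\<bar> \<le> \<epsilon>"
  shows "W V t2 t2 \<le> m\<^sup>2 * (K * c) ^ (2 * m) * W V t1 t2"
proof -
  define y where "y k = mpoly (a t2) (l t1 k) *v V t2" for k
  define S where "S = (\<Sum>k\<in>I. norm (y k))"
  have KcS: "0 \<le> (K * c) ^ m" "0 \<le> S" using K_ge c by (auto simp: S_def intro: sum_nonneg)
  have "norm (mpoly (a t2) (l t2 j) *v V t2) \<le> (K * c) ^ m * S" if j: "j \<in> I" for j
  proof -
    have deg: "degree (l t2 j) < card I"
    proof -
      have "degree (l t2 j) \<le> degree (\<Prod>i\<in>I - {j}. [:- complex_of_real (\<mu> t2 i), 1:])"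
        unfolding l_def lagrange_def by (rule degree_smult_le)
      also have "\<dots> = card (I - {j})"
        by (rule degree_prod_linear_factors) simp
      also have "\<dots> < card I" by (rule card_Diff1_less[OF _ j]) simp
      finally show ?thesis .
    qed
    have "l t2 j = (\<Sum>k\<in>I. smult (poly (l t2 j) (complex_of_real (\<mu> t1 k))) (l t1 k))"
      unfolding l_def[of t1] by (rule lagrange_interpolation[OF _ inj_mu[OF t(1)] deg]) simp
    from arg_cong[OF this, of "mpoly (a t2)"]
    have "mpoly (a t2) (l t2 j) = (\<Sum>k\<in>I. mpoly (a t2) (smult (poly (l t2 j) (complex_of_real (\<mu> t1 k))) (l t1 k)))"
      by (simp only: mpoly_sum)
    then have "mpoly (a t2) (l t2 j) *v V t2 = (\<Sum>k\<in>I. poly (l t2 j) (complex_of_real (\<mu> t1 k)) *s y k)"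
      by (simp only: y_def mpoly_smult_vec bounded_bilinear.sum_left[OF bounded_bilinear_matrix_vector_mult])
    then have "norm (mpoly (a t2) (l t2 j) *v V t2) \<le> (\<Sum>k\<in>I. norm (poly (l t2 j) (complex_of_real (\<mu> t1 k))) * norm (y k))"
      using norm_sum[of "\<lambda>k. poly (l t2 j) (complex_of_real (\<mu> t1 k)) *s y k" I] by (simp add: norm_smult_vec)
    also have "\<dots> \<le> (\<Sum>k\<in>I. (K * c) ^ m * norm (y k))"
    proof (intro sum_mono mult_right_mono)
      fix k assume k: "k \<in> I"
      have "norm (poly (l t2 j) (complex_of_real (\<mu> t1 k))) = (\<Prod>i\<in>I - {j}. \<bar>\<mu> t1 k - \<mu> t2 i\<bar>) / norm (d t2 j)"
        by (simp add: l_def lagrange_def d_def poly_prod norm_mult norm_divide prod_norm[symmetric] norm_of_real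
            del: of_real_diff flip: of_real_diff)
      also have "\<dots> \<le> (K * c) ^ m"
      proof (intro product_quotient_le[OF t(2) j] prod_nonneg)
        have "(\<Prod>i\<in>I - {j}. \<bar>\<mu> t1 k - \<mu> t2 i\<bar>) \<le> (\<Prod>i\<in>I - {j}. K * \<delta> t2)"
          using far(2)[OF t(2,1,3) _ k] by (intro prod_mono) auto
        then show "(\<Prod>i\<in>I - {j}. \<bar>\<mu> t1 k - \<mu> t2 i\<bar>) \<le> (K * \<delta> t2) ^ (m - 1)"
          using j by simp
      qed auto
      finally show "norm (poly (l t2 j) (complex_of_real (\<mu> t1 k))) \<le> (K * c) ^ m" .
    qed auto
    finally show ?thesis by (simp add: S_def sum_distrib_left)
  qed
  then have "W V t2 t2 \<le> (\<Sum>j\<in>I. ((K * c) ^ m * S)\<^sup>2)"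
    unfolding W_def by (intro sum_mono power_mono) auto
  also have "\<dots> = real m * (K * c) ^ (2 * m) * S\<^sup>2"
    by (simp add: power_mult_distrib mult.commute[of 2] flip: power_mult)
  also have "\<dots> \<le> real m * (K * c) ^ (2 * m) * (real m * W V t1 t2)"
    using sum_squared_le_sum_of_squares[of "\<lambda>k. norm (y k)" I] K_ge c
    by (intro mult_left_mono) (auto simp: S_def W_def y_def mult.commute)
  finally show ?thesis by (simp add: power2_eq_square mult_ac)
qed

text \<open>The cost of one time step: the change of nodes times the growth of the energy.\<close>

definition "C2 = m\<^sup>2 * (K * c) ^ (2 * m) * exp (2 * m * C1)"

lemma C2_ge: "1 \<le> C2"
proof -
  have C1: "0 \<le> C1" using K_ge c N_nonneg R_ge D by (simp add: C1_def)
  have "1 \<le> K * c" using mult_mono[of 1 K 1 c] K_ge c by simp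
  then have "1 * 1 * 1 \<le> (real m)\<^sup>2 * (K * c) ^ (2 * m) * exp (2 * m * C1)"
    using m_pos C1 by (intro mult_mono one_le_power) auto
  then show ?thesis by (simp add: C2_def)
qed

lemma W_iterate:
  assumes V: "solution V"
  shows "t1 \<in> {0..T} \<Longrightarrow> t2 \<in> {0..T} \<Longrightarrow> t1 \<le> t2 \<Longrightarrow> t2 - t1 \<le> real n * \<epsilon> \<Longrightarrow> W V t2 t2 \<le> C2 ^ n * W V t1 t1"
proof (induction n arbitrary: t2)
  case 0
  then show ?case by simp
next
  case (Suc n)
  \<comment> \<open>The steps are counted backwards from \<open>t2\<close>; the maximum shortens the
    one that would pass \<open>t1\<close>.\<close>
  define t where "t = max t1 (t2 - \<epsilon>)"
  have t: "t \<in> {0..T}" "t1 \<le> t" "t - t1 \<le> real n * \<epsilon>" "t \<le> t2" "t2 - t \<le> \<epsilon>"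
    using Suc.prems eps by (auto simp: t_def max_def algebra_simps)
  have "W V t2 t2 \<le> m\<^sup>2 * (K * c) ^ (2 * m) * W V t t2"
    using t Suc.prems by (intro W_rebase) auto
  also have "\<dots> \<le> m\<^sup>2 * (K * c) ^ (2 * m) * (exp (2 * m * C1) * W V t t)"
    using t Suc.prems K_ge c by (intro mult_left_mono W_step V) auto
  also have "\<dots> = C2 * W V t t" by (simp add: C2_def)
  also have "\<dots> \<le> C2 * (C2 ^ n * W V t1 t1)"
    using Suc.IH[of t] Suc.prems t C2_ge by (intro mult_left_mono) auto
  finally show ?case by (simp add: mult_ac)
qed

text \<open>At most \<open>T / \<epsilon> + 1\<close> steps are made. Passing from the norm to the
  energy at \<open>t1\<close> costs powers of \<open>1 / \<epsilon>\<close>, because of the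
  denominators of the Lagrange polynomials; the way back at \<open>t2\<close> costs only the factor
  \<open>m\<close>.\<close>

lemma solution_bound:
  assumes V: "solution V" and t: "t1 \<in> {0..T}" "t2 \<in> {0..T}" "t1 \<le> t2"
  shows "(norm (V t2))\<^sup>2 \<le> m\<^sup>2 * (N * R ^ m * c ^ m / \<epsilon>)\<^sup>2 * (C2 powr (T / \<epsilon> + 1)) * (norm (V t1))\<^sup>2"
proof -
  define n where "n = nat \<lceil>T / \<epsilon>\<rceil>"
  have n: "T / \<epsilon> \<le> real n" "real n \<le> T / \<epsilon> + 1"
  proof -
    show "T / \<epsilon> \<le> real n" unfolding n_def by (rule real_nat_ceiling_ge)
    have "0 \<le> T / \<epsilon>" using T eps by simp
    then have "real n = of_int \<lceil>T / \<epsilon>\<rceil>" by (simp add: n_def)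
    then show "real n \<le> T / \<epsilon> + 1" by linarith
  qed
  have "T \<le> real n * \<epsilon>" using n(1) eps by (simp add: divide_le_eq)
  then have "t2 - t1 \<le> real n * \<epsilon>" using t by simp
  then have "W V t2 t2 \<le> C2 ^ n * W V t1 t1" by (intro W_iterate V t)
  also have "\<dots> \<le> C2 powr (T / \<epsilon> + 1) * W V t1 t1"
    using C2_ge n(2) by (intro mult_right_mono) (auto simp: W_def powr_realpow[symmetric] intro!: sum_nonneg powr_mono)
  also have "\<dots> \<le> C2 powr (T / \<epsilon> + 1) * (real m * ((N * R ^ m * c ^ m / \<epsilon>) * norm (V t1))\<^sup>2)"
  proof (intro mult_left_mono)
    have "W V t1 t1 \<le> (\<Sum>j\<in>I. ((N * R ^ m * c ^ m / \<epsilon>) * norm (V t1))\<^sup>2)"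
      unfolding W_def
      by (intro sum_mono power_mono order_trans[OF matrix_vector_mult_norm_le] mult_right_mono mpoly_l_bound t) auto
    then show "W V t1 t1 \<le> real m * ((N * R ^ m * c ^ m / \<epsilon>) * norm (V t1))\<^sup>2" by simp
  qed auto
  finally have 1: "W V t2 t2 \<le> C2 powr (T / \<epsilon> + 1) * (real m * ((N * R ^ m * c ^ m / \<epsilon>) * norm (V t1))\<^sup>2)" .
  have "norm (V t2) \<le> (\<Sum>k\<in>I. norm (mpoly (a t2) (l t2 k) *v V t2))"
    using norm_sum[of "\<lambda>k. mpoly (a t2) (l t2 k) *v V t2" I] sum_lagrange[OF t(2), of "a t2" "V t2"] by metis
  then have "(norm (V t2))\<^sup>2 \<le> (\<Sum>k\<in>I. norm (mpoly (a t2) (l t2 k) *v V t2))\<^sup>2"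
    by (intro power_mono) auto
  also have "\<dots> \<le> W V t2 t2 * m"
    using sum_squared_le_sum_of_squares[of "\<lambda>k. norm (mpoly (a t2) (l t2 k) *v V t2)" I] by (simp add: W_def)
  also have "\<dots> \<le> C2 powr (T / \<epsilon> + 1) * (real m * ((N * R ^ m * c ^ m / \<epsilon>) * norm (V t1))\<^sup>2) * m"
    using 1 by (intro mult_right_mono) auto
  finally show ?thesis by (simp add: power2_eq_square mult_ac)
qed

end

section \<open>Coefficient bounds and the growth estimate for all real frequencies\<close>

lemma has_vector_derivative_vecI:
  fixes f :: "real \<Rightarrow> 'a::real_normed_vector ^ 'm::finite"
  assumes "\<And>i. ((\<lambda>t. f t $ i) has_vector_derivative (f' $ i)) (at t within S)"
  shows "(f has_vector_derivative f') (at t within S)"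
  using assms unfolding has_vector_derivative_def has_derivative_within
  by (auto intro!: vec_tendstoI bounded_linear_scaleR_left)

lemma C_k_on_continuous: "C_k_on k S f \<Longrightarrow> continuous_on S f"
proof (cases k)
  case (Suc n)
  assume "C_k_on k S f"
  then show ?thesis using Suc
    by (auto simp: continuous_on_eq_continuous_within intro: has_vector_derivative_continuous)
qed simp

lemma C_k_on_matrix_deriv:
  fixes A :: "real \<Rightarrow> complex ^ 'm::finite ^ 'm"
  assumes "\<And>i j. C_k_on (Suc k) S (\<lambda>t. A t $ i $ j)"
  obtains A' where "\<And>t. t \<in> S \<Longrightarrow> (A has_vector_derivative A' t) (at t within S)" "continuous_on S A'"
proof -
  have "\<forall>i j. \<exists>f'. (\<forall>t\<in>S. ((\<lambda>t. A t $ i $ j) has_vector_derivative f' t) (at t within S)) \<and> continuous_on S f'"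
    using assms C_k_on_continuous by fastforce
  then obtain f' where f': "\<And>i j t. t \<in> S \<Longrightarrow> ((\<lambda>t. A t $ i $ j) has_vector_derivative f' i j t) (at t within S)"
    "\<And>i j. continuous_on S (f' i j)" by metis
  show thesis
  proof (rule that[of "\<lambda>t. \<chi> i j. f' i j t"])
    show "(A has_vector_derivative (\<chi> i j. f' i j t)) (at t within S)" if "t \<in> S" for t
      using f'(1)[OF that] by (intro has_vector_derivative_vecI) simp
    show "continuous_on S (\<lambda>t. \<chi> i j. f' i j t)"
      using f'(2) by (intro continuous_intros) auto
  qed
qed

lemma continuous_on_Icc_bounded:
  fixes f :: "real \<Rightarrow> 'a::real_normed_vector"
  assumes "continuous_on {a..b} f"
  shows "\<exists>D\<ge>0. \<forall>t\<in>{a..b}. norm (f t) \<le> D"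
proof -
  have "bounded (f ` {a..b})"
    using assms by (intro compact_imp_bounded compact_continuous_image) auto
  then obtain D where "\<And>t. t \<in> {a..b} \<Longrightarrow> norm (f t) \<le> D"
    unfolding bounded_iff by blast
  then show ?thesis by (intro exI[of _ "max D 0"]) (force simp: le_max_iff_disj)
qed

lemma continuous_on_matrixI:
  fixes A :: "real \<Rightarrow> complex ^ 'm::finite ^ 'm"
  assumes "\<And>i j. continuous_on S (\<lambda>t. A t $ i $ j)"
  shows "continuous_on S A"
  using assms unfolding continuous_on_def by (auto intro!: vec_tendstoI)

lemma norm_symbol_le: "norm (symbol A t \<xi>) \<le> norm \<xi> * (\<Sum>k\<in>UNIV. norm (A k t))"
  unfolding symbol_def sum_distrib_left
  by (intro sum_norm_le) (auto intro!: mult_right_mono component_le_norm_cart)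

text \<open>Gronwall for the squared norm. This crude bound, exponential in the size of the
  generator, serves for low real frequencies and for complex ones.\<close>

lemma linear_ode_growth:
  fixes V :: "real \<Rightarrow> 'a::real_inner"
  assumes V: "\<And>t. t \<in> {0..T} \<Longrightarrow> (V has_vector_derivative V' t) (at t within {0..T})"
    and le: "\<And>t. t \<in> {0..T} \<Longrightarrow> norm (V' t) \<le> \<Lambda> * norm (V t)" and t: "0 \<le> t1" "t1 \<le> t2" "t2 \<le> T"
  shows "norm (V t2) \<le> exp (\<Lambda> * (t2 - t1)) * norm (V t1)"
proof -
  have sub: "{t1..t2} \<subseteq> {0..T}" using t by auto
  have "(norm (V t2))\<^sup>2 \<le> exp (2 * \<Lambda> * (t2 - t1)) * (norm (V t1))\<^sup>2"
  proof (rule gronwall_decreasing[where W="\<lambda>t. (norm (V t))\<^sup>2" and W'="\<lambda>t. 2 * (V t \<bullet> V' t)"])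
    fix t assume "t \<in> {t1..t2}"
    then have t: "t \<in> {0..T}" using sub by auto
    show "((\<lambda>t. (norm (V t))\<^sup>2) has_real_derivative 2 * (V t \<bullet> V' t)) (at t within {t1..t2})"
      by (intro has_vector_derivative_norm_square has_vector_derivative_within_subset[OF V[OF t] sub])
    have "V t \<bullet> V' t \<le> norm (V t) * (\<Lambda> * norm (V t))"
      by (intro order_trans[OF norm_cauchy_schwarz] mult_left_mono le t) auto
    then show "2 * (V t \<bullet> V' t) \<le> 2 * \<Lambda> * (norm (V t))\<^sup>2" by (simp add: power2_eq_square mult_ac)
  qed fact
  also have "\<dots> = (exp (\<Lambda> * (t2 - t1)) * norm (V t1))\<^sup>2"
    by (simp add: power_mult_distrib mult.assoc flip: exp_double)
  finally show ?thesis by (rule power2_le_imp_le) auto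
qed

lemma symbol_inverse_scale: "symbol A t (inverse r *\<^sub>R \<xi>) = inverse r *\<^sub>R symbol A t \<xi>"
  by (simp add: symbol_def scaleR_sum_right)

text \<open>For \<open>norm \<xi> < 1\<close> the crude bound is uniform. Otherwise
  \<open>\<xi>\<close> is normalised and \<open>hyperbolic_path\<close> applies with the Hoelder
  exponent \<open>s - 1\<close>. The steps produce \<open>G powr (T / \<epsilon> + 1)\<close>, an
  exponential of \<open>norm \<xi> powr (1 / s)\<close>, which also absorbs the powers of
  \<open>1 / \<epsilon>\<close>.\<close>

proposition hyperbolic_system_growth:
  fixes A :: "'n::finite \<Rightarrow> real \<Rightarrow> complex ^ 'm::finite ^ 'm"
    and B :: "real \<Rightarrow> complex ^ 'm ^ 'm"
    and lam :: "nat \<Rightarrow> real \<Rightarrow> real ^ 'n \<Rightarrow> real"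
    and T \<alpha> M c s :: real
  assumes T: "0 < T"
    and A_regular: "\<And>k i j. C_k_on (CARD('m) - 1) {0..T} (\<lambda>t. A k t $ i $ j)"
    and B_continuous: "\<And>i j. continuous_on {0..T} (\<lambda>t. B t $ i $ j)"
    and eigenvalues: "\<And>t \<xi>. t \<in> {0..T} \<Longrightarrow>
      charpoly (symbol A t \<xi>) = (\<Prod>j\<in>{1..CARD('m)}. [:- complex_of_real (lam j t \<xi>), 1:])"
    and ordered: "\<And>t \<xi> i j. t \<in> {0..T} \<Longrightarrow> 1 \<le> i \<Longrightarrow> i \<le> j \<Longrightarrow> j \<le> CARD('m) \<Longrightarrow>
      lam i t \<xi> \<le> lam j t \<xi>"
    and M: "0 < M"
    and hoelder: "\<And>j t t' \<xi>. j \<in> {1..CARD('m)} \<Longrightarrow> t \<in> {0..T} \<Longrightarrow> t' \<in> {0..T} \<Longrightarrow>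
      \<bar>lam j t \<xi> - lam j t' \<xi>\<bar> \<le> M * norm \<xi> * \<bar>t - t'\<bar> powr \<alpha>"
    and separation: "\<And>i j k t \<xi>. i \<in> {1..CARD('m)} \<Longrightarrow> j \<in> {1..CARD('m)} \<Longrightarrow>
      k \<in> {2..CARD('m)} \<Longrightarrow> t \<in> {0..T} \<Longrightarrow>
      \<bar>lam i t \<xi> - lam j t \<xi>\<bar> \<le> c * \<bar>lam k t \<xi> - lam (k - 1) t \<xi>\<bar>"
    and s: "1 < s" "s - 1 \<le> \<alpha>" "(s - 1) * (real CARD('m) - 1) \<le> 1"
  shows "\<exists>C\<ge>0. \<forall>\<xi> V t1 t2. 0 \<le> t1 \<and> t1 \<le> t2 \<and> t2 \<le> T \<and>
    (\<forall>t\<in>{0..T}. (V has_vector_derivative (\<i> *s (symbol A t \<xi> *v V t + B t *v V t))) (at t within {0..T}))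
    \<longrightarrow> norm (V t2) \<le> exp (C * (1 + norm \<xi> powr (1 / s))) * norm (V t1)"
proof -
  define m where "m = CARD('m)"
  define N where "N = norm (mat 1 :: complex ^ 'm ^ 'm)"
  have contA: "continuous_on {0..T} (A k)" for k
    using A_regular C_k_on_continuous by (intro continuous_on_matrixI) blast
  have "continuous_on {0..T} (\<lambda>t. \<Sum>k\<in>UNIV. norm (A k t))"
    by (intro continuous_intros contA)
  from continuous_on_Icc_bounded[OF this] obtain D1 where
    D1: "0 \<le> D1" "\<And>t. t \<in> {0..T} \<Longrightarrow> (\<Sum>k\<in>UNIV. norm (A k t)) \<le> D1"
    by (metis abs_le_D1 real_norm_def)
  from continuous_on_Icc_bounded[OF continuous_on_matrixI[OF B_continuous]] obtain D2 where
    D2: "0 \<le> D2" "\<And>t. t \<in> {0..T} \<Longrightarrow> norm (B t) \<le> D2" by auto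
  have "\<exists>D3\<ge>0. \<exists>A'. m \<noteq> 1 \<longrightarrow> (\<forall>t\<in>{0..T}. (\<forall>k. (A k has_vector_derivative A' k t) (at t within {0..T})) \<and>
      (\<Sum>k\<in>UNIV. norm (A' k t)) \<le> D3)"
  proof (cases "m = 1")
    case False
    then have "\<exists>p. CARD('m) - 1 = Suc p"
      unfolding m_def by (metis One_nat_def Suc_pred' diff_is_0_eq' zero_less_card_finite le_antisym Suc_leI gr0I)
    then obtain p where p: "CARD('m) - 1 = Suc p" ..
    have "\<forall>k. \<exists>A'. (\<forall>t\<in>{0..T}. (A k has_vector_derivative A' t) (at t within {0..T})) \<and> continuous_on {0..T} A'"
      using C_k_on_matrix_deriv[of p "{0..T}" "A _"] A_regular unfolding p by metis
    then obtain A' where A': "\<And>k t. t \<in> {0..T} \<Longrightarrow> (A k has_vector_derivative A' k t) (at t within {0..T})"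
      "\<And>k. continuous_on {0..T} (A' k)" by metis
    have "continuous_on {0..T} (\<lambda>t. \<Sum>k\<in>UNIV. norm (A' k t))"
      by (intro continuous_intros A')
    from continuous_on_Icc_bounded[OF this] obtain D3 where "0 \<le> D3"
      "\<And>t. t \<in> {0..T} \<Longrightarrow> (\<Sum>k\<in>UNIV. norm (A' k t)) \<le> D3" by (metis abs_le_D1 real_norm_def)
    with A'(1) show ?thesis by blast
  qed auto
  then obtain D3 A' where D3: "0 \<le> D3" "\<And>t k. m \<noteq> 1 \<Longrightarrow> t \<in> {0..T} \<Longrightarrow> (A k has_vector_derivative A' k t) (at t within {0..T})"
    "\<And>t. m \<noteq> 1 \<Longrightarrow> t \<in> {0..T} \<Longrightarrow> (\<Sum>k\<in>UNIV. norm (A' k t)) \<le> D3" by blast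
  define D where "D = D1 + D2 + D3"
  \<comment> \<open>Lowering the Hoelder exponent from \<alpha> to \<open>s - 1\<close> on an
    interval of length \<open>T\<close> costs this factor.\<close>
  define M' where "M' = M * T powr (\<alpha> - (s - 1))"
  define c' where "c' = max c 1"
  \<comment> \<open>The constants of the locale depend only on bounds uniform in the frequency, so
    they can be fixed before \<open>\<xi>\<close>. The absolute value here and the maximum in
    \<open>C\<close> replace sign information that is available only inside the locale.\<close>
  define X where "X = \<bar>N * hyperbolic_path.R D N m ^ m * c' ^ m\<bar>"
  define G where "G = hyperbolic_path.C2 D M' c' N m"
  define C where "C = real m + X + ln (max G 1) * (T + 1) + 2 * D * T"
  have D: "0 \<le> D" "D1 \<le> D" "D2 \<le> D" "D3 \<le> D" using D1 D2 D3 by (auto simp: D_def)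
  have lnG: "0 \<le> ln (max G 1)" by simp
  have DT: "0 \<le> 2 * D * T" using D T by simp
  have C: "0 \<le> C" using DT lnG T by (simp add: C_def X_def)
  show ?thesis
  proof (intro exI[of _ C] conjI C allI impI, elim conjE)
    fix \<xi> :: "real ^ 'n" and V :: "real \<Rightarrow> complex ^ 'm" and t1 t2
    assume t: "0 \<le> t1" "t1 \<le> t2" "t2 \<le> T"
      and V: "\<forall>t\<in>{0..T}. (V has_vector_derivative (\<i> *s (symbol A t \<xi> *v V t + B t *v V t))) (at t within {0..T})"
    define \<rho> where "\<rho> = norm \<xi>"
    show "norm (V t2) \<le> exp (C * (1 + norm \<xi> powr (1 / s))) * norm (V t1)"
    proof (cases "\<rho> < 1")
      case True
      have "norm (V t2) \<le> exp ((2 * D) * (t2 - t1)) * norm (V t1)"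
      proof (rule linear_ode_growth[OF _ _ t])
        fix t assume tT: "t \<in> {0..T}"
        show "(V has_vector_derivative (\<i> *s (symbol A t \<xi> *v V t + B t *v V t))) (at t within {0..T})"
          using V tT by blast
        have "norm (symbol A t \<xi>) \<le> 1 * D1"
          using True D1 tT by (intro order_trans[OF norm_symbol_le] mult_mono sum_nonneg) (auto simp: \<rho>_def)
        then have "norm (symbol A t \<xi>) + norm (B t) \<le> 2 * D"
          using D2(2)[OF tT] D by simp
        then have "(norm (symbol A t \<xi>) + norm (B t)) * norm (V t) \<le> 2 * D * norm (V t)"
          by (rule mult_right_mono) simp
        moreover have "norm (symbol A t \<xi> *v V t + B t *v V t) \<le> (norm (symbol A t \<xi>) + norm (B t)) * norm (V t)"
          unfolding distrib_right by (intro norm_triangle_le add_mono matrix_vector_mult_norm_le)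
        ultimately show "norm (\<i> *s (symbol A t \<xi> *v V t + B t *v V t)) \<le> 2 * D * norm (V t)"
          unfolding norm_smult_vec norm_ii mult_1_left by linarith
      qed
      also have "\<dots> \<le> exp (C * (1 + norm \<xi> powr (1 / s))) * norm (V t1)"
      proof (intro mult_right_mono)
        have "2 * D * (t2 - t1) \<le> 2 * D * T"
          using D t by (intro mult_left_mono) auto
        also have "\<dots> \<le> C" using lnG T by (simp add: C_def X_def)
        also have "\<dots> \<le> C * (1 + norm \<xi> powr (1 / s))"
          using mult_left_mono[OF _ C, of 1 "1 + norm \<xi> powr (1 / s)"] by simp
        finally show "exp (2 * D * (t2 - t1)) \<le> exp (C * (1 + norm \<xi> powr (1 / s)))" by simp
      qed simp
      finally show ?thesis .
    next
      case False
      then have \<rho>: "1 \<le> \<rho>" by simp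
      define w where "w = \<rho> powr (1 / s)"
      define \<epsilon> where "\<epsilon> = \<rho> powr (- 1 / s)"
      define \<omega> where "\<omega> = inverse \<rho> *\<^sub>R \<xi>"
      have \<omega>: "norm \<omega> = 1" using \<rho> by (simp add: \<omega>_def \<rho>_def, subst left_inverse, auto)
      have w: "1 \<le> w" using \<rho> s by (simp add: w_def ge_one_powr_ge_zero)
      have \<epsilon>w: "\<epsilon> = 1 / w" by (simp add: \<epsilon>_def w_def powr_minus_divide)
      interpret hyperbolic_path "\<lambda>t. symbol A t \<omega>" B "\<lambda>j t. lam j t \<omega>" T "s - 1" \<epsilon> \<rho> D M' c' N m
      proof
        show "m = CARD('m)" "N = norm (mat 1 :: complex ^ 'm ^ 'm)" "0 < T" "0 < s - 1" "0 < \<rho>" "0 \<le> D" "1 \<le> c'" "0 \<le> M'"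
          using T s \<rho> D M by (auto simp: m_def N_def c'_def M'_def)
        show \<epsilon>: "0 < \<epsilon>" "\<epsilon> \<le> 1" using w by (auto simp: \<epsilon>w)
        \<comment> \<open>This identity determines \<epsilon>: the exponent 1 - (s - 1) / s equals 1
          / s, so the motion of the eigenvalues at frequency size \<rho> is exactly the inverse step
          length.\<close>
        have "\<rho> * \<epsilon> powr (s - 1) = \<rho> powr 1 * \<rho> powr ((- 1 / s) * (s - 1))"
          using \<rho> by (simp add: \<epsilon>_def powr_powr)
        also have "\<dots> = \<rho> powr (1 / s)"
          using s by (subst powr_add[symmetric]) (auto simp: field_simps)
        finally show "\<rho> * \<epsilon> powr (s - 1) \<le> 1 / \<epsilon>" by (simp add: \<epsilon>w w_def)
        \<comment> \<open>The bound of \<open>s - 1\<close> by \<open>1 / (m - 1)\<close> enters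
          here; the base is at most 1, so a smaller exponent gives a larger power.\<close>
        have "\<epsilon> powr 1 \<le> \<epsilon> powr ((s - 1) * (real m - 1))"
          using s \<epsilon> by (intro powr_mono') (auto simp: m_def)
        also have "\<dots> = (\<epsilon> powr (s - 1)) ^ (m - 1)"
          using \<epsilon> by (simp add: powr_powr powr_realpow[symmetric] of_nat_diff Suc_leI m_def)
        finally show "\<epsilon> \<le> (\<epsilon> powr (s - 1)) ^ (m - 1)" using \<epsilon> by simp
      next
        fix t assume tT: "t \<in> {0..T}"
        have "norm (symbol A t \<omega>) \<le> D1"
          using norm_symbol_le[of A t \<omega>] D1(2)[OF tT] \<omega> by simp
        then show "norm (symbol A t \<omega>) \<le> D" using D by simp
        show "norm (B t) \<le> D" using D2(2)[OF tT] D by simp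
        show "charpoly (symbol A t \<omega>) = (\<Prod>j\<in>{1..m}. [:- complex_of_real (lam j t \<omega>), 1:])"
          using eigenvalues[OF tT] by (simp add: m_def)
        assume m: "m \<noteq> 1"
        have "((\<lambda>t. symbol A t \<omega>) has_vector_derivative symbol A' t \<omega>) (at t within {0..T})"
          unfolding symbol_def using D3(2)[OF m tT] by (auto intro!: derivative_eq_intros)
        moreover have "norm (symbol A' t \<omega>) \<le> D3"
          using norm_symbol_le[of A' t \<omega>] D3(3)[OF m tT] \<omega> by simp
        ultimately show "\<exists>a'. ((\<lambda>t. symbol A t \<omega>) has_vector_derivative a') (at t within {0..T}) \<and> norm a' \<le> D"
          using D by (meson order_trans)
      next
        fix t i j assume "t \<in> {0..T}" "1 \<le> i" "i \<le> j" "j \<le> m"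
        then show "lam i t \<omega> \<le> lam j t \<omega>" by (intro ordered) (auto simp: m_def)
      next
        fix j t t' assume h: "j \<in> {1..m}" "t \<in> {0..T}" "t' \<in> {0..T}"
        have "\<bar>lam j t \<omega> - lam j t' \<omega>\<bar> \<le> M * norm \<omega> * \<bar>t - t'\<bar> powr \<alpha>"
          using h unfolding m_def by (rule hoelder)
        also have "\<dots> = M * (\<bar>t - t'\<bar> powr (s - 1) * \<bar>t - t'\<bar> powr (\<alpha> - (s - 1)))"
          by (simp add: \<omega> powr_add[symmetric])
        also have "\<dots> \<le> M * (\<bar>t - t'\<bar> powr (s - 1) * T powr (\<alpha> - (s - 1)))"
          using M h s by (intro mult_left_mono powr_mono2) auto
        finally show "\<bar>lam j t \<omega> - lam j t' \<omega>\<bar> \<le> M' * \<bar>t - t'\<bar> powr (s - 1)"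
          by (simp add: M'_def mult_ac)
      next
        fix i j k t assume h: "i \<in> {1..m}" "j \<in> {1..m}" "k \<in> {2..m}" "t \<in> {0..T}"
        have "\<bar>lam i t \<omega> - lam j t \<omega>\<bar> \<le> c * \<bar>lam k t \<omega> - lam (k - 1) t \<omega>\<bar>"
          using h unfolding m_def by (rule separation)
        also have "\<dots> \<le> c' * \<bar>lam k t \<omega> - lam (k - 1) t \<omega>\<bar>"
          by (intro mult_right_mono) (auto simp: c'_def)
        finally show "\<bar>lam i t \<omega> - lam j t \<omega>\<bar> \<le> c' * \<bar>lam k t \<omega> - lam (k - 1) t \<omega>\<bar>" .
      qed
      have "solution V"
        unfolding solution_def
      proof
        fix t assume "t \<in> {0..T}"
        moreover have "(\<i> * complex_of_real \<rho>) *s (symbol A t \<omega> *v V t) = \<i> *s (symbol A t \<xi> *v V t)"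
        proof -
          have "complex_of_real \<rho> *s (symbol A t \<omega> *v V t) = \<rho> *\<^sub>R (symbol A t \<omega> *v V t)"
            unfolding vec_eq_iff vector_scaleR_component vector_smult_component
              by (simp add: scaleR_conv_of_real)
          also have "\<dots> = (\<rho> *\<^sub>R symbol A t \<omega>) *v V t"
            by (simp add: bounded_bilinear.scaleR_left[OF bounded_bilinear_matrix_vector_mult])
          also have "\<rho> *\<^sub>R symbol A t \<omega> = symbol A t \<xi>"
            using \<rho> by (simp add: \<omega>_def symbol_inverse_scale)
          finally show ?thesis by (simp only: vector_smult_assoc[symmetric])
        qed
        ultimately show "(V has_vector_derivative ((\<i> * complex_of_real \<rho>) *s (symbol A t \<omega> *v V t) + \<i> *s (B t *v V t))) (at t within {0..T})"
          using V by (simp add: vector_add_ldistrib)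
      qed
      then have "(norm (V t2))\<^sup>2 \<le> m\<^sup>2 * (N * R ^ m * c' ^ m / \<epsilon>)\<^sup>2 * (G powr (T / \<epsilon> + 1)) * (norm (V t1))\<^sup>2"
        unfolding G_def using t by (intro solution_bound) auto
      also have "\<dots> \<le> exp (2 * real m) * exp (2 * X * w) * exp (ln (max G 1) * (T + 1) * w) * (norm (V t1))\<^sup>2"
      proof (intro mult_right_mono mult_mono)
        \<comment> \<open>Turns the prefactors, which are polynomial in \<open>w\<close>, into
          exponentials of the same type as the main factor.\<close>
        have sq: "x\<^sup>2 \<le> exp (2 * x)" if "0 \<le> x" for x :: real
        proof -
          have "x \<le> exp x" using exp_ge_add_one_self[of x] by linarith
          from power_mono[OF this that, of 2] show ?thesis by (simp add: exp_double)
        qed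
        have "(real m)\<^sup>2 \<le> exp (2 * real m)" by (rule sq) simp
        then show "real (m\<^sup>2) \<le> exp (2 * real m)" by simp
        have "(N * R ^ m * c' ^ m / \<epsilon>)\<^sup>2 = (X * w)\<^sup>2"
          by (simp add: X_def \<epsilon>w power_mult_distrib)
        also have "\<dots> \<le> exp (2 * (X * w))" using w by (intro sq) (simp add: X_def)
        finally show "(N * R ^ m * c' ^ m / \<epsilon>)\<^sup>2 \<le> exp (2 * X * w)" by (simp only: mult.assoc)
        have G: "1 \<le> G" unfolding G_def by (rule C2_ge)
        have "G powr (T / \<epsilon> + 1) = exp (ln (max G 1) * (T * w + 1))"
          using G by (simp add: powr_def \<epsilon>w mult.commute)
        also have "\<dots> \<le> exp (ln (max G 1) * ((T + 1) * w))"
          using lnG w by (simp only: exp_le_cancel_iff, intro mult_left_mono) (auto simp: distrib_right)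
        finally show "G powr (T / \<epsilon> + 1) \<le> exp (ln (max G 1) * (T + 1) * w)" by (simp only: mult.assoc)
      qed auto
      also have "\<dots> = exp (2 * real m + 2 * X * w + ln (max G 1) * (T + 1) * w) * (norm (V t1))\<^sup>2"
        by (simp only: exp_add)
      also have "\<dots> \<le> exp (2 * (C * (1 + w))) * (norm (V t1))\<^sup>2"
      proof (intro mult_right_mono)
        have aux: "2 * a + 2 * x * w + q * w \<le> 2 * ((a + x + q + r) * (1 + w))"
          if "0 \<le> a" "0 \<le> x" "0 \<le> q" "0 \<le> r" for a x q r :: real
          using that w mult_nonneg_nonneg[of a w] mult_nonneg_nonneg[of q w] mult_nonneg_nonneg[of r w]
          by (simp add: algebra_simps)
        have "2 * real m + 2 * X * w + ln (max G 1) * (T + 1) * w \<le> 2 * (C * (1 + w))"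
          unfolding C_def by (rule aux) (use lnG T DT in \<open>simp_all add: X_def\<close>)
        then show "exp (2 * real m + 2 * X * w + ln (max G 1) * (T + 1) * w) \<le> exp (2 * (C * (1 + w)))" by simp
      qed simp
      also have "\<dots> = (exp (C * (1 + w)) * norm (V t1))\<^sup>2"
        by (simp add: power_mult_distrib exp_double)
      finally have "norm (V t2) \<le> exp (C * (1 + w)) * norm (V t1)"
        by (rule power2_le_imp_le) simp
      then show ?thesis by (simp add: w_def \<rho>_def)
    qed
  qed
qed

section \<open>The weight of the Gevrey scale\<close>

text \<open>Up to constants this is the associated function of the sequence
  \<open>fact j powr s\<close>: the following lemmas pass between bounds with all powers
  \<open>t ^ j\<close> and exponentials of \<open>t powr (1 / s)\<close>.\<close>

definition weight :: "real \<Rightarrow> 'a::real_normed_vector \<Rightarrow> real" where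
  "weight s \<xi> = norm \<xi> powr (1 / s)"

lemma weight_nonneg [simp]: "0 \<le> weight s \<xi>"
  by (simp add: weight_def)

lemma weight_measurable [measurable]: "weight s \<in> borel_measurable borel"
  unfolding weight_def by measurable

lemma power_le_fact_exp: "(x::real) ^ j \<le> fact j * exp x" if "0 \<le> x"
proof -
  have "(\<Sum>n\<in>{j}. x ^ n /\<^sub>R fact n) \<le> (\<Sum>n. x ^ n /\<^sub>R fact n)"
    using that by (intro sum_le_suminf sums_summable[OF exp_converges]) auto
  also have "\<dots> = exp x" using exp_converges sums_iff by blast
  finally show ?thesis by (simp add: field_simps)
qed

lemma power_powr: "(x ^ j) powr s = (x powr s) ^ j" if "0 < x" for x s :: real
  using that by (simp add: powr_realpow[symmetric] powr_powr mult.commute)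

text \<open>A term of the exponential series at \<open>N * y / s\<close>, with
  \<open>y = t powr (1 / s)\<close>, is raised to the power \<open>s\<close>. As \<open>N\<close>
  grows, \<open>(s / N) powr s\<close> becomes arbitrarily small, which matches the quantifier over
  all \<open>A\<close> in the Beurling class.\<close>

lemma power_le_powr_fact_exp:
  fixes N s t :: real
  assumes "0 < N" "0 < s" "0 \<le> t"
  shows "t ^ j \<le> ((s / N) powr s) ^ j * fact j powr s * exp (N * t powr (1 / s))"
proof (cases "t = 0")
  case True
  then show ?thesis by (cases "j = 0") (auto simp: power_0_left)
next
  case False
  define y where "y = t powr (1 / s)"
  have y: "0 < y" "y powr s = t" using False assms by (auto simp: y_def powr_powr)
  have "(N * y / s) ^ j \<le> fact j * exp (N * y / s)"
    using assms y by (intro power_le_fact_exp) auto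
  then have "((N * y / s) ^ j) powr s \<le> (fact j * exp (N * y / s)) powr s"
    using assms y by (intro powr_mono2) auto
  also have "\<dots> = fact j powr s * exp (N * y)"
    using assms by (simp add: powr_mult exp_powr_real)
  also have "((N * y / s) ^ j) powr s = ((N / s) powr s) ^ j * t ^ j"
  proof -
    have "((N * y / s) ^ j) powr s = ((N / s * y) powr s) ^ j"
      using assms y by (subst power_powr) auto
    also have "(N / s * y) powr s = (N / s) powr s * t"
      using assms y by (subst powr_mult) auto
    finally show ?thesis by (simp only: power_mult_distrib)
  qed
  finally have *: "((N / s) powr s) ^ j * t ^ j \<le> fact j powr s * exp (N * y)" .
  have inv: "((s / N) powr s) ^ j * ((N / s) powr s) ^ j = 1"
  proof -
    have "(s / N) powr s * (N / s) powr s = 1"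
      using assms by (subst powr_mult[symmetric]) auto
    then show ?thesis by (simp only: power_mult_distrib[symmetric] power_one)
  qed
  have "((s / N) powr s) ^ j * (((N / s) powr s) ^ j * t ^ j) \<le> ((s / N) powr s) ^ j * (fact j powr s * exp (N * y))"
    using * by (intro mult_left_mono) auto
  then show ?thesis unfolding mult.assoc[symmetric] inv by (simp add: y_def)
qed

text \<open>The root of order \<open>s\<close> of the moment bounds controls each term of the
  exponential series at \<open>y / a\<close>. At half of that point a geometric series of sum 2 is
  left, whence the factor \<open>2 powr s\<close>.\<close>

lemma gevrey_moments_imp_exp_decay:
  fixes A s t u D :: real
  assumes "0 < A" "0 < s" "0 \<le> t" "0 \<le> u" "0 \<le> D"
    and le: "\<And>j. u * t ^ j \<le> D * A ^ j * fact j powr s"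
  shows "u \<le> 2 powr s * D * exp (- (s / (2 * A powr (1 / s))) * t powr (1 / s))"
proof (cases "u = 0")
  case True
  then show ?thesis using assms by simp
next
  case False
  then have u: "0 < u" using assms by simp
  define y where "y = t powr (1 / s)"
  define a where "a = A powr (1 / s)"
  define d where "d = (D / u) powr (1 / s)"
  have a: "0 < a" using assms by (simp add: a_def)
  have y: "0 \<le> y" by (simp add: y_def)
  have summand: "(y / a) ^ j \<le> d * fact j" for j
  proof -
    have "t ^ j \<le> (D / u) * A ^ j * fact j powr s"
      using le[of j] u by (simp add: field_simps)
    then have "(t ^ j) powr (1 / s) \<le> ((D / u) * A ^ j * fact j powr s) powr (1 / s)"
      using assms by (intro powr_mono2) auto
    also have "(t ^ j) powr (1 / s) = y ^ j"
    proof (cases "t = 0")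
      case True
      then show ?thesis by (cases "j = 0") (auto simp: y_def power_0_left)
    next
      case False
      then show ?thesis unfolding y_def using assms by (intro power_powr) auto
    qed
    also have "((D / u) * A ^ j * fact j powr s) powr (1 / s) = d * a ^ j * fact j"
    proof -
      have "((D / u) * A ^ j * fact j powr s) powr (1 / s) = (D / u) powr (1 / s) * (A ^ j) powr (1 / s) * (fact j powr s) powr (1 / s)"
        using assms u by (simp only: powr_mult)
      also have "(A ^ j) powr (1 / s) = a ^ j" unfolding a_def using assms by (intro power_powr)
      also have "(fact j powr s) powr (1 / s) = fact j" using assms by (simp add: powr_powr)
      finally show ?thesis by (simp add: d_def)
    qed
    finally show ?thesis using a by (simp add: power_divide field_simps)
  qed
  have "exp (y / (2 * a)) \<le> 2 * d"
  proof -
    have "(\<lambda>n. (y / (2 * a)) ^ n /\<^sub>R fact n) sums exp (y / (2 * a))" by (rule exp_converges)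
    moreover have "(\<lambda>n. d * (1 / 2) ^ n) sums (d * (1 / (1 - 1 / 2)))"
      by (intro sums_mult geometric_sums) auto
    moreover have "(y / (2 * a)) ^ n /\<^sub>R fact n \<le> d * (1 / 2) ^ n" for n
    proof -
      have "(y / a) ^ n / fact n \<le> d" using summand[of n] by (simp only: divide_le_eq fact_gt_zero if_True)
      then have "(y / a) ^ n / fact n * (1 / 2) ^ n \<le> d * (1 / 2) ^ n" by (rule mult_right_mono) simp
      moreover have "(y / (2 * a)) ^ n /\<^sub>R fact n = (y / a) ^ n / fact n * (1 / 2) ^ n"
        by (simp add: power_divide power_mult_distrib field_simps)
      ultimately show ?thesis by simp
    qed
    ultimately have "exp (y / (2 * a)) \<le> d * (1 / (1 - 1 / 2))" by (rule sums_le[rotated]) 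
    then show ?thesis by simp
  qed
  then have "exp (y / (2 * a)) powr s \<le> (2 * d) powr s"
    using assms by (intro powr_mono2) auto
  also have "(2 * d) powr s = 2 powr s * (D / u)"
    using assms u by (simp add: powr_mult d_def powr_powr)
  also have "exp (y / (2 * a)) powr s = exp (s / (2 * a) * y)"
    by (simp add: exp_powr_real mult.commute)
  finally have "u * exp (s / (2 * a) * y) \<le> 2 powr s * D"
    using u by (simp add: field_simps)
  then show ?thesis
    by (simp add: y_def[symmetric] a_def[symmetric] exp_minus field_simps)
qed

text \<open>The exponential is split into as many equal factors as there are coordinates. Each
  factor is spent on one coordinate, where it beats \<open>1 / (1 + t\<^sup>2)\<close> up to a
  constant, so a product of integrable functions dominates.\<close>

lemma integrable_exp_weight:
  fixes N s :: real
  assumes N: "0 < N" and s: "0 < s"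
  shows "integrable lborel (\<lambda>\<xi>::'a::euclidean_space. exp (- N * weight s \<xi>))"
proof -
  define n where "n = real DIM('a)"
  have n: "0 < n" by (simp add: n_def)
  define P where "P = 1 + ((s / (N / n)) powr s) ^ 2 * fact 2 powr s"
  have P: "0 \<le> P" by (simp add: P_def)
  have le1: "exp (- (N / n) * \<bar>t\<bar> powr (1 / s)) \<le> P * inverse (1 + t\<^sup>2)" for t :: real
  proof -
    have "t\<^sup>2 \<le> ((s / (N / n)) powr s) ^ 2 * fact 2 powr s * exp (N / n * \<bar>t\<bar> powr (1 / s))"
      using power_le_powr_fact_exp[of "N / n" s "\<bar>t\<bar>" 2] N n s by simp
    then have "1 + t\<^sup>2 \<le> P * exp (N / n * \<bar>t\<bar> powr (1 / s))"
      unfolding P_def distrib_right using N n by (intro add_mono) auto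
    then have "exp (- (N / n * \<bar>t\<bar> powr (1 / s))) * (1 + t\<^sup>2) \<le> exp (- (N / n * \<bar>t\<bar> powr (1 / s))) * (P * exp (N / n * \<bar>t\<bar> powr (1 / s)))"
      by (intro mult_left_mono) auto
    also have "\<dots> = P" by (simp add: exp_minus)
    finally show ?thesis by (simp add: field_simps add_pos_nonneg)
  qed
  have le: "exp (- N * weight s \<xi>) \<le> (\<Prod>b\<in>Basis. P * inverse (1 + (\<xi> \<bullet> b)\<^sup>2))" for \<xi> :: 'a
  proof -
    have "exp (- N * weight s \<xi>) = (\<Prod>b\<in>(Basis :: 'a set). exp (- (N / n) * weight s \<xi>))"
      using n by (simp add: exp_of_nat_mult[symmetric] n_def)
    also have "\<dots> \<le> (\<Prod>b\<in>Basis. P * inverse (1 + (\<xi> \<bullet> b)\<^sup>2))"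
    proof (rule prod_mono, intro conjI)
      fix b :: 'a assume b: "b \<in> Basis"
      have "\<bar>\<xi> \<bullet> b\<bar> powr (1 / s) \<le> weight s \<xi>"
        unfolding weight_def using s by (intro powr_mono2 Basis_le_norm b) auto
      then have "exp (- (N / n) * weight s \<xi>) \<le> exp (- (N / n) * \<bar>\<xi> \<bullet> b\<bar> powr (1 / s))"
        using N n by (simp add: divide_right_mono mult_left_mono)
      then show "exp (- (N / n) * weight s \<xi>) \<le> P * inverse (1 + (\<xi> \<bullet> b)\<^sup>2)"
        using le1[of "\<xi> \<bullet> b"] by linarith
    qed auto
    finally show ?thesis .
  qed
  have fin: "(\<integral>\<^sup>+t. ennreal (P * inverse (1 + t\<^sup>2)) \<partial>lborel) < \<infinity>"
  proof -
    have "integrable lborel (\<lambda>t::real. inverse (1 + t\<^sup>2))"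
      using integrable_inverse_1_plus_square by (simp add: set_integrable_def einterval_def)
    then have "integrable lborel (\<lambda>t::real. P * inverse (1 + t\<^sup>2))" by (rule integrable_mult_right)
    then show ?thesis using P by (subst nn_integral_eq_integral) auto
  qed
  have prod: "integrable lborel (\<lambda>\<xi>::'a. \<Prod>b\<in>Basis. P * inverse (1 + (\<xi> \<bullet> b)\<^sup>2))"
  proof (rule integrableI_bounded)
    have "(\<integral>\<^sup>+\<xi>. ennreal (norm (\<Prod>b\<in>(Basis::'a set). P * inverse (1 + (\<xi> \<bullet> b)\<^sup>2))) \<partial>lborel)
        = (\<integral>\<^sup>+\<xi>. (\<Prod>b\<in>(Basis::'a set). ennreal (P * inverse (1 + (\<xi> \<bullet> b)\<^sup>2))) \<partial>lborel)"
      using P by (intro nn_integral_cong) (simp add: prod_ennreal abs_of_nonneg prod_nonneg)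
    also have "\<dots> = (\<Prod>b\<in>(Basis::'a set). \<integral>\<^sup>+t. ennreal (P * inverse (1 + t\<^sup>2)) \<partial>lborel)"
      by (rule nn_integral_lborel_prod[of "\<lambda>b t. ennreal (P * inverse (1 + t\<^sup>2))"]) auto
    also have "\<dots> < \<infinity>" using fin by (simp add: power_less_top_ennreal)
    finally show "(\<integral>\<^sup>+\<xi>. ennreal (norm (\<Prod>b\<in>(Basis::'a set). P * inverse (1 + (\<xi> \<bullet> b)\<^sup>2))) \<partial>lborel) < \<infinity>" .
  qed measurable
  show ?thesis
    by (rule Bochner_Integration.integrable_bound[OF prod]) (auto intro!: AE_I2 order_trans[OF le[simplified] abs_ge_self])
qed

section \<open>Fourier transforms of entire functions of exponential type\<close>

lemma gaussian_has_integral: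
  assumes "0 < \<sigma>"
  shows "integrable lborel (\<lambda>x. exp (- x\<^sup>2 / (2 * \<sigma>\<^sup>2)))"
    "(\<integral>x. exp (- x\<^sup>2 / (2 * \<sigma>\<^sup>2)) \<partial>lborel) = sqrt (2 * pi * \<sigma>\<^sup>2)"
proof -
  have eq: "exp (- x\<^sup>2 / (2 * \<sigma>\<^sup>2)) = sqrt (2 * pi * \<sigma>\<^sup>2) * normal_density 0 \<sigma> x" for x
    using assms by (simp add: normal_density_def)
  show "integrable lborel (\<lambda>x. exp (- x\<^sup>2 / (2 * \<sigma>\<^sup>2)))"
    unfolding eq using assms by (intro integrable_mult_right integrable_normal_density)
  show "(\<integral>x. exp (- x\<^sup>2 / (2 * \<sigma>\<^sup>2)) \<partial>lborel) = sqrt (2 * pi * \<sigma>\<^sup>2)"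
    unfolding eq using assms by (simp add: integral_normal_density del: real_sqrt_mult)
qed

lemma lborel_integral_as_limit:
  fixes f :: "real \<Rightarrow> complex"
  assumes f: "integrable lborel f"
  shows "(\<lambda>n. \<integral>x. indicator {- real n..real n} x *\<^sub>R f x \<partial>lborel) \<longlonglongrightarrow> (\<integral>x. f x \<partial>lborel)"
proof (rule integral_dominated_convergence[where w="\<lambda>x. norm (f x)"])
  show "integrable lborel (\<lambda>x. norm (f x))" using f by simp
  show "AE x in lborel. (\<lambda>n. indicator {- real n..real n} x *\<^sub>R f x) \<longlonglongrightarrow> f x"
  proof (intro AE_I2 tendsto_eventually)
    fix x
    have "eventually (\<lambda>n. \<bar>x\<bar> \<le> real n) sequentially"
      using filterlim_real_sequentially by (simp add: filterlim_at_top)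
    then show "eventually (\<lambda>n. indicator {- real n..real n} x *\<^sub>R f x = f x) sequentially"
      by eventually_elim (auto simp: indicator_def)
  qed
qed (use f in \<open>auto simp: indicator_def\<close>)

text \<open>A primitive of \<open>k\<close> turns the truncated integrals into differences of end
  point values. At the two heights these differ by the contribution of vertical sides of length
  \<open>\<eta>\<close>, which tends to 0 because \<open>b\<close> does.\<close>

lemma horizontal_contour_shift:
  fixes k :: "complex \<Rightarrow> complex"
  assumes k: "k holomorphic_on UNIV" and \<eta>: "0 \<le> \<eta>"
    and bound: "\<And>x \<tau>. 0 \<le> \<tau> \<Longrightarrow> \<tau> \<le> \<eta> \<Longrightarrow> norm (k (Complex x \<tau>)) \<le> b \<bar>x\<bar>"
    and b: "((\<lambda>n. b (real n)) \<longlongrightarrow> 0) sequentially"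
    and int: "integrable lborel (\<lambda>x. k (Complex x 0))" "integrable lborel (\<lambda>x. k (Complex x \<eta>))"
  shows "(\<integral>x. k (Complex x 0) \<partial>lborel) = (\<integral>x. k (Complex x \<eta>) \<partial>lborel)"
proof -
  obtain K where K: "\<And>z. (K has_field_derivative k z) (at z)"
    using holomorphic_convex_primitive'[OF convex_UNIV open_UNIV k] by auto
  have FTC: "(\<integral>x. indicator {- real n..real n} x *\<^sub>R k (Complex x \<tau>) \<partial>lborel) = K (Complex n \<tau>) - K (Complex (- real n) \<tau>)" for n \<tau>
  proof (rule integral_FTC_Icc)
    show "((\<lambda>x. K (Complex x \<tau>)) has_vector_derivative k (Complex x \<tau>)) (at x within {- real n..real n})" for x
    proof -
      have "((\<lambda>x. Complex x \<tau>) has_vector_derivative 1) (at x within {- real n..real n})"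
        unfolding Complex_eq by (auto intro!: derivative_eq_intros)
      from field_vector_diff_chain_within[OF this has_field_derivative_at_within[OF K]]
      show ?thesis by (simp add: o_def)
    qed
    have "continuous_on UNIV k" using k by (rule holomorphic_on_imp_continuous_on)
    then show "continuous_on {- real n..real n} (\<lambda>x. k (Complex x \<tau>))"
      by (rule continuous_on_compose2) (auto intro!: continuous_intros simp: Complex_eq)
  qed simp
  have vert: "norm (K (Complex x 0) - K (Complex x \<eta>)) \<le> b \<bar>x\<bar> * \<eta>" for x
  proof -
    have "norm (K (Complex x 0) - K (Complex x \<eta>)) \<le> b \<bar>x\<bar> * norm (Complex x 0 - Complex x \<eta>)"
    proof (rule field_differentiable_bound[of "closed_segment (Complex x 0) (Complex x \<eta>)" _ k])
      fix z assume "z \<in> closed_segment (Complex x 0) (Complex x \<eta>)"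
      then obtain u where u: "z = (1 - u) *\<^sub>R Complex x 0 + u *\<^sub>R Complex x \<eta>" "0 \<le> u" "u \<le> 1"
        by (auto simp: closed_segment_def)
      have "Re z = x" "Im z = u * \<eta>" by (simp_all add: u(1) algebra_simps)
      moreover from this have "0 \<le> Im z" "Im z \<le> \<eta>"
        using \<eta> u by (simp_all add: mult_left_le_one_le)
      ultimately have "Re z = x" "0 \<le> Im z" "Im z \<le> \<eta>" by blast+
      then show "norm (k z) \<le> b \<bar>x\<bar>" using bound[of "Im z" x] by (metis complex_surj)
    qed (auto intro: has_field_derivative_at_within K)
    also have "norm (Complex x 0 - Complex x \<eta>) = \<eta>"
      using \<eta> by (simp add: norm_complex_def)
    finally show ?thesis .
  qed
  let ?P = "\<lambda>\<tau> n. \<integral>x. indicator {- real n..real n} x *\<^sub>R k (Complex x \<tau>) \<partial>lborel"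
  have "(\<lambda>n. ?P 0 n - ?P \<eta> n) \<longlonglongrightarrow> 0"
  proof (rule Lim_null_comparison)
    show "(\<lambda>n. 2 * \<eta> * b (real n)) \<longlonglongrightarrow> 0" using b by (auto intro!: tendsto_eq_intros)
    have "norm (?P 0 n - ?P \<eta> n) \<le> norm (K (Complex n 0) - K (Complex n \<eta>)) + norm (K (Complex (- real n) 0) - K (Complex (- real n) \<eta>))" for n
    proof -
      have eq: "?P 0 n - ?P \<eta> n = (K (Complex n 0) - K (Complex n \<eta>)) - (K (Complex (- real n) 0) - K (Complex (- real n) \<eta>))"
        unfolding FTC by simp
      show ?thesis unfolding eq by (rule norm_triangle_ineq4)
    qed
    note tri = this
    show "\<forall>\<^sub>F n in sequentially. norm (?P 0 n - ?P \<eta> n) \<le> 2 * \<eta> * b (real n)"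
    proof (intro always_eventually allI)
      fix n
      show "norm (?P 0 n - ?P \<eta> n) \<le> 2 * \<eta> * b (real n)"
        by (rule order_trans[OF tri])
           (use vert[of "real n"] vert[of "- real n"] in \<open>simp add: algebra_simps\<close>)
    qed
  qed
  moreover have "(\<lambda>n. ?P 0 n - ?P \<eta> n) \<longlonglongrightarrow> (\<integral>x. k (Complex x 0) \<partial>lborel) - (\<integral>x. k (Complex x \<eta>) \<partial>lborel)"
    by (intro tendsto_diff lborel_integral_as_limit int)
  ultimately show ?thesis using LIMSEQ_unique by fastforce
qed

text \<open>
  The Gaussian factor makes the contour shift to height \<open>a / \<kappa>\<close> legitimate.  It costs a factor
  \<open>exp (5 * a\<^sup>2 / (2 * \<kappa>))\<close> and gains \<open>exp (- a * y / \<kappa>)\<close>.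
\<close>

lemma damped_exponential_type_fourier_le:
  fixes f :: "complex \<Rightarrow> complex"
  assumes f: "f holomorphic_on UNIV" and le: "\<And>z. norm (f z) \<le> C * exp (a * norm z)"
    and a: "0 < a" and y: "4 * a \<le> y" and \<kappa>: "0 < \<kappa>"
  shows "norm (\<integral>x. exp (- of_real \<kappa> * (of_real x)\<^sup>2) * cis (y * x) * f (of_real x) \<partial>lborel)
    \<le> C * exp (- (3 / 2) * a\<^sup>2 / \<kappa>) * sqrt (2 * pi / \<kappa>)"
proof -
  define k where "k z = exp (- of_real \<kappa> * z\<^sup>2 + \<i> * of_real y * z) * f z" for z
  define \<eta> where "\<eta> = a / \<kappa>"
  define g where "g x = exp (- x\<^sup>2 / (2 * (1 / sqrt \<kappa>)\<^sup>2))" for x :: real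
  have g: "g x = exp (- \<kappa> * x\<^sup>2 / 2)" for x
    using \<kappa> by (simp add: g_def power_divide)
  have C: "0 \<le> C" using order_trans[OF norm_ge_zero le[of 0]] by simp
  have \<eta>: "0 \<le> \<eta>" using a \<kappa> by (simp add: \<eta>_def)
  have kb: "norm (k (Complex x \<tau>)) \<le> C * exp (a * \<tau> + \<kappa> * \<tau>\<^sup>2 - y * \<tau> + a\<^sup>2 / (2 * \<kappa>)) * g x"
    if "0 \<le> \<tau>" for x \<tau>
  proof -
    have "norm (k (Complex x \<tau>)) = exp (- \<kappa> * (x\<^sup>2 - \<tau>\<^sup>2) - y * \<tau>) * norm (f (Complex x \<tau>))"
      by (simp add: k_def norm_mult power2_eq_square)
    also have "\<dots> \<le> exp (- \<kappa> * (x\<^sup>2 - \<tau>\<^sup>2) - y * \<tau>) * (C * exp (a * (\<bar>x\<bar> + \<tau>)))"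
    proof (intro mult_left_mono)
      have "norm (Complex x \<tau>) \<le> \<bar>x\<bar> + \<tau>"
        using cmod_le[of "Complex x \<tau>"] that by simp
      then have "C * exp (a * norm (Complex x \<tau>)) \<le> C * exp (a * (\<bar>x\<bar> + \<tau>))"
        using C a by (intro mult_left_mono) auto
      with le[of "Complex x \<tau>"] show "norm (f (Complex x \<tau>)) \<le> C * exp (a * (\<bar>x\<bar> + \<tau>))"
        by linarith
    qed auto
    also have "\<dots> = C * exp (- \<kappa> * (x\<^sup>2 - \<tau>\<^sup>2) - y * \<tau> + a * (\<bar>x\<bar> + \<tau>))"
      by (simp add: exp_add)
    also have "\<dots> \<le> C * exp (a * \<tau> + \<kappa> * \<tau>\<^sup>2 - y * \<tau> + a\<^sup>2 / (2 * \<kappa>) + (- \<kappa> * x\<^sup>2 / 2))"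
    proof (intro mult_left_mono C)
      \<comment> \<open>Completing the square lets half of the Gaussian absorb the growth
        \<open>exp (a * \<bar>x\<bar>)\<close>, at the cost
        \<open>a\<^sup>2 / (2 * \<kappa>)\<close> in the exponent.\<close>
      have "0 \<le> (\<kappa> * \<bar>x\<bar> - a)\<^sup>2 / (2 * \<kappa>)" using \<kappa> by simp
      also have "\<dots> = \<kappa> * x\<^sup>2 / 2 - a * \<bar>x\<bar> + a\<^sup>2 / (2 * \<kappa>)"
        using \<kappa> by (simp add: power2_diff field_simps power2_eq_square) 
      finally show "exp (- \<kappa> * (x\<^sup>2 - \<tau>\<^sup>2) - y * \<tau> + a * (\<bar>x\<bar> + \<tau>)) \<le> exp (a * \<tau> + \<kappa> * \<tau>\<^sup>2 - y * \<tau> + a\<^sup>2 / (2 * \<kappa>) + (- \<kappa> * x\<^sup>2 / 2))"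
        by (simp add: algebra_simps)
    qed
    also have "\<dots> = C * exp (a * \<tau> + \<kappa> * \<tau>\<^sup>2 - y * \<tau> + a\<^sup>2 / (2 * \<kappa>)) * g x"
      by (simp only: g exp_add mult.assoc)
    finally show ?thesis .
  qed
  have gi: "integrable lborel g" "(\<integral>x. g x \<partial>lborel) = sqrt (2 * pi / \<kappa>)"
    unfolding g_def using gaussian_has_integral[of "1 / sqrt \<kappa>"] \<kappa> by (simp_all add: power_divide)
  have holk: "k holomorphic_on UNIV" unfolding k_def by (intro holomorphic_intros f)
  have meas: "(\<lambda>x. k (Complex x \<tau>)) \<in> borel_measurable lborel" for \<tau>
  proof -
    have "continuous_on UNIV (\<lambda>x. k (Complex x \<tau>))"
      by (rule continuous_on_compose2[OF holomorphic_on_imp_continuous_on[OF holk]])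
         (auto intro!: continuous_intros simp: Complex_eq)
    then show ?thesis by (simp add: borel_measurable_continuous_onI)
  qed
  have int: "integrable lborel (\<lambda>x. k (Complex x \<tau>))" if "0 \<le> \<tau>" for \<tau>
    by (rule Bochner_Integration.integrable_bound[OF integrable_mult_right[OF gi(1), of "C * exp (a * \<tau> + \<kappa> * \<tau>\<^sup>2 - y * \<tau> + a\<^sup>2 / (2 * \<kappa>))"] meas])
       (use kb[OF that] C in \<open>auto simp: g\<close>)
  have "(\<integral>x. k (Complex x 0) \<partial>lborel) = (\<integral>x. k (Complex x \<eta>) \<partial>lborel)"
  proof (rule horizontal_contour_shift[OF holk \<eta> _ _ int int])
    let ?E = "C * exp (a * \<eta> + \<kappa> * \<eta>\<^sup>2 + a\<^sup>2 / (2 * \<kappa>))"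
    show "norm (k (Complex x \<tau>)) \<le> ?E * g \<bar>x\<bar>" if \<tau>: "0 \<le> \<tau>" "\<tau> \<le> \<eta>" for x \<tau>
    proof -
      have "a * \<tau> + \<kappa> * \<tau>\<^sup>2 - y * \<tau> \<le> a * \<eta> + \<kappa> * \<eta>\<^sup>2 - 0"
        using \<tau> a \<kappa> y by (intro diff_mono add_mono mult_left_mono power_mono) auto
      then have "C * exp (a * \<tau> + \<kappa> * \<tau>\<^sup>2 - y * \<tau> + a\<^sup>2 / (2 * \<kappa>)) * g x \<le> ?E * g x"
        using C by (intro mult_right_mono mult_left_mono) (auto simp: g)
      then show ?thesis using kb[OF \<tau>(1), of x] by (simp add: g)
    qed
    have "(\<lambda>n. exp (- \<kappa> * (real n)\<^sup>2 / 2)) \<longlonglongrightarrow> 0" using \<kappa> by real_asymp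
    then show "(\<lambda>n. ?E * g (real n)) \<longlonglongrightarrow> 0" unfolding g by (rule tendsto_mult_right_zero)
  qed (use \<eta> in auto)
  also have "norm \<dots> \<le> (\<integral>x. C * exp (- (3 / 2) * a\<^sup>2 / \<kappa>) * g x \<partial>lborel)"
  proof (rule order_trans[OF integral_norm_bound integral_mono[OF integrable_norm[OF int[OF \<eta>]]]])
    fix x
    \<comment> \<open>At \<open>\<eta> = a / \<kappa>\<close> the terms without \<open>y\<close> add
      up to \<open>(5 / 2) * a\<^sup>2 / \<kappa>\<close>; the distance \<open>4 * a\<close> makes
      the total negative.\<close>
    have "a * \<eta> + \<kappa> * \<eta>\<^sup>2 - y * \<eta> + a\<^sup>2 / (2 * \<kappa>) \<le> a * \<eta> + \<kappa> * \<eta>\<^sup>2 - (4 * a) * \<eta> + a\<^sup>2 / (2 * \<kappa>)"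
      using mult_right_mono[OF y \<eta>] by linarith
    also have "\<dots> = - (3 / 2) * a\<^sup>2 / \<kappa>"
      using \<kappa> by (simp add: \<eta>_def field_simps power2_eq_square)
    finally have "C * exp (a * \<eta> + \<kappa> * \<eta>\<^sup>2 - y * \<eta> + a\<^sup>2 / (2 * \<kappa>)) * g x \<le> C * exp (- (3 / 2) * a\<^sup>2 / \<kappa>) * g x"
      using C by (intro mult_right_mono mult_left_mono) (auto simp: g)
    then show "norm (k (Complex x \<eta>)) \<le> C * exp (- (3 / 2) * a\<^sup>2 / \<kappa>) * g x" using kb[OF \<eta>, of x] by linarith
  qed (use gi in auto)
  also have "\<dots> = C * exp (- (3 / 2) * a\<^sup>2 / \<kappa>) * sqrt (2 * pi / \<kappa>)" by (simp only: integral_mult_right_zero gi)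
  finally have *: "norm (\<integral>x. k (Complex x 0) \<partial>lborel) \<le> C * exp (- (3 / 2) * a\<^sup>2 / \<kappa>) * sqrt (2 * pi / \<kappa>)" .
  have "k (Complex x 0) = exp (- of_real \<kappa> * (of_real x)\<^sup>2) * cis (y * x) * f (of_real x)" for x
  proof -
    have "Complex x 0 = of_real x" by (simp add: complex_of_real_def)
    then show ?thesis by (simp add: k_def cis_conv_exp mult_ac flip: exp_add)
  qed
  with * show ?thesis by (simp only:)
qed

text \<open>The damping is removed by letting \<kappa> tend to 0. The damped integrals converge to
  the undamped one by dominated convergence, and to 0 because the exponential in
  \<open>- 1 / \<kappa>\<close> beats the square root of \<open>1 / \<kappa>\<close>.\<close>

lemma exponential_type_fourier_zero_pos:
  fixes f :: "complex \<Rightarrow> complex"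
  assumes f: "f holomorphic_on UNIV" and le: "\<And>z. norm (f z) \<le> C * exp (a * norm z)"
    and a: "0 < a" and y: "4 * a \<le> y" and int: "integrable lborel (\<lambda>x. f (of_real x))"
  shows "(\<integral>x. cis (y * x) * f (of_real x) \<partial>lborel) = 0"
proof -
  let ?F = "\<lambda>n. \<integral>x. exp (- of_real (1 / real (Suc n)) * (of_real x)\<^sup>2) * cis (y * x) * f (of_real x) \<partial>lborel"
  have [measurable]: "(\<lambda>x. f (complex_of_real x)) \<in> borel_measurable lborel"
    using int by auto
  have cis_meas [measurable]: "(\<lambda>x. cis (y * x)) \<in> borel_measurable lborel"
    by (simp, intro borel_measurable_continuous_onI continuous_intros)
  have "?F \<longlonglongrightarrow> (\<integral>x. cis (y * x) * f (of_real x) \<partial>lborel)"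
  proof (rule integral_dominated_convergence[where w="\<lambda>x. norm (f (of_real x))"])
    show "AE x in lborel. (\<lambda>n. exp (- of_real (1 / real (Suc n)) * (of_real x)\<^sup>2) * cis (y * x) * f (of_real x)) \<longlonglongrightarrow> cis (y * x) * f (of_real x)"
    proof (intro AE_I2)
      fix x :: real
      have "(\<lambda>n. - of_real (1 / real (Suc n)) * (complex_of_real x)\<^sup>2) \<longlonglongrightarrow> - of_real 0 * (complex_of_real x)\<^sup>2"
        by (intro tendsto_intros LIMSEQ_inverse_real_of_nat[unfolded inverse_eq_divide])
      then have "(\<lambda>n. exp (- of_real (1 / real (Suc n)) * (complex_of_real x)\<^sup>2)) \<longlonglongrightarrow> exp (- of_real 0 * (complex_of_real x)\<^sup>2)"
        by (rule tendsto_exp)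
      then have "(\<lambda>n. exp (- of_real (1 / real (Suc n)) * (complex_of_real x)\<^sup>2)) \<longlonglongrightarrow> 1"
        by simp
      from tendsto_mult_right[OF this, of "cis (y * x) * f (of_real x)"]
      show "(\<lambda>n. exp (- of_real (1 / real (Suc n)) * (of_real x)\<^sup>2) * cis (y * x) * f (of_real x)) \<longlonglongrightarrow> cis (y * x) * f (of_real x)"
        by (simp only: mult.assoc mult_1_left)
    qed
    show "AE x in lborel. norm (exp (- of_real (1 / real (Suc n)) * (of_real x)\<^sup>2) * cis (y * x) * f (of_real x)) \<le> norm (f (of_real x))" for n
      by (intro AE_I2) (auto simp: norm_mult mult_left_le_one_le simp flip: of_real_power)
    show "integrable lborel (\<lambda>x. norm (f (of_real x)))" using int by (rule integrable_norm)
  qed measurable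
  moreover have "?F \<longlonglongrightarrow> 0"
  proof (rule Lim_null_comparison)
    show "\<forall>\<^sub>F n in sequentially. norm (?F n) \<le> C * (exp (- (3 / 2) * a\<^sup>2 * real (Suc n)) * sqrt (2 * pi * real (Suc n)))"
      using damped_exponential_type_fourier_le[OF f le a y, of "1 / real (Suc n)" for n]
      by (intro always_eventually allI) (simp add: mult.assoc)
    have "(\<lambda>n. exp (- (3 / 2) * a\<^sup>2 * real (Suc n)) * sqrt (2 * pi * real (Suc n))) \<longlonglongrightarrow> 0"
      using a by real_asymp
    then show "(\<lambda>n. C * (exp (- (3 / 2) * a\<^sup>2 * real (Suc n)) * sqrt (2 * pi * real (Suc n)))) \<longlonglongrightarrow> 0"
      by (rule tendsto_mult_right_zero)
  qed
  ultimately show ?thesis by (rule LIMSEQ_unique)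
qed

lemma exponential_type_fourier_zero:
  fixes f :: "complex \<Rightarrow> complex"
  assumes f: "f holomorphic_on UNIV" and le: "\<And>z. norm (f z) \<le> C * exp (a * norm z)"
    and a: "0 < a" and y: "4 * a \<le> \<bar>y\<bar>" and int: "integrable lborel (\<lambda>x. f (of_real x))"
  shows "(\<integral>x. cis (y * x) * f (of_real x) \<partial>lborel) = 0"
proof (cases "0 \<le> y")
  case True
  then show ?thesis using exponential_type_fourier_zero_pos[OF f le a _ int] y by simp
next
  case False
  have "(\<integral>x. cis (- y * x) * f (- of_real x) \<partial>lborel) = 0"
  proof (rule exponential_type_fourier_zero_pos[where f="\<lambda>z. f (- z)"])
    show "(\<lambda>z. f (- z)) holomorphic_on UNIV"
    proof -
      have "(\<lambda>z. - z :: complex) holomorphic_on UNIV" by (intro holomorphic_intros)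
      from holomorphic_on_compose_gen[OF this f] show ?thesis by (simp add: o_def)
    qed
    show "norm (f (- z)) \<le> C * exp (a * norm z)" for z using le[of "- z"] by simp
    show "integrable lborel (\<lambda>x. f (- of_real x))"
      using lborel_integrable_real_affine[OF int, of "- 1" 0] by simp
  qed (use a y False in auto)
  then show ?thesis
    using lborel_integral_real_affine[of "-1" "\<lambda>x. cis (y * x) * f (of_real x)" 0] by simp
qed

section \<open>Oscillatory integrals of rapidly decaying functions\<close>

text \<open>The inverse Fourier transform without the factor \<open>1 / (2 * pi) ^ n\<close>. At the
  reflected argument it is the Fourier transform, see \<open>ft\<close>, so its properties serve
  both.\<close>

definition osc :: "(real ^ 'n::finite \<Rightarrow> complex) \<Rightarrow> real ^ 'n \<Rightarrow> complex" where
  "osc h x = (\<integral>\<xi>. cis (x \<bullet> \<xi>) * h \<xi> \<partial>lborel)"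

text \<open>Decay at every exponential rate in the weight. The test functions and their Fourier
  transforms both have this property.\<close>

definition decaying :: "real \<Rightarrow> (real ^ 'n::finite \<Rightarrow> complex) \<Rightarrow> bool" where
  "decaying s h \<longleftrightarrow> h \<in> borel_measurable borel \<and> (\<forall>N. \<exists>C. \<forall>\<xi>. norm (h \<xi>) \<le> C * exp (- N * weight s \<xi>))"

lemma cis_inner_measurable [measurable]: "(\<lambda>\<xi>. cis (x \<bullet> \<xi>)) \<in> borel_measurable borel"
  by (intro borel_measurable_continuous_onI continuous_intros)

lemma decaying_measurable: "decaying s h \<Longrightarrow> h \<in> borel_measurable borel"
  by (simp add: decaying_def)

lemma decaying_bound: "decaying s h \<Longrightarrow> \<exists>C. \<forall>\<xi>. norm (h \<xi>) \<le> C * exp (- N * weight s \<xi>)"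
  by (simp add: decaying_def)

lemma decaying_mult:
  assumes h: "decaying s h" and m: "m \<in> borel_measurable borel"
    and le: "\<And>\<xi>. norm (m \<xi>) \<le> C * exp (D * weight s \<xi>)"
  shows "decaying s (\<lambda>\<xi>. m \<xi> * h \<xi>)"
  unfolding decaying_def
proof (intro conjI allI)
  show "(\<lambda>\<xi>. m \<xi> * h \<xi>) \<in> borel_measurable borel"
    using m decaying_measurable[OF h] by measurable
  fix N
  obtain C' where C': "\<And>\<xi>. norm (h \<xi>) \<le> C' * exp (- (N + D) * weight s \<xi>)"
    using decaying_bound[OF h] by blast
  have "norm (m \<xi> * h \<xi>) \<le> C * C' * exp (- N * weight s \<xi>)" for \<xi>
  proof -
    have "norm (m \<xi> * h \<xi>) \<le> (C * exp (D * weight s \<xi>)) * (C' * exp (- (N + D) * weight s \<xi>))"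
      unfolding norm_mult using le[of \<xi>] C'[of \<xi>]
      by (intro mult_mono order_trans[OF norm_ge_zero le[of \<xi>]]) auto
    also have "\<dots> = C * C' * exp (D * weight s \<xi> + - (N + D) * weight s \<xi>)"
      by (simp only: exp_add mult_ac)
    finally show ?thesis by (simp add: algebra_simps)
  qed
  then show "\<exists>C. \<forall>\<xi>. norm (m \<xi> * h \<xi>) \<le> C * exp (- N * weight s \<xi>)" by blast
qed

lemma decaying_add:
  assumes h: "decaying s h" "decaying s h'"
  shows "decaying s (\<lambda>\<xi>. h \<xi> + h' \<xi>)"
  unfolding decaying_def
proof (intro conjI allI)
  show "(\<lambda>\<xi>. h \<xi> + h' \<xi>) \<in> borel_measurable borel"
    using h[THEN decaying_measurable] by measurable
  fix N
  obtain C C' where "\<And>\<xi>. norm (h \<xi>) \<le> C * exp (- N * weight s \<xi>)" "\<And>\<xi>. norm (h' \<xi>) \<le> C' * exp (- N * weight s \<xi>)"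
    using h[THEN decaying_bound] by metis
  then have "\<forall>\<xi>. norm (h \<xi> + h' \<xi>) \<le> (C + C') * exp (- N * weight s \<xi>)"
    by (auto simp: distrib_right intro!: norm_triangle_le add_mono)
  then show "\<exists>C. \<forall>\<xi>. norm (h \<xi> + h' \<xi>) \<le> C * exp (- N * weight s \<xi>)" by blast
qed

lemma decaying_0: "decaying s (\<lambda>\<xi>. 0)"
  by (auto simp: decaying_def intro!: exI[of _ 0])

lemma decaying_cmult: "decaying s h \<Longrightarrow> decaying s (\<lambda>\<xi>. c * h \<xi>)"
  by (rule decaying_mult[where C="norm c" and D=0]) auto

lemma decaying_sum:
  "(\<And>i. i \<in> I \<Longrightarrow> decaying s (h i)) \<Longrightarrow> decaying s (\<lambda>\<xi>. \<Sum>i\<in>I. h i \<xi>)"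
  by (induction I rule: infinite_finite_induct) (auto intro: decaying_0 decaying_add)

lemma abs_component_le_exp_weight:
  assumes "0 < s"
  shows "\<bar>\<xi> $ k\<bar> \<le> s powr s * exp (weight s \<xi>)"
proof -
  have "norm \<xi> \<le> s powr s * exp (weight s \<xi>)"
    using power_le_powr_fact_exp[of 1 s "norm \<xi>" 1] assms by (simp add: weight_def)
  with component_le_norm_cart[of \<xi> k] show ?thesis by linarith
qed

lemma decaying_component:
  assumes "0 < s" "decaying s h"
  shows "decaying s (\<lambda>\<xi>. \<i> * complex_of_real (\<xi> $ k) * h \<xi>)"
  using assms(2)
proof (rule decaying_mult)
  show "norm (\<i> * complex_of_real (\<xi> $ k)) \<le> s powr s * exp (1 * weight s \<xi>)" for \<xi>
    using abs_component_le_exp_weight[OF assms(1), of \<xi> k] by (simp add: norm_mult)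
qed (auto intro!: borel_measurable_continuous_onI continuous_intros)

lemma decaying_integrable:
  assumes s: "0 < s" and h: "decaying s h"
  shows "integrable lborel (\<lambda>\<xi>. (norm \<xi>) ^ j * norm (h \<xi>))" "integrable lborel h"
    "integrable lborel (\<lambda>\<xi>. cis (x \<bullet> \<xi>) * h \<xi>)"
proof -
  have [measurable]: "h \<in> borel_measurable borel" using h by (rule decaying_measurable)
  show 1: "integrable lborel (\<lambda>\<xi>. (norm \<xi>) ^ j * norm (h \<xi>))" for j
  proof -
    obtain C where C: "\<And>\<xi>. norm (h \<xi>) \<le> C * exp (- 2 * weight s \<xi>)" using decaying_bound[OF h] by blast
    define P where "P = ((s / 1) powr s) ^ j * fact j powr s"
    have "norm \<xi> ^ j * norm (h \<xi>) \<le> P * C * exp (- 1 * weight s \<xi>)" for \<xi>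
    proof -
      have "norm \<xi> ^ j * norm (h \<xi>) \<le> (P * exp (1 * weight s \<xi>)) * (C * exp (- 2 * weight s \<xi>))"
        unfolding P_def weight_def using s C[unfolded weight_def]
        by (intro mult_mono power_le_powr_fact_exp) auto
      also have "\<dots> = P * C * exp (1 * weight s \<xi> + - 2 * weight s \<xi>)"
        by (simp only: exp_add mult_ac)
      finally show ?thesis by simp
    qed
    then show ?thesis
      by (intro Bochner_Integration.integrable_bound[OF integrable_mult_right[OF integrable_exp_weight[of 1 s], of "P * C"]])
         (use s in \<open>auto intro!: AE_I2 order_trans[OF _ abs_ge_self]\<close>)
  qed
  show 2: "integrable lborel h"
    using 1[of 0] integrable_norm_iff[of h lborel] by simp
  show "integrable lborel (\<lambda>\<xi>. cis (x \<bullet> \<xi>) * h \<xi>)"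
    by (rule Bochner_Integration.integrable_bound[OF 2]) (auto simp: norm_mult)
qed

lemma osc_add: "0 < s \<Longrightarrow> decaying s h \<Longrightarrow> decaying s h' \<Longrightarrow> osc (\<lambda>\<xi>. h \<xi> + h' \<xi>) x = osc h x + osc h' x"
  unfolding osc_def distrib_left
  by (intro Bochner_Integration.integral_add decaying_integrable)

lemma osc_cmult: "osc (\<lambda>\<xi>. c * h \<xi>) x = c * osc h x"
  unfolding osc_def by (simp add: mult.left_commute)

lemma osc_0 [simp]: "osc (\<lambda>\<xi>. 0) x = 0"
  by (simp add: osc_def)

lemma osc_sum:
  assumes s: "0 < s" and h: "\<And>i. i \<in> I \<Longrightarrow> decaying s (h i)"
  shows "osc (\<lambda>\<xi>. \<Sum>i\<in>I. h i \<xi>) x = (\<Sum>i\<in>I. osc (h i) x)"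
  unfolding osc_def sum_distrib_left
  using assms by (intro Bochner_Integration.integral_sum decaying_integrable)

lemma cis_remainder: "norm (cis \<theta> - 1 - \<i> * complex_of_real \<theta>) \<le> \<theta>\<^sup>2"
proof -
  have "norm (iexp \<theta> - (\<Sum>k\<le>1. (\<i> * \<theta>) ^ k / fact k)) \<le> \<bar>\<theta>\<bar> ^ Suc 1 / fact (Suc 1)"
    by (rule iexp_approx1)
  also have "\<dots> \<le> \<theta>\<^sup>2" by (simp add: power2_eq_square fact_numeral)
  finally show ?thesis by (simp add: cis_conv_exp mult.commute diff_diff_eq)
qed

text \<open>The second order remainder of \<open>cis\<close> bounds the error of the linear
  approximation by \<open>(norm (y - x))\<^sup>2\<close> times the second moment of
  \<open>h\<close>, which is finite by the decay.\<close>

lemma osc_has_derivative: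
  assumes s: "0 < s" and h: "decaying s h"
  shows "(osc h has_derivative (\<lambda>v. \<integral>\<xi>. \<i> * complex_of_real (v \<bullet> \<xi>) * (cis (x \<bullet> \<xi>) * h \<xi>) \<partial>lborel)) (at x)"
    (is "(_ has_derivative ?L) _")
proof -
  have [measurable]: "h \<in> borel_measurable borel" using h by (rule decaying_measurable)
  note int = decaying_integrable[OF s h]
  have intL: "integrable lborel (\<lambda>\<xi>. \<i> * complex_of_real (v \<bullet> \<xi>) * (cis (x \<bullet> \<xi>) * h \<xi>))" for v
  proof (rule Bochner_Integration.integrable_bound[OF integrable_mult_right[OF int(1)[of 1], of "norm v"]])
    show "AE \<xi> in lborel. norm (\<i> * complex_of_real (v \<bullet> \<xi>) * (cis (x \<bullet> \<xi>) * h \<xi>)) \<le> norm (norm v * (norm \<xi> ^ 1 * norm (h \<xi>)))"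
      using Cauchy_Schwarz_ineq2[of v]
      by (auto simp: norm_mult mult.assoc[symmetric] intro!: mult_right_mono)
  qed measurable
  have "bounded_linear ?L"
  proof (rule bounded_linear_intro[where K="\<integral>\<xi>. norm \<xi> ^ 1 * norm (h \<xi>) \<partial>lborel"])
    show "?L (v + w) = ?L v + ?L w" for v w
      unfolding Bochner_Integration.integral_add[OF intL intL, symmetric]
      by (simp add: inner_add_left algebra_simps)
    show "?L (r *\<^sub>R v) = r *\<^sub>R ?L v" for r v
      unfolding integral_scaleR_right[symmetric]
      by (simp add: scaleR_conv_of_real[of _ "_::complex"] mult_ac)
    show "norm (?L v) \<le> norm v * (\<integral>\<xi>. norm \<xi> ^ 1 * norm (h \<xi>) \<partial>lborel)" for v
    proof -
      have "norm (?L v) \<le> (\<integral>\<xi>. norm v * (norm \<xi> ^ 1 * norm (h \<xi>)) \<partial>lborel)"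
      proof (rule order_trans[OF integral_norm_bound integral_mono[OF integrable_norm[OF intL]]])
        show "norm (\<i> * complex_of_real (v \<bullet> \<xi>) * (cis (x \<bullet> \<xi>) * h \<xi>)) \<le> norm v * (norm \<xi> ^ 1 * norm (h \<xi>))" for \<xi>
          using Cauchy_Schwarz_ineq2[of v \<xi>]
          by (auto simp: norm_mult mult.assoc[symmetric] intro!: mult_right_mono)
      qed (intro integrable_mult_right int)
      then show ?thesis by (simp only: integral_mult_right_zero)
    qed
  qed
  moreover
  define Q where "Q = (\<integral>\<xi>. norm \<xi> ^ 2 * norm (h \<xi>) \<partial>lborel)"
  have Q: "0 \<le> Q" unfolding Q_def by (intro Bochner_Integration.integral_nonneg) auto
  have rem: "norm (osc h y - osc h x - ?L (y - x)) \<le> (norm (y - x))\<^sup>2 * Q" for y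
  proof -
    define v where "v = y - x"
    have "osc h y - osc h x - ?L v = (\<integral>\<xi>. cis (y \<bullet> \<xi>) * h \<xi> - cis (x \<bullet> \<xi>) * h \<xi> - \<i> * complex_of_real (v \<bullet> \<xi>) * (cis (x \<bullet> \<xi>) * h \<xi>) \<partial>lborel)"
      unfolding osc_def
      by (simp add: int intL)
    also have "norm \<dots> \<le> (\<integral>\<xi>. (norm v)\<^sup>2 * (norm \<xi> ^ 2 * norm (h \<xi>)) \<partial>lborel)"
    proof (rule order_trans[OF integral_norm_bound integral_mono[OF integrable_norm]])
      show "integrable lborel (\<lambda>\<xi>. cis (y \<bullet> \<xi>) * h \<xi> - cis (x \<bullet> \<xi>) * h \<xi> - \<i> * complex_of_real (v \<bullet> \<xi>) * (cis (x \<bullet> \<xi>) * h \<xi>))"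
        by (intro Bochner_Integration.integrable_diff int intL)
      show "integrable lborel (\<lambda>\<xi>. (norm v)\<^sup>2 * (norm \<xi> ^ 2 * norm (h \<xi>)))"
        by (intro integrable_mult_right int)
      fix \<xi>
      have "cis (y \<bullet> \<xi>) = cis (v \<bullet> \<xi>) * cis (x \<bullet> \<xi>)"
        by (simp add: cis_mult v_def inner_diff_left)
      then have "cis (y \<bullet> \<xi>) * h \<xi> - cis (x \<bullet> \<xi>) * h \<xi> - \<i> * complex_of_real (v \<bullet> \<xi>) * (cis (x \<bullet> \<xi>) * h \<xi>)
          = (cis (v \<bullet> \<xi>) - 1 - \<i> * complex_of_real (v \<bullet> \<xi>)) * (cis (x \<bullet> \<xi>) * h \<xi>)"
        by (simp add: algebra_simps)
      also have "norm \<dots> \<le> (v \<bullet> \<xi>)\<^sup>2 * norm (h \<xi>)"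
        using cis_remainder[of "v \<bullet> \<xi>"] by (simp add: norm_mult mult_right_mono)
      also have "\<dots> \<le> (norm v * norm \<xi>)\<^sup>2 * norm (h \<xi>)"
        using Cauchy_Schwarz_ineq2[of v \<xi>] by (intro mult_right_mono) (auto simp: abs_le_square_iff[symmetric] abs_mult)
      finally show "norm (cis (y \<bullet> \<xi>) * h \<xi> - cis (x \<bullet> \<xi>) * h \<xi> - \<i> * complex_of_real (v \<bullet> \<xi>) * (cis (x \<bullet> \<xi>) * h \<xi>)) \<le> (norm v)\<^sup>2 * (norm \<xi> ^ 2 * norm (h \<xi>))"
        by (simp add: power_mult_distrib mult.assoc)
    qed
    also have "\<dots> = (norm v)\<^sup>2 * Q" unfolding Q_def by (simp only: integral_mult_right_zero)
    finally show ?thesis by (simp add: v_def)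
  qed
  have "\<exists>d>0. \<forall>y. norm (y - x) < d \<longrightarrow> norm (osc h y - osc h x - ?L (y - x)) \<le> e * norm (y - x)" if e: "0 < e" for e
  proof (intro exI[of _ "e / (Q + 1)"] conjI allI impI)
    show "0 < e / (Q + 1)" using e Q by simp
    fix y assume "norm (y - x) < e / (Q + 1)"
    then have "norm (y - x) * (Q + 1) \<le> e" using Q by (simp add: pos_less_divide_eq)
    then have "norm (y - x) * Q \<le> e" using Q by (simp add: distrib_left) (smt (verit) norm_ge_zero)
    then have "norm (y - x) * (norm (y - x) * Q) \<le> norm (y - x) * e" by (rule mult_left_mono) simp
    with rem[of y] show "norm (osc h y - osc h x - ?L (y - x)) \<le> e * norm (y - x)"
      by (simp add: power2_eq_square mult_ac)
  qed
  ultimately show ?thesis unfolding has_derivative_at_alt by blast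
qed

lemma partial_deriv_osc:
  assumes s: "0 < s" and h: "decaying s h"
  shows "partial_deriv k (osc h) = osc (\<lambda>\<xi>. \<i> * complex_of_real (\<xi> $ k) * h \<xi>)"
proof
  fix x
  have "partial_deriv k (osc h) x = (\<integral>\<xi>. \<i> * complex_of_real (axis k 1 \<bullet> \<xi>) * (cis (x \<bullet> \<xi>) * h \<xi>) \<partial>lborel)"
    unfolding partial_deriv_def frechet_derivative_at[OF osc_has_derivative[OF s h], symmetric] ..
  then show "partial_deriv k (osc h) x = osc (\<lambda>\<xi>. \<i> * complex_of_real (\<xi> $ k) * h \<xi>) x"
    by (simp add: osc_def inner_axis' mult_ac)
qed

lemma foldr_partial_deriv_osc:
  assumes s: "0 < s" and h: "decaying s h"
  shows "decaying s (\<lambda>\<xi>. (\<Prod>k\<leftarrow>ks. \<i> * complex_of_real (\<xi> $ k)) * h \<xi>)"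
    "foldr partial_deriv ks (osc h) = osc (\<lambda>\<xi>. (\<Prod>k\<leftarrow>ks. \<i> * complex_of_real (\<xi> $ k)) * h \<xi>)"
proof (induction ks)
  case (Cons k ks)
  case 1
  show ?case using decaying_component[OF s Cons(1), of k] by (simp add: mult.assoc)
  case 2
  show ?case using partial_deriv_osc[OF s Cons(1), of k] Cons(2) by (simp add: mult.assoc)
qed (use h in auto)

section \<open>Gevrey regularity of oscillatory integrals\<close>

lemma C_infinity_osc:
  assumes s: "0 < s" and h: "decaying s h"
  shows "C_infinity (osc h)"
  unfolding C_infinity_def foldr_partial_deriv_osc(2)[OF s h]
  by (intro allI differentiableI[OF osc_has_derivative[OF s foldr_partial_deriv_osc(1)[OF s h]]])

text \<open>This makes the choice in \<open>multi_deriv\<close> meaningful: the \<open>SOME\<close>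
  ranges over a nonempty set of lists.\<close>

lemma ex_list_with_counts: "\<exists>ks. \<forall>k::'n::finite. count_list ks k = \<beta> k"
proof -
  obtain xs :: "'n list" where xs: "set xs = UNIV" "distinct xs"
    using finite_distinct_list[of "UNIV :: 'n set"] by auto
  have "count_list (concat (map (\<lambda>k. replicate (\<beta> k) k) ys)) k = (if k \<in> set ys then \<beta> k else 0)"
    if "distinct ys" for k and ys :: "'n list"
    using that
  proof (induction ys)
    case (Cons y ys)
    have "count_list (replicate n y) k = (if k = y then n else 0)" for n
      by (induction n) auto
    with Cons show ?case by auto
  qed simp
  then show ?thesis using xs by (intro exI[of _ "concat (map (\<lambda>k. replicate (\<beta> k) k) xs)"]) auto
qed

lemma multi_deriv_eq:
  obtains ks where "multi_deriv \<beta> = foldr partial_deriv ks" "\<And>k. count_list ks k = \<beta> k"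
proof
  let ?ks = "SOME ks. \<forall>k. count_list ks k = \<beta> k"
  show "multi_deriv \<beta> = foldr partial_deriv ?ks" by (simp add: multi_deriv_def fun_eq_iff)
  show "count_list ?ks k = \<beta> k" for k using someI_ex[OF ex_list_with_counts[of \<beta>]] by blast
qed

lemma prod_list_eq_prod_count:
  fixes f :: "'n::finite \<Rightarrow> 'a::comm_monoid_mult"
  shows "(\<Prod>k\<leftarrow>ks. f k) = (\<Prod>k\<in>UNIV. f k ^ count_list ks k)"
proof (induction ks)
  case (Cons j ks)
  have "(\<Prod>k\<in>UNIV. f k ^ count_list (j # ks) k) = (\<Prod>k\<in>UNIV. (if k = j then f j else 1) * f k ^ count_list ks k)"
    by (intro prod.cong) auto
  also have "\<dots> = f j * (\<Prod>k\<in>UNIV. f k ^ count_list ks k)"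
    by (simp add: prod.distrib)
  finally show ?case using Cons by simp
qed simp

text \<open>A derivative multiplies \<open>h\<close> by components of \<open>\<xi>\<close>, whose
  powers are traded for exponentials of the weight. \<open>N\<close> and \<open>C\<close> depend on
  \<open>A\<close> only and the bound is linear in \<open>D\<close>, so that it expresses continuity
  from the Fourier side.\<close>

lemma multi_deriv_osc_bound:
  assumes s: "0 < s" and A: "0 < A"
  shows "\<exists>N C. 0 \<le> C \<and> (\<forall>(h :: real ^ 'n::finite \<Rightarrow> complex) D \<beta> x. decaying s h \<longrightarrow>
    (\<forall>\<xi>. norm (h \<xi>) \<le> D * exp (- N * weight s \<xi>)) \<longrightarrow>
    norm (multi_deriv \<beta> (osc h) x) \<le> C * D * (A ^ multi_abs \<beta> * multi_fact \<beta> powr s))"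
proof -
  define n where "n = real CARD('n)"
  have n: "0 < n" by (simp add: n_def)
  \<comment> \<open>Chosen such that \<open>power_le_powr_fact_exp\<close>, used with the rate
    \<open>N / n\<close> for each of the \<open>n\<close> coordinates, produces exactly the constant
    \<open>A\<close>.\<close>
  define N where "N = s * n / A powr (1 / s)"
  have N: "0 < N" using s A n by (simp add: N_def)
  have A_eq: "(s / (N / n)) powr s = A"
    using s A n by (simp add: N_def powr_powr)
  define C where "C = (\<integral>\<xi>. exp (- 1 * weight s (\<xi> :: real ^ 'n)) \<partial>lborel)"
  have "0 \<le> C" unfolding C_def by (intro Bochner_Integration.integral_nonneg) auto
  \<comment> \<open>Of the rate \<open>N + 1\<close>, the part \<open>N\<close> pays for the
    components of \<open>\<xi>\<close> and the remaining unit makes the integral converge.\<close>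
  moreover have "norm (multi_deriv \<beta> (osc h) x) \<le> C * D * (A ^ multi_abs \<beta> * multi_fact \<beta> powr s)"
    if h: "decaying s h" and le: "\<And>\<xi>. norm (h \<xi>) \<le> D * exp (- (N + 1) * weight s \<xi>)"
    for h :: "real ^ 'n \<Rightarrow> complex" and D \<beta> x
  proof -
    define B where "B = A ^ multi_abs \<beta> * multi_fact \<beta> powr s"
    obtain ks where ks: "multi_deriv \<beta> = foldr partial_deriv ks" "\<And>k. count_list ks k = \<beta> k"
      using multi_deriv_eq by blast
    let ?g = "\<lambda>\<xi>. (\<Prod>k\<leftarrow>ks. \<i> * complex_of_real (\<xi> $ k)) * h \<xi>"
    have g: "norm (?g \<xi>) \<le> (B * D) * exp (- 1 * weight s \<xi>)" for \<xi>
    proof -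
      have "norm (\<Prod>k\<leftarrow>ks. \<i> * complex_of_real (\<xi> $ k)) = (\<Prod>k\<in>UNIV. \<bar>\<xi> $ k\<bar> ^ \<beta> k)"
        by (simp add: prod_list_eq_prod_count ks prod_norm[symmetric] norm_power norm_mult)
      also have "\<dots> \<le> (\<Prod>k\<in>UNIV. A ^ \<beta> k * fact (\<beta> k) powr s * exp (N / n * weight s \<xi>))"
      proof (intro prod_mono conjI)
        fix k
        have "\<bar>\<xi> $ k\<bar> ^ \<beta> k \<le> A ^ \<beta> k * fact (\<beta> k) powr s * exp (N / n * \<bar>\<xi> $ k\<bar> powr (1 / s))"
          unfolding A_eq[symmetric] using N n s by (intro power_le_powr_fact_exp) auto
        also have "\<dots> \<le> A ^ \<beta> k * fact (\<beta> k) powr s * exp (N / n * weight s \<xi>)"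
          unfolding weight_def using A N n s
          by (intro mult_left_mono) (auto intro!: mult_left_mono divide_right_mono powr_mono2 component_le_norm_cart)
        finally show "\<bar>\<xi> $ k\<bar> ^ \<beta> k \<le> A ^ \<beta> k * fact (\<beta> k) powr s * exp (N / n * weight s \<xi>)" .
      qed auto
      also have "\<dots> = B * exp (N * weight s \<xi>)"
        using n by (simp add: prod.distrib B_def multi_abs_def multi_fact_def power_sum prod_powr_distrib
            exp_of_nat_mult[symmetric] n_def)
      finally have "norm (?g \<xi>) \<le> (B * exp (N * weight s \<xi>)) * (D * exp (- (N + 1) * weight s \<xi>))"
        unfolding norm_mult using le[of \<xi>] A
        by (intro mult_mono) (auto simp: B_def)
      also have "\<dots> = (B * D) * exp (N * weight s \<xi> + - (N + 1) * weight s \<xi>)"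
        by (simp only: exp_add mult_ac)
      finally show ?thesis by (simp add: algebra_simps)
    qed
    have "norm (osc ?g x) \<le> (\<integral>\<xi>. (B * D) * exp (- 1 * weight s (\<xi> :: real ^ 'n)) \<partial>lborel)"
      unfolding osc_def
    proof (rule order_trans[OF integral_norm_bound integral_mono])
      show "integrable lborel (\<lambda>\<xi>. norm (cis (x \<bullet> \<xi>) * ?g \<xi>))"
        by (intro integrable_norm decaying_integrable[OF s] foldr_partial_deriv_osc[OF s h])
      show "integrable lborel (\<lambda>\<xi>::real^'n. (B * D) * exp (- 1 * weight s \<xi>))"
        using s by (intro integrable_mult_right integrable_exp_weight) auto
      show "norm (cis (x \<bullet> \<xi>) * ?g \<xi>) \<le> (B * D) * exp (- 1 * weight s \<xi>)" for \<xi>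
        using g[of \<xi>] by (simp add: norm_mult)
    qed
    also have "\<dots> = (B * D) * C" unfolding C_def by (rule integral_mult_right_zero)
    finally show ?thesis
      unfolding ks foldr_partial_deriv_osc(2)[OF s h] B_def by (simp add: mult_ac)
  qed
  ultimately show ?thesis by blast
qed

lemma osc_in_gevrey:
  fixes h :: "real ^ 'n::finite \<Rightarrow> complex"
  assumes s: "0 < s" and h: "decaying s h"
  shows "osc h \<in> gevrey s"
  unfolding gevrey_def
proof (intro CollectI conjI allI impI C_infinity_osc[OF s h])
  fix K :: "(real ^ 'n) set" and A :: real assume "compact K \<and> 0 < A"
  then obtain N C where NC: "0 \<le> C" "\<And>(h :: real ^ 'n \<Rightarrow> complex) D \<beta> x. decaying s h \<Longrightarrow>
    (\<And>\<xi>. norm (h \<xi>) \<le> D * exp (- N * weight s \<xi>)) \<Longrightarrow>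
    norm (multi_deriv \<beta> (osc h) x) \<le> C * D * (A ^ multi_abs \<beta> * multi_fact \<beta> powr s)"
    using multi_deriv_osc_bound[OF s, of A] by blast
  obtain D where D: "\<And>\<xi>. norm (h \<xi>) \<le> D * exp (- N * weight s \<xi>)" using decaying_bound[OF h] by blast
  have A0: "0 \<le> A ^ multi_abs \<beta> * multi_fact \<beta> powr s" for \<beta> :: "'n \<Rightarrow> nat"
    using \<open>compact K \<and> 0 < A\<close> by simp
  have "norm (multi_deriv \<beta> (osc h) x) \<le> (\<bar>C * D\<bar> + 1) * A ^ multi_abs \<beta> * multi_fact \<beta> powr s" for \<beta> x
    unfolding mult.assoc
    by (rule order_trans[OF NC(2)[OF h, OF D] mult_right_mono[OF _ A0]]) simp
  then show "\<exists>C>0. \<forall>\<beta>. \<forall>x\<in>K. norm (multi_deriv \<beta> (osc h) x) \<le> C * A ^ multi_abs \<beta> * multi_fact \<beta> powr s"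
    by (intro exI[of _ "\<bar>C * D\<bar> + 1"]) auto
qed

lemma gevrey_seminorm_osc_le:
  assumes s: "0 < s" and A: "0 < A"
  shows "\<exists>N C. 0 \<le> C \<and> (\<forall>(h :: real ^ 'n::finite \<Rightarrow> complex) D K. decaying s h \<longrightarrow> K \<noteq> {} \<longrightarrow>
    (\<forall>\<xi>. norm (h \<xi>) \<le> D * exp (- N * weight s \<xi>)) \<longrightarrow> gevrey_seminorm s K A (osc h) \<le> C * D)"
proof -
  obtain N C where NC: "0 \<le> C" "\<And>(h :: real ^ 'n \<Rightarrow> complex) D \<beta> x. decaying s h \<Longrightarrow>
    (\<And>\<xi>. norm (h \<xi>) \<le> D * exp (- N * weight s \<xi>)) \<Longrightarrow>
    norm (multi_deriv \<beta> (osc h) x) \<le> C * D * (A ^ multi_abs \<beta> * multi_fact \<beta> powr s)"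
    using multi_deriv_osc_bound[OF s A] by blast
  have pos: "0 < A ^ multi_abs \<beta> * multi_fact \<beta> powr s" for \<beta> :: "'n \<Rightarrow> nat"
    using A by (simp add: multi_fact_def prod_zero_iff)
  have *: "gevrey_seminorm s K A (osc h) \<le> C * D"
    if "decaying s h" "K \<noteq> {}" "\<And>\<xi>. norm (h \<xi>) \<le> D * exp (- N * weight s \<xi>)" for h :: "real ^ 'n \<Rightarrow> complex" and D K
    unfolding gevrey_seminorm_def
  proof (rule cSUP_least)
    fix p :: "('n \<Rightarrow> nat) \<times> (real ^ 'n)"
    obtain \<beta> x where p: "p = (\<beta>, x)" by (cases p)
    show "(case p of (\<beta>, x) \<Rightarrow> norm (multi_deriv \<beta> (osc h) x) / (A ^ multi_abs \<beta> * multi_fact \<beta> powr s)) \<le> C * D"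
      unfolding p prod.case pos_divide_le_eq[OF pos] using NC(2)[OF that(1), OF that(3)] .
  qed (use that(2) in simp)
  show ?thesis
    by (intro exI[of _ N] exI[of _ C] conjI NC(1) allI impI) (rule *, simp_all)
qed

section \<open>Fourier transforms of test functions\<close>

definition ft :: "(real ^ 'n::finite \<Rightarrow> complex) \<Rightarrow> real ^ 'n \<Rightarrow> complex" where
  "ft \<phi> \<xi> = osc \<phi> (- \<xi>)"

text \<open>In \<open>C1_with_deriv\<close> derivatives are limits of difference quotients, whereas
  \<open>has_vector_derivative\<close> is phrased by a linear remainder.\<close>

lemma has_vector_derivative_iff_quotient:
  fixes f :: "real \<Rightarrow> 'a::real_normed_vector"
  shows "(f has_vector_derivative D) (at t within S) \<longleftrightarrow> ((\<lambda>r. (f r - f t) /\<^sub>R (r - t)) \<longlongrightarrow> D) (at t within S)"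
proof -
  let ?q = "\<lambda>r. (f r - f t) /\<^sub>R (r - t)" and ?p = "\<lambda>r. (1 / norm (r - t)) *\<^sub>R (f r - (f t + (r - t) *\<^sub>R D))"
  have eq: "norm (?q r - D) = norm (?p r)" if "r \<noteq> t" for r
  proof -
    have "?q r - D = (1 / (r - t)) *\<^sub>R (f r - (f t + (r - t) *\<^sub>R D))"
      using that by (simp add: scaleR_right_diff_distrib scaleR_right_distrib inverse_eq_divide diff_diff_eq)
    then show ?thesis by simp
  qed
  have "(f has_vector_derivative D) (at t within S) \<longleftrightarrow> ((\<lambda>r. norm (?p r)) \<longlongrightarrow> 0) (at t within S)"
    unfolding tendsto_norm_zero_iff has_vector_derivative_def has_derivative_within by (simp add: bounded_linear_scaleR_left)
  also have "\<dots> \<longleftrightarrow> ((\<lambda>r. norm (?q r - D)) \<longlongrightarrow> 0) (at t within S)"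
  proof (rule tendsto_cong)
    show "\<forall>\<^sub>F r in at t within S. norm (?p r) = norm (?q r - D)"
      unfolding eventually_at_filter by (intro always_eventually allI impI) (rule eq[symmetric])
  qed
  also have "\<dots> \<longleftrightarrow> (?q \<longlongrightarrow> D) (at t within S)"
    unfolding tendsto_norm_zero_iff by (rule LIM_zero_iff)
  finally show ?thesis .
qed

lemma partial_deriv_eq_0_outside:
  assumes K: "closed K" and \<phi>: "\<And>x. x \<notin> K \<Longrightarrow> \<phi> x = 0" and x: "x \<notin> K"
  shows "partial_deriv k \<phi> x = 0"
proof -
  have "(\<phi> has_derivative (\<lambda>v. 0)) (at x)"
  proof (rule has_derivative_transform_within_open[of "\<lambda>x. 0" _ _ _ "- K"])
    show "open (- K)" using K by (simp add: open_Compl)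
  qed (use x \<phi> in auto)
  from frechet_derivative_at[OF this, symmetric] show ?thesis
    by (simp add: partial_deriv_def)
qed

text \<open>The decay is in the space variable. It makes the results about \<open>osc\<close>
  applicable to \<open>ft\<close>, where the test function takes the place of
  \<open>h\<close>.\<close>

lemma decaying_compact_support:
  assumes s: "0 < s" and cont: "continuous_on UNIV \<phi>" and K: "compact K" and \<phi>: "\<And>x. x \<notin> K \<Longrightarrow> \<phi> x = 0"
  shows "decaying s \<phi>"
  unfolding decaying_def
proof (intro conjI allI)
  show "\<phi> \<in> borel_measurable borel" using cont by (rule borel_measurable_continuous_onI)
  fix N
  have "compact ((\<lambda>x. norm (\<phi> x) * exp (N * weight s x)) ` K)"
    unfolding weight_def using s
    by (intro compact_continuous_image K continuous_intros continuous_on_subset[OF cont] continuous_on_powr') auto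
  then obtain C where C: "\<And>x. x \<in> K \<Longrightarrow> norm (norm (\<phi> x) * exp (N * weight s x)) \<le> C"
    using compact_imp_bounded bounded_iff by (metis (no_types, lifting) imageI)
  have "norm (\<phi> x) \<le> max C 0 * exp (- N * weight s x)" for x
  proof (cases "x \<in> K")
    case True
    have "norm (\<phi> x) * exp (N * weight s x) * exp (- N * weight s x) \<le> max C 0 * exp (- N * weight s x)"
      using C[OF True] by (intro mult_right_mono) auto
    then show ?thesis by (simp add: mult.assoc flip: exp_add)
  qed (use \<phi> in auto)
  then show "\<exists>C. \<forall>x. norm (\<phi> x) \<le> C * exp (- N * weight s x)" by blast
qed

lemma compact_support_integrable:
  fixes \<phi> :: "real ^ 'n::finite \<Rightarrow> complex"
  assumes "continuous_on UNIV \<phi>" "compact K" "\<And>x. x \<notin> K \<Longrightarrow> \<phi> x = 0"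
  shows "integrable lborel (\<lambda>x. cis (y \<bullet> x) * \<phi> x)"
  by (rule decaying_integrable(3)[of 1]) (use decaying_compact_support[of 1 \<phi> K] assms in auto)

lemma norm_ft_le:
  assumes cont: "continuous_on UNIV \<phi>" and K: "compact K" and \<phi>: "\<And>x. x \<notin> K \<Longrightarrow> \<phi> x = 0"
    and B: "\<And>x. x \<in> K \<Longrightarrow> norm (\<phi> x) \<le> B"
  shows "norm (ft \<phi> \<xi>) \<le> measure lborel K * B"
proof -
  have "norm (ft \<phi> \<xi>) \<le> (\<integral>x. indicator K x *\<^sub>R B \<partial>lborel)"
    unfolding ft_def osc_def
  proof (rule order_trans[OF integral_norm_bound integral_mono])
    show "integrable lborel (\<lambda>x. norm (cis (- \<xi> \<bullet> x) * \<phi> x))"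
      by (intro integrable_norm compact_support_integrable[OF cont K \<phi>])
    show "integrable lborel (\<lambda>x. indicator K x *\<^sub>R B)"
      by (rule borel_integrable_compact[OF K continuous_on_const])
    show "norm (cis (- \<xi> \<bullet> x) * \<phi> x) \<le> indicator K x *\<^sub>R B" for x
      using B[of x] \<phi>[of x] by (auto simp: norm_mult indicator_def)
  qed
  also have "\<dots> = measure lborel K * B"
    using borel_compact[OF K] emeasure_compact_finite[OF K]
    by (simp add: less_top)
  finally show ?thesis .
qed

lemma lborel_integral_translation:
  fixes g :: "'a::euclidean_space \<Rightarrow> complex"
  assumes [measurable]: "g \<in> borel_measurable borel"
  shows "(\<integral>x. g (c + x) \<partial>lborel) = (\<integral>x. g x \<partial>lborel)"
proof -
  have "(\<integral>x. g x \<partial>distr lborel borel ((+) c)) = (\<integral>x. g (c + x) \<partial>lborel)"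
    by (rule integral_distr) auto
  then show ?thesis by (simp add: lborel_distr_plus)
qed

lemma line_has_vector_derivative:
  assumes "\<phi> differentiable (at (x + t *\<^sub>R axis k 1))"
  shows "((\<lambda>t. \<phi> (x + t *\<^sub>R axis k 1)) has_vector_derivative partial_deriv k \<phi> (x + t *\<^sub>R axis k 1)) (at t within S)"
proof -
  have "((\<lambda>t. x + t *\<^sub>R axis k 1) has_vector_derivative axis k 1) (at t within S)"
    by (auto intro!: derivative_eq_intros)
  note a = this
  have "(\<phi> has_derivative frechet_derivative \<phi> (at (x + t *\<^sub>R axis k 1))) (at (x + t *\<^sub>R axis k 1))"
    using assms by (simp add: frechet_derivative_works)
  note b = this
  have "(\<phi> \<circ> (\<lambda>t. x + t *\<^sub>R axis k 1) has_vector_derivative frechet_derivative \<phi> (at (x + t *\<^sub>R axis k 1)) (axis k 1)) (at t within S)"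
    by (rule vector_derivative_diff_chain_within[OF a has_derivative_at_withinI[OF b]])
  then show ?thesis by (simp add: o_def partial_deriv_def)
qed

text \<open>Instead of integrating by parts, the difference quotient of \<open>\<phi>\<close> is
  moved to the exponential by translation invariance of Lebesgue measure, and the step tends to 0
  under dominated convergence.\<close>

lemma ft_partial_deriv:
  fixes \<phi> :: "real ^ 'n::finite \<Rightarrow> complex"
  assumes diff: "\<And>x. \<phi> differentiable (at x)" and cont': "continuous_on UNIV (partial_deriv k \<phi>)"
    and K: "compact K" and \<phi>: "\<And>x. x \<notin> K \<Longrightarrow> \<phi> x = 0"
  shows "ft (partial_deriv k \<phi>) \<xi> = \<i> * complex_of_real (\<xi> $ k) * ft \<phi> \<xi>"
proof -
  let ?e = "axis k 1 :: real ^ 'n"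
  let ?c = "\<lambda>x. cis (- \<xi> \<bullet> x)"
  define h where "h n = 1 / real (Suc n)" for n
  have h: "0 < h n" "h n \<le> 1" for n by (auto simp: h_def)
  have h0: "h \<longlonglongrightarrow> 0" unfolding h_def using LIMSEQ_inverse_real_of_nat by (simp add: inverse_eq_divide)
  have cont: "continuous_on UNIV \<phi>"
    using diff by (simp add: continuous_at_imp_continuous_on differentiable_imp_continuous_within)
  have [measurable]: "\<phi> \<in> borel_measurable borel" "partial_deriv k \<phi> \<in> borel_measurable borel"
    using cont cont' by (auto intro: borel_measurable_continuous_onI)
  have int: "integrable lborel (\<lambda>x. ?c x * \<phi> x)"
    by (rule compact_support_integrable[OF cont K \<phi>])
  have "compact (partial_deriv k \<phi> ` K)"
    using K cont' by (intro compact_continuous_image continuous_on_subset[OF cont']) auto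
  then obtain B where "\<And>x. x \<in> K \<Longrightarrow> norm (partial_deriv k \<phi> x) \<le> B"
    using compact_imp_bounded bounded_iff by (metis (no_types, lifting) imageI)
  moreover have "partial_deriv k \<phi> x = 0" if "x \<notin> K" for x
    using partial_deriv_eq_0_outside[of K \<phi> x k] compact_imp_closed[OF K] \<phi> that by blast
  ultimately have B: "norm (partial_deriv k \<phi> x) \<le> max B 0" for x
    by (cases "x \<in> K") (auto simp: le_max_iff_disj)
  \<comment> \<open>Contains the supports of all difference quotients with a step in the unit
    interval, so that one integrable majorant serves for every \<open>n\<close>.\<close>
  define K' where "K' = (\<lambda>(x, t). x - t *\<^sub>R ?e) ` (K \<times> {0..1})"
  have K': "compact K'" unfolding K'_def
    by (intro compact_continuous_image compact_Times K compact_Icc) (auto intro!: continuous_intros simp: case_prod_unfold)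
  have quot: "norm (\<phi> (x + h n *\<^sub>R ?e) - \<phi> x) \<le> max B 0 * h n" for x n
  proof -
    have "norm (\<phi> (x + h n *\<^sub>R ?e) - \<phi> (x + 0 *\<^sub>R ?e)) \<le> max B 0 * norm (h n - 0)"
    proof (rule differentiable_bound[where S=UNIV and f="\<lambda>t. \<phi> (x + t *\<^sub>R ?e)" and f'="\<lambda>t v. v *\<^sub>R partial_deriv k \<phi> (x + t *\<^sub>R ?e)"])
      show "((\<lambda>t. \<phi> (x + t *\<^sub>R ?e)) has_derivative (\<lambda>v. v *\<^sub>R partial_deriv k \<phi> (x + t *\<^sub>R ?e))) (at t within UNIV)" for t
        using line_has_vector_derivative[OF diff] by (simp add: has_vector_derivative_def)
      show "onorm (\<lambda>v. v *\<^sub>R partial_deriv k \<phi> (x + t *\<^sub>R ?e)) \<le> max B 0" for t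
        using B by (intro onorm_le) (simp add: mult.commute mult_left_mono)
    qed auto
    then show ?thesis using h[of n] by simp
  qed
  have dom: "norm (?c x * ((\<phi> (x + h n *\<^sub>R ?e) - \<phi> x) / of_real (h n))) \<le> indicator K' x *\<^sub>R max B 0" for x n
  proof (cases "x \<in> K'")
    case True
    have "norm (\<phi> (x + h n *\<^sub>R ?e) - \<phi> x) / h n \<le> max B 0"
      using quot[where x=x and n=n] h[of n] by (simp add: divide_le_eq)
    then show ?thesis using True h[of n] by (simp add: norm_mult norm_divide)
  next
    case False
    have "y \<in> K'" if "y + t *\<^sub>R ?e \<in> K" "0 \<le> t" "t \<le> 1" for y t
      unfolding K'_def using that by (intro image_eqI[of _ _ "(y + t *\<^sub>R ?e, t)"]) auto
    from this[of x "h n"] this[of x 0] False have "\<phi> (x + h n *\<^sub>R ?e) = 0" "\<phi> x = 0"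
      using \<phi> h[of n] by auto
    then show ?thesis by simp
  qed
  have lim1: "(\<lambda>n. \<integral>x. ?c x * ((\<phi> (x + h n *\<^sub>R ?e) - \<phi> x) / of_real (h n)) \<partial>lborel) \<longlonglongrightarrow> (\<integral>x. ?c x * partial_deriv k \<phi> x \<partial>lborel)"
  proof (rule integral_dominated_convergence[where w="\<lambda>x. indicator K' x *\<^sub>R max B 0"])
    show "integrable lborel (\<lambda>x. indicator K' x *\<^sub>R max B 0)"
      by (rule borel_integrable_compact[OF K' continuous_on_const])
    show "AE x in lborel. (\<lambda>n. ?c x * ((\<phi> (x + h n *\<^sub>R ?e) - \<phi> x) / of_real (h n))) \<longlonglongrightarrow> ?c x * partial_deriv k \<phi> x"
    proof (intro AE_I2 tendsto_mult tendsto_const)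
      fix x
      have "((\<lambda>t. \<phi> (x + t *\<^sub>R ?e)) has_vector_derivative partial_deriv k \<phi> (x + 0 *\<^sub>R ?e)) (at 0)"
        by (rule line_has_vector_derivative[OF diff])
      from this[unfolded has_vector_derivative_iff_quotient]
      have "((\<lambda>t. (\<phi> (x + t *\<^sub>R ?e) - \<phi> x) /\<^sub>R t) \<longlongrightarrow> partial_deriv k \<phi> x) (at 0)"
        by simp
      moreover have "filterlim h (at 0) sequentially"
        using h h0 by (auto simp: filterlim_at intro!: always_eventually) (metis less_irrefl)
      ultimately have "(\<lambda>n. (\<phi> (x + h n *\<^sub>R ?e) - \<phi> x) /\<^sub>R h n) \<longlonglongrightarrow> partial_deriv k \<phi> x"
        by (rule filterlim_compose)
      then show "(\<lambda>n. (\<phi> (x + h n *\<^sub>R ?e) - \<phi> x) / of_real (h n)) \<longlonglongrightarrow> partial_deriv k \<phi> x"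
        by (simp add: scaleR_conv_of_real divide_inverse mult.commute)
    qed
    show "AE x in lborel. norm (?c x * ((\<phi> (x + h n *\<^sub>R ?e) - \<phi> x) / of_real (h n))) \<le> indicator K' x *\<^sub>R max B 0" for n
      using dom by auto
  qed measurable
  have eq: "(\<integral>x. ?c x * ((\<phi> (x + h n *\<^sub>R ?e) - \<phi> x) / of_real (h n)) \<partial>lborel) = (cis (h n * \<xi> $ k) - 1) / of_real (h n) * ft \<phi> \<xi>" for n
  proof -
    have shift: "?c x * \<phi> (x + h n *\<^sub>R ?e) = cis (h n * \<xi> $ k) * (?c (h n *\<^sub>R ?e + x) * \<phi> (h n *\<^sub>R ?e + x))" for x
      by (simp add: mult.assoc[symmetric] cis_mult inner_diff_right inner_add_right inner_axis algebra_simps)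
    have int': "integrable lborel (\<lambda>x. ?c x * \<phi> (x + h n *\<^sub>R ?e))"
      unfolding shift using int
      by (intro integrable_mult_right) (subst integrable_distr_eq[of "(+) (h n *\<^sub>R ?e)" lborel borel "\<lambda>x. ?c x * \<phi> x", symmetric], auto simp: lborel_distr_plus)
    have "(\<integral>x. ?c x * ((\<phi> (x + h n *\<^sub>R ?e) - \<phi> x) / of_real (h n)) \<partial>lborel)
        = (\<integral>x. (?c x * \<phi> (x + h n *\<^sub>R ?e) - ?c x * \<phi> x) / of_real (h n) \<partial>lborel)"
      by (intro Bochner_Integration.integral_cong) (auto simp: algebra_simps diff_divide_distrib)
    also have "\<dots> = ((\<integral>x. ?c x * \<phi> (x + h n *\<^sub>R ?e) \<partial>lborel) - (\<integral>x. ?c x * \<phi> x \<partial>lborel)) / of_real (h n)"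
      by (simp only: integral_divide_zero Bochner_Integration.integral_diff[OF int' int])
    also have "(\<integral>x. ?c x * \<phi> (x + h n *\<^sub>R ?e) \<partial>lborel) = cis (h n * \<xi> $ k) * (\<integral>x. ?c x * \<phi> x \<partial>lborel)"
    proof -
      have m: "(\<lambda>x. ?c x * \<phi> x) \<in> borel_measurable borel" by measurable
      show ?thesis unfolding shift integral_mult_right_zero lborel_integral_translation[OF m] ..
    qed
    finally show ?thesis by (simp add: ft_def osc_def algebra_simps diff_divide_distrib)
  qed
  have lim2: "(\<lambda>n. (cis (h n * \<xi> $ k) - 1) / of_real (h n) * ft \<phi> \<xi>) \<longlonglongrightarrow> \<i> * complex_of_real (\<xi> $ k) * ft \<phi> \<xi>"
  proof (rule tendsto_mult_right)
    have "norm ((cis (h n * \<xi> $ k) - 1) / of_real (h n) - \<i> * complex_of_real (\<xi> $ k)) \<le> h n * (\<xi> $ k)\<^sup>2" for n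
    proof -
      have "(cis (h n * \<xi> $ k) - 1) / of_real (h n) - \<i> * complex_of_real (\<xi> $ k)
          = (cis (h n * \<xi> $ k) - 1 - \<i> * complex_of_real (h n * \<xi> $ k)) / of_real (h n)"
        using h[of n] by (simp add: field_simps)
      then show ?thesis
        using cis_remainder[of "h n * \<xi> $ k"] h[of n]
        by (simp add: norm_divide divide_le_eq power_mult_distrib power2_eq_square mult_ac)
    qed
    moreover have "(\<lambda>n. h n * (\<xi> $ k)\<^sup>2) \<longlonglongrightarrow> 0" using h0 by (rule tendsto_mult_left_zero)
    ultimately have "(\<lambda>n. (cis (h n * \<xi> $ k) - 1) / of_real (h n) - \<i> * complex_of_real (\<xi> $ k)) \<longlonglongrightarrow> 0"
      by (rule Lim_null_comparison[OF always_eventually[OF allI]])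
    then show "(\<lambda>n. (cis (h n * \<xi> $ k) - 1) / of_real (h n)) \<longlonglongrightarrow> \<i> * complex_of_real (\<xi> $ k)"
      by (rule LIM_zero_cancel)
  qed
  show ?thesis
    using LIMSEQ_unique[OF lim1 lim2[folded eq]] by (simp add: ft_def osc_def)
qed

lemma C_infinity_partial_deriv_continuous:
  fixes \<phi> :: "real ^ 'n::finite \<Rightarrow> complex"
  assumes "C_infinity \<phi>"
  shows "foldr partial_deriv ks \<phi> differentiable (at x)" "continuous_on UNIV (foldr partial_deriv ks \<phi>)"
proof -
  show "foldr partial_deriv ks \<phi> differentiable (at x)" for x
    using assms by (simp add: C_infinity_def)
  then show "continuous_on UNIV (foldr partial_deriv ks \<phi>)"
    by (simp add: continuous_at_imp_continuous_on differentiable_imp_continuous_within)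
qed

lemma foldr_partial_deriv_eq_0_outside:
  assumes "closed K" "\<And>x. x \<notin> K \<Longrightarrow> \<phi> x = 0"
  shows "x \<notin> K \<Longrightarrow> foldr partial_deriv ks \<phi> x = 0"
  by (induction ks arbitrary: x) (auto intro: partial_deriv_eq_0_outside assms)

lemma ft_partial_deriv_replicate:
  fixes \<phi> :: "real ^ 'n::finite \<Rightarrow> complex"
  assumes \<phi>: "C_infinity \<phi>" and K: "compact K" and supp: "\<And>x. x \<notin> K \<Longrightarrow> \<phi> x = 0"
  shows "ft (foldr partial_deriv (replicate j k) \<phi>) \<xi> = (\<i> * complex_of_real (\<xi> $ k)) ^ j * ft \<phi> \<xi>"
proof (induction j)
  case (Suc j)
  have "ft (partial_deriv k (foldr partial_deriv (replicate j k) \<phi>)) \<xi>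
      = \<i> * complex_of_real (\<xi> $ k) * ft (foldr partial_deriv (replicate j k) \<phi>) \<xi>"
  proof (rule ft_partial_deriv[OF C_infinity_partial_deriv_continuous(1)[OF \<phi>] _ K])
    show "continuous_on UNIV (partial_deriv k (foldr partial_deriv (replicate j k) \<phi>))"
      using C_infinity_partial_deriv_continuous(2)[OF \<phi>, of "k # replicate j k"] by (simp only: foldr_Cons o_apply)
    show "foldr partial_deriv (replicate j k) \<phi> x = 0" if "x \<notin> K" for x
      using foldr_partial_deriv_eq_0_outside[OF compact_imp_closed[OF K] supp that] .
  qed
  then show ?case using Suc by simp
qed simp

lemma multi_deriv_single: "multi_deriv (\<lambda>i. if i = k then j else 0) \<phi> = foldr partial_deriv (replicate j k) \<phi>"
proof -
  obtain ks where ks: "multi_deriv (\<lambda>i. if i = k then j else 0) = foldr partial_deriv ks"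
    "\<And>i. count_list ks i = (if i = k then j else 0)" using multi_deriv_eq by blast
  have "set ks \<subseteq> {k}"
    using ks(2) count_list_0_iff by (metis singletonI subsetI)
  then have eq: "ks = replicate (length ks) k"
    by (induction ks) auto
  have "count_list (replicate n k) k = n" for n by (induction n) auto
  then have "length ks = j" using ks(2)[of k] eq by metis
  then show ?thesis using ks(1) eq by simp
qed

text \<open>On the Gevrey space the values under the \<open>SUP\<close> are bounded above, so the
  real supremum is a genuine one.\<close>

lemma gevrey_seminorm_bounds:
  assumes f: "f \<in> gevrey s" and K: "compact K" and A: "0 < A" and x: "x \<in> K"
  shows "norm (multi_deriv \<beta> f x) \<le> gevrey_seminorm s K A f * (A ^ multi_abs \<beta> * multi_fact \<beta> powr s)"
    and "0 \<le> gevrey_seminorm s K A f"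
proof -
  have pos: "0 < A ^ multi_abs \<beta> * multi_fact \<beta> powr s" for \<beta> :: "'a \<Rightarrow> nat"
    using A by (simp add: multi_fact_def)
  have "\<exists>C>0. \<forall>\<beta>. \<forall>x\<in>K. norm (multi_deriv \<beta> f x) \<le> C * A ^ multi_abs \<beta> * multi_fact \<beta> powr s"
    using f K A unfolding gevrey_def by blast
  then obtain C where C: "\<And>\<beta> x. x \<in> K \<Longrightarrow> norm (multi_deriv \<beta> f x) \<le> C * A ^ multi_abs \<beta> * multi_fact \<beta> powr s"
    by blast
  have bdd: "bdd_above ((\<lambda>(\<beta>, x). norm (multi_deriv \<beta> f x) / (A ^ multi_abs \<beta> * multi_fact \<beta> powr s)) ` (UNIV \<times> K))"
    using C pos by (intro bdd_aboveI2[of _ _ C]) (auto simp: pos_divide_le_eq mult.assoc)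
  have *: "norm (multi_deriv \<beta> f x) / (A ^ multi_abs \<beta> * multi_fact \<beta> powr s) \<le> gevrey_seminorm s K A f" for \<beta>
    unfolding gevrey_seminorm_def using cSUP_upper[OF _ bdd, of "(\<beta>, x)"] x by simp
  then show "norm (multi_deriv \<beta> f x) \<le> gevrey_seminorm s K A f * (A ^ multi_abs \<beta> * multi_fact \<beta> powr s)"
    unfolding pos_divide_le_eq[OF pos] .
  show "0 \<le> gevrey_seminorm s K A f"
    by (rule order_trans[OF _ *[of "\<lambda>_. 0"]]) (use pos[of "\<lambda>_. 0"] in simp)
qed

lemma gevrey_in_zero_outside:
  assumes "f \<in> gevrey_in s K" "x \<notin> K"
  shows "f x = 0"
  using assms closure_subset[of "{x. f x \<noteq> 0}"] by (auto simp: gevrey_in_def)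

text \<open>Derivatives are taken only in the direction \<open>k\<close> of the largest component of
  \<open>\<xi>\<close>. Their Fourier transforms give all moments in
  \<open>\<bar>\<xi> $ k\<bar>\<close>, hence exponential decay in it, and this component is at
  least \<open>norm \<xi> / n\<close>.\<close>

lemma ft_decay:
  fixes K :: "(real ^ 'n::finite) set"
  assumes s: "0 < s" and N: "0 < N" and K: "compact K" "K \<noteq> {}"
  shows "\<exists>A>0. \<exists>C\<ge>0. \<forall>\<phi>\<in>gevrey_in s K. \<forall>\<xi>. norm (ft \<phi> \<xi>) \<le> C * gevrey_seminorm s K A \<phi> * exp (- N * weight s \<xi>)"
proof -
  define n where "n = real CARD('n)"
  have n: "0 < n" by (simp add: n_def)
  \<comment> \<open>Solves \<open>A_eq\<close>: the rate delivered by the moment lemma, reduced by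
    the comparison of \<open>\<xi>\<close> with its largest component, is to be
    \<open>N\<close>.\<close>
  define A where "A = (s / (2 * N)) powr s / n"
  have A: "0 < A" using s N n by (simp add: A_def)
  have "(A * n) powr (1 / s) = s / (2 * N)" using s N n by (simp add: A_def powr_powr)
  then have A_eq: "s / (2 * A powr (1 / s)) * (1 / n powr (1 / s)) = N"
    using s N n A by (simp add: powr_mult field_simps)
  define C where "C = 2 powr s * measure lborel K"
  have "norm (ft \<phi> \<xi>) \<le> C * gevrey_seminorm s K A \<phi> * exp (- N * weight s \<xi>)" if \<phi>: "\<phi> \<in> gevrey_in s K" for \<phi> \<xi>
  proof -
    let ?p = "gevrey_seminorm s K A \<phi>"
    have \<phi>g: "\<phi> \<in> gevrey s" "C_infinity \<phi>" using \<phi> by (auto simp: gevrey_in_def gevrey_def)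
    obtain x0 where "x0 \<in> K" using K by blast
    then have p0: "0 \<le> ?p" using gevrey_seminorm_bounds(2)[OF \<phi>g(1) K(1) A] by blast
    have supp: "\<And>x. x \<notin> K \<Longrightarrow> \<phi> x = 0" using gevrey_in_zero_outside[OF \<phi>] .
    obtain k where k: "\<And>i. \<bar>\<xi> $ i\<bar> \<le> \<bar>\<xi> $ k\<bar>"
    proof -
      have "Max (range (\<lambda>i. \<bar>\<xi> $ i\<bar>)) \<in> range (\<lambda>i. \<bar>\<xi> $ i\<bar>)" by (intro Max_in) auto
      then obtain k where "Max (range (\<lambda>i. \<bar>\<xi> $ i\<bar>)) = \<bar>\<xi> $ k\<bar>" by blast
      with that[of k] Max_ge[of "range (\<lambda>i. \<bar>\<xi> $ i\<bar>)"] show thesis by auto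
    qed
    define t where "t = \<bar>\<xi> $ k\<bar>"
    have moment: "norm (ft \<phi> \<xi>) * t ^ j \<le> measure lborel K * ?p * A ^ j * fact j powr s" for j
    proof -
      let ?\<beta> = "\<lambda>i. if i = k then j else 0"
      let ?f = "foldr partial_deriv (replicate j k) \<phi>"
      have abs: "multi_abs ?\<beta> = j" by (simp add: multi_abs_def)
      have fct: "multi_fact ?\<beta> = fact j"
        by (simp add: multi_fact_def if_distrib[where f=fact] prod.delta cong: if_cong)
      have "ft ?f \<xi> = (\<i> * complex_of_real (\<xi> $ k)) ^ j * ft \<phi> \<xi>"
        by (rule ft_partial_deriv_replicate[OF \<phi>g(2) K(1) supp])
      then have "norm (ft \<phi> \<xi>) * t ^ j = norm (ft ?f \<xi>)"
        by (simp only: norm_mult norm_power t_def norm_ii norm_of_real mult_1_left mult.commute)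
      also have "\<dots> \<le> measure lborel K * (?p * (A ^ j * fact j powr s))"
      proof (rule norm_ft_le[OF C_infinity_partial_deriv_continuous(2)[OF \<phi>g(2)] K(1)])
        show "?f x = 0" if "x \<notin> K" for x
          using foldr_partial_deriv_eq_0_outside[OF compact_imp_closed[OF K(1)] supp that] .
        show "norm (?f x) \<le> ?p * (A ^ j * fact j powr s)" if "x \<in> K" for x
          using gevrey_seminorm_bounds(1)[OF \<phi>g(1) K(1) A that, of ?\<beta>] unfolding multi_deriv_single abs fct .
      qed
      finally show ?thesis by (simp add: mult.assoc)
    qed
    have "norm (ft \<phi> \<xi>) \<le> 2 powr s * (measure lborel K * ?p) * exp (- (s / (2 * A powr (1 / s))) * t powr (1 / s))"
      by (rule gevrey_moments_imp_exp_decay[OF A s _ _ _ moment]) (auto simp: t_def p0)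
    also have "\<dots> \<le> 2 powr s * (measure lborel K * ?p) * exp (- N * weight s \<xi>)"
    proof (intro mult_left_mono)
      have "norm \<xi> \<le> (\<Sum>i\<in>UNIV. \<bar>\<xi> $ i\<bar>)" by (rule norm_le_l1_cart)
      also have "\<dots> \<le> n * t" unfolding n_def t_def using sum_bounded_above[of UNIV "\<lambda>i. \<bar>\<xi> $ i\<bar>" "\<bar>\<xi> $ k\<bar>"] k by simp
      finally have "norm \<xi> / n \<le> t" using n by (simp add: divide_le_eq mult.commute)
      then have "(norm \<xi> / n) powr (1 / s) \<le> t powr (1 / s)" using s n by (intro powr_mono2) auto
      then have "s / (2 * A powr (1 / s)) * ((norm \<xi> / n) powr (1 / s)) \<le> s / (2 * A powr (1 / s)) * t powr (1 / s)"
        using s by (intro mult_left_mono) auto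
      moreover have "s / (2 * A powr (1 / s)) * ((norm \<xi> / n) powr (1 / s)) = N * weight s \<xi>"
        unfolding A_eq[symmetric] weight_def using n by (simp add: powr_divide)
      ultimately show "exp (- (s / (2 * A powr (1 / s))) * t powr (1 / s)) \<le> exp (- N * weight s \<xi>)" by simp
    qed (use p0 in auto)
    finally show ?thesis by (simp add: C_def mult.assoc)
  qed
  moreover have "0 \<le> C" by (simp add: C_def)
  ultimately show ?thesis using A by blast
qed

text \<open>The point 0 is added to the support because that of the zero function is empty, and
  seminorms are indexed by nonempty sets.\<close>

lemma gevrey_c_imp_gevrey_in: "\<phi> \<in> gevrey_c s \<Longrightarrow> \<exists>K. compact K \<and> K \<noteq> {} \<and> \<phi> \<in> gevrey_in s K"
  unfolding gevrey_c_def gevrey_in_def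
  by (auto intro!: exI[of _ "insert 0 (closure {x. \<phi> x \<noteq> 0})"])

lemma gevrey_c_decaying:
  fixes \<phi> :: "real ^ 'n::finite \<Rightarrow> complex"
  assumes "0 < s" "\<phi> \<in> gevrey_c s"
  shows "decaying s \<phi>"
proof -
  obtain K where K: "compact K" "K \<noteq> {}" "\<phi> \<in> gevrey_in s K" using gevrey_c_imp_gevrey_in[OF assms(2)] by blast
  have C: "C_infinity \<phi>" using assms(2) by (auto simp: gevrey_c_def gevrey_def)
  show ?thesis
    using decaying_compact_support[OF assms(1) _ K(1) gevrey_in_zero_outside[OF K(3)]] C_infinity_partial_deriv_continuous(2)[OF C, of "[]"]
    by simp
qed

lemma decaying_ft:
  assumes s: "0 < s" and \<phi>: "\<phi> \<in> gevrey_c s"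
  shows "decaying s (ft \<phi>)"
proof -
  obtain K where K: "compact K" "K \<noteq> {}" "\<phi> \<in> gevrey_in s K" using gevrey_c_imp_gevrey_in[OF \<phi>] by blast
  have "continuous_on UNIV (osc \<phi>)"
    using C_infinity_partial_deriv_continuous(2)[OF C_infinity_osc[OF s gevrey_c_decaying[OF assms]], of "[]"] by simp
  then have cont: "continuous_on UNIV (ft \<phi>)"
    unfolding ft_def by (rule continuous_on_compose2) (auto intro!: continuous_intros)
  show ?thesis unfolding decaying_def
  proof (intro conjI allI)
    show "ft \<phi> \<in> borel_measurable borel" using cont by (rule borel_measurable_continuous_onI)
    fix N
    obtain A C where AC: "0 \<le> C" "\<And>\<phi> \<xi>. \<phi> \<in> gevrey_in s K \<Longrightarrow> norm (ft \<phi> \<xi>) \<le> C * gevrey_seminorm s K A \<phi> * exp (- max N 1 * weight s \<xi>)"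
      using ft_decay[OF s _ K(1,2), of "max N 1"] by (metis max.strict_coboundedI2 zero_less_one)
    have "norm (ft \<phi> \<xi>) \<le> \<bar>C * gevrey_seminorm s K A \<phi>\<bar> * exp (- N * weight s \<xi>)" for \<xi>
    proof -
      have "norm (ft \<phi> \<xi>) \<le> C * gevrey_seminorm s K A \<phi> * exp (- max N 1 * weight s \<xi>)" by (rule AC(2)[OF K(3)])
      also have "\<dots> \<le> \<bar>C * gevrey_seminorm s K A \<phi>\<bar> * exp (- N * weight s \<xi>)"
        by (intro mult_mono) (auto intro!: mult_right_mono)
      finally show ?thesis .
    qed
    then show "\<exists>C. \<forall>\<xi>. norm (ft \<phi> \<xi>) \<le> C * exp (- N * weight s \<xi>)" by blast
  qed
qed

text \<open>The Fourier-Laplace integral with a single complex variable, along a coordinate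
  direction, which is the form that \<open>osc_eq_0_outside\<close> asks for. The compact support
  makes it entire, and the size of the coordinate \<open>x $ k\<close> on the support is its
  exponential type.\<close>

lemma ft_entire_extension:
  fixes \<phi> :: "real ^ 'n::finite \<Rightarrow> complex" and K :: "(real ^ 'n) set" and \<xi> :: "real ^ 'n"
  assumes cont: "continuous_on UNIV \<phi>" and K: "compact K" and supp: "\<And>x. x \<notin> K \<Longrightarrow> \<phi> x = 0"
    and r: "\<And>x. x \<in> K \<Longrightarrow> \<bar>x $ k\<bar> \<le> r"
  shows "\<exists>f C. f holomorphic_on UNIV \<and> (\<forall>z. norm (f z) \<le> C * exp (r * norm z)) \<and>
    (\<forall>\<tau>. f (complex_of_real \<tau>) = ft \<phi> (\<xi> + \<tau> *\<^sub>R axis k 1))"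
proof -
  \<comment> \<open>A box is introduced because differentiation under the integral sign is applied
    to integrals over boxes; outside the support the integrand vanishes.\<close>
  obtain a b where ab: "K \<subseteq> cbox a b" using bounded_subset_cbox_symmetric[OF compact_imp_bounded[OF K]] by blast
  define g where "g x = cis (- \<xi> \<bullet> x) * \<phi> x" for x
  have gc: "continuous_on UNIV g" unfolding g_def by (intro continuous_intros cont)
  have g0: "g x = 0" if "x \<notin> cbox a b" for x using that ab supp by (auto simp: g_def)
  define F where "F z x = exp (- \<i> * z * complex_of_real (x $ k)) * g x" for z x
  have Fc: "continuous_on UNIV (F z)" for z unfolding F_def by (intro continuous_intros gc)
  define f where "f z = integral (cbox a b) (F z)" for z
  have leb: "f z = (\<integral>x. F z x \<partial>lborel)" "integrable lborel (F z)" for z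
  proof -
    have F0: "F z x = indicator (cbox a b) x *\<^sub>R F z x" for x
      using g0[of x] by (auto simp: F_def indicator_def)
    have "integrable lborel (\<lambda>x. indicator (cbox a b) x *\<^sub>R F z x)"
      by (rule borel_integrable_compact[OF compact_cbox continuous_on_subset[OF Fc]]) auto
    then have si: "set_integrable lborel (cbox a b) (F z)" by (simp add: set_integrable_def)
    show "integrable lborel (F z)" using si F0 unfolding set_integrable_def by simp
    have "f z = (\<integral>x. indicator (cbox a b) x *\<^sub>R F z x \<partial>lborel)"
      unfolding f_def set_borel_integral_eq_integral(2)[OF si, symmetric] by (simp add: set_lebesgue_integral_def)
    then show "f z = (\<integral>x. F z x \<partial>lborel)" using F0 by simp
  qed
  have "f holomorphic_on UNIV"
    unfolding f_def
  proof (rule leibniz_rule_holomorphic)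
    show "((\<lambda>z. F z x) has_field_derivative (- \<i> * complex_of_real (x $ k)) * F z x) (at z within UNIV)" for z x
      unfolding F_def by (auto intro!: derivative_eq_intros)
    show "F z integrable_on cbox a b" for z
      by (intro integrable_continuous continuous_on_subset[OF Fc]) auto
    show "continuous_on (UNIV \<times> cbox a b) (\<lambda>(z, x). (- \<i> * complex_of_real (x $ k)) * F z x)"
      unfolding F_def case_prod_unfold
      by (intro continuous_intros continuous_on_compose2[OF gc]) auto
  qed auto
  moreover have "norm (f z) \<le> (\<integral>x. norm (g x) \<partial>lborel) * exp (r * norm z)" for z
  proof -
    have gi: "integrable lborel g" 
    proof -
      have "F 0 = g" by (simp add: F_def fun_eq_iff)
      then show ?thesis using leb(2)[of 0] by simp
    qed
    have "norm (f z) \<le> (\<integral>x. norm (g x) * exp (r * norm z) \<partial>lborel)"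
      unfolding leb(1)
    proof (rule order_trans[OF integral_norm_bound integral_mono[OF integrable_norm[OF leb(2)]]])
      show "integrable lborel (\<lambda>x. norm (g x) * exp (r * norm z))" using gi by auto
      fix x
      show "norm (F z x) \<le> norm (g x) * exp (r * norm z)"
      proof (cases "x \<in> K")
        case True
        have "norm (exp (- \<i> * z * complex_of_real (x $ k))) \<le> exp (norm (- \<i> * z * complex_of_real (x $ k)))"
          by (rule norm_exp)
        also have "\<dots> \<le> exp (r * norm z)"
          using mult_right_mono[OF r[OF True], of "norm z"] by (simp add: norm_mult mult.commute)
        finally have "norm (exp (- \<i> * z * complex_of_real (x $ k))) * norm (g x) \<le> exp (r * norm z) * norm (g x)"
          by (rule mult_right_mono) simp
        then show ?thesis unfolding F_def norm_mult by (simp add: mult.commute)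
      next
        case False
        then show ?thesis by (simp add: F_def g_def supp)
      qed
    qed
    then show ?thesis by simp
  qed
  moreover have "f (complex_of_real \<tau>) = ft \<phi> (\<xi> + \<tau> *\<^sub>R axis k 1)" for \<tau>
  proof -
    have "F (complex_of_real \<tau>) x = cis (- (\<xi> + \<tau> *\<^sub>R axis k 1) \<bullet> x) * \<phi> x" for x
      by (simp add: F_def g_def cis_conv_exp inner_add_left inner_axis' algebra_simps flip: exp_add mult.assoc)
    then show ?thesis by (simp add: leb ft_def osc_def)
  qed
  ultimately show ?thesis by blast
qed

section \<open>Fourier inversion and supports\<close>

text \<open>The characteristic function of the standard normal distribution.\<close>

lemma gaussian_fourier_real:
  fixes v :: real
  shows "integrable lborel (\<lambda>t. cis (v * t) * complex_of_real (exp (- t\<^sup>2 / 2)))"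
    "(\<integral>t. cis (v * t) * complex_of_real (exp (- t\<^sup>2 / 2)) \<partial>lborel) = complex_of_real (sqrt (2 * pi) * exp (- v\<^sup>2 / 2))"
proof -
  have meas [measurable]: "(\<lambda>t. cis (v * t)) \<in> borel_measurable borel"
    by (intro borel_measurable_continuous_onI continuous_intros)
  have int: "integrable lborel (\<lambda>t::real. complex_of_real (exp (- t\<^sup>2 / 2)))"
    using gaussian_has_integral(1)[of 1] by (simp add: complex_of_real_integrable_eq)
  show "integrable lborel (\<lambda>t. cis (v * t) * complex_of_real (exp (- t\<^sup>2 / 2)))"
    by (rule Bochner_Integration.integrable_bound[OF int]) (auto simp: norm_mult)
  have eq: "cis (v * t) * complex_of_real (exp (- t\<^sup>2 / 2)) = of_real (sqrt (2 * pi)) * (std_normal_density t *\<^sub>R iexp (v * t))" for t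
    by (simp add: std_normal_density_def scaleR_conv_of_real cis_conv_exp)
  have "complex_of_real (exp (- v\<^sup>2 / 2)) = (CLINT t|std_normal_distribution. iexp (v * t))"
    using char_std_normal_distribution by (simp add: char_def fun_eq_iff)
  also have "\<dots> = (\<integral>t. std_normal_density t *\<^sub>R iexp (v * t) \<partial>lborel)"
    by (rule integral_density) auto
  finally show "(\<integral>t. cis (v * t) * complex_of_real (exp (- t\<^sup>2 / 2)) \<partial>lborel) = complex_of_real (sqrt (2 * pi) * exp (- v\<^sup>2 / 2))"
    unfolding eq integral_mult_right_zero by simp
qed

definition gauss :: "'a::euclidean_space \<Rightarrow> real" where
  "gauss \<xi> = exp (- (norm \<xi>)\<^sup>2 / 2)"

lemma gauss_measurable [measurable]: "gauss \<in> borel_measurable borel"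
  unfolding gauss_def by measurable

lemma gauss_pos: "0 < gauss x" and gauss_le: "gauss x \<le> 1" and gauss_0 [simp]: "gauss 0 = 1"
  by (auto simp: gauss_def)

lemma abs_gauss [simp]: "\<bar>gauss x\<bar> = gauss x"
  by (simp add: gauss_def)

lemma gauss_prod: "gauss \<xi> = (\<Prod>b\<in>Basis. exp (- (\<xi> \<bullet> b)\<^sup>2 / 2))"
proof -
  have "(norm \<xi>)\<^sup>2 = (\<Sum>b\<in>Basis. (\<xi> \<bullet> b)\<^sup>2)"
    unfolding power2_norm_eq_inner by (subst euclidean_inner) (simp add: power2_eq_square)
  then show ?thesis
    by (simp add: gauss_def exp_sum[symmetric] sum_negf sum_divide_distrib)
qed

text \<open>The Gaussian and the character both factor over the coordinates, and Lebesgue measure is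
  a product measure.\<close>

lemma gaussian_fourier:
  fixes v :: "'a::euclidean_space"
  shows "integrable lborel (\<lambda>\<xi>. cis (v \<bullet> \<xi>) * complex_of_real (gauss \<xi>))"
    "(\<integral>\<xi>. cis (v \<bullet> \<xi>) * complex_of_real (gauss \<xi>) \<partial>lborel) = complex_of_real (sqrt (2 * pi) ^ DIM('a) * gauss v)"
proof -
  interpret product_sigma_finite "\<lambda>_::'a. lborel :: real measure" ..
  define f where "f b t = cis ((v \<bullet> b) * t) * complex_of_real (exp (- t\<^sup>2 / 2))" for b t
  have cisv: "cis (v \<bullet> \<xi>) = (\<Prod>b\<in>Basis. cis ((v \<bullet> b) * (\<xi> \<bullet> b)))" for \<xi>
  proof -
    have "(\<Prod>b\<in>A. cis ((v \<bullet> b) * (\<xi> \<bullet> b))) = cis (\<Sum>b\<in>A. (v \<bullet> b) * (\<xi> \<bullet> b))" if "finite A" for A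
      using that by (induction A rule: finite_induct) (auto simp: cis_mult)
    then show ?thesis by (simp add: euclidean_inner[of v \<xi>])
  qed
  have prod: "cis (v \<bullet> \<xi>) * complex_of_real (gauss \<xi>) = (\<Prod>b\<in>Basis. f b (\<xi> \<bullet> b))" for \<xi>
    by (simp add: cisv gauss_prod f_def prod.distrib)
  have coord: "(\<Sum>b\<in>Basis. x b *\<^sub>R b) \<bullet> b = x b" if "b \<in> Basis" for x and b :: 'a
    using that by (simp add: inner_sum_left inner_Basis if_distrib cong: if_cong)
  have int: "integrable (\<Pi>\<^sub>M b\<in>(Basis::'a set). lborel) (\<lambda>x. \<Prod>b\<in>Basis. f b (x b))"
    unfolding f_def by (intro product_integrable_prod gaussian_fourier_real) auto
  have L: "(lborel :: 'a measure) = distr (\<Pi>\<^sub>M b\<in>Basis. lborel) borel (\<lambda>f. \<Sum>b\<in>Basis. f b *\<^sub>R b)"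
    by (rule lborel_eq)
  have m: "(\<lambda>x. \<Sum>b\<in>(Basis::'a set). x b *\<^sub>R b) \<in> measurable (\<Pi>\<^sub>M b\<in>Basis. lborel) borel"
    by measurable
  have meas: "(\<lambda>\<xi>::'a. \<Prod>b\<in>Basis. f b (\<xi> \<bullet> b)) \<in> borel_measurable borel"
    unfolding f_def by (intro borel_measurable_continuous_onI continuous_intros) auto
  have comp: "(\<Prod>b\<in>Basis. f b ((\<Sum>b\<in>(Basis::'a set). x b *\<^sub>R b) \<bullet> b)) = (\<Prod>b\<in>Basis. f b (x b))" for x
    by (intro prod.cong refl) (simp add: coord)
  show "integrable lborel (\<lambda>\<xi>. cis (v \<bullet> \<xi>) * complex_of_real (gauss \<xi>))"
    unfolding prod L integrable_distr_eq[OF m meas] comp by (rule int)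
  have "(\<integral>\<xi>. cis (v \<bullet> \<xi>) * complex_of_real (gauss \<xi>) \<partial>lborel) = (\<integral>x. (\<Prod>b\<in>Basis. f b (x b)) \<partial>(\<Pi>\<^sub>M b\<in>(Basis::'a set). lborel))"
    unfolding prod L integral_distr[OF m meas] comp ..
  also have "\<dots> = (\<Prod>b\<in>(Basis::'a set). \<integral>t. f b t \<partial>lborel)"
    unfolding f_def by (intro product_integral_prod gaussian_fourier_real) auto
  also have "\<dots> = (\<Prod>b\<in>(Basis::'a set). complex_of_real (sqrt (2 * pi) * exp (- (v \<bullet> b)\<^sup>2 / 2)))"
    by (simp only: f_def gaussian_fourier_real(2))
  also have "\<dots> = complex_of_real (sqrt (2 * pi) ^ DIM('a) * gauss v)"
    by (simp add: prod.distrib gauss_prod)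
  finally show "(\<integral>\<xi>. cis (v \<bullet> \<xi>) * complex_of_real (gauss \<xi>) \<partial>lborel) = complex_of_real (sqrt (2 * pi) ^ DIM('a) * gauss v)" .
qed

lemma integrable_gauss: "integrable lborel (gauss :: 'a::euclidean_space \<Rightarrow> real)"
  using integrable_norm[OF gaussian_fourier(1)[of "0 :: 'a"]] by simp

lemma lborel_integral_affine:
  fixes f :: "'a::euclidean_space \<Rightarrow> complex"
  assumes [measurable]: "f \<in> borel_measurable borel" and c: "c \<noteq> 0"
  shows "(\<integral>x. f x \<partial>lborel) = complex_of_real (\<bar>c\<bar> ^ DIM('a)) * (\<integral>x. f (t + c *\<^sub>R x) \<partial>lborel)"
  by (subst lborel_affine[OF c, of t])
     (simp add: integral_density integral_distr scaleR_conv_of_real)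

lemma cis_measurable [measurable]: "cis \<in> borel_measurable borel"
  by (intro borel_measurable_continuous_onI continuous_intros)

text \<open>A Gaussian cut-off makes Fubini applicable, and the inner integral becomes a Gaussian
  concentrating at \<open>x\<close>. The factor \<open>sqrt (2 * pi) ^ n\<close> arises twice, from
  the transform of the Gaussian and from its total mass.\<close>

theorem fourier_inversion:
  fixes \<phi> :: "real ^ 'n::finite \<Rightarrow> complex"
  assumes cont: "continuous_on UNIV \<phi>" and K: "compact K" and supp: "\<And>x. x \<notin> K \<Longrightarrow> \<phi> x = 0"
    and s: "0 < s" and ft: "decaying s (ft \<phi>)"
  shows "osc (ft \<phi>) x = complex_of_real ((2 * pi) ^ CARD('n)) * \<phi> x"
proof -
  define e where "e n = 1 / real (Suc n)" for n
  have e: "0 < e n" for n by (simp add: e_def)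
  have e0: "e \<longlonglongrightarrow> 0" unfolding e_def using LIMSEQ_inverse_real_of_nat by (simp add: inverse_eq_divide)
  have [measurable]: "\<phi> \<in> borel_measurable borel" "ft \<phi> \<in> borel_measurable borel"
    using cont decaying_measurable[OF ft] by (auto intro: borel_measurable_continuous_onI)
  have \<phi>int: "integrable lborel \<phi>"
    using compact_support_integrable[OF cont K supp, of 0] by simp
  have gauss_lim: "(\<lambda>n. complex_of_real (gauss (e n *\<^sub>R \<xi>))) \<longlonglongrightarrow> 1" for \<xi> :: "real ^ 'n"
  proof -
    have "(\<lambda>n. complex_of_real (exp (- (norm (e n *\<^sub>R \<xi>))\<^sup>2 / 2))) \<longlonglongrightarrow> complex_of_real (exp (- (norm ((0::real) *\<^sub>R \<xi>))\<^sup>2 / 2))"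
      by (intro tendsto_intros e0) auto
    then show ?thesis by (simp add: gauss_def)
  qed
  define J where "J n = (\<integral>\<xi>. cis (x \<bullet> \<xi>) * ft \<phi> \<xi> * complex_of_real (gauss (e n *\<^sub>R \<xi>)) \<partial>lborel)" for n
  have lim1: "J \<longlonglongrightarrow> osc (ft \<phi>) x"
    unfolding J_def osc_def
  proof (rule integral_dominated_convergence[where w="\<lambda>\<xi>. norm (cis (x \<bullet> \<xi>) * ft \<phi> \<xi>)"])
    show "integrable lborel (\<lambda>\<xi>. norm (cis (x \<bullet> \<xi>) * ft \<phi> \<xi>))"
      by (intro integrable_norm decaying_integrable[OF s ft])
    show "AE \<xi> in lborel. (\<lambda>n. cis (x \<bullet> \<xi>) * ft \<phi> \<xi> * complex_of_real (gauss (e n *\<^sub>R \<xi>))) \<longlonglongrightarrow> cis (x \<bullet> \<xi>) * ft \<phi> \<xi>"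
      using tendsto_mult_left[OF gauss_lim] by (intro AE_I2) (metis mult.right_neutral)
    show "AE \<xi> in lborel. norm (cis (x \<bullet> \<xi>) * ft \<phi> \<xi> * complex_of_real (gauss (e n *\<^sub>R \<xi>))) \<le> norm (cis (x \<bullet> \<xi>) * ft \<phi> \<xi>)" for n
      by (intro AE_I2) (simp add: norm_mult mult_left_le[OF gauss_le])
  qed measurable
  have J_eq: "J n = complex_of_real (sqrt (2 * pi) ^ CARD('n)) * (\<integral>u. \<phi> (x + e n *\<^sub>R u) * complex_of_real (gauss u) \<partial>lborel)" for n
  proof -
    \<comment> \<open>The transform of the dilated Gaussian; with
      \<open>y = x + e n *\<^sub>R u\<close> it is a multiple of the standard Gaussian in
      \<open>u\<close>, so that the limit can be taken under the integral.\<close>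
    define G where "G y = (\<integral>\<xi>. cis ((x - y) \<bullet> \<xi>) * complex_of_real (gauss (e n *\<^sub>R \<xi>)) \<partial>lborel)" for y
    have G_eq: "G (x + e n *\<^sub>R u) = complex_of_real (1 / e n ^ CARD('n)) * complex_of_real (sqrt (2 * pi) ^ CARD('n) * gauss u)" for u
    proof -
      have "G (x + e n *\<^sub>R u) = complex_of_real (\<bar>1 / e n\<bar> ^ DIM(real^'n)) *
        (\<integral>\<xi>. cis ((x - (x + e n *\<^sub>R u)) \<bullet> (0 + (1 / e n) *\<^sub>R \<xi>)) * complex_of_real (gauss (e n *\<^sub>R (0 + (1 / e n) *\<^sub>R \<xi>))) \<partial>lborel)"
        unfolding G_def using e[of n] by (intro lborel_integral_affine) auto
      also have "(\<integral>\<xi>. cis ((x - (x + e n *\<^sub>R u)) \<bullet> (0 + (1 / e n) *\<^sub>R \<xi>)) * complex_of_real (gauss (e n *\<^sub>R (0 + (1 / e n) *\<^sub>R \<xi>))) \<partial>lborel)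
         = (\<integral>\<xi>. cis ((- u) \<bullet> \<xi>) * complex_of_real (gauss \<xi>) \<partial>lborel)"
        using e[of n] by simp
      also have "\<dots> = complex_of_real (sqrt (2 * pi) ^ DIM(real^'n) * gauss (- u))"
        by (rule gaussian_fourier(2))
      finally show ?thesis using e[of n] by (simp add: gauss_def power_divide)
    qed
    have gi: "integrable lborel (\<lambda>\<xi>::real^'n. gauss (e n *\<^sub>R \<xi>))"
    proof -
      have "integrable (density (distr lborel borel (\<lambda>x. 0 + (1 / e n) *\<^sub>R x)) (\<lambda>_. ennreal (\<bar>1 / e n\<bar> ^ DIM(real^'n)))) (\<lambda>\<xi>::real^'n. gauss (e n *\<^sub>R \<xi>))
         \<longleftrightarrow> integrable lborel (\<lambda>\<xi>::real^'n. (\<bar>1 / e n\<bar> ^ DIM(real^'n)) *\<^sub>R gauss (e n *\<^sub>R ((1 / e n) *\<^sub>R \<xi>)))"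
        by (subst integrable_density) (auto simp: integrable_distr_eq)
      then show ?thesis
        using lborel_affine[of "1 / e n" "0 :: real^'n"] e[of n] integrable_gauss[where 'a="real^'n"] by simp
    qed
    have pi: "integrable (lborel \<Otimes>\<^sub>M lborel) (\<lambda>(\<xi>, y). cis ((x - y) \<bullet> \<xi>) * \<phi> y * complex_of_real (gauss (e n *\<^sub>R \<xi>)))"
    proof (rule lborel_pair.Fubini_integrable)
      show "integrable lborel (\<lambda>\<xi>. \<integral>y. norm (case (\<xi>, y) of (\<xi>, y) \<Rightarrow> cis ((x - y) \<bullet> \<xi>) * \<phi> y * complex_of_real (gauss (e n *\<^sub>R \<xi>))) \<partial>lborel)"
        using gi by (simp add: norm_mult)
      show "AE \<xi> in lborel. integrable lborel (\<lambda>y. case (\<xi>, y) of (\<xi>, y) \<Rightarrow> cis ((x - y) \<bullet> \<xi>) * \<phi> y * complex_of_real (gauss (e n *\<^sub>R \<xi>)))"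
      proof (intro AE_I2)
        fix \<xi>
        show "integrable lborel (\<lambda>y. case (\<xi>, y) of (\<xi>, y) \<Rightarrow> cis ((x - y) \<bullet> \<xi>) * \<phi> y * complex_of_real (gauss (e n *\<^sub>R \<xi>)))"
          by (rule Bochner_Integration.integrable_bound[OF \<phi>int])
             (auto simp: norm_mult mult_left_le[OF gauss_le])
      qed
    qed measurable
    have "J n = (\<integral>\<xi>. (\<integral>y. cis ((x - y) \<bullet> \<xi>) * \<phi> y * complex_of_real (gauss (e n *\<^sub>R \<xi>)) \<partial>lborel) \<partial>lborel)"
      unfolding J_def
    proof (intro Bochner_Integration.integral_cong refl)
      fix \<xi>
      have "cis (x \<bullet> \<xi>) * ft \<phi> \<xi> * complex_of_real (gauss (e n *\<^sub>R \<xi>))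
          = (cis (x \<bullet> \<xi>) * complex_of_real (gauss (e n *\<^sub>R \<xi>))) * (\<integral>y. cis (- \<xi> \<bullet> y) * \<phi> y \<partial>lborel)"
        by (simp add: ft_def osc_def)
      also have "\<dots> = (\<integral>y. (cis (x \<bullet> \<xi>) * complex_of_real (gauss (e n *\<^sub>R \<xi>))) * (cis (- \<xi> \<bullet> y) * \<phi> y) \<partial>lborel)"
        by (rule integral_mult_right_zero[symmetric])
      also have "\<dots> = (\<integral>y. cis ((x - y) \<bullet> \<xi>) * \<phi> y * complex_of_real (gauss (e n *\<^sub>R \<xi>)) \<partial>lborel)"
      proof (intro Bochner_Integration.integral_cong refl)
        fix y
        have "cis ((x - y) \<bullet> \<xi>) = cis (x \<bullet> \<xi>) * cis (- \<xi> \<bullet> y)"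
          by (simp add: cis_mult inner_diff_left inner_commute[of y \<xi>])
        then show "(cis (x \<bullet> \<xi>) * complex_of_real (gauss (e n *\<^sub>R \<xi>))) * (cis (- \<xi> \<bullet> y) * \<phi> y) = cis ((x - y) \<bullet> \<xi>) * \<phi> y * complex_of_real (gauss (e n *\<^sub>R \<xi>))"
          by (simp only: mult_ac)
      qed
      finally show "cis (x \<bullet> \<xi>) * ft \<phi> \<xi> * complex_of_real (gauss (e n *\<^sub>R \<xi>)) = (\<integral>y. cis ((x - y) \<bullet> \<xi>) * \<phi> y * complex_of_real (gauss (e n *\<^sub>R \<xi>)) \<partial>lborel)" .
    qed
    also have "\<dots> = (\<integral>y. (\<integral>\<xi>. cis ((x - y) \<bullet> \<xi>) * \<phi> y * complex_of_real (gauss (e n *\<^sub>R \<xi>)) \<partial>lborel) \<partial>lborel)"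
      using lborel_pair.Fubini_integral[OF pi] by simp
    also have "\<dots> = (\<integral>y. \<phi> y * G y \<partial>lborel)"
      unfolding G_def integral_mult_right_zero[symmetric] by (simp only: mult_ac)
    also have "\<dots> = complex_of_real (\<bar>e n\<bar> ^ DIM(real^'n)) * (\<integral>u. \<phi> (x + e n *\<^sub>R u) * G (x + e n *\<^sub>R u) \<partial>lborel)"
      using e[of n] unfolding G_def by (intro lborel_integral_affine) auto
    also have "(\<integral>u. \<phi> (x + e n *\<^sub>R u) * G (x + e n *\<^sub>R u) \<partial>lborel)
       = (\<integral>u. (complex_of_real (1 / e n ^ CARD('n)) * complex_of_real (sqrt (2 * pi) ^ CARD('n))) * (\<phi> (x + e n *\<^sub>R u) * complex_of_real (gauss u)) \<partial>lborel)"
      unfolding G_eq by (simp only: of_real_mult mult_ac)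
    also have "\<dots> = (complex_of_real (1 / e n ^ CARD('n)) * complex_of_real (sqrt (2 * pi) ^ CARD('n))) * (\<integral>u. \<phi> (x + e n *\<^sub>R u) * complex_of_real (gauss u) \<partial>lborel)"
      by (rule integral_mult_right_zero)
    finally show ?thesis
      using e[of n] by simp
  qed
  have "bounded (range \<phi>)"
  proof -
    have "range \<phi> \<subseteq> insert 0 (\<phi> ` K)" using supp by blast
    moreover have "bounded (insert 0 (\<phi> ` K))"
      using compact_imp_bounded[OF compact_continuous_image[OF continuous_on_subset[OF cont] K]] by simp
    ultimately show ?thesis by (rule bounded_subset[rotated])
  qed
  then obtain B where B: "\<And>y. norm (\<phi> y) \<le> B" by (auto simp: bounded_iff)
  have lim2: "(\<lambda>n. \<integral>u. \<phi> (x + e n *\<^sub>R u) * complex_of_real (gauss u) \<partial>lborel) \<longlonglongrightarrow> (\<integral>u. \<phi> x * complex_of_real (gauss (u :: real^'n)) \<partial>lborel)"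
  proof (rule integral_dominated_convergence[where w="\<lambda>u. B * gauss u"])
    show "integrable lborel (\<lambda>u::real^'n. B * gauss u)" by (intro integrable_mult_right integrable_gauss)
    show "AE u in lborel. norm (\<phi> (x + e n *\<^sub>R u) * complex_of_real (gauss u)) \<le> B * gauss u" for n
      using B by (intro AE_I2) (auto simp: norm_mult less_imp_le[OF gauss_pos] intro!: mult_right_mono)
    show "AE u in lborel. (\<lambda>n. \<phi> (x + e n *\<^sub>R u) * complex_of_real (gauss u)) \<longlonglongrightarrow> \<phi> x * complex_of_real (gauss u)"
    proof (intro AE_I2 tendsto_mult tendsto_const)
      fix u
      have "(\<lambda>n. x + e n *\<^sub>R u) \<longlonglongrightarrow> x + 0 *\<^sub>R u" by (intro tendsto_intros e0)
      then show "(\<lambda>n. \<phi> (x + e n *\<^sub>R u)) \<longlonglongrightarrow> \<phi> x"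
        using continuous_on_tendsto_compose[OF cont, of "\<lambda>n. x + e n *\<^sub>R u" x] by simp
    qed
  qed measurable
  have "(\<integral>u. \<phi> x * complex_of_real (gauss (u :: real^'n)) \<partial>lborel) = \<phi> x * complex_of_real (sqrt (2 * pi) ^ CARD('n))"
    using gaussian_fourier(2)[of "0 :: real^'n"] by simp
  note lim3 = lim2[unfolded this]
  have "J \<longlonglongrightarrow> complex_of_real (sqrt (2 * pi) ^ CARD('n)) * (\<phi> x * complex_of_real (sqrt (2 * pi) ^ CARD('n)))"
    unfolding J_eq by (intro tendsto_mult tendsto_const lim3)
  with lim1 have "osc (ft \<phi>) x = complex_of_real (sqrt (2 * pi) ^ CARD('n)) * (\<phi> x * complex_of_real (sqrt (2 * pi) ^ CARD('n)))"
    by (rule LIMSEQ_unique)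
  also have "\<dots> = complex_of_real ((sqrt (2 * pi) * sqrt (2 * pi)) ^ CARD('n)) * \<phi> x"
    by (simp only: power_mult_distrib of_real_mult mult_ac)
  also have "sqrt (2 * pi) * sqrt (2 * pi) = 2 * pi" by simp
  finally show ?thesis .
qed

text \<open>A form of Fubini that keeps \<open>real ^ 'n\<close> unsplit. The factor
  \<open>\<kappa> (\<xi> $ k - \<tau>)\<close>, of integral 1 in \<tau>, is inserted; after an
  exchange of the integrals and a translation by \<tau> along the axis, it no longer contains
  \<tau>, and a second exchange brings the line integrals inside.\<close>

lemma integral_eq_0_if_line_integrals_eq_0:
  fixes F :: "real ^ 'n::finite \<Rightarrow> complex"
  assumes F: "integrable lborel F" and zero: "\<And>\<xi>. (\<integral>\<tau>. F (\<xi> + \<tau> *\<^sub>R axis k 1) \<partial>lborel) = 0"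
  shows "(\<integral>\<xi>. F \<xi> \<partial>lborel) = 0"
proof -
  let ?e = "axis k 1 :: real ^ 'n"
  define \<kappa> :: "real \<Rightarrow> real" where "\<kappa> = indicator {0..1}"
  have [measurable]: "F \<in> borel_measurable borel" "\<kappa> \<in> borel_measurable borel"
    using F by (auto simp: \<kappa>_def)
  have [measurable]: "(\<lambda>\<xi>::real^'n. \<xi> $ k) \<in> borel_measurable borel"
    by (intro borel_measurable_continuous_onI continuous_intros)
  have \<kappa>: "integrable lborel (\<lambda>\<tau>. \<kappa> (a - \<tau>))" "(\<integral>\<tau>. \<kappa> (a - \<tau>) \<partial>lborel) = 1" for a
  proof -
    have eq: "\<kappa> (a - \<tau>) = indicator {a - 1..a} \<tau>" for \<tau> by (auto simp: \<kappa>_def indicator_def)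
    show "integrable lborel (\<lambda>\<tau>. \<kappa> (a - \<tau>))" "(\<integral>\<tau>. \<kappa> (a - \<tau>) \<partial>lborel) = 1"
      unfolding eq by auto
  qed
  have \<kappa>0: "0 \<le> \<kappa> t" "\<kappa> t \<le> 1" for t by (auto simp: \<kappa>_def indicator_def)
  have P: "integrable (lborel \<Otimes>\<^sub>M lborel) (\<lambda>(\<xi>, \<tau>). \<kappa> (\<xi> $ k - \<tau>) *\<^sub>R F \<xi>)"
  proof (rule lborel_pair.Fubini_integrable)
    show "integrable lborel (\<lambda>\<xi>. \<integral>\<tau>. norm (case (\<xi>, \<tau>) of (\<xi>, \<tau>) \<Rightarrow> \<kappa> (\<xi> $ k - \<tau>) *\<^sub>R F \<xi>) \<partial>lborel)"
      using integrable_norm[OF F] by (simp add: \<kappa>0 \<kappa>(2))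
    show "AE \<xi> in lborel. integrable lborel (\<lambda>\<tau>. case (\<xi>, \<tau>) of (\<xi>, \<tau>) \<Rightarrow> \<kappa> (\<xi> $ k - \<tau>) *\<^sub>R F \<xi>)"
      using \<kappa>(1) by (intro AE_I2) (simp add: integrable_scaleR_left)
  qed measurable
  have shift: "(\<integral>\<xi>. \<kappa> (\<xi> $ k - \<tau>) *\<^sub>R F \<xi> \<partial>lborel) = (\<integral>\<xi>. \<kappa> (\<xi> $ k) *\<^sub>R F (\<xi> + \<tau> *\<^sub>R ?e) \<partial>lborel)" for \<tau>
    using lborel_integral_translation[of "\<lambda>\<xi>. \<kappa> (\<xi> $ k - \<tau>) *\<^sub>R F \<xi>" "\<tau> *\<^sub>R ?e"]
    by (simp add: add.commute)
  have Q: "integrable (lborel \<Otimes>\<^sub>M lborel) (\<lambda>(\<tau>, \<xi>). \<kappa> (\<xi> $ k) *\<^sub>R F (\<xi> + \<tau> *\<^sub>R ?e))"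
  proof (rule lborel_pair.Fubini_integrable)
    have nshift: "(\<integral>\<xi>. \<kappa> (\<xi> $ k - \<tau>) * norm (F \<xi>) \<partial>lborel) = (\<integral>\<xi>. \<kappa> (\<xi> $ k) * norm (F (\<xi> + \<tau> *\<^sub>R ?e)) \<partial>lborel)" for \<tau>
    proof -
      have "(\<integral>x. \<kappa> (x $ k - \<tau>) * norm (F x) \<partial>distr lborel borel ((+) (\<tau> *\<^sub>R ?e))) = (\<integral>\<xi>. \<kappa> ((\<tau> *\<^sub>R ?e + \<xi>) $ k - \<tau>) * norm (F (\<tau> *\<^sub>R ?e + \<xi>)) \<partial>lborel)"
        by (rule integral_distr) measurable
      then show ?thesis by (simp add: lborel_distr_plus add.commute)
    qed
    have "integrable (lborel \<Otimes>\<^sub>M lborel) (\<lambda>(\<tau>, \<xi>). \<kappa> (\<xi> $ k - \<tau>) * norm (F \<xi>))"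
      using lborel_pair.integrable_product_swap[OF integrable_norm[OF P]]
      by (simp add: case_prod_unfold \<kappa>0)
    from lborel_pair.integrable_fst'[OF this]
    show "integrable lborel (\<lambda>\<tau>. \<integral>\<xi>. norm (case (\<tau>, \<xi>) of (\<tau>, \<xi>) \<Rightarrow> \<kappa> (\<xi> $ k) *\<^sub>R F (\<xi> + \<tau> *\<^sub>R ?e)) \<partial>lborel)"
      by (simp add: \<kappa>0 nshift)
    show "AE \<tau> in lborel. integrable lborel (\<lambda>\<xi>. case (\<tau>, \<xi>) of (\<tau>, \<xi>) \<Rightarrow> \<kappa> (\<xi> $ k) *\<^sub>R F (\<xi> + \<tau> *\<^sub>R ?e))"
    proof (intro AE_I2)
      fix \<tau>
      have "integrable (distr lborel borel ((+) (\<tau> *\<^sub>R ?e))) F" using F by (simp add: lborel_distr_plus)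
      then have "integrable lborel (\<lambda>\<xi>. F (\<tau> *\<^sub>R ?e + \<xi>))" by (subst (asm) integrable_distr_eq) auto
      then have Fs: "integrable lborel (\<lambda>\<xi>. F (\<xi> + \<tau> *\<^sub>R ?e))" by (simp add: add.commute)
      show "integrable lborel (\<lambda>\<xi>. case (\<tau>, \<xi>) of (\<tau>, \<xi>) \<Rightarrow> \<kappa> (\<xi> $ k) *\<^sub>R F (\<xi> + \<tau> *\<^sub>R ?e))"
        by (rule Bochner_Integration.integrable_bound[OF Fs]) (auto simp: \<kappa>0 mult_left_le_one_le)
    qed
  qed measurable
  have "(\<integral>\<xi>. F \<xi> \<partial>lborel) = (\<integral>\<xi>. (\<integral>\<tau>. \<kappa> (\<xi> $ k - \<tau>) *\<^sub>R F \<xi> \<partial>lborel) \<partial>lborel)"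
    by (simp add: \<kappa> integral_scaleR_left)
  also have "\<dots> = (\<integral>\<tau>. (\<integral>\<xi>. \<kappa> (\<xi> $ k - \<tau>) *\<^sub>R F \<xi> \<partial>lborel) \<partial>lborel)"
    using lborel_pair.Fubini_integral[OF P] by simp
  also have "\<dots> = (\<integral>\<tau>. (\<integral>\<xi>. \<kappa> (\<xi> $ k) *\<^sub>R F (\<xi> + \<tau> *\<^sub>R ?e) \<partial>lborel) \<partial>lborel)"
    by (simp only: shift)
  also have "\<dots> = (\<integral>\<xi>. (\<integral>\<tau>. \<kappa> (\<xi> $ k) *\<^sub>R F (\<xi> + \<tau> *\<^sub>R ?e) \<partial>lborel) \<partial>lborel)"
    using lborel_pair.Fubini_integral[OF Q] by simp
  also have "\<dots> = 0" by (simp only: integral_scaleR_right zero) simp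
  finally show ?thesis .
qed

text \<open>Paley-Wiener for one coordinate at a time: the one-dimensional result makes the integral
  vanish along every line in direction \<open>k\<close>. The type \<open>a\<close> has to be the
  same on all lines, whereas \<open>C\<close> may vary with the line.\<close>

theorem osc_eq_0_outside:
  fixes h :: "real ^ 'n::finite \<Rightarrow> complex" and x :: "real ^ 'n"
  assumes s: "0 < s" and h: "decaying s h" and a: "0 < a"
    and entire: "\<And>\<xi>. \<exists>f C. f holomorphic_on UNIV \<and> (\<forall>z. norm (f z) \<le> C * exp (a * norm z)) \<and>
      (\<forall>\<tau>. f (complex_of_real \<tau>) = h (\<xi> + \<tau> *\<^sub>R axis k 1))"
    and x: "4 * a \<le> \<bar>x $ k\<bar>"
  shows "osc h x = 0"
  unfolding osc_def
proof (rule integral_eq_0_if_line_integrals_eq_0[where k=k])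
  show "integrable lborel (\<lambda>\<xi>. cis (x \<bullet> \<xi>) * h \<xi>)" by (rule decaying_integrable(3)[OF s h])
  fix \<xi> :: "real ^ 'n"
  obtain f C where f: "f holomorphic_on UNIV" "\<And>z. norm (f z) \<le> C * exp (a * norm z)"
    "\<And>\<tau>. f (complex_of_real \<tau>) = h (\<xi> + \<tau> *\<^sub>R axis k 1)" using entire by blast
  obtain D where D: "\<And>\<xi>. norm (h \<xi>) \<le> D * exp (- 1 * weight s \<xi>)" using decaying_bound[OF h] by blast
  have D0: "0 \<le> D" using order_trans[OF norm_ge_zero D[of 0]] by (simp add: weight_def zero_le_mult_iff)
  have [measurable]: "h \<in> borel_measurable borel" using h by (rule decaying_measurable)
  have "integrable lborel (\<lambda>\<tau>. D * exp (- 1 * weight s (\<xi> $ k + 1 * \<tau>)))"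
    using s by (intro integrable_mult_right lborel_integrable_real_affine[OF integrable_exp_weight]) auto
  then have int: "integrable lborel (\<lambda>\<tau>. h (\<xi> + \<tau> *\<^sub>R axis k 1))"
  proof (rule Bochner_Integration.integrable_bound)
    have "norm (h (\<xi> + \<tau> *\<^sub>R axis k 1)) \<le> D * exp (- 1 * weight s (\<xi> $ k + 1 * \<tau>))" for \<tau>
    proof -
      have "\<bar>\<xi> $ k + \<tau>\<bar> \<le> norm (\<xi> + \<tau> *\<^sub>R axis k 1)"
        using component_le_norm_cart[of "\<xi> + \<tau> *\<^sub>R axis k 1" k] by simp
      then have "weight s (\<xi> $ k + 1 * \<tau>) \<le> weight s (\<xi> + \<tau> *\<^sub>R axis k 1)"
        unfolding weight_def using s by (intro powr_mono2) auto
      then have "D * exp (- 1 * weight s (\<xi> + \<tau> *\<^sub>R axis k 1)) \<le> D * exp (- 1 * weight s (\<xi> $ k + 1 * \<tau>))"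
        using D0 by (intro mult_left_mono) auto
      with D[of "\<xi> + \<tau> *\<^sub>R axis k 1"] show ?thesis by linarith
    qed
    then show "AE \<tau> in lborel. norm (h (\<xi> + \<tau> *\<^sub>R axis k 1)) \<le> norm (D * exp (- 1 * weight s (\<xi> $ k + 1 * \<tau>)))"
      using D0 by (intro AE_I2) (simp add: abs_mult)
  qed measurable
  have "(\<integral>\<tau>. cis (x \<bullet> (\<xi> + \<tau> *\<^sub>R axis k 1)) * h (\<xi> + \<tau> *\<^sub>R axis k 1) \<partial>lborel)
      = (\<integral>\<tau>. cis (x \<bullet> \<xi>) * (cis (x $ k * \<tau>) * f (complex_of_real \<tau>)) \<partial>lborel)"
    by (simp add: f(3) inner_add_right inner_axis mult.assoc[symmetric] cis_mult mult.commute[of "_ $ k"])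
  also have "\<dots> = cis (x \<bullet> \<xi>) * (\<integral>\<tau>. cis (x $ k * \<tau>) * f (complex_of_real \<tau>) \<partial>lborel)"
    by (rule integral_mult_right_zero)
  also have "\<dots> = 0"
    using exponential_type_fourier_zero[OF f(1,2) a x] int by (simp add: f(3))
  finally show "(\<integral>\<tau>. cis (x \<bullet> (\<xi> + \<tau> *\<^sub>R axis k 1)) * h (\<xi> + \<tau> *\<^sub>R axis k 1) \<partial>lborel) = 0" .
qed

section \<open>Linear ordinary differential equations with a complex parameter\<close>

text \<open>
  The Picard iterates differ by terms that are geometrically small in the norm with
  weight \<open>exp (- 2 * \<Lambda> * t)\<close>, so no restriction on the length of the interval is needed.
\<close>

proposition linear_ode_exists:
  fixes L :: "real \<Rightarrow> 'a::euclidean_space \<Rightarrow> 'a"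
  assumes T: "0 \<le> T" and \<Lambda>: "0 < \<Lambda>"
    and cont: "\<And>x. continuous_on {0..T} x \<Longrightarrow> continuous_on {0..T} (\<lambda>t. L t (x t))"
    and lin: "\<And>t. linear (L t)" and le: "\<And>t x. t \<in> {0..T} \<Longrightarrow> norm (L t x) \<le> \<Lambda> * norm x"
  shows "\<exists>x. x 0 = x0 \<and> (\<forall>t\<in>{0..T}. (x has_vector_derivative L t (x t)) (at t within {0..T}))"
proof -
  \<comment> \<open>These are the increments of the Picard iteration. By linearity they satisfy the
    recursion without the initial value.\<close>
  define \<Delta> where "\<Delta> = rec_nat (\<lambda>_. x0) (\<lambda>k x t. integral {0..t} (\<lambda>\<sigma>. L \<sigma> (x \<sigma>)))"
  have \<Delta>_0: "\<Delta> 0 = (\<lambda>_. x0)" and \<Delta>_Suc: "\<Delta> (Suc k) = (\<lambda>t. integral {0..t} (\<lambda>\<sigma>. L \<sigma> (\<Delta> k \<sigma>)))" for k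
    by (simp_all add: \<Delta>_def)
  have \<Delta>_cont: "continuous_on {0..T} (\<Delta> k)" for k
  proof (induction k)
    case (Suc k)
    show ?case unfolding \<Delta>_Suc
      by (intro indefinite_integral_continuous_1 integrable_continuous_real cont Suc)
  qed (simp add: \<Delta>_0)
  have int: "(\<lambda>\<sigma>. L \<sigma> (x \<sigma>)) integrable_on {0..t}" if "continuous_on {0..T} x" "t \<in> {0..T}" for x t
    using that by (intro integrable_continuous_real continuous_on_subset[OF cont]) auto
  have \<Delta>_le: "norm (\<Delta> k t) \<le> norm x0 * (1 / 2) ^ k * exp (2 * \<Lambda> * t)" if "t \<in> {0..T}" for k t
    using that
  proof (induction k arbitrary: t)
    case 0
    then show ?case using \<Lambda> mult_left_mono[of 1 "exp (2 * \<Lambda> * t)" "norm x0"] by (simp add: \<Delta>_0)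
  next
    case (Suc k)
    let ?c = "norm x0 * (1 / 2) ^ Suc k"
    have deriv: "((\<lambda>\<sigma>. ?c * exp (2 * \<Lambda> * \<sigma>)) has_vector_derivative \<Lambda> * (norm x0 * (1 / 2) ^ k * exp (2 * \<Lambda> * \<sigma>))) (at \<sigma> within {0..t})" for \<sigma>
      unfolding has_real_derivative_iff_has_vector_derivative[symmetric]
      by (auto intro!: derivative_eq_intros)
    have hi: "((\<lambda>\<sigma>. \<Lambda> * (norm x0 * (1 / 2) ^ k * exp (2 * \<Lambda> * \<sigma>))) has_integral (?c * exp (2 * \<Lambda> * t) - ?c * exp (2 * \<Lambda> * 0))) {0..t}"
      using Suc.prems by (intro fundamental_theorem_of_calculus deriv) auto
    have "norm (\<Delta> (Suc k) t) \<le> integral {0..t} (\<lambda>\<sigma>. \<Lambda> * (norm x0 * (1 / 2) ^ k * exp (2 * \<Lambda> * \<sigma>)))"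
      unfolding \<Delta>_Suc
    proof (rule integral_norm_bound_integral[OF int[OF \<Delta>_cont Suc.prems] has_integral_integrable[OF hi]])
      fix \<sigma> assume "\<sigma> \<in> {0..t}"
      then have \<sigma>: "\<sigma> \<in> {0..T}" using Suc.prems by auto
      show "norm (L \<sigma> (\<Delta> k \<sigma>)) \<le> \<Lambda> * (norm x0 * (1 / 2) ^ k * exp (2 * \<Lambda> * \<sigma>))"
        using le[OF \<sigma>, of "\<Delta> k \<sigma>"] mult_left_mono[OF Suc.IH[OF \<sigma>], of \<Lambda>] \<Lambda> by linarith
    qed
    also have "\<dots> = ?c * exp (2 * \<Lambda> * t) - ?c * exp (2 * \<Lambda> * 0)" using hi by (rule integral_unique)
    also have "\<dots> \<le> ?c * exp (2 * \<Lambda> * t)" by simp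
    finally show ?case .
  qed
  define S where "S n t = (\<Sum>k<n. \<Delta> k t)" for n t
  define x where "x t = (\<Sum>k. \<Delta> k t)" for t
  have unif: "uniform_limit {0..T} S x sequentially"
    unfolding S_def x_def
  proof (rule Weierstrass_m_test[where M="\<lambda>k. norm x0 * exp (2 * \<Lambda> * T) * (1 / 2) ^ k"])
    show "norm (\<Delta> k t) \<le> norm x0 * exp (2 * \<Lambda> * T) * (1 / 2) ^ k" if "t \<in> {0..T}" for k t
    proof -
      have "norm x0 * (1 / 2) ^ k * exp (2 * \<Lambda> * t) \<le> norm x0 * (1 / 2) ^ k * exp (2 * \<Lambda> * T)"
        using that \<Lambda> by (intro mult_left_mono) auto
      with \<Delta>_le[OF that, of k] show ?thesis by (simp add: mult_ac)
    qed
    show "summable (\<lambda>k. norm x0 * exp (2 * \<Lambda> * T) * (1 / 2) ^ k)"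
      by (intro summable_mult summable_geometric) auto
  qed
  have S_cont: "continuous_on {0..T} (S n)" for n
    unfolding S_def by (intro continuous_on_sum \<Delta>_cont)
  have x_cont: "continuous_on {0..T} x"
    by (rule uniform_limit_theorem[OF _ unif]) (auto simp: S_cont)
  have S_Suc: "S (Suc n) t = x0 + integral {0..t} (\<lambda>\<sigma>. L \<sigma> (S n \<sigma>))" if t: "t \<in> {0..T}" for n t
  proof -
    have "S (Suc n) t = x0 + (\<Sum>k<n. \<Delta> (Suc k) t)"
      unfolding S_def by (subst sum.lessThan_Suc_shift) (simp add: \<Delta>_0)
    also have "(\<Sum>k<n. \<Delta> (Suc k) t) = integral {0..t} (\<lambda>\<sigma>. \<Sum>k<n. L \<sigma> (\<Delta> k \<sigma>))"
      unfolding \<Delta>_Suc by (rule integral_sum[symmetric]) (auto intro: int \<Delta>_cont t)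
    also have "(\<lambda>\<sigma>. \<Sum>k<n. L \<sigma> (\<Delta> k \<sigma>)) = (\<lambda>\<sigma>. L \<sigma> (S n \<sigma>))"
      by (simp add: S_def linear_sum[OF lin])
    finally show ?thesis .
  qed
  have eq: "x t = x0 + integral {0..t} (\<lambda>\<sigma>. L \<sigma> (x \<sigma>))" if t: "t \<in> {0..T}" for t
  proof -
    have "uniform_limit {0..t} (\<lambda>n \<sigma>. L \<sigma> (S n \<sigma>)) (\<lambda>\<sigma>. L \<sigma> (x \<sigma>)) sequentially"
    proof (rule uniform_limitI)
      fix e :: real assume "0 < e"
      then have "0 < e / \<Lambda>" using \<Lambda> by simp
      from uniform_limitD[OF unif this]
      show "\<forall>\<^sub>F n in sequentially. \<forall>\<sigma>\<in>{0..t}. dist (L \<sigma> (S n \<sigma>)) (L \<sigma> (x \<sigma>)) < e"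
      proof eventually_elim
        case (elim n)
        show ?case
        proof
          fix \<sigma> assume "\<sigma> \<in> {0..t}"
          then have \<sigma>: "\<sigma> \<in> {0..T}" using t by auto
          have "dist (L \<sigma> (S n \<sigma>)) (L \<sigma> (x \<sigma>)) \<le> \<Lambda> * dist (S n \<sigma>) (x \<sigma>)"
            using le[OF \<sigma>, of "S n \<sigma> - x \<sigma>"] by (simp add: dist_norm linear_diff[OF lin])
          also have "\<dots> < e" using elim \<sigma> \<Lambda> by (auto simp: field_simps)
          finally show "dist (L \<sigma> (S n \<sigma>)) (L \<sigma> (x \<sigma>)) < e" .
        qed
      qed
    qed
    moreover have "continuous_on {0..t} (\<lambda>\<sigma>. L \<sigma> (S n \<sigma>))" for n
      using t by (intro continuous_on_subset[OF cont[OF S_cont]]) auto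
    ultimately obtain I J where IJ: "\<And>n. ((\<lambda>\<sigma>. L \<sigma> (S n \<sigma>)) has_integral I n) {0..t}"
      "((\<lambda>\<sigma>. L \<sigma> (x \<sigma>)) has_integral J) {0..t}" "I \<longlonglongrightarrow> J"
      by (rule uniform_limit_integral) auto
    have "(\<lambda>n. integral {0..t} (\<lambda>\<sigma>. L \<sigma> (S n \<sigma>))) \<longlonglongrightarrow> integral {0..t} (\<lambda>\<sigma>. L \<sigma> (x \<sigma>))"
      unfolding integral_unique[OF IJ(1)] integral_unique[OF IJ(2)] by (rule IJ(3))
    then have "(\<lambda>n. S (Suc n) t) \<longlonglongrightarrow> x0 + integral {0..t} (\<lambda>\<sigma>. L \<sigma> (x \<sigma>))"
      unfolding S_Suc[OF t] by (intro tendsto_intros)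
    moreover have "(\<lambda>n. S (Suc n) t) \<longlonglongrightarrow> x t"
      by (rule LIMSEQ_Suc[OF tendsto_uniform_limitI[OF unif t]])
    ultimately show ?thesis using LIMSEQ_unique by blast
  qed
  have "(x has_vector_derivative L t (x t)) (at t within {0..T})" if t: "t \<in> {0..T}" for t
  proof -
    have "((\<lambda>t. x0 + integral {0..t} (\<lambda>\<sigma>. L \<sigma> (x \<sigma>))) has_vector_derivative 0 + L t (x t)) (at t within {0..T})"
      by (intro has_vector_derivative_add has_vector_derivative_const integral_has_vector_derivative cont x_cont t)
    then have "((\<lambda>t. x0 + integral {0..t} (\<lambda>\<sigma>. L \<sigma> (x \<sigma>))) has_vector_derivative L t (x t)) (at t within {0..T})"
      by simp
    with t eq show ?thesis by (rule has_vector_derivative_transform)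
  qed
  moreover have "x 0 = x0" using eq[of 0] T by simp
  ultimately show ?thesis by blast
qed

text \<open>\<open>\<Psi>\<close> is the inverse of \<open>\<Phi>\<close>. It is introduced by its
  own differential equation, so that existence, growth and continuity are obtained for both in the
  same way.\<close>

definition fundamental ::
  "real \<Rightarrow> (real \<Rightarrow> complex ^ 'm ^ 'm) \<Rightarrow> (real \<Rightarrow> complex ^ 'm ^ 'm) \<Rightarrow> (real \<Rightarrow> complex ^ 'm::finite ^ 'm) \<Rightarrow> bool"
  where
  "fundamental T L \<Phi> \<Psi> \<longleftrightarrow> \<Phi> 0 = mat 1 \<and> \<Psi> 0 = mat 1 \<and>
     (\<forall>t\<in>{0..T}. (\<Phi> has_vector_derivative L t ** \<Phi> t) (at t within {0..T})) \<and>
     (\<forall>t\<in>{0..T}. (\<Psi> has_vector_derivative - (\<Psi> t ** L t)) (at t within {0..T}))"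

lemma fundamental_exists:
  fixes L :: "real \<Rightarrow> complex ^ 'm::finite ^ 'm"
  assumes T: "0 \<le> T" and L: "continuous_on {0..T} L"
  shows "\<exists>\<Phi> \<Psi>. fundamental T L \<Phi> \<Psi>"
proof -
  obtain D where D: "0 \<le> D" "\<And>t. t \<in> {0..T} \<Longrightarrow> norm (L t) \<le> D"
    using continuous_on_Icc_bounded[OF L] by blast
  have mono: "D * norm X \<le> (D + 1) * norm X" for X :: "complex ^ 'm ^ 'm"
    by (simp add: mult_right_mono)
  have "\<exists>\<Phi>. \<Phi> 0 = mat 1 \<and> (\<forall>t\<in>{0..T}. (\<Phi> has_vector_derivative L t ** \<Phi> t) (at t within {0..T}))"
  proof (rule linear_ode_exists[OF T, of "D + 1"])
    show "continuous_on {0..T} (\<lambda>t. L t ** x t)" if "continuous_on {0..T} x" for x :: "real \<Rightarrow> complex ^ 'm ^ 'm"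
      by (rule bounded_bilinear.continuous_on[OF bounded_bilinear_matrix_mult L that])
    show "linear ((**) (L t) :: complex ^ 'm ^ 'm \<Rightarrow> _)" for t
      by (rule bounded_linear.linear[OF bounded_bilinear.bounded_linear_right[OF bounded_bilinear_matrix_mult]])
    show "norm (L t ** X) \<le> (D + 1) * norm X" if "t \<in> {0..T}" for t and X :: "complex ^ 'm ^ 'm"
      using matrix_matrix_mult_norm_le[of "L t" X] mult_right_mono[OF D(2)[OF that], of "norm X"] mono[of X] by simp
  qed (use D in auto)
  moreover have "\<exists>\<Psi>. \<Psi> 0 = mat 1 \<and> (\<forall>t\<in>{0..T}. (\<Psi> has_vector_derivative - (\<Psi> t ** L t)) (at t within {0..T}))"
  proof (rule linear_ode_exists[OF T, of "D + 1"])
    show "continuous_on {0..T} (\<lambda>t. - (x t ** L t))" if "continuous_on {0..T} x" for x :: "real \<Rightarrow> complex ^ 'm ^ 'm"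
      by (intro continuous_on_minus bounded_bilinear.continuous_on[OF bounded_bilinear_matrix_mult that L])
    show "linear (\<lambda>X :: complex ^ 'm ^ 'm. - (X ** L t))" for t
      by (intro linear_compose_neg bounded_linear.linear[OF bounded_bilinear.bounded_linear_left[OF bounded_bilinear_matrix_mult]])
    show "norm (- (X ** L t)) \<le> (D + 1) * norm X" if "t \<in> {0..T}" for t and X :: "complex ^ 'm ^ 'm"
      using matrix_matrix_mult_norm_le[of X "L t"] mult_left_mono[OF D(2)[OF that], of "norm X"] mono[of X]
      by (simp add: mult.commute)
  qed (use D in auto)
  ultimately show ?thesis unfolding fundamental_def by blast
qed

lemma fundamental_continuous:
  assumes "fundamental T L \<Phi> \<Psi>"
  shows "continuous_on {0..T} \<Phi>" "continuous_on {0..T} \<Psi>"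
  using assms by (auto simp: fundamental_def continuous_on_eq_continuous_within intro: has_vector_derivative_continuous)

text \<open>The derivative of \<open>\<Psi> t ** \<Phi> t\<close> vanishes, and a left inverse of a
  square matrix is a right inverse.\<close>

lemma fundamental_inverse:
  assumes f: "fundamental T L \<Phi> \<Psi>" and t: "t \<in> {0..T}"
  shows "\<Psi> t ** \<Phi> t = mat 1" "\<Phi> t ** \<Psi> t = mat 1"
proof -
  have "((\<lambda>t. \<Psi> t ** \<Phi> t) has_vector_derivative 0) (at t within {0..T})" if "t \<in> {0..T}" for t
  proof -
    have "((\<lambda>t. \<Psi> t ** \<Phi> t) has_vector_derivative (\<Psi> t ** (L t ** \<Phi> t) + (- (\<Psi> t ** L t)) ** \<Phi> t)) (at t within {0..T})"
      using f that by (intro bounded_bilinear.has_vector_derivative[OF bounded_bilinear_matrix_mult]) (auto simp: fundamental_def)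
    then show ?thesis
      by (simp add: bounded_bilinear.minus_left[OF bounded_bilinear_matrix_mult] matrix_mul_assoc)
  qed
  then obtain c where c: "\<And>t. t \<in> {0..T} \<Longrightarrow> \<Psi> t ** \<Phi> t = c"
    using has_vector_derivative_zero_constant[of "{0..T}" "\<lambda>t. \<Psi> t ** \<Phi> t"] by auto
  have "\<Psi> 0 ** \<Phi> 0 = mat 1" using f by (simp add: fundamental_def)
  then show 1: "\<Psi> t ** \<Phi> t = mat 1" using c[of 0] c[OF t] t by auto
  then show "\<Phi> t ** \<Psi> t = mat 1" by (simp add: matrix_left_right_inverse)
qed

lemma fundamental_growth:
  fixes \<Phi> :: "real \<Rightarrow> complex ^ 'm::finite ^ 'm"
  assumes f: "fundamental T L \<Phi> \<Psi>" and L: "\<And>t. t \<in> {0..T} \<Longrightarrow> norm (L t) \<le> \<Lambda>" and \<Lambda>: "0 \<le> \<Lambda>" and t: "t \<in> {0..T}"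
  shows "norm (\<Phi> t) \<le> exp (\<Lambda> * T) * norm (mat 1 :: complex ^ 'm ^ 'm)"
    "norm (\<Psi> t) \<le> exp (\<Lambda> * T) * norm (mat 1 :: complex ^ 'm ^ 'm)"
proof -
  have e: "exp (\<Lambda> * (t - 0)) * norm (mat 1 :: complex ^ 'm ^ 'm) \<le> exp (\<Lambda> * T) * norm (mat 1 :: complex ^ 'm ^ 'm)"
    using t \<Lambda> by (intro mult_right_mono) (auto intro: mult_left_mono)
  have "norm (\<Phi> t) \<le> exp (\<Lambda> * (t - 0)) * norm (\<Phi> 0)"
  proof (rule linear_ode_growth[where T=T])
    show "norm (L t ** \<Phi> t) \<le> \<Lambda> * norm (\<Phi> t)" if "t \<in> {0..T}" for t
      by (rule order_trans[OF matrix_matrix_mult_norm_le mult_right_mono[OF L[OF that]]]) simp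
  qed (use f t in \<open>auto simp: fundamental_def\<close>)
  then show "norm (\<Phi> t) \<le> exp (\<Lambda> * T) * norm (mat 1 :: complex ^ 'm ^ 'm)"
    using e f by (simp add: fundamental_def)
  have "norm (\<Psi> t) \<le> exp (\<Lambda> * (t - 0)) * norm (\<Psi> 0)"
  proof (rule linear_ode_growth[where T=T])
    show "norm (- (\<Psi> t ** L t)) \<le> \<Lambda> * norm (\<Psi> t)" if "t \<in> {0..T}" for t
      using order_trans[OF matrix_matrix_mult_norm_le[of "\<Psi> t" "L t"] mult_left_mono[OF L[OF that], of "norm (\<Psi> t)"]]
      by (simp add: mult.commute)
  qed (use f t in \<open>auto simp: fundamental_def\<close>)
  then show "norm (\<Psi> t) \<le> exp (\<Lambda> * T) * norm (mat 1 :: complex ^ 'm ^ 'm)"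
    using e f by (simp add: fundamental_def)
qed

text \<open>In the derivative of \<open>\<Psi> \<sigma> ** \<Phi>' \<sigma>\<close> only the
  difference of the two generators survives.\<close>

lemma duhamel:
  assumes f: "fundamental T L \<Phi> \<Psi>" and f': "fundamental T L' \<Phi>' \<Psi>'" and t: "t \<in> {0..T}"
  shows "((\<lambda>\<sigma>. \<Psi> \<sigma> ** (L' \<sigma> - L \<sigma>) ** \<Phi>' \<sigma>) has_integral (\<Psi> t ** \<Phi>' t - mat 1)) {0..t}"
    "\<Phi>' t - \<Phi> t = \<Phi> t ** integral {0..t} (\<lambda>\<sigma>. \<Psi> \<sigma> ** (L' \<sigma> - L \<sigma>) ** \<Phi>' \<sigma>)"
proof -
  note bb = bounded_bilinear_matrix_mult
  have "((\<lambda>\<sigma>. \<Psi> \<sigma> ** \<Phi>' \<sigma>) has_vector_derivative (\<Psi> \<sigma> ** (L' \<sigma> - L \<sigma>) ** \<Phi>' \<sigma>)) (at \<sigma> within {0..t})"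
    if "\<sigma> \<in> {0..t}" for \<sigma>
  proof -
    have \<sigma>: "\<sigma> \<in> {0..T}" "{0..t} \<subseteq> {0..T}" using that t by auto
    have "((\<lambda>\<sigma>. \<Psi> \<sigma> ** \<Phi>' \<sigma>) has_vector_derivative (\<Psi> \<sigma> ** (L' \<sigma> ** \<Phi>' \<sigma>) + (- (\<Psi> \<sigma> ** L \<sigma>)) ** \<Phi>' \<sigma>)) (at \<sigma> within {0..T})"
      using f f' \<sigma> by (intro bounded_bilinear.has_vector_derivative[OF bb]) (auto simp: fundamental_def)
    moreover have "\<Psi> \<sigma> ** (L' \<sigma> ** \<Phi>' \<sigma>) + (- (\<Psi> \<sigma> ** L \<sigma>)) ** \<Phi>' \<sigma> = \<Psi> \<sigma> ** (L' \<sigma> - L \<sigma>) ** \<Phi>' \<sigma>"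
      by (simp add: bounded_bilinear.minus_left[OF bb] bounded_bilinear.diff_left[OF bb] bounded_bilinear.diff_right[OF bb] matrix_mul_assoc)
    ultimately show ?thesis using has_vector_derivative_within_subset[OF _ \<sigma>(2)] by metis
  qed
  then have "((\<lambda>\<sigma>. \<Psi> \<sigma> ** (L' \<sigma> - L \<sigma>) ** \<Phi>' \<sigma>) has_integral (\<Psi> t ** \<Phi>' t - \<Psi> 0 ** \<Phi>' 0)) {0..t}"
    using t by (intro fundamental_theorem_of_calculus) auto
  then show *: "((\<lambda>\<sigma>. \<Psi> \<sigma> ** (L' \<sigma> - L \<sigma>) ** \<Phi>' \<sigma>) has_integral (\<Psi> t ** \<Phi>' t - mat 1)) {0..t}"
    using f f' by (simp add: fundamental_def)
  have "\<Phi> t ** (\<Psi> t ** \<Phi>' t - mat 1) = \<Phi>' t - \<Phi> t"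
    using fundamental_inverse(2)[OF f t] by (simp add: bounded_bilinear.diff_right[OF bb] matrix_mul_assoc)
  then show "\<Phi>' t - \<Phi> t = \<Phi> t ** integral {0..t} (\<lambda>\<sigma>. \<Psi> \<sigma> ** (L' \<sigma> - L \<sigma>) ** \<Phi>' \<sigma>)"
    using integral_unique[OF *] by simp
qed

text \<open>The first bound is Duhamel's formula with three factors \<open>G\<close>. The second one
  follows from the identity
  \<open>\<Psi>' - \<Psi> = \<Psi>' ** (\<Phi> - \<Phi>') ** \<Psi>\<close>, which adds two
  more.\<close>

lemma fundamental_diff_le:
  assumes f: "fundamental T L \<Phi> \<Psi>" and f': "fundamental T L' \<Phi>' \<Psi>'" and t: "t \<in> {0..T}"
    and G: "\<And>t. t \<in> {0..T} \<Longrightarrow> norm (\<Phi> t) \<le> G" "\<And>t. t \<in> {0..T} \<Longrightarrow> norm (\<Psi> t) \<le> G" "\<And>t. t \<in> {0..T} \<Longrightarrow> norm (\<Phi>' t) \<le> G" "\<And>t. t \<in> {0..T} \<Longrightarrow> norm (\<Psi>' t) \<le> G"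
    and d: "\<And>t. t \<in> {0..T} \<Longrightarrow> norm (L' t - L t) \<le> d"
  shows "norm (\<Phi>' t - \<Phi> t) \<le> G ^ 3 * T * d" "norm (\<Psi>' t - \<Psi> t) \<le> G ^ 5 * T * d"
proof -
  note bb = bounded_bilinear_matrix_mult
  have G0: "0 \<le> G" "0 \<le> d" using order_trans[OF norm_ge_zero G(1)[OF t]] order_trans[OF norm_ge_zero d[OF t]] by auto
  have "norm (\<Psi> t ** \<Phi>' t - mat 1) \<le> (G * d * G) * measure lborel {0..t}"
  proof (rule has_integral_bound_real[where S="{}", OF _ _ duhamel(1)[OF f f' t]])
    show "0 \<le> G * d * G" using G0 by simp
    show "norm (\<Psi> \<sigma> ** (L' \<sigma> - L \<sigma>) ** \<Phi>' \<sigma>) \<le> G * d * G" if "\<sigma> \<in> {0..t} - {}" for \<sigma>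
    proof -
      have \<sigma>: "\<sigma> \<in> {0..T}" using that t by auto
      have "norm (\<Psi> \<sigma> ** (L' \<sigma> - L \<sigma>) ** \<Phi>' \<sigma>) \<le> norm (\<Psi> \<sigma>) * norm (L' \<sigma> - L \<sigma>) * norm (\<Phi>' \<sigma>)"
        by (intro order_trans[OF matrix_matrix_mult_norm_le] mult_right_mono matrix_matrix_mult_norm_le) auto
      also have "\<dots> \<le> G * d * G" using G[OF \<sigma>] d[OF \<sigma>] G0 by (intro mult_mono) auto
      finally show ?thesis .
    qed
  qed simp
  also have "\<dots> \<le> (G * d * G) * T" using t G0 by (intro mult_left_mono) auto
  finally have 1: "norm (\<Psi> t ** \<Phi>' t - mat 1) \<le> (G * d * G) * T" .
  have "\<Phi> t ** (\<Psi> t ** \<Phi>' t - mat 1) = \<Phi>' t - \<Phi> t"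
    using fundamental_inverse(2)[OF f t] by (simp add: bounded_bilinear.diff_right[OF bb] matrix_mul_assoc)
  then have "norm (\<Phi>' t - \<Phi> t) \<le> norm (\<Phi> t) * norm (\<Psi> t ** \<Phi>' t - mat 1)"
    by (metis matrix_matrix_mult_norm_le)
  also have "\<dots> \<le> G * ((G * d * G) * T)" using 1 G(1)[OF t] G0 by (intro mult_mono) auto
  finally show 2: "norm (\<Phi>' t - \<Phi> t) \<le> G ^ 3 * T * d" by (simp add: power3_eq_cube mult_ac)
  have "\<Psi>' t ** (\<Phi> t - \<Phi>' t) ** \<Psi> t = \<Psi>' t ** (\<Phi> t ** \<Psi> t) - (\<Psi>' t ** \<Phi>' t) ** \<Psi> t"
    by (simp add: bounded_bilinear.diff_right[OF bb] bounded_bilinear.diff_left[OF bb] matrix_mul_assoc)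
  also have "\<dots> = \<Psi>' t - \<Psi> t"
    by (simp add: fundamental_inverse[OF f t] fundamental_inverse[OF f' t])
  finally have "norm (\<Psi>' t - \<Psi> t) \<le> norm (\<Psi>' t ** (\<Phi> t - \<Phi>' t)) * norm (\<Psi> t)"
    by (metis matrix_matrix_mult_norm_le)
  also have "\<dots> \<le> (norm (\<Psi>' t) * norm (\<Phi> t - \<Phi>' t)) * norm (\<Psi> t)"
    by (intro mult_right_mono matrix_matrix_mult_norm_le) auto
  also have "\<dots> \<le> (G * (G ^ 3 * T * d)) * G"
    using 2 G(2,4)[OF t] G0 t by (intro mult_mono) (auto simp: norm_minus_commute)
  finally show "norm (\<Psi>' t - \<Psi> t) \<le> G ^ 5 * T * d" by (simp add: power_numeral_reduce mult_ac)
qed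

section \<open>Complex frequencies and the evolution matrix\<close>

definition cvec :: "real ^ 'n::finite \<Rightarrow> complex ^ 'n" where
  "cvec \<xi> = (\<chi> k. complex_of_real (\<xi> $ k))"

lemma cvec_add_axis: "cvec (\<xi> + \<tau> *\<^sub>R axis k 1) = cvec \<xi> + complex_of_real \<tau> *s axis k 1"
  by (simp add: cvec_def vec_eq_iff axis_def)

lemma norm_cvec: "norm (cvec \<xi>) = norm \<xi>"
  by (simp add: cvec_def norm_vec_def)

lemma continuous_on_cvec: "continuous_on UNIV cvec"
  unfolding cvec_def by (intro continuous_intros)

lemma isCont_if_locally_lipschitz:
  fixes f :: "'a::real_normed_vector \<Rightarrow> 'b::real_normed_vector"
  assumes "\<And>y. norm (y - x) < 1 \<Longrightarrow> norm (f y - f x) \<le> K * norm (y - x)"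
  shows "isCont f x"
proof -
  have "(f \<longlongrightarrow> f x) (at x)"
  proof (rule LIM_zero_cancel)
    show "((\<lambda>y. f y - f x) \<longlongrightarrow> 0) (at x)"
    proof (rule Lim_null_comparison)
      show "\<forall>\<^sub>F y in at x. norm (f y - f x) \<le> K * norm (y - x)"
        unfolding eventually_at using assms by (intro exI[of _ 1]) (auto simp: dist_norm)
      have "((\<lambda>y. K * norm (y - x)) \<longlongrightarrow> K * norm (x - x)) (at x)" by (intro tendsto_intros)
      then show "((\<lambda>y. K * norm (y - x)) \<longlongrightarrow> 0) (at x)" by simp
    qed
  qed
  then show ?thesis by (simp add: isCont_def)
qed

lemma mat_mult_left_commute: "X ** (mat c ** Y) = mat c ** (X ** Y)"
  for X Y :: "complex ^ 'm::finite ^ 'm"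
  unfolding matrix_mul_assoc mat_mult_commute[of c X] ..

lemma symbol_nth: "symbol A t \<xi> $ i $ j = (\<Sum>k\<in>UNIV. complex_of_real (\<xi> $ k) * A k t $ i $ j)"
  unfolding symbol_def sum_component vector_scaleR_component
  by (simp add: scaleR_conv_of_real[of _ "_::complex"])

text \<open>Complex difference quotients of matrices are written with \<open>mat\<close>, since
  \<open>*\<^sub>R\<close> takes real scalars; entrywise they are the usual ones.\<close>

lemma matrix_entry_holomorphic:
  fixes X :: "complex \<Rightarrow> complex ^ 'm::finite ^ 'm"
  assumes "\<And>z. \<exists>D. ((\<lambda>w. mat (1 / (w - z)) ** (X w - X z)) \<longlongrightarrow> D) (at z)"
  shows "(\<lambda>z. X z $ i $ j) holomorphic_on UNIV"
proof -
  have "(\<lambda>z. X z $ i $ j) field_differentiable (at z)" for z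
  proof -
    obtain D where "((\<lambda>w. mat (1 / (w - z)) ** (X w - X z)) \<longlongrightarrow> D) (at z)" using assms by blast
    then have "((\<lambda>w. (mat (1 / (w - z)) ** (X w - X z)) $ i $ j) \<longlongrightarrow> D $ i $ j) (at z)"
      by (intro tendsto_vec_nth)
    then have "((\<lambda>z. X z $ i $ j) has_field_derivative D $ i $ j) (at z)"
      by (simp add: mat_mult_nth has_field_derivative_iff)
    then show ?thesis by (auto simp: field_differentiable_def)
  qed
  then show ?thesis by (simp add: holomorphic_on_def field_differentiable_at_within)
qed

text \<open>Hyperbolicity plays no part up to the locale \<open>evolution\<close>: what is shown
  here holds for any system with continuous coefficients.\<close>

locale cauchy_system =
  fixes A :: "'n::finite \<Rightarrow> real \<Rightarrow> complex ^ 'm::finite ^ 'm" and B :: "real \<Rightarrow> complex ^ 'm ^ 'm" and T :: real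
  assumes T: "0 < T" and A_cont: "\<And>k. continuous_on {0..T} (A k)" and B_cont: "continuous_on {0..T} B"
begin

text \<open>
  The sign of \<open>\<zeta>\<close> comes from duality: \<open>D\<^sub>k u\<close> is \<open>\<i> * u (\<partial>\<^sub>k \<phi>)\<close>, and \<open>\<partial>\<^sub>k \<phi>\<close> has the Fourier transform \<open>\<i> * \<xi>\<^sub>k * \<F> \<phi>\<close>.
\<close>

definition L :: "complex ^ 'n \<Rightarrow> real \<Rightarrow> complex ^ 'm ^ 'm" where
  "L \<zeta> t = mat \<i> ** (B t - (\<Sum>k\<in>UNIV. mat (\<zeta> $ k) ** A k t))"

lemma L_nth: "L \<zeta> t $ i $ j = \<i> * (B t $ i $ j - (\<Sum>k\<in>UNIV. \<zeta> $ k * A k t $ i $ j))"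
  by (simp add: L_def mat_mult_nth)

text \<open>On a complex line in a coordinate direction \<open>L\<close> is affine. The factor
  \<open>w - z\<close> comes out of Duhamel's formula and cancels in the difference
  quotient.\<close>

lemma L_line_diff: "L (\<zeta> + w *s axis k 1) t - L (\<zeta> + z *s axis k 1) t = mat (w - z) ** (mat (- \<i>) ** A k t)"
proof -
  have "(\<Sum>l\<in>UNIV. (\<zeta> + w *s axis k 1) $ l * A l t $ i $ j) = (\<Sum>l\<in>UNIV. \<zeta> $ l * A l t $ i $ j) + w * A k t $ i $ j" for w i j
  proof -
    have "(\<Sum>l\<in>UNIV. (\<zeta> + w *s axis k 1) $ l * A l t $ i $ j) = (\<Sum>l\<in>UNIV. \<zeta> $ l * A l t $ i $ j + (if l = k then w * A k t $ i $ j else 0))"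
      by (intro sum.cong) (auto simp: axis_def algebra_simps)
    then show ?thesis by (simp add: sum.distrib)
  qed
  then show ?thesis by (simp add: vec_eq_iff L_nth mat_mult_nth algebra_simps)
qed

lemma L_cvec: "L (cvec \<xi>) t *v x = \<i> *s (symbol A t (- \<xi>) *v x + B t *v x)"
proof -
  have "L (cvec \<xi>) t = mat \<i> ** (symbol A t (- \<xi>) + B t)"
    by (simp add: vec_eq_iff L_nth mat_mult_nth symbol_nth cvec_def sum_negf)
  then show ?thesis
    by (simp add: mat_vector_mult bounded_bilinear.add_left[OF bounded_bilinear_matrix_vector_mult] flip: matrix_vector_mul_assoc)
qed

lemma D_ex: "\<exists>D. 0 \<le> D \<and> (\<forall>t\<in>{0..T}. norm (B t) \<le> D \<and> (\<forall>k. norm (A k t) \<le> D) \<and> (\<Sum>k\<in>UNIV. norm (A k t)) \<le> D)"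
proof -
  have "continuous_on {0..T} (\<lambda>t. norm (B t) + (\<Sum>k\<in>UNIV. norm (A k t)))"
    by (intro continuous_intros A_cont B_cont)
  from continuous_on_Icc_bounded[OF this] obtain D where D: "0 \<le> D"
    "\<And>t. t \<in> {0..T} \<Longrightarrow> norm (B t) + (\<Sum>k\<in>UNIV. norm (A k t)) \<le> D" by (metis abs_le_D1 real_norm_def)
  show ?thesis
  proof (intro exI[of _ D] conjI D(1) ballI allI)
    fix t assume t: "t \<in> {0..T}"
    have s: "0 \<le> (\<Sum>k\<in>UNIV. norm (A k t))" by (intro sum_nonneg) auto
    show "norm (B t) \<le> D" using D(2)[OF t] s by linarith
    show *: "(\<Sum>k\<in>UNIV. norm (A k t)) \<le> D" using D(2)[OF t] norm_ge_zero[of "B t"] by linarith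
    show "norm (A k t) \<le> D" for k
      using member_le_sum[of k UNIV "\<lambda>k. norm (A k t)"] * by simp
  qed
qed

definition "D = (SOME D. 0 \<le> D \<and> (\<forall>t\<in>{0..T}. norm (B t) \<le> D \<and> (\<forall>k. norm (A k t) \<le> D) \<and> (\<Sum>k\<in>UNIV. norm (A k t)) \<le> D))"

lemma D: "0 \<le> D" "t \<in> {0..T} \<Longrightarrow> norm (B t) \<le> D" "t \<in> {0..T} \<Longrightarrow> norm (A k t) \<le> D"
  "t \<in> {0..T} \<Longrightarrow> (\<Sum>k\<in>UNIV. norm (A k t)) \<le> D"
  using someI_ex[OF D_ex, folded D_def] by auto

lemma norm_lin_comb_le:
  assumes "t \<in> {0..T}"
  shows "norm (\<Sum>k\<in>UNIV. mat (\<zeta> $ k) ** A k t) \<le> D * norm \<zeta>"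
proof -
  have "norm (\<Sum>k\<in>UNIV. mat (\<zeta> $ k) ** A k t) \<le> (\<Sum>k\<in>UNIV. norm \<zeta> * norm (A k t))"
    by (intro sum_norm_le) (auto simp: norm_mat_mult intro!: mult_right_mono Finite_Cartesian_Product.norm_nth_le)
  also have "\<dots> \<le> norm \<zeta> * D"
    unfolding sum_distrib_left[symmetric] using D(4)[OF assms] by (intro mult_left_mono) auto
  finally show ?thesis by (simp add: mult.commute)
qed

lemma L_le: "t \<in> {0..T} \<Longrightarrow> norm (L \<zeta> t) \<le> D * (1 + norm \<zeta>)"
  unfolding L_def norm_mat_mult
  using norm_triangle_ineq4[of "B t" "\<Sum>k\<in>UNIV. mat (\<zeta> $ k) ** A k t"] D(2) norm_lin_comb_le[of t \<zeta>]
  by (force simp: distrib_left)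

lemma L_diff_le:
  assumes "t \<in> {0..T}"
  shows "norm (L \<zeta>' t - L \<zeta> t) \<le> D * norm (\<zeta>' - \<zeta>)"
proof -
  have "L \<zeta>' t - L \<zeta> t = mat \<i> ** (\<Sum>k\<in>UNIV. mat ((\<zeta> - \<zeta>') $ k) ** A k t)"
    by (simp add: vec_eq_iff L_nth mat_mult_nth sum_subtractf algebra_simps)
  then show ?thesis using norm_lin_comb_le[OF assms, of "\<zeta> - \<zeta>'"]
    by (simp add: norm_mat_mult norm_minus_commute)
qed

lemma L_time_diff_le:
  "norm (L \<zeta> \<sigma> - L \<zeta> \<tau>) \<le> (norm (B \<sigma> - B \<tau>) + (\<Sum>k\<in>UNIV. norm (A k \<sigma> - A k \<tau>))) * (1 + norm \<zeta>)"
proof -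
  have "L \<zeta> \<sigma> - L \<zeta> \<tau> = mat \<i> ** ((B \<sigma> - B \<tau>) - (\<Sum>k\<in>UNIV. mat (\<zeta> $ k) ** (A k \<sigma> - A k \<tau>)))"
    by (simp add: vec_eq_iff L_nth mat_mult_nth sum_subtractf algebra_simps)
  then have "norm (L \<zeta> \<sigma> - L \<zeta> \<tau>) \<le> norm (B \<sigma> - B \<tau>) + norm (\<Sum>k\<in>UNIV. mat (\<zeta> $ k) ** (A k \<sigma> - A k \<tau>))"
    by (simp add: norm_mat_mult norm_triangle_ineq4)
  also have "norm (\<Sum>k\<in>UNIV. mat (\<zeta> $ k) ** (A k \<sigma> - A k \<tau>)) \<le> (\<Sum>k\<in>UNIV. norm \<zeta> * norm (A k \<sigma> - A k \<tau>))"
    by (intro sum_norm_le) (auto simp: norm_mat_mult intro!: mult_right_mono Finite_Cartesian_Product.norm_nth_le)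
  also have "norm (B \<sigma> - B \<tau>) + (\<Sum>k\<in>UNIV. norm \<zeta> * norm (A k \<sigma> - A k \<tau>)) \<le> norm (B \<sigma> - B \<tau>) * (1 + norm \<zeta>) + (\<Sum>k\<in>UNIV. norm (A k \<sigma> - A k \<tau>)) * (1 + norm \<zeta>)"
    by (intro add_mono) (auto simp: sum_distrib_left[symmetric] algebra_simps intro!: sum_nonneg)
  finally show ?thesis by (simp add: distrib_right)
qed

lemma L_cont: "continuous_on {0..T} (L \<zeta>)"
  unfolding L_def
  by (intro continuous_on_diff continuous_on_sum A_cont B_cont continuous_on_const
      bounded_bilinear.continuous_on[OF bounded_bilinear_matrix_mult])

text \<open>The pair is chosen separately for each \<open>\<zeta>\<close>; its regularity in
  \<open>\<zeta>\<close> is derived afterwards from \<open>duhamel\<close> and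
  \<open>fundamental_diff_le\<close>.\<close>

definition "FM \<zeta> = (SOME p. fundamental T (L \<zeta>) (fst p) (snd p))"
definition "\<Phi> \<zeta> = fst (FM \<zeta>)"
definition "\<Psi> \<zeta> = snd (FM \<zeta>)"

lemma fund: "fundamental T (L \<zeta>) (\<Phi> \<zeta>) (\<Psi> \<zeta>)"
proof -
  have "\<exists>p. fundamental T (L \<zeta>) (fst p) (snd p)"
    using fundamental_exists[OF _ L_cont] T by (metis fst_conv less_imp_le snd_conv)
  from someI_ex[OF this] show ?thesis by (simp add: FM_def \<Phi>_def \<Psi>_def)
qed

definition "G r = exp (D * (1 + r) * T) * norm (mat 1 :: complex ^ 'm ^ 'm)"

lemma FM_le:
  assumes t: "t \<in> {0..T}" and r: "norm \<zeta> \<le> r"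
  shows "norm (\<Phi> \<zeta> t) \<le> G r" "norm (\<Psi> \<zeta> t) \<le> G r"
proof -
  have "norm (L \<zeta> t) \<le> D * (1 + r)" if "t \<in> {0..T}" for t
    using L_le[OF that, of \<zeta>] mult_left_mono[of "1 + norm \<zeta>" "1 + r" D] r D(1) by linarith
  moreover have "0 \<le> D * (1 + r)" using D(1) order_trans[OF norm_ge_zero r] by simp
  ultimately show "norm (\<Phi> \<zeta> t) \<le> G r" "norm (\<Psi> \<zeta> t) \<le> G r"
    unfolding G_def using fundamental_growth[OF fund _ _ t] by blast+
qed

lemma FM_diff_le:
  assumes t: "t \<in> {0..T}" and r: "norm \<zeta> \<le> r" "norm \<zeta>' \<le> r"
  shows "norm (\<Phi> \<zeta>' t - \<Phi> \<zeta> t) \<le> G r ^ 3 * T * (D * norm (\<zeta>' - \<zeta>))"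
    "norm (\<Psi> \<zeta>' t - \<Psi> \<zeta> t) \<le> G r ^ 5 * T * (D * norm (\<zeta>' - \<zeta>))"
  using fundamental_diff_le[OF fund fund t FM_le(1)[OF _ r(1)] FM_le(2)[OF _ r(1)] FM_le(1)[OF _ r(2)] FM_le(2)[OF _ r(2)] L_diff_le]
  by blast+

lemma norm_near: "norm (y - x) < 1 \<Longrightarrow> norm y \<le> norm x + 1" for x y :: "'z::real_normed_vector"
  using norm_triangle_ineq2[of y x] by simp

lemma FM_isCont:
  assumes t: "t \<in> {0..T}"
  shows "isCont (\<lambda>\<zeta>. \<Phi> \<zeta> t) \<zeta>" "isCont (\<lambda>\<zeta>. \<Psi> \<zeta> t) \<zeta>"
proof -
  have r: "norm \<zeta> \<le> norm \<zeta> + 1" by simp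
  show "isCont (\<lambda>\<zeta>. \<Phi> \<zeta> t) \<zeta>"
    by (rule isCont_if_locally_lipschitz[where K="G (norm \<zeta> + 1) ^ 3 * T * D"])
       (use FM_diff_le(1)[OF t r norm_near] in \<open>simp add: mult.assoc\<close>)
  show "isCont (\<lambda>\<zeta>. \<Psi> \<zeta> t) \<zeta>"
    by (rule isCont_if_locally_lipschitz[where K="G (norm \<zeta> + 1) ^ 5 * T * D"])
       (use FM_diff_le(2)[OF t r norm_near] in \<open>simp add: mult.assoc\<close>)
qed

lemma isCont_line: "isCont (\<lambda>w. \<zeta> + w *s axis k 1 :: complex ^ 'n) z"
proof -
  have "continuous_on UNIV (\<lambda>w. (\<chi> l. \<zeta> $ l + w * (axis k 1 :: complex ^ 'n) $ l) :: complex ^ 'n)"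
    by (intro continuous_intros)
  moreover have "(\<lambda>w. \<zeta> + w *s axis k 1 :: complex ^ 'n) = (\<lambda>w. \<chi> l. \<zeta> $ l + w * (axis k 1 :: complex ^ 'n) $ l)"
    by (simp add: vec_eq_iff fun_eq_iff)
  ultimately show ?thesis by (simp add: continuous_on_eq_continuous_at)
qed

text \<open>By Duhamel the difference quotient is exactly \<open>\<Phi> (?l z) t ** J w\<close>,
  where \<open>w\<close> occurs only in the factor \<open>\<Phi> (?l w)\<close> under the integral.
  Continuity of \<open>J\<close> at \<open>z\<close>, by the Lipschitz bound for
  \<open>\<Phi>\<close>, gives the limit.\<close>

lemma \<Phi>_line_derivative:
  assumes t: "t \<in> {0..T}"
  shows "\<exists>D. ((\<lambda>w. mat (1 / (w - z)) ** (\<Phi> (\<zeta> + w *s axis k 1) t - \<Phi> (\<zeta> + z *s axis k 1) t)) \<longlongrightarrow> D) (at z)"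
proof -
  note bb = bounded_bilinear_matrix_mult
  let ?l = "\<lambda>w. \<zeta> + w *s axis k 1 :: complex ^ 'n"
  define M where "M \<sigma> = mat (- \<i>) ** A k \<sigma>" for \<sigma>
  define J where "J w = integral {0..t} (\<lambda>\<sigma>. \<Psi> (?l z) \<sigma> ** M \<sigma> ** \<Phi> (?l w) \<sigma>)" for w
  have sub: "{0..t} \<subseteq> {0..T}" using t by auto
  have cont: "continuous_on {0..t} (\<lambda>\<sigma>. \<Psi> (?l z) \<sigma> ** M \<sigma> ** \<Phi> (?l w) \<sigma>)" for w
    unfolding M_def
    by (intro bounded_bilinear.continuous_on[OF bb] continuous_on_const
        continuous_on_subset[OF fundamental_continuous(1)[OF fund] sub] continuous_on_subset[OF fundamental_continuous(2)[OF fund] sub]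
        continuous_on_subset[OF A_cont sub])
  then have int: "(\<lambda>\<sigma>. \<Psi> (?l z) \<sigma> ** M \<sigma> ** \<Phi> (?l w) \<sigma>) integrable_on {0..t}" for w
    by (rule integrable_continuous_real)
  have quot: "mat (1 / (w - z)) ** (\<Phi> (?l w) t - \<Phi> (?l z) t) = \<Phi> (?l z) t ** J w" if "w \<noteq> z" for w
  proof -
    have "\<Psi> (?l z) \<sigma> ** (L (?l w) \<sigma> - L (?l z) \<sigma>) ** \<Phi> (?l w) \<sigma> = mat (w - z) ** (\<Psi> (?l z) \<sigma> ** M \<sigma> ** \<Phi> (?l w) \<sigma>)" for \<sigma>
    proof -
      have "\<Psi> (?l z) \<sigma> ** (mat (w - z) ** M \<sigma>) = mat (w - z) ** (\<Psi> (?l z) \<sigma> ** M \<sigma>)"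
        by (rule mat_mult_left_commute)
      then show ?thesis unfolding L_line_diff M_def[symmetric] by (simp only: matrix_mul_assoc)
    qed
    then have "\<Phi> (?l w) t - \<Phi> (?l z) t = \<Phi> (?l z) t ** integral {0..t} (\<lambda>\<sigma>. mat (w - z) ** (\<Psi> (?l z) \<sigma> ** M \<sigma> ** \<Phi> (?l w) \<sigma>))"
      using duhamel(2)[OF fund fund t, of "?l w" "?l z"] by simp
    also have "integral {0..t} (\<lambda>\<sigma>. mat (w - z) ** (\<Psi> (?l z) \<sigma> ** M \<sigma> ** \<Phi> (?l w) \<sigma>)) = mat (w - z) ** J w"
      unfolding J_def
      using integral_linear[OF int bounded_bilinear.bounded_linear_right[OF bb, of "mat (w - z)"]] by (simp add: o_def)
    finally have "mat (1 / (w - z)) ** (\<Phi> (?l w) t - \<Phi> (?l z) t) = mat (1 / (w - z)) ** (\<Phi> (?l z) t ** (mat (w - z) ** J w))"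
      by simp
    also have "\<dots> = (mat (1 / (w - z)) ** mat (w - z)) ** (\<Phi> (?l z) t ** J w)"
      unfolding mat_mult_left_commute[of "\<Phi> (?l z) t"] by (rule matrix_mul_assoc)
    also have "mat (1 / (w - z)) ** mat (w - z) = (mat 1 :: complex ^ 'm ^ 'm)"
      using that by (simp flip: mat_mult)
    finally show ?thesis by simp
  qed
  define r where "r = norm (?l z) + norm (axis k 1 :: complex ^ 'n)"
  have r: "norm (?l w) \<le> r" if "norm (w - z) < 1" for w
  proof -
    have "?l w = ?l z + (w - z) *s axis k 1" by (simp add: vec_eq_iff algebra_simps)
    then have "norm (?l w) \<le> norm (?l z) + norm ((w - z) *s (axis k 1 :: complex ^ 'n))"
      by (simp only: norm_triangle_ineq)
    moreover have "norm ((w - z) *s (axis k 1 :: complex ^ 'n)) \<le> norm (axis k 1 :: complex ^ 'n)"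
      using mult_right_mono[of "norm (w - z)" 1 "norm (axis k 1 :: complex ^ 'n)"] that unfolding norm_smult_vec by simp
    ultimately show ?thesis unfolding r_def by linarith
  qed
  have G0: "0 \<le> G r" by (simp add: G_def)
  have "isCont J z"
  proof (rule isCont_if_locally_lipschitz)
    fix w assume w: "norm (w - z) < 1"
    let ?d = "G r ^ 3 * T * (D * norm (?l w - ?l z))"
    have "norm (J w - J z) \<le> (G r * D * ?d) * measure lborel {0..t}"
    proof (rule has_integral_bound_real[where S="{}"])
      show "((\<lambda>\<sigma>. \<Psi> (?l z) \<sigma> ** M \<sigma> ** \<Phi> (?l w) \<sigma> - \<Psi> (?l z) \<sigma> ** M \<sigma> ** \<Phi> (?l z) \<sigma>) has_integral (J w - J z)) {0..t}"
        unfolding J_def by (intro has_integral_diff integrable_integral int)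
      show "0 \<le> G r * D * ?d" using G0 D(1) T by simp
      fix \<sigma> assume "\<sigma> \<in> {0..t} - {}"
      then have \<sigma>: "\<sigma> \<in> {0..T}" using t by auto
      have "norm (\<Psi> (?l z) \<sigma> ** M \<sigma> ** (\<Phi> (?l w) \<sigma> - \<Phi> (?l z) \<sigma>)) \<le> norm (\<Psi> (?l z) \<sigma>) * norm (M \<sigma>) * norm (\<Phi> (?l w) \<sigma> - \<Phi> (?l z) \<sigma>)"
        by (intro order_trans[OF matrix_matrix_mult_norm_le] mult_right_mono matrix_matrix_mult_norm_le) auto
      also have "\<dots> \<le> G r * D * ?d"
      proof (intro mult_mono)
        show "norm (\<Psi> (?l z) \<sigma>) \<le> G r" using FM_le(2)[OF \<sigma> r[of z]] by simp
        show "norm (M \<sigma>) \<le> D" using D(3)[OF \<sigma>] by (simp add: M_def norm_mat_mult)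
        show "norm (\<Phi> (?l w) \<sigma> - \<Phi> (?l z) \<sigma>) \<le> ?d" using FM_diff_le(1)[OF \<sigma> r[of z] r[OF w]] by simp
      qed (use G0 D(1) in auto)
      finally show "norm (\<Psi> (?l z) \<sigma> ** M \<sigma> ** \<Phi> (?l w) \<sigma> - \<Psi> (?l z) \<sigma> ** M \<sigma> ** \<Phi> (?l z) \<sigma>) \<le> G r * D * ?d"
        by (simp add: bounded_bilinear.diff_right[OF bb])
    qed simp
    also have "?l w - ?l z = (w - z) *s axis k 1" by (simp add: vec_eq_iff algebra_simps)
    also have "G r * D * (G r ^ 3 * T * (D * norm ((w - z) *s (axis k 1 :: complex ^ 'n)))) * measure lborel {0..t}
        = (G r * D * (G r ^ 3 * T * (D * norm (axis k 1 :: complex ^ 'n))) * measure lborel {0..t}) * norm (w - z)"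
      unfolding norm_smult_vec by (simp only: mult_ac)
    finally show "norm (J w - J z) \<le> (G r * D * (G r ^ 3 * T * (D * norm (axis k 1 :: complex ^ 'n))) * measure lborel {0..t}) * norm (w - z)" .
  qed
  then have "((\<lambda>w. \<Phi> (?l z) t ** J w) \<longlongrightarrow> \<Phi> (?l z) t ** J z) (at z)"
    unfolding isCont_def by (intro bounded_bilinear.tendsto[OF bb] tendsto_const)
  moreover have "\<forall>\<^sub>F w in at z. \<Phi> (?l z) t ** J w = mat (1 / (w - z)) ** (\<Phi> (?l w) t - \<Phi> (?l z) t)"
    using quot by (auto simp: eventually_at intro!: exI[of _ 1])
  ultimately have "((\<lambda>w. mat (1 / (w - z)) ** (\<Phi> (?l w) t - \<Phi> (?l z) t)) \<longlongrightarrow> \<Phi> (?l z) t ** J z) (at z)"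
    by (rule Lim_transform_eventually)
  then show ?thesis by blast
qed

text \<open>The inverse is differentiated by the resolvent identity
  \<open>?Y w - ?Y z = - (?Y w ** (?X w - ?X z) ** ?Y z)\<close>.\<close>

lemma \<Psi>_line_derivative:
  assumes t: "t \<in> {0..T}"
  shows "\<exists>D. ((\<lambda>w. mat (1 / (w - z)) ** (\<Psi> (\<zeta> + w *s axis k 1) t - \<Psi> (\<zeta> + z *s axis k 1) t)) \<longlongrightarrow> D) (at z)"
proof -
  note bb = bounded_bilinear_matrix_mult
  let ?X = "\<lambda>w. \<Phi> (\<zeta> + w *s axis k 1) t" and ?Y = "\<lambda>w. \<Psi> (\<zeta> + w *s axis k 1) t"
  obtain D where D: "((\<lambda>w. mat (1 / (w - z)) ** (?X w - ?X z)) \<longlongrightarrow> D) (at z)"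
    using \<Phi>_line_derivative[OF t] by blast
  have inv: "?Y w ** ?X w = mat 1" "?X w ** ?Y w = mat 1" for w
    using fundamental_inverse[OF fund t] by auto
  have "isCont ?Y z"
    using isCont_o2[OF isCont_line FM_isCont(2)[OF t]] .
  then have Y: "(?Y \<longlongrightarrow> ?Y z) (at z)" by (simp add: isCont_def)
  have eq: "mat (1 / (w - z)) ** (?Y w - ?Y z) = - (?Y w ** (mat (1 / (w - z)) ** (?X w - ?X z)) ** ?Y z)" for w
  proof -
    have "?Y w ** (?X w - ?X z) ** ?Y z = (?Y w ** ?X w) ** ?Y z - ?Y w ** (?X z ** ?Y z)"
      by (simp add: bounded_bilinear.diff_right[OF bb] bounded_bilinear.diff_left[OF bb] matrix_mul_assoc)
    also have "\<dots> = ?Y z - ?Y w" by (simp add: inv)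
    finally have 1: "?Y w - ?Y z = - (?Y w ** (?X w - ?X z) ** ?Y z)" by simp
    have "?Y w ** (mat (1 / (w - z)) ** (?X w - ?X z)) ** ?Y z = mat (1 / (w - z)) ** (?Y w ** (?X w - ?X z) ** ?Y z)"
      by (simp only: mat_mult_left_commute matrix_mul_assoc[symmetric])
    then show ?thesis unfolding 1 by (simp add: bounded_bilinear.minus_right[OF bb])
  qed
  have "((\<lambda>w. - (?Y w ** (mat (1 / (w - z)) ** (?X w - ?X z)) ** ?Y z)) \<longlongrightarrow> - (?Y z ** D ** ?Y z)) (at z)"
    by (intro tendsto_minus bounded_bilinear.tendsto[OF bb] tendsto_const D Y)
  then show ?thesis unfolding eq by blast
qed

text \<open>It carries data at time \<tau> to time \<open>t\<close>, and solves the system in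
  \<open>t\<close> and the adjoint system in \<tau>.\<close>

definition "E \<zeta> t \<tau> = \<Phi> \<zeta> t ** \<Psi> \<zeta> \<tau>"

lemma E_holomorphic:
  assumes "t \<in> {0..T}" "\<tau> \<in> {0..T}"
  shows "(\<lambda>z. E (\<zeta> + z *s axis k 1) t \<tau> $ i $ j) holomorphic_on UNIV"
  unfolding E_def matrix_matrix_mult_def vec_lambda_beta
  by (intro holomorphic_intros matrix_entry_holomorphic \<Phi>_line_derivative \<Psi>_line_derivative assms)

lemma E_isCont: "t \<in> {0..T} \<Longrightarrow> \<tau> \<in> {0..T} \<Longrightarrow> isCont (\<lambda>\<zeta>. E \<zeta> t \<tau>) \<zeta>"
  unfolding E_def using FM_isCont unfolding isCont_def
  by (intro bounded_bilinear.tendsto[OF bounded_bilinear_matrix_mult])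

lemma norm_entry_le: "norm (X $ i $ j) \<le> norm X" for X :: "complex ^ 'a::finite ^ 'b::finite"
  by (rule order_trans[OF Finite_Cartesian_Product.norm_nth_le Finite_Cartesian_Product.norm_nth_le])

text \<open>The crude bound, exponential in \<open>norm \<zeta>\<close>. Its rate
  \<open>2 * D * T\<close>, the same for all times, becomes part of the propagation radius.\<close>

lemma E_le:
  assumes "t \<in> {0..T}" "\<tau> \<in> {0..T}"
  shows "norm (E \<zeta> t \<tau>) \<le> G 0 ^ 2 * exp (2 * D * T * norm \<zeta>)"
proof -
  have "norm (E \<zeta> t \<tau>) \<le> norm (\<Phi> \<zeta> t) * norm (\<Psi> \<zeta> \<tau>)"
    unfolding E_def by (rule matrix_matrix_mult_norm_le)
  also have "\<dots> \<le> G (norm \<zeta>) * G (norm \<zeta>)"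
    using FM_le[OF _ order_refl] assms by (intro mult_mono) (auto simp: G_def)
  also have "\<dots> = G 0 ^ 2 * exp (2 * D * T * norm \<zeta>)"
    by (simp add: G_def power2_eq_square algebra_simps flip: exp_add)
  finally show ?thesis .
qed

lemma E_refl: "t \<in> {0..T} \<Longrightarrow> E \<zeta> t t = mat 1"
  unfolding E_def using fundamental_inverse[OF fund] by blast

lemma E_deriv1:
  assumes "t \<in> {0..T}"
  shows "((\<lambda>t. E \<zeta> t \<tau>) has_vector_derivative L \<zeta> t ** E \<zeta> t \<tau>) (at t within {0..T})"
proof -
  have "((\<lambda>t. \<Phi> \<zeta> t ** \<Psi> \<zeta> \<tau>) has_vector_derivative (L \<zeta> t ** \<Phi> \<zeta> t) ** \<Psi> \<zeta> \<tau>) (at t within {0..T})"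
    using fund[of \<zeta>] assms unfolding fundamental_def
    by (intro bounded_linear.has_vector_derivative[OF bounded_bilinear.bounded_linear_left[OF bounded_bilinear_matrix_mult]]) auto
  then show ?thesis by (simp add: E_def matrix_mul_assoc)
qed

lemma E_deriv2:
  assumes "\<tau> \<in> {0..T}"
  shows "((\<lambda>\<tau>. E \<zeta> t \<tau>) has_vector_derivative - (E \<zeta> t \<tau> ** L \<zeta> \<tau>)) (at \<tau> within {0..T})"
proof -
  have "((\<lambda>\<tau>. \<Phi> \<zeta> t ** \<Psi> \<zeta> \<tau>) has_vector_derivative \<Phi> \<zeta> t ** (- (\<Psi> \<zeta> \<tau> ** L \<zeta> \<tau>))) (at \<tau> within {0..T})"
    using fund[of \<zeta>] assms unfolding fundamental_def
    by (intro bounded_linear.has_vector_derivative[OF bounded_bilinear.bounded_linear_right[OF bounded_bilinear_matrix_mult]]) auto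
  then show ?thesis by (simp add: E_def matrix_mul_assoc bounded_bilinear.minus_right[OF bounded_bilinear_matrix_mult])
qed

end

section \<open>Continuity and boundedness in locally convex spaces\<close>

definition lin_space :: "('a \<Rightarrow> complex) set \<Rightarrow> bool" where
  "lin_space V \<longleftrightarrow> (\<lambda>x. 0) \<in> V \<and> (\<forall>f\<in>V. \<forall>g\<in>V. (\<lambda>x. f x + g x) \<in> V) \<and> (\<forall>c. \<forall>f\<in>V. (\<lambda>x. c * f x) \<in> V)"

lemma lin_spaceD:
  assumes "lin_space V"
  shows "(\<lambda>x. 0) \<in> V" "f \<in> V \<Longrightarrow> g \<in> V \<Longrightarrow> (\<lambda>x. f x + g x) \<in> V" "f \<in> V \<Longrightarrow> (\<lambda>x. c * f x) \<in> V"
    "f \<in> V \<Longrightarrow> g \<in> V \<Longrightarrow> (\<lambda>x. f x - g x) \<in> V"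
proof -
  show 1: "(\<lambda>x. 0) \<in> V" "f \<in> V \<Longrightarrow> g \<in> V \<Longrightarrow> (\<lambda>x. f x + g x) \<in> V" "f \<in> V \<Longrightarrow> (\<lambda>x. c * f x) \<in> V" for f g c
    using assms by (auto simp: lin_space_def)
  show "(\<lambda>x. f x - g x) \<in> V" if "f \<in> V" "g \<in> V" using 1(2)[OF that(1) 1(3)[OF that(2), of "- 1"]] by simp
qed

lemma lin_space_sum:
  assumes "lin_space V" "\<And>i. i \<in> I \<Longrightarrow> f i \<in> V"
  shows "(\<lambda>x. \<Sum>i\<in>I. f i x) \<in> V"
  using assms(2) by (induction I rule: infinite_finite_induct) (simp_all add: lin_spaceD(1,2)[OF assms(1)])

lemma is_seminorm_onD:
  assumes "is_seminorm_on V q" "lin_space V"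
  shows "f \<in> V \<Longrightarrow> 0 \<le> q f" "f \<in> V \<Longrightarrow> g \<in> V \<Longrightarrow> q (\<lambda>x. f x + g x) \<le> q f + q g"
    "f \<in> V \<Longrightarrow> q (\<lambda>x. c * f x) = norm c * q f" "q (\<lambda>x. 0) = 0"
proof -
  show 1: "f \<in> V \<Longrightarrow> 0 \<le> q f" "f \<in> V \<Longrightarrow> g \<in> V \<Longrightarrow> q (\<lambda>x. f x + g x) \<le> q f + q g"
    "f \<in> V \<Longrightarrow> q (\<lambda>x. c * f x) = norm c * q f" for f g c
    using assms(1) by (auto simp: is_seminorm_on_def)
  show "q (\<lambda>x. 0) = 0" using 1(3)[OF lin_spaceD(1)[OF assms(2)], of 0] by simp
qed

text \<open>The reverse inequality for scalars follows by applying \<open>scale\<close> to the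
  inverse scalar.\<close>

lemma is_seminorm_onI:
  assumes V: "lin_space V" and nonneg: "\<And>f. f \<in> V \<Longrightarrow> 0 \<le> q f"
    and add: "\<And>f g. f \<in> V \<Longrightarrow> g \<in> V \<Longrightarrow> q (\<lambda>x. f x + g x) \<le> q f + q g"
    and scale: "\<And>c f. f \<in> V \<Longrightarrow> q (\<lambda>x. c * f x) \<le> norm c * q f"
  shows "is_seminorm_on V q"
  unfolding is_seminorm_on_def
proof (intro conjI ballI allI nonneg add)
  fix c :: complex and f assume f: "f \<in> V"
  show "q (\<lambda>x. c * f x) = norm c * q f"
  proof (cases "c = 0")
    case True
    have "0 \<le> q (\<lambda>x. 0)" by (intro nonneg lin_spaceD[OF V])
    then show ?thesis using scale[OF f, of c] True by simp
  next
    case False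
    have "q (\<lambda>x. inverse c * (c * f x)) \<le> norm (inverse c) * q (\<lambda>x. c * f x)"
      by (intro scale lin_spaceD[OF V] f)
    then have "norm c * q f \<le> q (\<lambda>x. c * f x)"
      using False by (simp add: mult.assoc[symmetric] norm_divide field_simps)
    then show ?thesis using scale[OF f, of c] by simp
  qed
qed

lemma is_seminorm_on_SUP:
  assumes V: "lin_space V" and I: "I \<noteq> {}" and bdd: "\<And>f. f \<in> V \<Longrightarrow> bdd_above ((\<lambda>i. q i f) ` I)"
    and q: "\<And>i. i \<in> I \<Longrightarrow> is_seminorm_on V (q i)"
  shows "is_seminorm_on V (\<lambda>f. SUP i\<in>I. q i f)"
proof (rule is_seminorm_onI[OF V])
  note qD = is_seminorm_onD[OF q V]
  note up = cSUP_upper[OF _ bdd]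
  fix f assume f: "f \<in> V"
  obtain i where i: "i \<in> I" using I by blast
  show "0 \<le> (SUP i\<in>I. q i f)" using order_trans[OF qD(1)[OF i f] up[OF i f]] .
  show "(SUP i\<in>I. q i (\<lambda>x. f x + g x)) \<le> (SUP i\<in>I. q i f) + (SUP i\<in>I. q i g)" if g: "g \<in> V" for g
    by (rule cSUP_least[OF I], rule order_trans[OF qD(2)[OF _ f g] add_mono[OF up[OF _ f] up[OF _ g]]]) auto
  show "(SUP i\<in>I. q i (\<lambda>x. c * f x)) \<le> norm c * (SUP i\<in>I. q i f)" for c
    by (rule cSUP_least[OF I]) (simp add: qD(3)[OF _ f] mult_left_mono[OF up[OF _ f]])
qed

lemma openin_seminorm_ball:
  assumes V: "lin_space V" and P: "\<And>p. p \<in> P \<Longrightarrow> is_seminorm_on V p" and F: "finite F" "F \<subseteq> P" and f: "f \<in> V"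
  shows "openin (lc_topology V P) {g\<in>V. \<forall>p\<in>F. p (\<lambda>x. g x - f x) < e}"
  unfolding openin_lc_topology
proof (intro conjI ballI)
  fix g assume "g \<in> {g\<in>V. \<forall>p\<in>F. p (\<lambda>x. g x - f x) < e}"
  then have g: "g \<in> V" "\<And>p. p \<in> F \<Longrightarrow> p (\<lambda>x. g x - f x) < e" by auto
  \<comment> \<open>The element 1 keeps the minimum defined and positive when \<open>F\<close> is
    empty.\<close>
  define d where "d = Min (insert 1 ((\<lambda>p. e - p (\<lambda>x. g x - f x)) ` F))"
  have d: "0 < d" "\<And>p. p \<in> F \<Longrightarrow> d \<le> e - p (\<lambda>x. g x - f x)"
    using F g(2) by (auto simp: d_def)
  have "p (\<lambda>x. h x - f x) < e" if h: "h \<in> V" "\<forall>p\<in>F. p (\<lambda>x. h x - g x) < d" and p: "p \<in> F" for h p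
  proof -
    have "p (\<lambda>x. (h x - g x) + (g x - f x)) \<le> p (\<lambda>x. h x - g x) + p (\<lambda>x. g x - f x)"
      using p F(2) by (intro is_seminorm_onD(2)[OF P V] lin_spaceD(4)[OF V] g h f) auto
    also have "\<dots> < e" using h(2) p d(2)[OF p] by fastforce
    finally show ?thesis by simp
  qed
  then show "\<exists>G d. finite G \<and> G \<subseteq> P \<and> 0 < d \<and> {h\<in>V. \<forall>p\<in>G. p (\<lambda>x. h x - g x) < d} \<subseteq> {g\<in>V. \<forall>p\<in>F. p (\<lambda>x. g x - f x) < e}"
    using F d(1) by (intro exI[of _ F] exI[of _ d]) auto
qed auto

text \<open>The preimage of the unit ball contains a basic neighbourhood of 0, and homogeneity
  scales it. \<open>W\<close> is only closed under scalars and \<open>q\<close> only homogeneous in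
  norm, so that functionals on the whole space and seminorms on the subspaces
  \<open>gevrey_in\<close> are both covered.\<close>

lemma continuous_imp_seminorm_bound:
  fixes q :: "('a \<Rightarrow> complex) \<Rightarrow> 'b::real_normed_vector"
  assumes V: "lin_space V" and P: "\<And>p. p \<in> P \<Longrightarrow> is_seminorm_on V p"
    and W: "W \<subseteq> V" "(\<lambda>x. 0) \<in> W" "\<And>c f. f \<in> W \<Longrightarrow> (\<lambda>x. c * f x) \<in> W"
    and q: "continuous_map (subtopology (lc_topology V P) W) euclidean q"
    and hom: "\<And>c f. f \<in> W \<Longrightarrow> norm (q (\<lambda>x. c * f x)) = norm c * norm (q f)"
  shows "\<exists>F C. finite F \<and> F \<subseteq> P \<and> 0 \<le> C \<and> (\<forall>f\<in>W. norm (q f) \<le> C * (\<Sum>p\<in>F. p f))"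
proof -
  have q0: "q (\<lambda>x. 0) = 0" using hom[OF W(2), of 0] by simp
  have "openin (subtopology (lc_topology V P) W) {f \<in> topspace (subtopology (lc_topology V P) W). q f \<in> ball 0 1}"
    by (rule openin_continuous_map_preimage[OF q]) simp
  then obtain U where U: "openin (lc_topology V P) U"
    "{f \<in> topspace (subtopology (lc_topology V P) W). q f \<in> ball 0 1} = U \<inter> W"
    unfolding openin_subtopology by blast
  have "topspace (subtopology (lc_topology V P) W) = W"
    using W(1) by (auto simp: topspace_subtopology topspace_lc_topology)
  then have UW: "{f \<in> W. norm (q f) < 1} = U \<inter> W" using U(2) by simp
  have "(\<lambda>x. 0) \<in> {f \<in> W. norm (q f) < 1}" using W(2) q0 by simp
  then have U0: "(\<lambda>x. 0) \<in> U" unfolding UW by (rule IntD1)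
  then obtain F e where F: "finite F" "F \<subseteq> P" "0 < e" "{g \<in> V. \<forall>p\<in>F. p (\<lambda>x. g x - 0) < e} \<subseteq> U"
    using bspec[OF conjunct2[OF U(1)[unfolded openin_lc_topology]] U0] by (elim exE conjE)
  have "norm (q f) \<le> (1 / e) * (\<Sum>p\<in>F. p f)" if f: "f \<in> W" for f
  proof (rule field_le_epsilon)
    fix \<delta> :: real assume \<delta>: "0 < \<delta>"
    have nn: "0 \<le> p f" if "p \<in> F" for p using is_seminorm_onD(1)[OF P V] that F(2) f W(1) by blast
    \<comment> \<open>The positive slack treats the case that all seminorms of \<open>F\<close>
      vanish at \<open>f\<close>, where one could not divide by their sum.\<close>
    define S where "S = (\<Sum>p\<in>F. p f) + e * \<delta>"
    have S: "p f < S" if "p \<in> F" for p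
    proof -
      have "p f \<le> (\<Sum>p\<in>F. p f)" by (rule member_le_sum[OF that _ F(1)]) (use nn in auto)
      then show ?thesis using mult_pos_pos[OF F(3) \<delta>] unfolding S_def by linarith
    qed
    have S0: "0 < S" unfolding S_def
      by (intro add_nonneg_pos sum_nonneg mult_pos_pos F(3) \<delta>) (use nn in auto)
    define c where "c = complex_of_real (e / S)"
    have c: "norm c = e / S" using S0 F(3) by (simp add: c_def norm_divide)
    have "p (\<lambda>x. c * f x) < e" if p: "p \<in> F" for p
    proof -
      have "p (\<lambda>x. c * f x) = e / S * p f"
        using is_seminorm_onD(3)[OF P V, of p f c] p F(2) f W(1) c by auto
      also have "\<dots> < e / S * S" using S[OF p] S0 F(3) by (intro mult_strict_left_mono) auto
      finally show ?thesis using S0 by simp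
    qed
    then have "(\<lambda>x. c * f x) \<in> U \<inter> W" using F(4) W(1) W(3)[OF f, of c] by auto
    then have "norm (q (\<lambda>x. c * f x)) < 1" unfolding UW[symmetric] by simp
    then have "e / S * norm (q f) < 1" unfolding hom[OF f] c .
    then have "norm (q f) \<le> S / e" using S0 F(3) by (simp add: field_simps)
    then show "norm (q f) \<le> (1 / e) * (\<Sum>p\<in>F. p f) + \<delta>" using F(3) by (simp add: S_def field_simps)
  qed
  then show ?thesis using F by (intro exI[of _ F] exI[of _ "1 / e"]) auto
qed

lemma seminorm_bound_imp_continuous:
  fixes q :: "('a \<Rightarrow> complex) \<Rightarrow> 'b::real_normed_vector"
  assumes V: "lin_space V" and P: "\<And>p. p \<in> P \<Longrightarrow> is_seminorm_on V p" and F: "finite F" "F \<subseteq> P" and C: "0 \<le> C"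
    and q: "\<And>f g. f \<in> W \<Longrightarrow> g \<in> W \<Longrightarrow> f \<in> V \<Longrightarrow> g \<in> V \<Longrightarrow> norm (q g - q f) \<le> C * (\<Sum>p\<in>F. p (\<lambda>x. g x - f x))"
  shows "continuous_map (subtopology (lc_topology V P) W) euclidean q"
  unfolding continuous_map_def
proof (intro conjI allI impI)
  fix U :: "'b set" assume "openin euclidean U"
  then have U: "open U" by simp
  let ?X = "subtopology (lc_topology V P) W"
  have top: "topspace ?X = V \<inter> W" by (simp add: topspace_subtopology topspace_lc_topology)
  show "openin ?X {f \<in> topspace ?X. q f \<in> U}"
  proof (subst openin_subopen, intro ballI)
    fix f assume "f \<in> {f \<in> topspace ?X. q f \<in> U}"
    then have f: "f \<in> V" "f \<in> W" "q f \<in> U" by (auto simp: topspace_lc_topology)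
    obtain \<epsilon> where \<epsilon>: "0 < \<epsilon>" "ball (q f) \<epsilon> \<subseteq> U" using U f(3) openE by blast
    define d where "d = \<epsilon> / (C * real (card F) + 1)"
    have pos: "0 < C * real (card F) + 1" using C by (simp add: add_nonneg_pos)
    have d: "0 < d" using \<epsilon>(1) pos by (simp add: d_def)
    let ?N = "{g\<in>V. \<forall>p\<in>F. p (\<lambda>x. g x - f x) < d}"
    have "q g \<in> U" if g: "g \<in> ?N" "g \<in> W" for g
    proof -
      have "(\<Sum>p\<in>F. p (\<lambda>x. g x - f x)) \<le> (\<Sum>p\<in>F. d)" using g by (intro sum_mono) (auto simp: less_imp_le)
      then have "C * (\<Sum>p\<in>F. p (\<lambda>x. g x - f x)) \<le> C * (real (card F) * d)" using C by (intro mult_left_mono) auto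
      then have "norm (q g - q f) \<le> C * real (card F) * d" using q[OF f(2) g(2) f(1)] g(1) by force
      also have "\<dots> < (C * real (card F) + 1) * d" using d by simp
      also have "\<dots> = \<epsilon>" using pos by (simp add: d_def)
      finally show ?thesis using \<epsilon>(2) by (auto simp: dist_norm norm_minus_commute)
    qed
    then have "?N \<inter> W \<subseteq> {f \<in> topspace ?X. q f \<in> U}" by (auto simp: topspace_lc_topology)
    moreover have "openin ?X (?N \<inter> W)"
      using openin_seminorm_ball[OF V P F f(1)] unfolding openin_subtopology by blast
    moreover have "p (\<lambda>x. f x - f x) < d" if "p \<in> F" for p
      using is_seminorm_onD(4)[OF P[OF subsetD[OF F(2) that]] V] d by simp
    then have "f \<in> ?N \<inter> W" using f by blast
    ultimately show "\<exists>T. openin ?X T \<and> f \<in> T \<and> T \<subseteq> {f \<in> topspace ?X. q f \<in> U}" by blast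
  qed
qed auto

lemma limitin_lc_topologyI:
  assumes l: "l \<in> V" and f: "\<forall>\<^sub>F r in F. f r \<in> V"
    and lim: "\<And>p e. p \<in> P \<Longrightarrow> 0 < e \<Longrightarrow> \<forall>\<^sub>F r in F. p (\<lambda>x. f r x - l x) < e"
  shows "limitin (lc_topology V P) f l F"
  unfolding limitin_def topspace_lc_topology
proof (intro conjI l allI impI)
  fix U assume "openin (lc_topology V P) U \<and> l \<in> U"
  then have U: "openin (lc_topology V P) U" "l \<in> U" by auto
  obtain G e where G: "finite G" "G \<subseteq> P" "0 < e" "{g \<in> V. \<forall>p\<in>G. p (\<lambda>x. g x - l x) < e} \<subseteq> U"
    using bspec[OF conjunct2[OF U(1)[unfolded openin_lc_topology]] U(2)] by (elim exE conjE)
  have "\<forall>\<^sub>F r in F. \<forall>p\<in>G. p (\<lambda>x. f r x - l x) < e"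
    using G lim by (intro eventually_ball_finite) auto
  with f show "\<forall>\<^sub>F r in F. f r \<in> U" by eventually_elim (use G(4) in auto)
qed

lemma limitin_lc_topologyD:
  assumes V: "lin_space V" and P: "\<And>p. p \<in> P \<Longrightarrow> is_seminorm_on V p" and lim: "limitin (lc_topology V P) f l F"
    and p: "p \<in> P" and e: "0 < e"
  shows "\<forall>\<^sub>F r in F. f r \<in> V \<and> p (\<lambda>x. f r x - l x) < e"
proof -
  have l: "l \<in> V" using lim by (simp add: limitin_def topspace_lc_topology)
  have "openin (lc_topology V P) {g\<in>V. \<forall>p\<in>{p}. p (\<lambda>x. g x - l x) < e}"
    by (rule openin_seminorm_ball[OF V P _ _ l]) (use p in auto)
  moreover have "l \<in> {g\<in>V. \<forall>p\<in>{p}. p (\<lambda>x. g x - l x) < e}"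
    using l e is_seminorm_onD(4)[OF P[OF p] V] by simp
  ultimately have "\<forall>\<^sub>F r in F. f r \<in> {g\<in>V. \<forall>p\<in>{p}. p (\<lambda>x. g x - l x) < e}"
    using lim unfolding limitin_def by blast
  then show ?thesis by simp
qed

lemma atin_within_euclidean: "atin_within euclidean t S = at t within S"
  by (simp add: atin_within_def nhdsin_def at_within_def nhds_def)

lemma continuous_map_lc_topologyI:
  assumes "\<And>t. t \<in> S \<Longrightarrow> limitin (lc_topology V P) f (f t) (at t within S)"
  shows "continuous_map (top_of_set S) (lc_topology V P) f"
  unfolding continuous_map_atin topspace_euclidean_subtopology
proof
  fix t assume t: "t \<in> S"
  have "atin (top_of_set S) t = at t within S"
    using atin_subtopology_within[OF t, of euclidean] unfolding atin_within_euclidean .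
  then show "limitin (lc_topology V P) f (f t) (atin (top_of_set S) t)" using assms[OF t] by (simp only:)
qed

lemma vn_bounded_imp_seminorm_bounded:
  assumes V: "lin_space V" and P: "\<And>p. p \<in> P \<Longrightarrow> is_seminorm_on V p"
    and B: "vn_bounded (lc_topology V P) B" and p: "p \<in> P"
  shows "\<exists>M. \<forall>f\<in>B. p f \<le> M"
proof -
  have BV: "B \<subseteq> V" using B by (simp add: vn_bounded_def topspace_lc_topology)
  let ?U = "{g\<in>V. \<forall>p\<in>{p}. p (\<lambda>x. g x - 0) < 1}"
  have "openin (lc_topology V P) ?U"
    by (rule openin_seminorm_ball[OF V P _ _ lin_spaceD(1)[OF V]]) (use p in auto)
  moreover have "(\<lambda>x. 0) \<in> ?U" using lin_spaceD(1)[OF V] is_seminorm_onD(4)[OF P[OF p] V] by simp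
  ultimately have "\<exists>r>0. \<forall>t>r. \<forall>f\<in>B. (\<lambda>x. f x / complex_of_real t) \<in> ?U"
    using conjunct2[OF B[unfolded vn_bounded_def], rule_format, of ?U] by (simp only: simp_thms)
  then obtain r where r: "0 < r" "\<And>t f. r < t \<Longrightarrow> f \<in> B \<Longrightarrow> (\<lambda>x. f x / complex_of_real t) \<in> ?U"
    by (elim exE conjE) (rule that, assumption, simp only: )
  have "p f \<le> r + 1" if f: "f \<in> B" for f
  proof -
    have "p (\<lambda>x. f x / complex_of_real (r + 1)) < 1" using r(2)[OF _ f, of "r + 1"] by simp
    moreover have "(\<lambda>x. f x / complex_of_real (r + 1)) = (\<lambda>x. complex_of_real (1 / (r + 1)) * f x)"
      by simp
    ultimately have "norm (complex_of_real (1 / (r + 1))) * p f < 1"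
      using is_seminorm_onD(3)[OF P[OF p] V, of f "complex_of_real (1 / (r + 1))"] f BV by auto
    moreover have "norm (complex_of_real (1 / (r + 1))) = 1 / (r + 1)" unfolding norm_of_real using r(1) by simp
    ultimately have "1 / (r + 1) * p f < 1" by (simp only:)
    then show ?thesis using r(1) by (simp add: field_simps)
  qed
  then show ?thesis by blast
qed

text \<open>A basic neighbourhood of 0 involves finitely many seminorms, and division by any number
  beyond the sum of their bounds over \<open>e\<close> moves \<open>B\<close> into it.\<close>

lemma seminorm_bounded_imp_vn_bounded:
  assumes V: "lin_space V" and P: "\<And>p. p \<in> P \<Longrightarrow> is_seminorm_on V p" and B: "B \<subseteq> V"
    and bound: "\<And>p. p \<in> P \<Longrightarrow> \<exists>M. \<forall>f\<in>B. p f \<le> M"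
  shows "vn_bounded (lc_topology V P) B"
  unfolding vn_bounded_def topspace_lc_topology
proof (intro conjI B allI impI)
  fix U assume "openin (lc_topology V P) U \<and> (\<lambda>x. 0) \<in> U"
  then have U: "openin (lc_topology V P) U" "(\<lambda>x. 0) \<in> U" by auto
  obtain F e where F: "finite F" "F \<subseteq> P" "0 < e" "{g \<in> V. \<forall>p\<in>F. p (\<lambda>x. g x - 0) < e} \<subseteq> U"
    using bspec[OF conjunct2[OF U(1)[unfolded openin_lc_topology]] U(2)] by (elim exE conjE)
  have "\<forall>p\<in>F. \<exists>M. \<forall>f\<in>B. p f \<le> M" using bound F(2) by blast
  then obtain M where M: "\<And>p f. p \<in> F \<Longrightarrow> f \<in> B \<Longrightarrow> p f \<le> M p" by metis
  define r where "r = (\<Sum>p\<in>F. \<bar>M p\<bar>) / e + 1"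
  have r: "0 < r" using F(3) by (auto simp: r_def intro!: add_nonneg_pos divide_nonneg_pos sum_nonneg)
  have "(\<lambda>x. f x / complex_of_real t) \<in> U" if t: "r < t" and f: "f \<in> B" for t f
  proof -
    have eq: "(\<lambda>x. f x / complex_of_real t) = (\<lambda>x. complex_of_real (1 / t) * f x)" by simp
    have "p (\<lambda>x. complex_of_real (1 / t) * f x) < e" if p: "p \<in> F" for p
    proof -
      have "p f \<le> (\<Sum>p\<in>F. \<bar>M p\<bar>)"
        using M[OF p f] member_le_sum[of p F "\<lambda>p. \<bar>M p\<bar>"] p F(1) by auto
      also have "\<dots> = (r - 1) * e" using F(3) by (simp add: r_def)
      also have "\<dots> < t * e" using t F(3) by (intro mult_strict_right_mono) auto
      finally have "p f < t * e" .
      moreover have "p (\<lambda>x. complex_of_real (1 / t) * f x) = 1 / t * p f"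
        using is_seminorm_onD(3)[OF P V, of p f "complex_of_real (1 / t)"] p F(2) f B t r by (auto simp: norm_divide)
      moreover have "1 / t * p f < e" using \<open>p f < t * e\<close> t r by (simp add: field_simps)
      ultimately show ?thesis by linarith
    qed
    moreover have "(\<lambda>x. complex_of_real (1 / t) * f x) \<in> V" using lin_spaceD(3)[OF V] f B by blast
    ultimately show ?thesis unfolding eq using F(4) by auto
  qed
  then show "\<exists>r>0. \<forall>t>r. \<forall>f\<in>B. (\<lambda>x. f x / complex_of_real t) \<in> U" using r by blast
qed

section \<open>Dual spaces and the strong topology\<close>

lemma dual_spaceD:
  assumes "u \<in> dual_space (lc_topology V P)"
  shows "f \<in> V \<Longrightarrow> g \<in> V \<Longrightarrow> u (\<lambda>x. f x + g x) = u f + u g" "f \<in> V \<Longrightarrow> u (\<lambda>x. c * f x) = c * u f"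
    "f \<notin> V \<Longrightarrow> u f = 0"
proof -
  note * = assms[unfolded dual_space_def is_linear_on_def topspace_lc_topology mem_Collect_eq]
  show "f \<in> V \<Longrightarrow> g \<in> V \<Longrightarrow> u (\<lambda>x. f x + g x) = u f + u g"
    by (rule bspec[OF bspec[OF conjunct1[OF conjunct1[OF *]]]])
  show "f \<in> V \<Longrightarrow> u (\<lambda>x. c * f x) = c * u f"
    by (rule bspec[OF spec[OF conjunct2[OF conjunct1[OF *]]]])
  show "f \<notin> V \<Longrightarrow> u f = 0" using conjunct2[OF conjunct2[OF *]] by blast
qed

lemma dual_space_diff:
  assumes V: "lin_space V" and u: "u \<in> dual_space (lc_topology V P)" and fg: "f \<in> V" "g \<in> V"
  shows "u (\<lambda>x. f x - g x) = u f - u g"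
proof -
  have "u (\<lambda>x. f x + - 1 * g x) = u f + - 1 * u g"
    unfolding dual_spaceD(1)[OF u fg(1) lin_spaceD(3)[OF V fg(2)]] dual_spaceD(2)[OF u fg(2)] ..
  then show ?thesis by simp
qed

lemma dual_space_sum:
  assumes V: "lin_space V" and u: "u \<in> dual_space (lc_topology V P)" and f: "\<And>i. i \<in> I \<Longrightarrow> f i \<in> V"
  shows "u (\<lambda>x. \<Sum>i\<in>I. f i x) = (\<Sum>i\<in>I. u (f i))"
proof -
  have "u (\<lambda>x. 0) = 0" using dual_spaceD(2)[OF u lin_spaceD(1)[OF V], of 0] by simp
  then show ?thesis using f
    by (induction I rule: infinite_finite_induct) (auto simp: dual_spaceD(1)[OF u] lin_space_sum[OF V])
qed

lemma lin_space_dual_space: "lin_space (dual_space (lc_topology V P))"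
proof -
  have "continuous_map X euclidean (\<lambda>f. c * u f)" if "continuous_map X euclidean u" for X c and u :: "('a \<Rightarrow> complex) \<Rightarrow> complex"
    using continuous_map_compose[OF that, of euclidean "\<lambda>z. c * z"] by (simp add: o_def continuous_intros)
  then show ?thesis
    unfolding lin_space_def dual_space_def is_linear_on_def
    by (simp add: continuous_map_add algebra_simps)
qed

lemma dual_space_bound:
  assumes V: "lin_space V" and P: "\<And>p. p \<in> P \<Longrightarrow> is_seminorm_on V p" and u: "u \<in> dual_space (lc_topology V P)"
  shows "\<exists>F C. finite F \<and> F \<subseteq> P \<and> 0 \<le> C \<and> (\<forall>f\<in>V. norm (u f) \<le> C * (\<Sum>p\<in>F. p f))"
proof (rule continuous_imp_seminorm_bound[OF V P])
  have "continuous_map (lc_topology V P) euclidean u" using u by (simp add: dual_space_def)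
  then show "continuous_map (subtopology (lc_topology V P) V) euclidean u"
    by (rule continuous_map_from_subtopology)
qed (auto simp: lin_spaceD[OF V] dual_spaceD[OF u] norm_mult)

lemma dual_spaceI:
  assumes V: "lin_space V" and P: "\<And>p. p \<in> P \<Longrightarrow> is_seminorm_on V p" and p: "p \<in> P" "0 \<le> C"
    and le: "\<And>f. f \<in> V \<Longrightarrow> norm (u f) \<le> C * p f"
    and add: "\<And>f g. f \<in> V \<Longrightarrow> g \<in> V \<Longrightarrow> u (\<lambda>x. f x + g x) = u f + u g"
    and scale: "\<And>c f. f \<in> V \<Longrightarrow> u (\<lambda>x. c * f x) = c * u f" and off: "\<And>f. f \<notin> V \<Longrightarrow> u f = 0"
  shows "u \<in> dual_space (lc_topology V P)"
proof -
  have "continuous_map (subtopology (lc_topology V P) V) euclidean u"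
  proof (rule seminorm_bound_imp_continuous[OF V P, where F="{p}" and C=C])
    show "norm (u g - u f) \<le> C * (\<Sum>p\<in>{p}. p (\<lambda>x. g x - f x))" if "f \<in> V" "g \<in> V" for f g
      using le[OF lin_spaceD(4)[OF V that(2,1)]] add[OF that(2) lin_spaceD(3)[OF V that(1), of "- 1"]] scale[OF that(1), of "- 1"]
      by simp
  qed (use p in auto)
  then have "continuous_map (lc_topology V P) euclidean u"
    using subtopology_topspace[of "lc_topology V P"] by (simp add: topspace_lc_topology)
  then show ?thesis using add scale off by (simp add: dual_space_def is_linear_on_def topspace_lc_topology)
qed

text \<open>A continuous functional is dominated by finitely many generating seminorms, each of them
  bounded on \<open>B\<close>. This makes the suprema that generate the strong topology
  finite.\<close>

lemma vn_bounded_dual_bdd: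
  assumes V: "lin_space V" and P: "\<And>p. p \<in> P \<Longrightarrow> is_seminorm_on V p" and u: "u \<in> dual_space (lc_topology V P)"
    and B: "vn_bounded (lc_topology V P) B"
  shows "bdd_above ((\<lambda>f. norm (u f)) ` B)"
proof -
  obtain F C where F: "finite F" "F \<subseteq> P" "0 \<le> C" "\<And>f. f \<in> V \<Longrightarrow> norm (u f) \<le> C * (\<Sum>p\<in>F. p f)"
    using dual_space_bound[OF V P u] by blast
  have "\<forall>p\<in>F. \<exists>M. \<forall>f\<in>B. p f \<le> M" using vn_bounded_imp_seminorm_bounded[OF V P B] F(2) by blast
  then obtain M where M: "\<And>p f. p \<in> F \<Longrightarrow> f \<in> B \<Longrightarrow> p f \<le> M p" by metis
  have BV: "B \<subseteq> V" using B by (simp add: vn_bounded_def topspace_lc_topology)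
  have "norm (u f) \<le> C * (\<Sum>p\<in>F. M p)" if "f \<in> B" for f
    using F(4)[of f] mult_left_mono[OF sum_mono[of F "\<lambda>p. p f" M] F(3)] M that BV by force
  then show ?thesis by (rule bdd_aboveI2)
qed

lemma strong_dual_seminorm:
  assumes V: "lin_space V" and P: "\<And>p. p \<in> P \<Longrightarrow> is_seminorm_on V p"
    and B: "vn_bounded (lc_topology V P) B" "B \<noteq> {}"
  shows "is_seminorm_on (dual_space (lc_topology V P)) (\<lambda>u. SUP f\<in>B. norm (u f))"
proof (rule is_seminorm_on_SUP[OF lin_space_dual_space B(2) vn_bounded_dual_bdd[OF V P _ B(1)]])
  show "is_seminorm_on (dual_space (lc_topology V P)) (\<lambda>u. norm (u f))" for f
    unfolding is_seminorm_on_def by (intro conjI ballI allI) (simp_all add: norm_mult norm_triangle_ineq)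
qed

text \<open>Convergence on bounded sets is phrased by a bound for every element, which is also
  meaningful on the empty set, where the \<open>SUP\<close> is not. Half of \<open>e\<close> turns
  the weak inequality into the strict one.\<close>

lemma limitin_strong_dualI:
  assumes V: "lin_space V" and P: "\<And>p. p \<in> P \<Longrightarrow> is_seminorm_on V p"
    and l: "l \<in> dual_space (lc_topology V P)" and f: "\<forall>\<^sub>F r in F. f r \<in> dual_space (lc_topology V P)"
    and lim: "\<And>B e. vn_bounded (lc_topology V P) B \<Longrightarrow> 0 < e \<Longrightarrow> \<forall>\<^sub>F r in F. \<forall>\<phi>\<in>B. norm (f r \<phi> - l \<phi>) \<le> e"
  shows "limitin (strong_dual (lc_topology V P)) f l F"
  unfolding strong_dual_def
proof (rule limitin_lc_topologyI[OF l f])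
  fix p :: "(('a \<Rightarrow> complex) \<Rightarrow> complex) \<Rightarrow> real" and e :: real
  assume "p \<in> {\<lambda>u. SUP f\<in>B. norm (u f) |B. vn_bounded (lc_topology V P) B \<and> B \<noteq> {}}" and e: "0 < e"
  then obtain B where B: "vn_bounded (lc_topology V P) B" "B \<noteq> {}" and p: "p = (\<lambda>u. SUP f\<in>B. norm (u f))" by blast
  have "\<forall>\<^sub>F r in F. \<forall>\<phi>\<in>B. norm (f r \<phi> - l \<phi>) \<le> e / 2" using lim[OF B(1), of "e / 2"] e by simp
  then show "\<forall>\<^sub>F r in F. p (\<lambda>x. f r x - l x) < e"
  proof eventually_elim
    case (elim r)
    then have "p (\<lambda>x. f r x - l x) \<le> e / 2" unfolding p by (intro cSUP_least[OF B(2)]) blast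
    then show ?case using e by simp
  qed
qed

lemma limitin_strong_dualD:
  assumes V: "lin_space V" and P: "\<And>p. p \<in> P \<Longrightarrow> is_seminorm_on V p"
    and lim: "limitin (strong_dual (lc_topology V P)) f l F" and B: "vn_bounded (lc_topology V P) B" and e: "0 < e"
  shows "\<forall>\<^sub>F r in F. \<forall>\<phi>\<in>B. norm (f r \<phi> - l \<phi>) \<le> e"
proof (cases "B = {}")
  case False
  let ?D = "dual_space (lc_topology V P)"
  let ?P = "{\<lambda>u. SUP f\<in>B. norm (u f) |B. vn_bounded (lc_topology V P) B \<and> B \<noteq> {}}"
  note ld = lin_space_dual_space[of V P]
  have sem: "is_seminorm_on ?D p" if "p \<in> ?P" for p
    using that strong_dual_seminorm[OF V P] by blast
  have l: "l \<in> ?D" using lim by (simp add: limitin_def strong_dual_def topspace_lc_topology)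
  have "(\<lambda>u. SUP f\<in>B. norm (u f)) \<in> ?P" using B False by blast
  from limitin_lc_topologyD[OF ld sem lim[unfolded strong_dual_def] this e]
  have "\<forall>\<^sub>F r in F. f r \<in> ?D \<and> (SUP \<phi>\<in>B. norm (f r \<phi> - l \<phi>)) < e" .
  then show ?thesis
  proof (rule eventually_mono)
    fix r assume r: "f r \<in> ?D \<and> (SUP \<phi>\<in>B. norm (f r \<phi> - l \<phi>)) < e"
    have bdd: "bdd_above ((\<lambda>\<phi>. norm (f r \<phi> - l \<phi>)) ` B)"
      using vn_bounded_dual_bdd[OF V P lin_spaceD(4)[OF ld conjunct1[OF r] l] B] by simp
    show "\<forall>\<phi>\<in>B. norm (f r \<phi> - l \<phi>) \<le> e"
      using cSUP_upper[OF _ bdd] r by fastforce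
  qed
qed simp

section \<open>Gevrey spaces and ultradistributions\<close>

lemma partial_deriv_lin_comb:
  fixes f g :: "real ^ 'n::finite \<Rightarrow> complex"
  assumes "f differentiable (at x)" "g differentiable (at x)"
  shows "partial_deriv k (\<lambda>x. a * f x + b * g x) x = a * partial_deriv k f x + b * partial_deriv k g x"
proof -
  have "((\<lambda>x. a * f x + b * g x) has_derivative (\<lambda>h. a * frechet_derivative f (at x) h + b * frechet_derivative g (at x) h)) (at x)"
    by (intro derivative_intros assms[unfolded frechet_derivative_works])
  from frechet_derivative_at[OF this] show ?thesis by (simp add: partial_deriv_def fun_eq_iff)
qed

lemma foldr_partial_deriv_lin_comb:
  fixes f g :: "real ^ 'n::finite \<Rightarrow> complex"
  assumes "C_infinity f" "C_infinity g"
  shows "foldr partial_deriv ks (\<lambda>x. a * f x + b * g x) = (\<lambda>x. a * foldr partial_deriv ks f x + b * foldr partial_deriv ks g x)"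
proof (induction ks)
  case (Cons k ks)
  have "partial_deriv k (\<lambda>x. a * foldr partial_deriv ks f x + b * foldr partial_deriv ks g x) x
      = a * partial_deriv k (foldr partial_deriv ks f) x + b * partial_deriv k (foldr partial_deriv ks g) x" for x
    by (rule partial_deriv_lin_comb) (use assms in \<open>auto simp: C_infinity_def\<close>)
  then show ?case by (simp add: Cons fun_eq_iff)
qed simp

lemma C_infinity_lin_comb:
  fixes f g :: "real ^ 'n::finite \<Rightarrow> complex"
  assumes f: "C_infinity f" and g: "C_infinity g"
  shows "C_infinity (\<lambda>x. a * f x + b * g x)"
  unfolding C_infinity_def foldr_partial_deriv_lin_comb[OF assms]
proof (intro allI)
  fix ks x
  have "foldr partial_deriv ks f differentiable (at x)" "foldr partial_deriv ks g differentiable (at x)"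
    using f g by (auto simp: C_infinity_def)
  then show "(\<lambda>x. a * foldr partial_deriv ks f x + b * foldr partial_deriv ks g x) differentiable (at x)"
    by (intro derivative_intros)
qed

lemma multi_deriv_lin_comb:
  fixes f g :: "real ^ 'n::finite \<Rightarrow> complex"
  assumes "C_infinity f" "C_infinity g"
  shows "multi_deriv \<beta> (\<lambda>x. a * f x + b * g x) x = a * multi_deriv \<beta> f x + b * multi_deriv \<beta> g x"
proof -
  obtain ks where ks: "multi_deriv \<beta> = foldr partial_deriv ks" using multi_deriv_eq by metis
  show ?thesis unfolding ks foldr_partial_deriv_lin_comb[OF assms] ..
qed

lemma gevrey_lin_comb:
  fixes f g :: "real ^ 'n::finite \<Rightarrow> complex"
  assumes f: "f \<in> gevrey s" and g: "g \<in> gevrey s"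
  shows "(\<lambda>x. a * f x + b * g x) \<in> gevrey s"
proof -
  have C: "C_infinity f" "C_infinity g" using f g by (auto simp: gevrey_def)
  have "\<exists>E>0. \<forall>\<beta>. \<forall>x\<in>K. norm (multi_deriv \<beta> (\<lambda>x. a * f x + b * g x) x) \<le> E * A ^ multi_abs \<beta> * multi_fact \<beta> powr s"
    if K: "compact K" and A: "0 < A" for K A
  proof -
    let ?m = "\<lambda>\<beta>. A ^ multi_abs \<beta> * multi_fact \<beta> powr s"
    define E where "E = norm a * gevrey_seminorm s K A f + norm b * gevrey_seminorm s K A g"
    have le: "norm (multi_deriv \<beta> (\<lambda>x. a * f x + b * g x) x) \<le> (\<bar>E\<bar> + 1) * ?m \<beta>" if x: "x \<in> K" for \<beta> x
    proof -
      have m0: "0 \<le> ?m \<beta>" using A by simp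
      have "norm (multi_deriv \<beta> (\<lambda>x. a * f x + b * g x) x) \<le> norm a * norm (multi_deriv \<beta> f x) + norm b * norm (multi_deriv \<beta> g x)"
        unfolding multi_deriv_lin_comb[OF C] by (metis norm_mult norm_triangle_ineq)
      also have "\<dots> \<le> norm a * (gevrey_seminorm s K A f * ?m \<beta>) + norm b * (gevrey_seminorm s K A g * ?m \<beta>)"
        by (intro add_mono mult_left_mono gevrey_seminorm_bounds(1)[OF f K A x] gevrey_seminorm_bounds(1)[OF g K A x]) auto
      also have "\<dots> = E * ?m \<beta>" by (simp add: E_def algebra_simps)
      also have "\<dots> \<le> (\<bar>E\<bar> + 1) * ?m \<beta>" by (intro mult_right_mono m0) auto
      finally show ?thesis .
    qed
    then show ?thesis by (intro exI[of _ "\<bar>E\<bar> + 1"]) (auto simp: mult.assoc)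
  qed
  then show ?thesis using C_infinity_lin_comb[OF C] unfolding gevrey_def by blast
qed

section \<open>The Gevrey spaces as locally convex spaces\<close>

lemma osc_zero_fun: "osc (\<lambda>\<xi>. 0) = (\<lambda>x. 0)"
  by (simp add: fun_eq_iff)

lemma lin_space_gevrey:
  assumes "0 < s"
  shows "lin_space (gevrey s :: (real ^ 'n::finite \<Rightarrow> complex) set)"
  unfolding lin_space_def
proof (intro conjI ballI allI)
  show 0: "(\<lambda>x. 0) \<in> (gevrey s :: (real ^ 'n \<Rightarrow> complex) set)"
    using osc_in_gevrey[OF assms decaying_0] unfolding osc_zero_fun .
  fix f :: "real ^ 'n \<Rightarrow> complex" assume f: "f \<in> gevrey s"
  show "(\<lambda>x. f x + g x) \<in> gevrey s" if "g \<in> gevrey s" for g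
    using gevrey_lin_comb[OF f that, of 1 1] by simp
  show "(\<lambda>x. c * f x) \<in> gevrey s" for c
    using gevrey_lin_comb[OF f f, of c 0] by simp
qed

lemma gevrey_c_iff: "f \<in> gevrey_c s \<longleftrightarrow> f \<in> gevrey s \<and> bounded {x. f x \<noteq> 0}"
  by (simp add: gevrey_c_def compact_closure)

lemma lin_space_gevrey_c:
  assumes "0 < s"
  shows "lin_space (gevrey_c s :: (real ^ 'n::finite \<Rightarrow> complex) set)"
  unfolding lin_space_def gevrey_c_iff
proof (intro conjI ballI allI)
  note g = lin_spaceD[OF lin_space_gevrey[OF assms]]
  show "(\<lambda>x. 0) \<in> (gevrey s :: (real ^ 'n \<Rightarrow> complex) set)" by (rule g)
  fix f :: "real ^ 'n \<Rightarrow> complex" assume "f \<in> gevrey_c s"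
  then have f: "f \<in> gevrey s" "bounded {x. f x \<noteq> 0}" by (auto simp: gevrey_c_iff)
  {
    fix h :: "real ^ 'n \<Rightarrow> complex" assume "h \<in> gevrey_c s"
    then have h: "h \<in> gevrey s" "bounded {x. h x \<noteq> 0}" by (auto simp: gevrey_c_iff)
    show "(\<lambda>x. f x + h x) \<in> gevrey s" by (intro g f h)
    show "bounded {x. f x + h x \<noteq> 0}"
      by (rule bounded_subset[OF iffD2[OF bounded_Un conjI[OF f(2) h(2)]]]) auto
  next
    fix c
    show "(\<lambda>x. c * f x) \<in> gevrey s" by (intro g f)
    show "bounded {x. c * f x \<noteq> 0}" by (rule bounded_subset[OF f(2)]) auto
  }
qed simp

lemma lin_space_gevrey_in:
  assumes "0 < s"
  shows "lin_space (gevrey_in s K :: (real ^ 'n::finite \<Rightarrow> complex) set)"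
  unfolding lin_space_def
proof (intro conjI ballI allI)
  note g = lin_spaceD[OF lin_space_gevrey[OF assms]]
  show "(\<lambda>x. 0) \<in> (gevrey_in s K :: (real ^ 'n \<Rightarrow> complex) set)" by (simp add: gevrey_in_def g)
  fix f :: "real ^ 'n \<Rightarrow> complex" assume "f \<in> gevrey_in s K"
  then have f: "f \<in> gevrey s" "closure {x. f x \<noteq> 0} \<subseteq> K" by (auto simp: gevrey_in_def)
  show "(\<lambda>x. f x + h x) \<in> gevrey_in s K" if "h \<in> gevrey_in s K" for h
  proof -
    have h: "h \<in> gevrey s" "closure {x. h x \<noteq> 0} \<subseteq> K" using that by (auto simp: gevrey_in_def)
    have "closure {x. f x + h x \<noteq> 0} \<subseteq> closure ({x. f x \<noteq> 0} \<union> {x. h x \<noteq> 0})"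
      by (rule closure_mono) auto
    then show ?thesis using f h g(2)[OF f(1) h(1)] by (auto simp: gevrey_in_def)
  qed
  show "(\<lambda>x. c * f x) \<in> gevrey_in s K" for c
    using f g(3)[OF f(1)] closure_mono[of "{x. c * f x \<noteq> 0}" "{x. f x \<noteq> 0}"] by (auto simp: gevrey_in_def)
qed

lemma gevrey_in_subset_gevrey_c: "compact K \<Longrightarrow> gevrey_in s K \<subseteq> gevrey_c s"
  unfolding gevrey_in_def gevrey_c_def
  by (auto simp: compact_eq_bounded_closed intro: bounded_subset)

definition gevrey_sems :: "real \<Rightarrow> ((real ^ 'n::finite \<Rightarrow> complex) \<Rightarrow> real) set" where
  "gevrey_sems s = {gevrey_seminorm s K A | K A. compact K \<and> K \<noteq> {} \<and> 0 < A}"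

definition gevrey_c_sems :: "real \<Rightarrow> ((real ^ 'n::finite \<Rightarrow> complex) \<Rightarrow> real) set" where
  "gevrey_c_sems s = {q. is_seminorm_on (gevrey_c s) q \<and>
     (\<forall>K. compact K \<longrightarrow> continuous_map (subtopology (gevrey_top s) (gevrey_in s K)) euclidean q)}"

lemma gevrey_top_eq: "gevrey_top s = lc_topology (gevrey s) (gevrey_sems s)"
  by (simp add: gevrey_top_def gevrey_sems_def)

lemma gevrey_c_top_eq: "gevrey_c_top s = lc_topology (gevrey_c s) (gevrey_c_sems s)"
  by (simp add: gevrey_c_top_def gevrey_c_sems_def)

lemma gevrey_sems_seminorm:
  fixes p :: "(real ^ 'n::finite \<Rightarrow> complex) \<Rightarrow> real"
  assumes s: "0 < s" and p: "p \<in> gevrey_sems s"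
  shows "is_seminorm_on (gevrey s) p"
proof -
  obtain K A where K: "compact K" "K \<noteq> {}" and A: "0 < A" and p: "p = gevrey_seminorm s K A"
    using p by (auto simp: gevrey_sems_def)
  define q :: "('n \<Rightarrow> nat) \<times> (real ^ 'n) \<Rightarrow> (real ^ 'n \<Rightarrow> complex) \<Rightarrow> real"
    where "q i f = norm (multi_deriv (fst i) f (snd i)) / (A ^ multi_abs (fst i) * multi_fact (fst i) powr s)" for i f
  have m: "0 < A ^ multi_abs \<beta> * multi_fact \<beta> powr s" for \<beta> :: "'n \<Rightarrow> nat"
    using A by (simp add: multi_fact_def)
  have "p = (\<lambda>f. SUP i\<in>UNIV \<times> K. q i f)"
    unfolding p fun_eq_iff gevrey_seminorm_def q_def by (simp add: case_prod_unfold)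
  moreover have "is_seminorm_on (gevrey s) (\<lambda>f. SUP i\<in>UNIV \<times> K. q i f)"
  proof (rule is_seminorm_on_SUP[OF lin_space_gevrey[OF s]])
    fix f :: "real ^ 'n \<Rightarrow> complex" assume f: "f \<in> gevrey s"
    show "bdd_above ((\<lambda>i. q i f) ` (UNIV \<times> K))"
    proof (rule bdd_aboveI2)
      fix i :: "('n \<Rightarrow> nat) \<times> (real ^ 'n)" assume "i \<in> UNIV \<times> K"
      then have "snd i \<in> K" by auto
      from gevrey_seminorm_bounds(1)[OF f K(1) A this, of "fst i"]
      show "q i f \<le> gevrey_seminorm s K A f" unfolding q_def pos_divide_le_eq[OF m] .
    qed
  next
    fix i :: "('n \<Rightarrow> nat) \<times> (real ^ 'n)"
    show "is_seminorm_on (gevrey s) (q i)"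
      unfolding is_seminorm_on_def
    proof (intro conjI ballI allI)
      fix f :: "real ^ 'n \<Rightarrow> complex" assume "f \<in> gevrey s"
      then have f: "C_infinity f" by (simp add: gevrey_def)
      show "0 \<le> q i f" unfolding q_def using m[of "fst i"] by simp
      show "q i (\<lambda>x. c * f x) = norm c * q i f" for c
        using multi_deriv_lin_comb[OF f f, of "fst i" c 0] by (simp add: q_def norm_mult)
      show "q i (\<lambda>x. f x + g x) \<le> q i f + q i g" if "g \<in> gevrey s" for g
      proof -
        have g: "C_infinity g" using that by (simp add: gevrey_def)
        show ?thesis
          using multi_deriv_lin_comb[OF f g, of "fst i" 1 1] m[of "fst i"]
          unfolding q_def add_divide_distrib[symmetric]
          by (intro divide_right_mono) (simp_all add: norm_triangle_ineq)
      qed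
    qed
  qed (use K in auto)
  ultimately show ?thesis by simp
qed

text \<open>Finitely many seminorms share one rate of decay \<open>N\<close>.\<close>

lemma sum_decay_le:
  fixes p :: "'a \<Rightarrow> (real ^ 'n::finite \<Rightarrow> complex) \<Rightarrow> real"
  assumes "finite F" and "\<And>i. i \<in> F \<Longrightarrow> \<exists>N C. 0 \<le> C \<and> (\<forall>(h :: real ^ 'n \<Rightarrow> complex) D. Q h \<longrightarrow>
    (\<forall>\<xi>. norm (h \<xi>) \<le> D * exp (- N * weight s \<xi>)) \<longrightarrow> p i h \<le> C * D)"
  shows "\<exists>N C. 0 \<le> N \<and> 0 \<le> C \<and> (\<forall>(h :: real ^ 'n \<Rightarrow> complex) D. Q h \<longrightarrow>
    (\<forall>\<xi>. norm (h \<xi>) \<le> D * exp (- N * weight s \<xi>)) \<longrightarrow> (\<Sum>i\<in>F. p i h) \<le> C * D)"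
  using assms
proof (induction F)
  case empty
  show ?case by (intro exI[of _ 0]) auto
next
  case (insert i F)
  obtain N1 C1 where 1: "0 \<le> C1" "\<And>(h :: real ^ 'n \<Rightarrow> complex) D. Q h \<Longrightarrow> \<forall>\<xi>. norm (h \<xi>) \<le> D * exp (- N1 * weight s \<xi>) \<Longrightarrow> p i h \<le> C1 * D"
    using insert.prems by blast
  obtain N2 C2 where 2: "0 \<le> N2" "0 \<le> C2"
    "\<And>(h :: real ^ 'n \<Rightarrow> complex) D. Q h \<Longrightarrow> \<forall>\<xi>. norm (h \<xi>) \<le> D * exp (- N2 * weight s \<xi>) \<Longrightarrow> (\<Sum>i\<in>F. p i h) \<le> C2 * D"
    using insert.IH insert.prems by blast
  define N where "N = max N1 N2"
  show ?case
  proof (rule exI[of _ N], rule exI[of _ "C1 + C2"], intro conjI allI impI)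
    fix h :: "real ^ 'n \<Rightarrow> complex" and D
    assume h: "Q h" and le: "\<forall>\<xi>. norm (h \<xi>) \<le> D * exp (- N * weight s \<xi>)"
    have "0 \<le> D" using order_trans[OF norm_ge_zero le[rule_format, of 0]] by (simp add: zero_le_mult_iff)
    have le': "\<forall>\<xi>. norm (h \<xi>) \<le> D * exp (- M * weight s \<xi>)" if "M \<le> N" for M
    proof
      fix \<xi> :: "real ^ 'n"
      have "M * weight s \<xi> \<le> N * weight s \<xi>" using that weight_nonneg by (intro mult_right_mono)
      then have "D * exp (- N * weight s \<xi>) \<le> D * exp (- M * weight s \<xi>)" using \<open>0 \<le> D\<close> by (intro mult_left_mono) auto
      then show "norm (h \<xi>) \<le> D * exp (- M * weight s \<xi>)" using le by (meson order_trans)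
    qed
    have "p i h \<le> C1 * D" by (rule 1(2)[OF h le']) (simp add: N_def)
    moreover have "(\<Sum>i\<in>F. p i h) \<le> C2 * D" by (rule 2(3)[OF h le']) (simp add: N_def)
    ultimately show "(\<Sum>i\<in>insert i F. p i h) \<le> (C1 + C2) * D"
      using insert.hyps by (simp add: distrib_right)
  qed (use 1(1) 2(1,2) in \<open>auto simp: N_def\<close>)
qed

section \<open>Continuity estimates on the Fourier side\<close>

lemma gevrey_sems_osc_le:
  assumes s: "0 < s" and F: "finite F" "F \<subseteq> gevrey_sems s"
  shows "\<exists>N C. 0 \<le> N \<and> 0 \<le> C \<and> (\<forall>(h :: real ^ 'n::finite \<Rightarrow> complex) D. decaying s h \<longrightarrow>
    (\<forall>\<xi>. norm (h \<xi>) \<le> D * exp (- N * weight s \<xi>)) \<longrightarrow> (\<Sum>p\<in>F. p (osc h)) \<le> C * D)"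
proof (rule sum_decay_le[OF F(1)])
  fix p :: "(real ^ 'n \<Rightarrow> complex) \<Rightarrow> real" assume "p \<in> F"
  then have "p \<in> gevrey_sems s" using F(2) by blast
  then obtain K A where KA: "compact K" "K \<noteq> {}" "0 < A" and p: "p = gevrey_seminorm s K A"
    by (auto simp: gevrey_sems_def)
  obtain N C where 1: "0 \<le> C" "\<And>(h :: real ^ 'n \<Rightarrow> complex) D K. decaying s h \<Longrightarrow> K \<noteq> {} \<Longrightarrow>
      \<forall>\<xi>. norm (h \<xi>) \<le> D * exp (- N * weight s \<xi>) \<Longrightarrow> gevrey_seminorm s K A (osc h) \<le> C * D"
    using gevrey_seminorm_osc_le[OF s KA(3)] by blast
  show "\<exists>N C. 0 \<le> C \<and> (\<forall>h D. decaying s h \<longrightarrow> (\<forall>\<xi>. norm (h \<xi>) \<le> D * exp (- N * weight s \<xi>)) \<longrightarrow> p (osc h) \<le> C * D)"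
    unfolding p using 1(1) 1(2)[OF _ KA(2)] by blast
qed

text \<open>Nothing is said about the support of \<open>osc h\<close>, because a compactly supported
  ultradistribution acts on all of \<open>gevrey s\<close>.\<close>

lemma ultradistr_compact_osc_le:
  assumes s: "0 < s" and u: "u \<in> ultradistr_compact s"
  shows "\<exists>N C. 0 \<le> N \<and> 0 \<le> C \<and> (\<forall>(h :: real ^ 'n::finite \<Rightarrow> complex) D. decaying s h \<longrightarrow>
    (\<forall>\<xi>. norm (h \<xi>) \<le> D * exp (- N * weight s \<xi>)) \<longrightarrow> norm (u (osc h)) \<le> C * D)"
proof -
  obtain F C where F: "finite F" "F \<subseteq> gevrey_sems s" "0 \<le> C" "\<And>f. f \<in> gevrey s \<Longrightarrow> norm (u f) \<le> C * (\<Sum>p\<in>F. p f)"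
    using dual_space_bound[OF lin_space_gevrey[OF s] gevrey_sems_seminorm[OF s], where u=u and P="gevrey_sems s"] u
    unfolding ultradistr_compact_def gevrey_top_eq by blast
  obtain N C' where N: "0 \<le> N" "0 \<le> C'" "\<And>(h :: real ^ 'n \<Rightarrow> complex) D. decaying s h \<Longrightarrow>
      \<forall>\<xi>. norm (h \<xi>) \<le> D * exp (- N * weight s \<xi>) \<Longrightarrow> (\<Sum>p\<in>F. p (osc h)) \<le> C' * D"
    using gevrey_sems_osc_le[OF s F(1,2)] by blast
  have "norm (u (osc h)) \<le> C * C' * D" if h: "decaying s h" "\<forall>\<xi>. norm (h \<xi>) \<le> D * exp (- N * weight s \<xi>)" for h D
    using F(4)[OF osc_in_gevrey[OF s h(1)]] mult_left_mono[OF N(3)[OF h] F(3)] by (simp add: mult.assoc)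
  then show ?thesis using N(1,2) F(3) by (intro exI[of _ N] exI[of _ "C * C'"]) auto
qed

text \<open>Continuity of \<open>q\<close> is given on functions supported in a fixed compact set,
  so \<open>N\<close> and \<open>C\<close> depend on \<open>K\<close>. This is why the uniqueness
  argument asks for a support that is uniform in time.\<close>

lemma gevrey_c_sems_osc_le:
  fixes q :: "(real ^ 'n::finite \<Rightarrow> complex) \<Rightarrow> real"
  assumes s: "0 < s" and q: "q \<in> gevrey_c_sems s" and K: "compact K"
  shows "\<exists>N C. 0 \<le> N \<and> 0 \<le> C \<and> (\<forall>(h :: real ^ 'n \<Rightarrow> complex) D. decaying s h \<longrightarrow> osc h \<in> gevrey_in s K \<longrightarrow>
    (\<forall>\<xi>. norm (h \<xi>) \<le> D * exp (- N * weight s \<xi>)) \<longrightarrow> q (osc h) \<le> C * D)"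
proof -
  have sub: "gevrey_in s K \<subseteq> gevrey_c s" using gevrey_in_subset_gevrey_c[OF K] .
  have sem: "is_seminorm_on (gevrey_c s) q" and cont: "continuous_map (subtopology (lc_topology (gevrey s) (gevrey_sems s)) (gevrey_in s K)) euclidean q"
    using q K by (auto simp: gevrey_c_sems_def gevrey_top_eq)
  note qD = is_seminorm_onD[OF sem lin_space_gevrey_c[OF s]]
  note l = lin_spaceD[OF lin_space_gevrey_in[OF s]]
  have "\<exists>F C. finite F \<and> F \<subseteq> gevrey_sems s \<and> 0 \<le> C \<and> (\<forall>f\<in>gevrey_in s K. norm (q f) \<le> C * (\<Sum>p\<in>F. p f))"
  proof (rule continuous_imp_seminorm_bound[OF lin_space_gevrey[OF s] gevrey_sems_seminorm[OF s] _ _ _ cont])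
    show "norm (q (\<lambda>x. c * f x)) = norm c * norm (q f)" if "f \<in> gevrey_in s K" for c f
      using qD(3)[OF subsetD[OF sub that], of c] by (simp add: abs_mult)
  qed (use l(1,3) in \<open>auto simp: gevrey_in_def\<close>)
  then obtain F C where F: "finite F" "F \<subseteq> gevrey_sems s" "0 \<le> C" "\<And>f. f \<in> gevrey_in s K \<Longrightarrow> norm (q f) \<le> C * (\<Sum>p\<in>F. p f)"
    by blast
  obtain N C' where N: "0 \<le> N" "0 \<le> C'" "\<And>(h :: real ^ 'n \<Rightarrow> complex) D. decaying s h \<Longrightarrow>
      \<forall>\<xi>. norm (h \<xi>) \<le> D * exp (- N * weight s \<xi>) \<Longrightarrow> (\<Sum>p\<in>F. p (osc h)) \<le> C' * D"
    using gevrey_sems_osc_le[OF s F(1,2)] by blast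
  have "q (osc h) \<le> C * C' * D" if h: "decaying s h" "\<forall>\<xi>. norm (h \<xi>) \<le> D * exp (- N * weight s \<xi>)" "osc h \<in> gevrey_in s K" for h D
    using F(4)[OF h(3)] mult_left_mono[OF N(3)[OF h(1,2)] F(3)] by (simp add: mult.assoc)
  then show ?thesis using N(1,2) F(3) by (intro exI[of _ N] exI[of _ "C * C'"]) auto
qed

lemma gevrey_c_sems_seminorm: "q \<in> gevrey_c_sems s \<Longrightarrow> is_seminorm_on (gevrey_c s) q"
  by (simp add: gevrey_c_sems_def)

lemma ultradistr_osc_le:
  assumes s: "0 < s" and K: "compact K" and u: "u \<in> dual_space (gevrey_c_top s)"
  shows "\<exists>N C. 0 \<le> N \<and> 0 \<le> C \<and> (\<forall>(h :: real ^ 'n::finite \<Rightarrow> complex) D. decaying s h \<longrightarrow> osc h \<in> gevrey_in s K \<longrightarrow>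
    (\<forall>\<xi>. norm (h \<xi>) \<le> D * exp (- N * weight s \<xi>)) \<longrightarrow> norm (u (osc h)) \<le> C * D)"
proof -
  obtain F C where F: "finite F" "F \<subseteq> gevrey_c_sems s" "0 \<le> C" "\<And>f. f \<in> gevrey_c s \<Longrightarrow> norm (u f) \<le> C * (\<Sum>p\<in>F. p f)"
    using dual_space_bound[OF lin_space_gevrey_c[OF s] gevrey_c_sems_seminorm, where u=u and P="gevrey_c_sems s"] u
    unfolding gevrey_c_top_eq by blast
  have "\<exists>N C. 0 \<le> N \<and> 0 \<le> C \<and> (\<forall>(h :: real ^ 'n \<Rightarrow> complex) D. decaying s h \<and> osc h \<in> gevrey_in s K \<longrightarrow>
      (\<forall>\<xi>. norm (h \<xi>) \<le> D * exp (- N * weight s \<xi>)) \<longrightarrow> (\<Sum>p\<in>F. p (osc h)) \<le> C * D)"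
  proof (rule sum_decay_le[OF F(1)])
    fix p assume "p \<in> F"
    then have "p \<in> gevrey_c_sems s" using F(2) by blast
    from gevrey_c_sems_osc_le[OF s this K]
    show "\<exists>N C. 0 \<le> C \<and> (\<forall>h D. decaying s h \<and> osc h \<in> gevrey_in s K \<longrightarrow>
      (\<forall>\<xi>. norm (h \<xi>) \<le> D * exp (- N * weight s \<xi>)) \<longrightarrow> p (osc h) \<le> C * D)"
      by blast
  qed
  then obtain N C' where N: "0 \<le> N" "0 \<le> C'" "\<And>(h :: real ^ 'n \<Rightarrow> complex) D. decaying s h \<Longrightarrow> osc h \<in> gevrey_in s K \<Longrightarrow>
      \<forall>\<xi>. norm (h \<xi>) \<le> D * exp (- N * weight s \<xi>) \<Longrightarrow> (\<Sum>p\<in>F. p (osc h)) \<le> C' * D"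
    by blast
  have "norm (u (osc h)) \<le> C * C' * D" if h: "decaying s h" "osc h \<in> gevrey_in s K" "\<forall>\<xi>. norm (h \<xi>) \<le> D * exp (- N * weight s \<xi>)" for h D
    using F(4)[OF subsetD[OF gevrey_in_subset_gevrey_c[OF K] h(2)]] mult_left_mono[OF N(3)[OF h] F(3)] by (simp add: mult.assoc)
  then show ?thesis using N(1,2) F(3) by (intro exI[of _ N] exI[of _ "C * C'"]) auto
qed

text \<open>A weighted supremum on the Fourier side. By the decay of Fourier transforms it is one of
  the continuous seminorms of \<open>gevrey_c_top\<close>, and the functionals below are estimated
  by it alone.\<close>

definition ftq :: "real \<Rightarrow> real \<Rightarrow> (real ^ 'n::finite \<Rightarrow> complex) \<Rightarrow> real" where
  "ftq s N \<phi> = (SUP \<xi>. exp (N * weight s \<xi>) * norm (ft \<phi> \<xi>))"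

lemma ft_add: "0 < s \<Longrightarrow> \<phi> \<in> gevrey_c s \<Longrightarrow> \<psi> \<in> gevrey_c s \<Longrightarrow> ft (\<lambda>x. \<phi> x + \<psi> x) \<xi> = ft \<phi> \<xi> + ft \<psi> \<xi>"
  unfolding ft_def by (intro osc_add gevrey_c_decaying)

lemma ft_cmult: "ft (\<lambda>x. c * \<phi> x) \<xi> = c * ft \<phi> \<xi>"
  unfolding ft_def by (rule osc_cmult)

lemma ft_weight_le:
  fixes K :: "(real ^ 'n::finite) set"
  assumes s: "0 < s" and N: "0 < N" and K: "compact K" "K \<noteq> {}"
  shows "\<exists>A>0. \<exists>C\<ge>0. \<forall>\<phi>\<in>gevrey_in s K. \<forall>\<xi>. exp (N * weight s \<xi>) * norm (ft \<phi> \<xi>) \<le> C * gevrey_seminorm s K A \<phi>"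
proof -
  obtain A C where AC: "0 < A" "0 \<le> C" "\<And>\<phi> \<xi>. \<phi> \<in> gevrey_in s K \<Longrightarrow> norm (ft \<phi> \<xi>) \<le> C * gevrey_seminorm s K A \<phi> * exp (- N * weight s \<xi>)"
    using ft_decay[OF s N K] by blast
  have "exp (N * weight s \<xi>) * norm (ft \<phi> \<xi>) \<le> C * gevrey_seminorm s K A \<phi>" if "\<phi> \<in> gevrey_in s K" for \<phi> \<xi>
  proof -
    have "exp (N * weight s \<xi>) * norm (ft \<phi> \<xi>) \<le> exp (N * weight s \<xi>) * (C * gevrey_seminorm s K A \<phi> * exp (- N * weight s \<xi>))"
      using AC(3)[OF that] by (intro mult_left_mono) auto
    also have "\<dots> = C * gevrey_seminorm s K A \<phi>" by (simp add: exp_minus)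
    finally show ?thesis .
  qed
  then show ?thesis using AC(1,2) by blast
qed

lemma ftq_bdd:
  fixes \<phi> :: "real ^ 'n::finite \<Rightarrow> complex"
  assumes s: "0 < s" and N: "0 < N" and \<phi>: "\<phi> \<in> gevrey_c s"
  shows "bdd_above (range (\<lambda>\<xi>. exp (N * weight s \<xi>) * norm (ft \<phi> \<xi>)))"
proof -
  obtain K where K: "compact K" "K \<noteq> {}" "\<phi> \<in> gevrey_in s K" using gevrey_c_imp_gevrey_in[OF \<phi>] by blast
  obtain A C where "\<forall>\<phi>\<in>gevrey_in s K. \<forall>\<xi>. exp (N * weight s \<xi>) * norm (ft \<phi> \<xi>) \<le> C * gevrey_seminorm s K A \<phi>"
    using ft_weight_le[OF s N K(1,2)] by blast
  then show ?thesis using K(3) by (intro bdd_aboveI2) blast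
qed

lemma norm_ft_le_ftq:
  fixes \<phi> :: "real ^ 'n::finite \<Rightarrow> complex"
  assumes "0 < s" "0 < N" "\<phi> \<in> gevrey_c s"
  shows "norm (ft \<phi> \<xi>) \<le> ftq s N \<phi> * exp (- N * weight s \<xi>)"
proof -
  have "exp (N * weight s \<xi>) * norm (ft \<phi> \<xi>) \<le> ftq s N \<phi>"
    unfolding ftq_def by (rule cSUP_upper[OF UNIV_I ftq_bdd[OF assms]])
  then have "exp (N * weight s \<xi>) * norm (ft \<phi> \<xi>) * exp (- N * weight s \<xi>) \<le> ftq s N \<phi> * exp (- N * weight s \<xi>)"
    by (rule mult_right_mono) simp
  then show ?thesis by (simp add: exp_minus field_simps)
qed

lemma ftq_seminorm:
  assumes s: "0 < s" and N: "0 < N"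
  shows "is_seminorm_on (gevrey_c s :: (real ^ 'n::finite \<Rightarrow> complex) set) (ftq s N)"
proof -
  have "is_seminorm_on (gevrey_c s) (\<lambda>\<phi> :: real ^ 'n \<Rightarrow> complex. SUP \<xi>. exp (N * weight s \<xi>) * norm (ft \<phi> \<xi>))"
  proof (rule is_seminorm_on_SUP[OF lin_space_gevrey_c[OF s] _ ftq_bdd[OF s N]])
    fix \<xi> :: "real ^ 'n"
    show "is_seminorm_on (gevrey_c s) (\<lambda>\<phi>. exp (N * weight s \<xi>) * norm (ft \<phi> \<xi>))"
      unfolding is_seminorm_on_def
      by (intro conjI ballI allI) (simp_all add: ft_add[OF s] ft_cmult norm_mult distrib_left[symmetric] norm_triangle_ineq)
  qed auto
  then show ?thesis unfolding ftq_def .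
qed

lemma seminorm_diff_le:
  assumes "is_seminorm_on V q" "lin_space V" "f \<in> V" "g \<in> V"
  shows "\<bar>q g - q f\<bar> \<le> q (\<lambda>x. g x - f x)"
proof -
  note q = is_seminorm_onD[OF assms(1,2)]
  note d = lin_spaceD(4)[OF assms(2)]
  have "q (\<lambda>x. (g x - f x) + f x) \<le> q (\<lambda>x. g x - f x) + q f" by (intro q d assms)
  moreover have "q (\<lambda>x. (f x - g x) + g x) \<le> q (\<lambda>x. f x - g x) + q g" by (intro q d assms)
  moreover have "q (\<lambda>x. - 1 * (g x - f x)) = norm (- 1 :: complex) * q (\<lambda>x. g x - f x)" by (intro q d assms)
  ultimately show ?thesis by simp
qed

lemma ftq_in_gevrey_c_sems:
  assumes s: "0 < s" and N: "0 < N"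
  shows "(ftq s N :: (real ^ 'n::finite \<Rightarrow> complex) \<Rightarrow> real) \<in> gevrey_c_sems s"
  unfolding gevrey_c_sems_def mem_Collect_eq
proof (intro conjI ftq_seminorm[OF s N] allI impI)
  fix K :: "(real ^ 'n) set" assume K: "compact K"
  \<comment> \<open>The generating seminorms belong to nonempty sets; adding a point covers
    \<open>K = {}\<close>.\<close>
  have sub: "gevrey_in s K \<subseteq> gevrey_in s (insert 0 K)" by (auto simp: gevrey_in_def)
  have "compact (insert 0 K)" "insert 0 K \<noteq> {}" using K by auto
  then obtain A C where AC: "0 < A" "0 \<le> C" "\<And>\<phi> \<xi>. \<phi> \<in> gevrey_in s (insert 0 K) \<Longrightarrow>
    exp (N * weight s \<xi>) * norm (ft \<phi> \<xi>) \<le> C * gevrey_seminorm s (insert 0 K) A \<phi>"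
    using ft_weight_le[OF s N, of "insert 0 K"] by blast
  let ?p = "gevrey_seminorm s (insert 0 K) A"
  show "continuous_map (subtopology (gevrey_top s) (gevrey_in s K)) euclidean (ftq s N)"
    unfolding gevrey_top_eq
  proof (rule seminorm_bound_imp_continuous[OF lin_space_gevrey[OF s] gevrey_sems_seminorm[OF s], where F="{?p}" and C=C])
    fix f g :: "real ^ 'n \<Rightarrow> complex" assume f: "f \<in> gevrey_in s K" and g: "g \<in> gevrey_in s K"
    have "(\<lambda>x. g x - f x) \<in> gevrey_in s K" by (intro lin_spaceD(4)[OF lin_space_gevrey_in[OF s]] f g)
    then have "ftq s N (\<lambda>x. g x - f x) \<le> C * ?p (\<lambda>x. g x - f x)"
      unfolding ftq_def using sub AC(3) by (intro cSUP_least) auto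
    then show "norm (ftq s N g - ftq s N f) \<le> C * (\<Sum>p\<in>{?p}. p (\<lambda>x. g x - f x))"
      using seminorm_diff_le[OF ftq_seminorm[OF s N] lin_space_gevrey_c[OF s] subsetD[OF gevrey_in_subset_gevrey_c[OF K] f]
          subsetD[OF gevrey_in_subset_gevrey_c[OF K] g]] by simp
  next
    have "compact (insert 0 K)" "insert 0 K \<noteq> {}" using K by auto
    with AC(1) show "{?p} \<subseteq> gevrey_sems s" unfolding gevrey_sems_def by blast
  qed (use AC in auto)
qed

lemma ultradistrI:
  fixes u :: "(real ^ 'n::finite \<Rightarrow> complex) \<Rightarrow> complex"
  assumes s: "0 < s" and N: "0 < N" and C: "0 \<le> C" and le: "\<And>f. f \<in> gevrey_c s \<Longrightarrow> norm (u f) \<le> C * ftq s N f"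
    and add: "\<And>f g. f \<in> gevrey_c s \<Longrightarrow> g \<in> gevrey_c s \<Longrightarrow> u (\<lambda>x. f x + g x) = u f + u g"
    and scale: "\<And>c f. f \<in> gevrey_c s \<Longrightarrow> u (\<lambda>x. c * f x) = c * u f" and off: "\<And>f. f \<notin> gevrey_c s \<Longrightarrow> u f = 0"
  shows "u \<in> dual_space (gevrey_c_top s)"
  unfolding gevrey_c_top_eq
  by (rule dual_spaceI[OF lin_space_gevrey_c[OF s] gevrey_c_sems_seminorm ftq_in_gevrey_c_sems[OF s N] C le add scale off])

lemma topspace_ultradistr_top: "topspace (ultradistr_top s) = dual_space (gevrey_c_top s)"
  by (simp add: ultradistr_top_def strong_dual_def topspace_lc_topology)

text \<open>The seminorm \<open>ftq s N\<close> is continuous, hence bounded on bounded sets, so a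
  small multiple of it is uniformly small there.\<close>

lemma limitin_ultradistr_topI:
  fixes l :: "'n::finite functional"
  assumes s: "0 < s" and N: "0 < N" and l: "l \<in> dual_space (gevrey_c_top s)" and f: "\<forall>\<^sub>F r in F. f r \<in> dual_space (gevrey_c_top s)"
    and lim: "\<And>e. 0 < e \<Longrightarrow> \<forall>\<^sub>F r in F. \<forall>\<phi>\<in>gevrey_c s. norm (f r \<phi> - l \<phi>) \<le> e * ftq s N \<phi>"
  shows "limitin (ultradistr_top s) f l F"
  unfolding ultradistr_top_def gevrey_c_top_eq
proof (rule limitin_strong_dualI[OF lin_space_gevrey_c[OF s] gevrey_c_sems_seminorm])
  show "l \<in> dual_space (lc_topology (gevrey_c s) (gevrey_c_sems s))" "\<forall>\<^sub>F r in F. f r \<in> dual_space (lc_topology (gevrey_c s) (gevrey_c_sems s))"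
    using l f unfolding gevrey_c_top_eq .
  fix B :: "(real ^ 'n \<Rightarrow> complex) set" and e :: real
  assume B: "vn_bounded (lc_topology (gevrey_c s) (gevrey_c_sems s)) B" and e: "0 < e"
  have BV: "B \<subseteq> gevrey_c s" using B by (simp add: vn_bounded_def topspace_lc_topology)
  obtain M where M: "\<And>\<phi>. \<phi> \<in> B \<Longrightarrow> ftq s N \<phi> \<le> M"
    using vn_bounded_imp_seminorm_bounded[OF lin_space_gevrey_c[OF s] gevrey_c_sems_seminorm B ftq_in_gevrey_c_sems[OF s N]] by blast
  define d where "d = e / (\<bar>M\<bar> + 1)"
  have d: "0 < d" using e by (simp add: d_def add_nonneg_pos)
  have dM: "d * \<bar>M\<bar> \<le> e" using e by (simp add: d_def divide_simps mult_left_mono)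
  show "\<forall>\<^sub>F r in F. \<forall>\<phi>\<in>B. norm (f r \<phi> - l \<phi>) \<le> e"
  proof (rule eventually_mono[OF lim[OF d]], intro ballI)
    fix r \<phi> assume le: "\<forall>\<phi>\<in>gevrey_c s. norm (f r \<phi> - l \<phi>) \<le> d * ftq s N \<phi>" and \<phi>: "\<phi> \<in> B"
    have "norm (f r \<phi> - l \<phi>) \<le> d * ftq s N \<phi>" using le \<phi> BV by blast
    also have "\<dots> \<le> d * \<bar>M\<bar>" using M[OF \<phi>] d by (intro mult_left_mono) auto
    finally show "norm (f r \<phi> - l \<phi>) \<le> e" using dM by linarith
  qed
qed

lemma limitin_ultradistr_topD:
  fixes l :: "'n::finite functional"
  assumes s: "0 < s" and lim: "limitin (ultradistr_top s) f l F" and B: "B \<subseteq> gevrey_c s"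
    and bound: "\<And>q. q \<in> gevrey_c_sems s \<Longrightarrow> \<exists>M. \<forall>\<phi>\<in>B. q \<phi> \<le> M" and e: "0 < e"
  shows "\<forall>\<^sub>F r in F. \<forall>\<phi>\<in>B. norm (f r \<phi> - l \<phi>) \<le> e"
  by (rule limitin_strong_dualD[OF lin_space_gevrey_c[OF s] gevrey_c_sems_seminorm lim[unfolded ultradistr_top_def gevrey_c_top_eq]
        seminorm_bounded_imp_vn_bounded[OF lin_space_gevrey_c[OF s] gevrey_c_sems_seminorm B bound] e])

text \<open>
  The transpose, applied to \<open>g\<close>, of the Fourier multiplier with the row-vector symbol \<open>m\<close>, without the
  factor \<open>1 / (2 * pi) ^ n\<close> of the inversion formula.
\<close>

definition mult_functional :: "real \<Rightarrow> 'n::finite functional ^ 'm \<Rightarrow> (real ^ 'n \<Rightarrow> complex ^ 'm::finite) \<Rightarrow> 'n functional" where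
  "mult_functional s g m \<phi> = (if \<phi> \<in> gevrey_c s then \<Sum>j\<in>UNIV. (g $ j) (osc (\<lambda>\<xi>. m \<xi> $ j * ft \<phi> \<xi>)) else 0)"

lemma exp_weight_combine:
  assumes "norm (a :: complex) \<le> D * exp (C * w)" "norm (b :: complex) \<le> M * exp (- N * w)" "0 \<le> D"
  shows "norm (a * b) \<le> D * M * exp (- (N - C) * w)"
proof -
  have "norm a * norm b \<le> (D * exp (C * w)) * (M * exp (- N * w))"
    by (intro mult_mono assms) (use assms(3) in auto)
  also have "\<dots> = D * M * (exp (C * w) * exp (- N * w))" by simp
  also have "exp (C * w) * exp (- N * w) = exp (- (N - C) * w)" by (simp add: algebra_simps flip: exp_add)
  finally show ?thesis by (simp add: norm_mult)
qed

lemma mult_row_decaying: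
  fixes m :: "real ^ 'n::finite \<Rightarrow> complex ^ 'm::finite"
  assumes s: "0 < s" and m: "continuous_on UNIV m" "\<And>\<xi>. norm (m \<xi>) \<le> D * exp (C * weight s \<xi>)" and h: "decaying s h"
  shows "decaying s (\<lambda>\<xi>. m \<xi> $ j * h \<xi>)"
proof (rule decaying_mult[OF h])
  show "(\<lambda>\<xi>. m \<xi> $ j) \<in> borel_measurable borel"
    by (intro borel_measurable_continuous_onI continuous_intros m)
  show "norm (m \<xi> $ j) \<le> D * exp (C * weight s \<xi>)" for \<xi>
    using order_trans[OF Finite_Cartesian_Product.norm_nth_le m(2)] .
qed

lemma ultradistr_compact_linear:
  assumes s: "0 < s" and u: "u \<in> ultradistr_compact s" and h: "decaying s h" "decaying s h'"
  shows "u (osc (\<lambda>\<xi>. h \<xi> + h' \<xi>)) = u (osc h) + u (osc h')" "u (osc (\<lambda>\<xi>. c * h \<xi>)) = c * u (osc h)"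
proof -
  note u' = dual_spaceD[OF u[unfolded ultradistr_compact_def gevrey_top_eq]]
  have 1: "osc (\<lambda>\<xi>. h \<xi> + h' \<xi>) = (\<lambda>x. osc h x + osc h' x)" using osc_add[OF s h] by (simp add: fun_eq_iff)
  show "u (osc (\<lambda>\<xi>. h \<xi> + h' \<xi>)) = u (osc h) + u (osc h')"
    unfolding 1 by (intro u' osc_in_gevrey[OF s] h)
  have 2: "osc (\<lambda>\<xi>. c * h \<xi>) = (\<lambda>x. c * osc h x)" using osc_cmult[of c h] by (simp add: fun_eq_iff)
  show "u (osc (\<lambda>\<xi>. c * h \<xi>)) = c * u (osc h)"
    unfolding 2 by (intro u' osc_in_gevrey[OF s] h)
qed

text \<open>\<open>N\<close> and \<open>C\<close> do not depend on the multiplier but only on its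
  rate \<open>C1\<close>, and the bound is linear in \<open>D\<close>. Convergence of multipliers
  therefore yields convergence of functionals.\<close>

lemma mult_functional_bound:
  fixes g :: "'n::finite functional ^ 'm::finite"
  assumes s: "0 < s" and g: "\<And>j. g $ j \<in> ultradistr_compact s"
  shows "\<exists>N C. 0 < N \<and> 0 \<le> C \<and> (\<forall>m D. continuous_on UNIV m \<longrightarrow> (\<forall>\<xi>. norm (m \<xi>) \<le> D * exp (C1 * weight s \<xi>)) \<longrightarrow>
    (\<forall>\<phi>\<in>gevrey_c s. norm (mult_functional s g m \<phi>) \<le> C * D * ftq s N \<phi>))"
proof -
  have "\<forall>j. \<exists>N C. 0 \<le> N \<and> 0 \<le> C \<and> (\<forall>(h :: real ^ 'n::finite \<Rightarrow> complex) D. decaying s h \<longrightarrow>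
    (\<forall>\<xi>. norm (h \<xi>) \<le> D * exp (- N * weight s \<xi>)) \<longrightarrow> norm ((g $ j) (osc h)) \<le> C * D)"
    using ultradistr_compact_osc_le[OF s g] by blast
  then obtain N C where NC: "\<And>j. 0 \<le> N j" "\<And>j. 0 \<le> C j" "\<And>j (h :: real ^ 'n \<Rightarrow> complex) D. decaying s h \<Longrightarrow>
    (\<And>\<xi>. norm (h \<xi>) \<le> D * exp (- N j * weight s \<xi>)) \<Longrightarrow> norm ((g $ j) (osc h)) \<le> C j * D"
    by metis
  \<comment> \<open>The Fourier transform has to decay fast enough for the growth \<open>C1\<close>
    of the multiplier and, beyond that, for the rate \<open>N j\<close> demanded by each component
    of \<open>g\<close>.\<close>
  define N0 where "N0 = (\<Sum>j\<in>UNIV. N j) + \<bar>C1\<bar> + 1"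
  have N0: "0 < N0" using NC(1) by (simp add: N0_def add_nonneg_pos sum_nonneg)
  have Nj: "N j \<le> N0 - C1" for j
    using member_le_sum[of j UNIV N] NC(1) by (simp add: N0_def)
  have "norm (mult_functional s g m \<phi>) \<le> (\<Sum>j\<in>UNIV. C j) * D * ftq s N0 \<phi>"
    if m: "continuous_on UNIV m" "\<forall>\<xi>. norm (m \<xi>) \<le> D * exp (C1 * weight s \<xi>)" and \<phi>: "\<phi> \<in> gevrey_c s" for m D \<phi>
  proof -
    have D: "0 \<le> D" using order_trans[OF norm_ge_zero m(2)[rule_format, of 0]] by (simp add: zero_le_mult_iff)
    have q: "0 \<le> ftq s N0 \<phi>"
      using is_seminorm_onD(1)[OF ftq_seminorm[OF s N0] lin_space_gevrey_c[OF s] \<phi>] .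
    have "norm ((g $ j) (osc (\<lambda>\<xi>. m \<xi> $ j * ft \<phi> \<xi>))) \<le> C j * (D * ftq s N0 \<phi>)" for j
    proof (rule NC(3))
      show "decaying s (\<lambda>\<xi>. m \<xi> $ j * ft \<phi> \<xi>)"
        using mult_row_decaying[OF s m(1) m(2)[rule_format] decaying_ft[OF s \<phi>]] .
      fix \<xi>
      have "norm (m \<xi> $ j * ft \<phi> \<xi>) \<le> D * ftq s N0 \<phi> * exp (- (N0 - C1) * weight s \<xi>)"
        by (rule exp_weight_combine[OF order_trans[OF Finite_Cartesian_Product.norm_nth_le m(2)[rule_format]] norm_ft_le_ftq[OF s N0 \<phi>] D])
      moreover have "- (N0 - C1) * weight s \<xi> \<le> - N j * weight s \<xi>"
        using mult_right_mono[OF Nj[of j] weight_nonneg[of s \<xi>]] by (simp only: mult_minus_left neg_le_iff_le)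
      then have "D * ftq s N0 \<phi> * exp (- (N0 - C1) * weight s \<xi>) \<le> D * ftq s N0 \<phi> * exp (- N j * weight s \<xi>)"
        using D q by (intro mult_left_mono) (simp_all only: exp_le_cancel_iff mult_nonneg_nonneg)
      ultimately show "norm (m \<xi> $ j * ft \<phi> \<xi>) \<le> D * ftq s N0 \<phi> * exp (- N j * weight s \<xi>)" by linarith
    qed
    then have "norm (mult_functional s g m \<phi>) \<le> (\<Sum>j\<in>UNIV. C j * (D * ftq s N0 \<phi>))"
      using \<phi> unfolding mult_functional_def by (simp only: if_True) (rule sum_norm_le)
    then show ?thesis by (simp add: sum_distrib_right mult.assoc)
  qed
  then show ?thesis using N0 NC(2) by (intro exI[of _ N0] exI[of _ "\<Sum>j\<in>UNIV. C j"]) (auto intro!: sum_nonneg)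
qed

lemma mult_functional_add_cmult:
  fixes g :: "'n::finite functional ^ 'm::finite"
  assumes s: "0 < s" and g: "\<And>j. g $ j \<in> ultradistr_compact s"
    and m: "continuous_on UNIV m" "\<And>\<xi>. norm (m \<xi>) \<le> D * exp (C * weight s \<xi>)"
  shows "\<phi> \<in> gevrey_c s \<Longrightarrow> \<psi> \<in> gevrey_c s \<Longrightarrow>
      mult_functional s g m (\<lambda>x. \<phi> x + \<psi> x) = mult_functional s g m \<phi> + mult_functional s g m \<psi>"
    and "\<phi> \<in> gevrey_c s \<Longrightarrow> mult_functional s g m (\<lambda>x. c * \<phi> x) = c * mult_functional s g m \<phi>"
proof -
  note V = lin_spaceD[OF lin_space_gevrey_c[OF s]]
  note d = mult_row_decaying[OF s m decaying_ft[OF s]]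
  show "mult_functional s g m (\<lambda>x. \<phi> x + \<psi> x) = mult_functional s g m \<phi> + mult_functional s g m \<psi>"
    if \<phi>: "\<phi> \<in> gevrey_c s" and \<psi>: "\<psi> \<in> gevrey_c s"
    using ultradistr_compact_linear(1)[OF s g d[OF \<phi>] d[OF \<psi>]] V(2)[OF \<phi> \<psi>] \<phi> \<psi>
    by (simp add: mult_functional_def ft_add[OF s] distrib_left sum.distrib)
  show "mult_functional s g m (\<lambda>x. c * \<phi> x) = c * mult_functional s g m \<phi>" if \<phi>: "\<phi> \<in> gevrey_c s"
  proof -
    have "(\<lambda>\<xi>. m \<xi> $ j * (c * ft \<phi> \<xi>)) = (\<lambda>\<xi>. c * (m \<xi> $ j * ft \<phi> \<xi>))" for j by (simp add: mult.left_commute)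
    then show ?thesis
      using ultradistr_compact_linear(2)[OF s g d[OF \<phi>] d[OF \<phi>]] V(3)[OF \<phi>] \<phi>
      by (simp add: mult_functional_def ft_cmult sum_distrib_left)
  qed
qed

lemma mult_functional_dual:
  fixes g :: "'n::finite functional ^ 'm::finite"
  assumes s: "0 < s" and g: "\<And>j. g $ j \<in> ultradistr_compact s"
    and m: "continuous_on UNIV m" "\<And>\<xi>. norm (m \<xi>) \<le> D * exp (C1 * weight s \<xi>)"
  shows "mult_functional s g m \<in> dual_space (gevrey_c_top s)"
proof -
  obtain N C where NC: "0 < N" "0 \<le> C" "\<forall>m D. continuous_on UNIV m \<longrightarrow> (\<forall>\<xi>. norm (m \<xi>) \<le> D * exp (C1 * weight s \<xi>)) \<longrightarrow>
    (\<forall>\<phi>\<in>gevrey_c s. norm (mult_functional s g m \<phi>) \<le> C * D * ftq s N \<phi>)"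
    using mult_functional_bound[OF s g, of C1] by blast
  have D: "0 \<le> D" using order_trans[OF norm_ge_zero m(2)[of 0]] by (simp add: zero_le_mult_iff)
  show ?thesis
  proof (rule ultradistrI[OF s NC(1) mult_nonneg_nonneg[OF NC(2) D]])
    show "norm (mult_functional s g m f) \<le> C * D * ftq s N f" if "f \<in> gevrey_c s" for f
      using NC(3) m that by blast
  qed (auto simp: mult_functional_add_cmult[OF s g m], simp add: mult_functional_def)
qed

text \<open>Real coefficients are those of difference quotients in time. The two multipliers may
  have different growth rates.\<close>

lemma mult_functional_lin_comb:
  fixes g :: "'n::finite functional ^ 'm::finite" and a b :: real
  assumes s: "0 < s" and g: "\<And>j. g $ j \<in> ultradistr_compact s"
    and m: "continuous_on UNIV m" "\<And>\<xi>. norm (m \<xi>) \<le> D * exp (C * weight s \<xi>)"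
    and m': "continuous_on UNIV m'" "\<And>\<xi>. norm (m' \<xi>) \<le> D' * exp (C' * weight s \<xi>)"
  shows "mult_functional s g (\<lambda>\<xi>. a *\<^sub>R m \<xi> + b *\<^sub>R m' \<xi>) \<phi> = of_real a * mult_functional s g m \<phi> + of_real b * mult_functional s g m' \<phi>"
proof (cases "\<phi> \<in> gevrey_c s")
  case True
  have "(g $ j) (osc (\<lambda>\<xi>. (a *\<^sub>R m \<xi> + b *\<^sub>R m' \<xi>) $ j * ft \<phi> \<xi>))
      = of_real a * (g $ j) (osc (\<lambda>\<xi>. m \<xi> $ j * ft \<phi> \<xi>)) + of_real b * (g $ j) (osc (\<lambda>\<xi>. m' \<xi> $ j * ft \<phi> \<xi>))" for j
  proof -
    note d = mult_row_decaying[OF s m decaying_ft[OF s True], of j] mult_row_decaying[OF s m' decaying_ft[OF s True], of j]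
    have "(\<lambda>\<xi>. (a *\<^sub>R m \<xi> + b *\<^sub>R m' \<xi>) $ j * ft \<phi> \<xi>)
        = (\<lambda>\<xi>. of_real a * (m \<xi> $ j * ft \<phi> \<xi>) + of_real b * (m' \<xi> $ j * ft \<phi> \<xi>))"
      by (simp add: fun_eq_iff scaleR_conv_of_real[of _ "_ :: complex"] algebra_simps)
    then show ?thesis
      using ultradistr_compact_linear(1)[OF s g decaying_cmult[OF d(1)] decaying_cmult[OF d(2)], of j a b]
        ultradistr_compact_linear(2)[OF s g d(1) d(1), of j a] ultradistr_compact_linear(2)[OF s g d(2) d(2), of j b] by simp
  qed
  then show ?thesis using True by (simp add: mult_functional_def sum.distrib sum_distrib_left)
qed (simp add: mult_functional_def)

text \<open>\<open>mult_functional_bound\<close> is applied to the multiplier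
  \<open>M r - l\<close>, whose constant is small.\<close>

lemma mult_functional_limit:
  fixes g :: "'n::finite functional ^ 'm::finite" and M :: "real \<Rightarrow> real ^ 'n \<Rightarrow> complex ^ 'm"
  assumes s: "0 < s" and g: "\<And>j. g $ j \<in> ultradistr_compact s"
    and M: "\<forall>\<^sub>F r in F. continuous_on UNIV (M r) \<and> (\<exists>D. \<forall>\<xi>. norm (M r \<xi>) \<le> D * exp (C1 * weight s \<xi>))"
    and l: "continuous_on UNIV l" "\<And>\<xi>. norm (l \<xi>) \<le> D * exp (C1 * weight s \<xi>)"
    and lim: "\<And>e. 0 < e \<Longrightarrow> \<forall>\<^sub>F r in F. \<forall>\<xi>. norm (M r \<xi> - l \<xi>) \<le> e * exp (C1 * weight s \<xi>)"
  shows "limitin (ultradistr_top s) (\<lambda>r. mult_functional s g (M r)) (mult_functional s g l) F"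
proof -
  obtain N C where NC: "0 < N" "0 \<le> C" "\<forall>m D. continuous_on UNIV m \<longrightarrow> (\<forall>\<xi>. norm (m \<xi>) \<le> D * exp (C1 * weight s \<xi>)) \<longrightarrow>
    (\<forall>\<phi>\<in>gevrey_c s. norm (mult_functional s g m \<phi>) \<le> C * D * ftq s N \<phi>)"
    using mult_functional_bound[OF s g, of C1] by blast
  show ?thesis
  proof (rule limitin_ultradistr_topI[OF s NC(1) mult_functional_dual[OF s g l]])
    show "\<forall>\<^sub>F r in F. mult_functional s g (M r) \<in> dual_space (gevrey_c_top s)"
      using M by eventually_elim (use mult_functional_dual[OF s g] in blast)
    fix e :: real assume e: "0 < e"
    define d where "d = e / (C + 1)"
    have d: "0 < d" "C * d \<le> e" using e NC(2) by (auto simp: d_def field_simps)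
    from M lim[OF d(1)]
    show "\<forall>\<^sub>F r in F. \<forall>\<phi>\<in>gevrey_c s. norm (mult_functional s g (M r) \<phi> - mult_functional s g l \<phi>) \<le> e * ftq s N \<phi>"
    proof eventually_elim
      case (elim r)
      then obtain D' where Mr: "continuous_on UNIV (M r)" "\<And>\<xi>. norm (M r \<xi>) \<le> D' * exp (C1 * weight s \<xi>)" by blast
      show ?case
      proof
        fix \<phi> :: "real ^ 'n \<Rightarrow> complex" assume \<phi>: "\<phi> \<in> gevrey_c s"
        have q: "0 \<le> ftq s N \<phi>"
          using is_seminorm_onD(1)[OF ftq_seminorm[OF s NC(1)] lin_space_gevrey_c[OF s] \<phi>] .
        have "mult_functional s g (M r) \<phi> - mult_functional s g l \<phi> = mult_functional s g (\<lambda>\<xi>. 1 *\<^sub>R M r \<xi> + (- 1) *\<^sub>R l \<xi>) \<phi>"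
          unfolding mult_functional_lin_comb[OF s g Mr l] by simp
        also have "norm \<dots> \<le> C * d * ftq s N \<phi>"
        proof -
          have "continuous_on UNIV (\<lambda>\<xi>. 1 *\<^sub>R M r \<xi> + (- 1) *\<^sub>R l \<xi>)" by (intro continuous_intros Mr l)
          moreover have "\<forall>\<xi>. norm (1 *\<^sub>R M r \<xi> + (- 1) *\<^sub>R l \<xi>) \<le> d * exp (C1 * weight s \<xi>)" using elim(2) by simp
          ultimately show ?thesis using NC(3) \<phi> by blast
        qed
        also have "\<dots> \<le> e * ftq s N \<phi>" by (intro mult_right_mono d q)
        finally show "norm (mult_functional s g (M r) \<phi> - mult_functional s g l \<phi>) \<le> e * ftq s N \<phi>" .
      qed
    qed
  qed
qed

text \<open>The product rule for a pairing in which functional and test function both move with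
  time. The supports lie in one compact set, and all estimates of \<open>h\<close> are in weighted
  norms at every rate \<open>N\<close>, because the rate at which a given functional is continuous
  is not known in advance.\<close>

lemma pairing_has_vector_derivative:
  fixes h :: "real \<Rightarrow> real ^ 'n::finite \<Rightarrow> complex" and u :: "real \<Rightarrow> 'n functional"
  assumes s: "0 < s" and K: "compact K"
    and u: "\<And>r. r \<in> S \<Longrightarrow> u r \<in> dual_space (gevrey_c_top s)" and u': "u' \<in> dual_space (gevrey_c_top s)"
    and lim: "limitin (ultradistr_top s) (\<lambda>r \<phi>. (u r \<phi> - u t \<phi>) / complex_of_real (r - t)) u' (at t within S)"
    and t: "t \<in> S" and h: "\<And>r. r \<in> S \<Longrightarrow> decaying s (h r)" "\<And>r. r \<in> S \<Longrightarrow> osc (h r) \<in> gevrey_in s K"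
    and h_bound: "\<And>N. \<exists>D. \<forall>r\<in>S. \<forall>\<xi>. norm (h r \<xi>) \<le> D * exp (- N * weight s \<xi>)"
    and h': "decaying s h'" "osc h' \<in> gevrey_in s K"
    and h_lim: "\<And>N e. 0 < e \<Longrightarrow> \<forall>\<^sub>F r in at t within S. \<forall>\<xi>. norm ((h r \<xi> - h t \<xi>) / complex_of_real (r - t) - h' \<xi>) \<le> e * exp (- N * weight s \<xi>)"
  shows "((\<lambda>r. u r (osc (h r))) has_vector_derivative u' (osc (h t)) + u t (osc h')) (at t within S)"
unfolding has_vector_derivative_iff_quotient
proof -
  have sub: "gevrey_in s K \<subseteq> gevrey_c s" using gevrey_in_subset_gevrey_c[OF K] .
  have S: "\<forall>\<^sub>F r in at t within S. r \<in> S \<and> r \<noteq> t" by (simp add: eventually_at_filter)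
  note V = lin_space_gevrey_c[OF s]
  have hc: "osc (h r) \<in> gevrey_c s" if "r \<in> S" for r using h(2)[OF that] sub by blast
  have h'c: "osc h' \<in> gevrey_c s" using h'(2) sub by blast
  have diff: "v (osc f) - v (osc f') = v (osc (\<lambda>\<xi>. f \<xi> - f' \<xi>))" "osc (\<lambda>\<xi>. f \<xi> - f' \<xi>) \<in> gevrey_in s K"
    if v: "v \<in> dual_space (gevrey_c_top s)" and f: "decaying s f" "decaying s f'" "osc f \<in> gevrey_in s K" "osc f' \<in> gevrey_in s K" for v f f'
  proof -
    have "osc (\<lambda>\<xi>. f \<xi> + - 1 * f' \<xi>) = (\<lambda>x. osc f x + - 1 * osc f' x)"
      using osc_add[OF s f(1) decaying_cmult[OF f(2), of "- 1"]] osc_cmult[of "- 1" f'] by (simp add: fun_eq_iff)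
    then have eq: "osc (\<lambda>\<xi>. f \<xi> - f' \<xi>) = (\<lambda>x. osc f x - osc f' x)" by simp
    show "v (osc f) - v (osc f') = v (osc (\<lambda>\<xi>. f \<xi> - f' \<xi>))"
      unfolding eq
      by (rule dual_space_diff[symmetric, OF V v[unfolded gevrey_c_top_eq] subsetD[OF sub f(3)] subsetD[OF sub f(4)]])
    show "osc (\<lambda>\<xi>. f \<xi> - f' \<xi>) \<in> gevrey_in s K"
      unfolding eq by (intro lin_spaceD(4)[OF lin_space_gevrey_in[OF s]] f)
  qed
  have ddiff: "decaying s (\<lambda>\<xi>. f \<xi> - f' \<xi>)" if "decaying s f" "decaying s f'" for f f' :: "real ^ 'n \<Rightarrow> complex"
    using decaying_add[OF that(1) decaying_cmult[OF that(2), of "- 1"]] by simp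
  define Q where "Q r = (\<lambda>\<xi>. (1 / complex_of_real (r - t)) * (h r \<xi> - h t \<xi>))" for r
  have Qd: "decaying s (Q r)" if "r \<in> S" for r unfolding Q_def by (intro decaying_cmult ddiff h that t)
  have Qo: "osc (Q r) = (\<lambda>x. (1 / complex_of_real (r - t)) * osc (\<lambda>\<xi>. h r \<xi> - h t \<xi>) x)" for r
    unfolding Q_def by (rule ext) (rule osc_cmult)
  have Qin: "osc (Q r) \<in> gevrey_in s K" if "r \<in> S" for r
    unfolding Qo by (intro lin_spaceD(3)[OF lin_space_gevrey_in[OF s]] diff(2)[OF u'] h that t)
  have Qu: "v (osc (Q r)) = (v (osc (h r)) - v (osc (h t))) / complex_of_real (r - t)"
    if "r \<in> S" and v: "v \<in> dual_space (gevrey_c_top s)" for r v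
  proof -
    have *: "osc (\<lambda>\<xi>. h r \<xi> - h t \<xi>) \<in> gevrey_c s"
      by (rule subsetD[OF sub diff(2)[OF u' h(1)[OF that(1)] h(1)[OF t] h(2)[OF that(1)] h(2)[OF t]]])
    show ?thesis
      unfolding Qo dual_spaceD(2)[OF v[unfolded gevrey_c_top_eq] *] diff(1)[OF v h(1)[OF that(1)] h(1)[OF t] h(2)[OF that(1)] h(2)[OF t]]
      by simp
  qed
  have small: "((\<lambda>r. v (osc (f r))) \<longlongrightarrow> 0) (at t within S)"
    if v: "v \<in> dual_space (gevrey_c_top s)" and f: "\<And>r. r \<in> S \<Longrightarrow> decaying s (f r)" "\<And>r. r \<in> S \<Longrightarrow> osc (f r) \<in> gevrey_in s K"
      and fe: "\<And>N e. 0 < e \<Longrightarrow> \<forall>\<^sub>F r in at t within S. \<forall>\<xi>. norm (f r \<xi>) \<le> e * exp (- N * weight s \<xi>)" for v and f :: "real \<Rightarrow> real ^ 'n \<Rightarrow> complex"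
  proof -
    obtain N C where NC: "0 \<le> C" "\<And>(h :: real ^ 'n \<Rightarrow> complex) D. decaying s h \<Longrightarrow> osc h \<in> gevrey_in s K \<Longrightarrow>
      \<forall>\<xi>. norm (h \<xi>) \<le> D * exp (- N * weight s \<xi>) \<Longrightarrow> norm (v (osc h)) \<le> C * D"
      using ultradistr_osc_le[OF s K v] by blast
    show ?thesis
    proof (rule tendstoI)
      fix e :: real assume e: "0 < e"
      define d where "d = e / (C + 1)"
      have d: "0 < d" "C * d < e" using e NC(1) by (auto simp: d_def field_simps)
      from S fe[OF d(1), of N] show "\<forall>\<^sub>F r in at t within S. dist (v (osc (f r))) 0 < e"
      proof eventually_elim
        case (elim r)
        then have "norm (v (osc (f r))) \<le> C * d" by (intro NC(2) f) auto
        then show ?case using d(2) by simp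
      qed
    qed
  qed
  have lim1: "((\<lambda>r. u t (osc (Q r))) \<longlongrightarrow> u t (osc h')) (at t within S)"
  proof (rule LIM_zero_cancel)
    have "((\<lambda>r. u t (osc (\<lambda>\<xi>. Q r \<xi> - h' \<xi>))) \<longlongrightarrow> 0) (at t within S)"
    proof (rule small[OF u[OF t]])
      show "decaying s (\<lambda>\<xi>. Q r \<xi> - h' \<xi>)" if "r \<in> S" for r by (intro ddiff Qd that h')
      show "osc (\<lambda>\<xi>. Q r \<xi> - h' \<xi>) \<in> gevrey_in s K" if "r \<in> S" for r by (intro diff(2)[OF u'] Qd Qin that h')
      show "\<forall>\<^sub>F r in at t within S. \<forall>\<xi>. norm (Q r \<xi> - h' \<xi>) \<le> e * exp (- N * weight s \<xi>)" if "0 < e" for N e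
        using h_lim[OF that, of N] by (simp add: Q_def)
    qed
    then show "((\<lambda>r. u t (osc (Q r)) - u t (osc h')) \<longlongrightarrow> 0) (at t within S)"
    proof (rule Lim_transform_eventually)
      show "\<forall>\<^sub>F r in at t within S. u t (osc (\<lambda>\<xi>. Q r \<xi> - h' \<xi>)) = u t (osc (Q r)) - u t (osc h')"
        using S by eventually_elim (simp add: diff(1)[OF u[OF t] Qd h'(1) Qin h'(2)])
    qed
  qed
  \<comment> \<open>The increment \<open>h r - h t\<close> is \<open>r - t\<close> times a quotient
    that is bounded in the weighted norm.\<close>
  have h_cont: "\<forall>\<^sub>F r in at t within S. \<forall>\<xi>. norm (h r \<xi> - h t \<xi>) \<le> e * exp (- N * weight s \<xi>)" if e: "0 < e" for N e
  proof -
    obtain D where D: "\<And>\<xi>. norm (h' \<xi>) \<le> D * exp (- N * weight s \<xi>)" using decaying_bound[OF h'(1)] by blast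
    have D0: "0 \<le> D" using order_trans[OF norm_ge_zero D[of 0]] by (simp add: zero_le_mult_iff)
    have "((\<lambda>r. \<bar>r - t\<bar> * (1 + D)) \<longlongrightarrow> \<bar>t - t\<bar> * (1 + D)) (at t within S)" by (intro tendsto_intros)
    then have "\<forall>\<^sub>F r in at t within S. \<bar>r - t\<bar> * (1 + D) < e" using e by (intro order_tendstoD(2)) auto
    with S h_lim[OF zero_less_one, of N] show ?thesis
    proof eventually_elim
      case (elim r)
      show ?case
      proof
        fix \<xi>
        let ?q = "(h r \<xi> - h t \<xi>) / complex_of_real (r - t)"
        have "norm ?q \<le> norm (?q - h' \<xi>) + norm (h' \<xi>)" using norm_triangle_ineq[of "?q - h' \<xi>" "h' \<xi>"] by simp
        also have "\<dots> \<le> (1 + D) * exp (- N * weight s \<xi>)" using elim(2) D[of \<xi>] by (simp add: distrib_right add_mono)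
        finally have "\<bar>r - t\<bar> * norm ?q \<le> \<bar>r - t\<bar> * ((1 + D) * exp (- N * weight s \<xi>))" by (rule mult_left_mono) simp
        moreover have "\<bar>r - t\<bar> * norm ?q = norm (h r \<xi> - h t \<xi>)"
          using elim(1) by (simp add: norm_divide flip: of_real_diff)
        moreover have "\<bar>r - t\<bar> * (1 + D) * exp (- N * weight s \<xi>) \<le> e * exp (- N * weight s \<xi>)"
          using elim(3) by (intro mult_right_mono) auto
        ultimately show "norm (h r \<xi> - h t \<xi>) \<le> e * exp (- N * weight s \<xi>)" unfolding mult.assoc by linarith
      qed
    qed
  qed
  have lim2: "((\<lambda>r. u' (osc (h r))) \<longlongrightarrow> u' (osc (h t))) (at t within S)"
  proof (rule LIM_zero_cancel)
    have "((\<lambda>r. u' (osc (\<lambda>\<xi>. h r \<xi> - h t \<xi>))) \<longlongrightarrow> 0) (at t within S)"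
      by (rule small[OF u' ddiff diff(2)[OF u'] h_cont]) (use h t in auto)
    then show "((\<lambda>r. u' (osc (h r)) - u' (osc (h t))) \<longlongrightarrow> 0) (at t within S)"
    proof (rule Lim_transform_eventually)
      show "\<forall>\<^sub>F r in at t within S. u' (osc (\<lambda>\<xi>. h r \<xi> - h t \<xi>)) = u' (osc (h r)) - u' (osc (h t))"
        using S by eventually_elim (simp add: diff(1)[OF u' h(1) h(1)[OF t] h(2) h(2)[OF t]])
    qed
  qed
  define q where "q r \<phi> = (u r \<phi> - u t \<phi>) / complex_of_real (r - t)" for r \<phi>
  \<comment> \<open>The test functions move with \<open>r\<close>, so pointwise convergence of the
    quotients of \<open>u\<close> is too weak. The set of all \<open>osc (h r)\<close> is bounded by
    \<open>h_bound\<close>, and strong convergence is uniform on it.\<close>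
  have lim3: "((\<lambda>r. q r (osc (h r)) - u' (osc (h r))) \<longlongrightarrow> 0) (at t within S)"
  proof (rule tendstoI)
    fix e :: real assume e: "0 < e"
    have "\<forall>\<^sub>F r in at t within S. \<forall>\<phi>\<in>(\<lambda>r. osc (h r)) ` S. norm (q r \<phi> - u' \<phi>) \<le> e / 2"
    proof (rule limitin_ultradistr_topD[OF s lim[folded q_def]])
      show "(\<lambda>r. osc (h r)) ` S \<subseteq> gevrey_c s" using hc by blast
      fix p :: "(real ^ 'n \<Rightarrow> complex) \<Rightarrow> real" assume p: "p \<in> gevrey_c_sems s"
      obtain N C where NC: "0 \<le> C" "\<And>(h :: real ^ 'n \<Rightarrow> complex) D. decaying s h \<Longrightarrow> osc h \<in> gevrey_in s K \<Longrightarrow>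
        \<forall>\<xi>. norm (h \<xi>) \<le> D * exp (- N * weight s \<xi>) \<Longrightarrow> p (osc h) \<le> C * D"
        using gevrey_c_sems_osc_le[OF s p K] by blast
      obtain D where "\<forall>r\<in>S. \<forall>\<xi>. norm (h r \<xi>) \<le> D * exp (- N * weight s \<xi>)" using h_bound by blast
      then have "\<forall>r\<in>S. p (osc (h r)) \<le> C * D" using NC(2)[OF h(1) h(2)] by (simp only: Ball_def) metis
      then show "\<exists>M. \<forall>\<phi>\<in>(\<lambda>r. osc (h r)) ` S. p \<phi> \<le> M" by blast
    qed (use e in auto)
    with S show "\<forall>\<^sub>F r in at t within S. dist (q r (osc (h r)) - u' (osc (h r))) 0 < e"
    proof eventually_elim
      case (elim r)
      then have "norm (q r (osc (h r)) - u' (osc (h r))) \<le> e / 2" by blast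
      then show ?case using e by simp
    qed
  qed
  \<comment> \<open>The difference quotient of the pairing splits into that of \<open>u\<close>,
    tested on \<open>osc (h r)\<close>, and that of \<open>h\<close>, tested by
    \<open>u t\<close>.\<close>
  have "((\<lambda>r. (q r (osc (h r)) - u' (osc (h r))) + u' (osc (h r)) + u t (osc (Q r))) \<longlongrightarrow> 0 + u' (osc (h t)) + u t (osc h')) (at t within S)"
    by (intro tendsto_add lim1 lim2 lim3)
  then have lim4: "((\<lambda>r. q r (osc (h r)) + u t (osc (Q r))) \<longlongrightarrow> u' (osc (h t)) + u t (osc h')) (at t within S)" by simp
  show "((\<lambda>r. (u r (osc (h r)) - u t (osc (h t))) /\<^sub>R (r - t)) \<longlongrightarrow> u' (osc (h t)) + u t (osc h')) (at t within S)"
  proof (rule Lim_transform_eventually[OF lim4])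
    show "\<forall>\<^sub>F r in at t within S. q r (osc (h r)) + u t (osc (Q r)) = (u r (osc (h r)) - u t (osc (h t))) /\<^sub>R (r - t)"
      using S
    proof eventually_elim
      case (elim r)
      then show ?case
        unfolding Qu[OF conjunct1[OF elim] u[OF t]] q_def add_divide_distrib[symmetric] scaleR_conv_of_real of_real_inverse
        by (simp add: divide_inverse mult.commute)
    qed
  qed
qed

lemma vector_derivative_bound:
  fixes f :: "real \<Rightarrow> 'a::real_normed_vector"
  assumes "convex S" and f: "\<And>x. x \<in> S \<Longrightarrow> (f has_vector_derivative f' x) (at x within S)"
    and B: "\<And>x. x \<in> S \<Longrightarrow> norm (f' x) \<le> B" and xy: "x \<in> S" "y \<in> S"
  shows "norm (f x - f y) \<le> B * \<bar>x - y\<bar>"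
proof -
  have "norm (f x - f y) \<le> B * norm (x - y)"
  proof (rule differentiable_bound[OF assms(1) _ _ xy])
    show "(f has_derivative (\<lambda>h. h *\<^sub>R f' z)) (at z within S)" if "z \<in> S" for z
      using f[OF that] by (simp add: has_vector_derivative_def)
    show "onorm (\<lambda>h. h *\<^sub>R f' z) \<le> B" if "z \<in> S" for z
      using B[OF that] by (intro onorm_bound order_trans[OF norm_ge_zero B[OF that]]) (simp add: mult_left_mono mult.commute[of B])
  qed
  then show ?thesis by simp
qed

lemma one_plus_norm_le_exp_weight:
  assumes s: "0 < s"
  shows "1 + norm \<xi> \<le> (1 + s powr s) * exp (weight s \<xi>)"
proof -
  have "norm \<xi> \<le> s powr s * exp (weight s \<xi>)"
    using power_le_powr_fact_exp[of 1 s "norm \<xi>" 1] s by (simp add: weight_def)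
  moreover have "1 \<le> exp (weight s \<xi>)" using weight_nonneg[of s \<xi>] by (simp only: one_le_exp_iff)
  ultimately show ?thesis unfolding distrib_right by linarith
qed

section \<open>The Cauchy problem\<close>

text \<open>The growth bound on real frequencies, for \<tau> \<le> t, is made an assumption. The
  Cauchy problem is solved from it; hyperbolicity is used only to verify it.\<close>

locale evolution = cauchy_system A B T
  for A :: "'n::finite \<Rightarrow> real \<Rightarrow> complex ^ 'm::finite ^ 'm" and B :: "real \<Rightarrow> complex ^ 'm ^ 'm" and T :: real +
  fixes s C0 :: real
  assumes s: "0 < s" and C0: "0 \<le> C0"
    and E_growth: "\<And>\<xi> t \<tau>. 0 \<le> \<tau> \<Longrightarrow> \<tau> \<le> t \<Longrightarrow> t \<le> T \<Longrightarrow> norm (E (cvec \<xi>) t \<tau>) \<le> exp (C0 * (1 + weight s \<xi>))"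
begin

lemma continuous_cvec_compose:
  fixes f :: "complex ^ 'n \<Rightarrow> 'z::topological_space"
  assumes "\<And>\<zeta>. isCont f \<zeta>"
  shows "continuous_on UNIV (\<lambda>\<xi>. f (cvec \<xi>))"
  by (rule continuous_on_compose2[OF continuous_at_imp_continuous_on continuous_on_cvec, of UNIV]) (use assms in auto)

lemma E_continuous:
  assumes "t \<in> {0..T}" "\<tau> \<in> {0..T}"
  shows "continuous_on UNIV (\<lambda>\<xi>. E (cvec \<xi>) t \<tau>)"
  by (rule continuous_cvec_compose) (rule E_isCont[OF assms])

lemma L_continuous:
  assumes "t \<in> {0..T}"
  shows "continuous_on UNIV (\<lambda>\<xi>. L (cvec \<xi>) t)"
  by (rule continuous_cvec_compose, rule isCont_if_locally_lipschitz) (rule L_diff_le[OF assms])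

definition "c1 = 1 + s powr s"

lemma c1: "1 \<le> c1"
  by (simp add: c1_def)

lemma L_growth:
  assumes "t \<in> {0..T}"
  shows "norm (L (cvec \<xi>) t) \<le> D * c1 * exp (weight s \<xi>)"
  using L_le[OF assms, of "cvec \<xi>"] mult_left_mono[OF one_plus_norm_le_exp_weight[OF s, of \<xi>] D(1)]
  by (simp add: c1_def norm_cvec mult.assoc)

lemma exp_split: "exp (C0 * (1 + w)) = exp C0 * exp (C0 * w)" for w :: real
  by (simp add: algebra_simps exp_add)

lemma coefficient_modulus:
  assumes t: "t \<in> {0..T}"
  shows "((\<lambda>r. norm (B r - B t) + (\<Sum>k\<in>UNIV. norm (A k r - A k t))) \<longlongrightarrow> 0) (at t within {0..T})"
proof -
  have "((\<lambda>r. norm (B r - B t) + (\<Sum>k\<in>UNIV. norm (A k r - A k t))) \<longlongrightarrow> norm (B t - B t) + (\<Sum>k\<in>UNIV. norm (A k t - A k t))) (at t within {0..T})"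
    using A_cont B_cont t unfolding continuous_on_def by (intro tendsto_intros) auto
  then show ?thesis by simp
qed

text \<open>The operation \<open>op\<close> stands for \<open>P ** Q\<close> and for
  \<open>- (Q ** P)\<close>, so that one argument treats the derivatives of \<open>E\<close> in both
  of its time variables, the first on \<open>{0..T}\<close> and the second on
  \<open>{0..t0}\<close>.\<close>

context
  fixes op :: "complex ^ 'm ^ 'm \<Rightarrow> complex ^ 'm ^ 'm \<Rightarrow> complex ^ 'm ^ 'm"
    and X :: "real ^ 'n \<Rightarrow> real \<Rightarrow> complex ^ 'm ^ 'm" and a b :: real
  assumes bb: "bounded_bilinear op" and op_le: "\<And>P Q. norm (op P Q) \<le> norm P * norm Q"
    and ab: "0 \<le> a" "b \<le> T"
    and X: "\<And>\<xi> \<sigma>. \<sigma> \<in> {a..b} \<Longrightarrow> (X \<xi> has_vector_derivative op (L (cvec \<xi>) \<sigma>) (X \<xi> \<sigma>)) (at \<sigma> within {a..b})"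
    and X_le: "\<And>\<xi> \<sigma>. \<sigma> \<in> {a..b} \<Longrightarrow> norm (X \<xi> \<sigma>) \<le> exp (C0 * (1 + weight s \<xi>))"
begin

lemma in_0T: "\<sigma> \<in> {a..b} \<Longrightarrow> \<sigma> \<in> {0..T}"
  using ab by auto

lemma generator_le:
  assumes "\<sigma> \<in> {a..b}"
  shows "norm (op (L (cvec \<xi>) \<sigma>) (X \<xi> \<sigma>)) \<le> D * c1 * exp C0 * exp ((C0 + 1) * weight s \<xi>)"
proof -
  have "norm (op (L (cvec \<xi>) \<sigma>) (X \<xi> \<sigma>)) \<le> (D * c1 * exp (weight s \<xi>)) * (exp C0 * exp (C0 * weight s \<xi>))"
    using mult_mono'[OF L_growth[OF in_0T[OF assms], of \<xi>] X_le[OF assms, of \<xi>, unfolded exp_split]] op_le[of "L (cvec \<xi>) \<sigma>" "X \<xi> \<sigma>"]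
    by (meson norm_ge_zero order_trans)
  also have "\<dots> = D * c1 * exp C0 * exp ((C0 + 1) * weight s \<xi>)"
    by (simp add: distrib_right exp_add)
  finally show ?thesis .
qed

text \<open>The generator varies with the modulus of continuity of the coefficients, and
  \<open>X\<close> is Lipschitz in time. Each occurrence of \<open>L\<close> costs one factor
  \<open>exp (weight s \<xi>)\<close>; the second one comes from the derivative of \<open>X\<close>.
  Hence the rate \<open>C0 + 2\<close>.\<close>

lemma derivative_modulus:
  assumes t: "t \<in> {a..b}" and e: "0 < e"
  shows "\<forall>\<^sub>F r in at t within {a..b}. \<forall>\<xi>. norm (op (L (cvec \<xi>) r) (X \<xi> r) - op (L (cvec \<xi>) t) (X \<xi> t)) \<le> e * exp ((C0 + 2) * weight s \<xi>)"
proof -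
  define \<omega> where "\<omega> r = norm (B r - B t) + (\<Sum>k\<in>UNIV. norm (A k r - A k t))" for r
  have \<omega>0: "0 \<le> \<omega> r" for r unfolding \<omega>_def by (intro add_nonneg_nonneg sum_nonneg) auto
  define Z where "Z r = \<omega> r * c1 * exp C0 + D * c1 * (D * c1 * exp C0 * \<bar>r - t\<bar>)" for r
  have sub: "{a..b} \<subseteq> {0..T}" using ab by auto
  have "(\<omega> \<longlongrightarrow> 0) (at t within {a..b})"
    using tendsto_within_subset[OF coefficient_modulus[OF in_0T[OF t]] sub] unfolding \<omega>_def .
  then have "(Z \<longlongrightarrow> 0 * c1 * exp C0 + D * c1 * (D * c1 * exp C0 * \<bar>t - t\<bar>)) (at t within {a..b})"
    unfolding Z_def by (intro tendsto_intros)
  then have "(Z \<longlongrightarrow> 0) (at t within {a..b})" by simp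
  then have "\<forall>\<^sub>F r in at t within {a..b}. Z r < e" using e by (rule order_tendstoD(2))
  moreover have "\<forall>\<^sub>F r in at t within {a..b}. r \<in> {a..b}" by (simp add: eventually_at_filter)
  ultimately show ?thesis
  proof eventually_elim
    case (elim r)
    show ?case
    proof
      fix \<xi>
      let ?w = "weight s \<xi>" and ?L = "L (cvec \<xi>)"
      have "op (?L r) (X \<xi> r) - op (?L t) (X \<xi> t) = op (?L r - ?L t) (X \<xi> r) + op (?L t) (X \<xi> r - X \<xi> t)"
        by (simp add: bounded_bilinear.diff_left[OF bb] bounded_bilinear.diff_right[OF bb])
      also have "norm \<dots> \<le> norm (?L r - ?L t) * norm (X \<xi> r) + norm (?L t) * norm (X \<xi> r - X \<xi> t)"
        by (rule order_trans[OF norm_triangle_ineq add_mono[OF op_le op_le]])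
      also have "\<dots> \<le> (\<omega> r * (c1 * exp ?w)) * (exp C0 * exp (C0 * ?w))
          + (D * c1 * exp ?w) * (D * c1 * exp C0 * exp ((C0 + 1) * ?w) * \<bar>r - t\<bar>)"
      proof (intro add_mono mult_mono')
        have "norm (?L r - ?L t) \<le> \<omega> r * (1 + norm \<xi>)"
          using L_time_diff_le[of "cvec \<xi>" r t] by (simp add: \<omega>_def norm_cvec)
        also have "\<dots> \<le> \<omega> r * (c1 * exp ?w)"
          using one_plus_norm_le_exp_weight[OF s, of \<xi>] \<omega>0 by (intro mult_left_mono) (simp_all add: c1_def)
        finally show "norm (?L r - ?L t) \<le> \<omega> r * (c1 * exp ?w)" .
        show "norm (X \<xi> r) \<le> exp C0 * exp (C0 * ?w)" using X_le[OF elim(2), of \<xi>] unfolding exp_split .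
        show "norm (?L t) \<le> D * c1 * exp ?w" by (rule L_growth[OF in_0T[OF t]])
        show "norm (X \<xi> r - X \<xi> t) \<le> D * c1 * exp C0 * exp ((C0 + 1) * ?w) * \<bar>r - t\<bar>"
          by (rule vector_derivative_bound[OF convex_real_interval(5) X generator_le elim(2) t])
      qed auto
      also have "\<dots> = \<omega> r * c1 * exp C0 * exp ((C0 + 1) * ?w) + D * c1 * (D * c1 * exp C0 * \<bar>r - t\<bar>) * exp ((C0 + 2) * ?w)"
      proof -
        have "exp ((C0 + 1) * ?w) = exp ?w * exp (C0 * ?w)" "exp ((C0 + 2) * ?w) = exp ?w * exp ((C0 + 1) * ?w)"
          by (simp_all add: algebra_simps flip: exp_add)
        then show ?thesis by simp
      qed
      also have "\<dots> \<le> \<omega> r * c1 * exp C0 * exp ((C0 + 2) * ?w) + D * c1 * (D * c1 * exp C0 * \<bar>r - t\<bar>) * exp ((C0 + 2) * ?w)"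
        using \<omega>0[of r] c1 by (intro add_mono mult_left_mono order_refl) (auto intro!: mult_right_mono mult_nonneg_nonneg)
      also have "\<dots> = Z r * exp ((C0 + 2) * ?w)" by (simp add: Z_def distrib_right)
      also have "\<dots> \<le> e * exp ((C0 + 2) * ?w)" using elim(1) by (intro mult_right_mono) auto
      finally show "norm (op (?L r) (X \<xi> r) - op (?L t) (X \<xi> t)) \<le> e * exp ((C0 + 2) * ?w)" .
    qed
  qed
qed

text \<open>The mean value inequality for \<open>X \<xi> \<sigma> - \<sigma> *\<^sub>R ?Y t\<close>
  near \<open>t\<close>. The radius \<open>d\<close> is common to all frequencies, which gives the
  uniformity.\<close>

lemma quotient_modulus:
  assumes t: "t \<in> {a..b}" and e: "0 < e"
  shows "\<forall>\<^sub>F r in at t within {a..b}. \<forall>\<xi>. norm ((X \<xi> r - X \<xi> t) /\<^sub>R (r - t) - op (L (cvec \<xi>) t) (X \<xi> t)) \<le> e * exp ((C0 + 2) * weight s \<xi>)"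
proof -
  obtain d where d: "0 < d" "\<And>r \<xi>. r \<in> {a..b} \<Longrightarrow> r \<noteq> t \<Longrightarrow> dist r t < d \<Longrightarrow>
      norm (op (L (cvec \<xi>) r) (X \<xi> r) - op (L (cvec \<xi>) t) (X \<xi> t)) \<le> e * exp ((C0 + 2) * weight s \<xi>)"
    using derivative_modulus[OF assms] unfolding eventually_at by blast
  have "norm ((X \<xi> r - X \<xi> t) /\<^sub>R (r - t) - op (L (cvec \<xi>) t) (X \<xi> t)) \<le> e * exp ((C0 + 2) * weight s \<xi>)"
    if r: "r \<in> {a..b}" "r \<noteq> t" "dist r t < d" for r \<xi>
  proof -
    let ?Y = "\<lambda>\<sigma>. op (L (cvec \<xi>) \<sigma>) (X \<xi> \<sigma>)" and ?S = "{a..b} \<inter> ball t d"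
    have "norm ((X \<xi> r - r *\<^sub>R ?Y t) - (X \<xi> t - t *\<^sub>R ?Y t)) \<le> e * exp ((C0 + 2) * weight s \<xi>) * \<bar>r - t\<bar>"
    proof (rule vector_derivative_bound[where S="?S" and f'="\<lambda>\<sigma>. ?Y \<sigma> - ?Y t"])
      show "convex ?S" by (intro convex_Int convex_real_interval convex_ball)
      show "((\<lambda>\<sigma>. X \<xi> \<sigma> - \<sigma> *\<^sub>R ?Y t) has_vector_derivative ?Y \<sigma> - ?Y t) (at \<sigma> within ?S)" if "\<sigma> \<in> ?S" for \<sigma>
      proof (rule has_vector_derivative_within_subset[of _ _ _ "{a..b}"])
        have "((\<lambda>\<sigma>. X \<xi> \<sigma> - \<sigma> *\<^sub>R ?Y t) has_vector_derivative ?Y \<sigma> - 1 *\<^sub>R ?Y t) (at \<sigma> within {a..b})"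
          using that X[of \<sigma> \<xi>] by (auto intro!: derivative_eq_intros)
        then show "((\<lambda>\<sigma>. X \<xi> \<sigma> - \<sigma> *\<^sub>R ?Y t) has_vector_derivative ?Y \<sigma> - ?Y t) (at \<sigma> within {a..b})" by simp
      qed auto
      show "norm (?Y \<sigma> - ?Y t) \<le> e * exp ((C0 + 2) * weight s \<xi>)" if "\<sigma> \<in> ?S" for \<sigma>
        using d(2)[of \<sigma> \<xi>] that e by (cases "\<sigma> = t") (auto simp: dist_commute)
    qed (use r t d(1) in \<open>auto simp: dist_commute\<close>)
    moreover have "(X \<xi> r - r *\<^sub>R ?Y t) - (X \<xi> t - t *\<^sub>R ?Y t) = (r - t) *\<^sub>R ((X \<xi> r - X \<xi> t) /\<^sub>R (r - t) - ?Y t)"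
      using r(2) by (simp add: scaleR_right_diff_distrib scaleR_left_diff_distrib)
    ultimately have "\<bar>r - t\<bar> * norm ((X \<xi> r - X \<xi> t) /\<^sub>R (r - t) - ?Y t) \<le> \<bar>r - t\<bar> * (e * exp ((C0 + 2) * weight s \<xi>))"
      by (simp only: norm_scaleR mult.commute)
    then show ?thesis using r(2) by (simp only: mult_le_cancel_left zero_less_abs_iff right_minus_eq simp_thms)
  qed
  then show ?thesis unfolding eventually_at using d(1) by blast
qed

end

lemma bounded_bilinear_minus_flip: "bounded_bilinear (\<lambda>P Q. - (Q ** P :: complex ^ 'm ^ 'm))"
  using bounded_bilinear.flip[OF bounded_bilinear.comp[OF bounded_bilinear_matrix_mult bounded_linear_minus[OF bounded_linear_ident] bounded_linear_ident]]
  by (simp add: bounded_bilinear.minus_left[OF bounded_bilinear_matrix_mult])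

lemma forward_growth: "\<sigma> \<in> {0..T} \<Longrightarrow> norm (E (cvec \<xi>) \<sigma> 0) \<le> exp (C0 * (1 + weight s \<xi>))"
  using E_growth by simp

lemmas forward_generator_le = generator_le[OF bounded_bilinear_matrix_mult matrix_matrix_mult_norm_le order_refl order_refl E_deriv1 forward_growth]
lemmas forward_derivative_modulus = derivative_modulus[OF bounded_bilinear_matrix_mult matrix_matrix_mult_norm_le order_refl order_refl E_deriv1 forward_growth]
lemmas forward_quotient_modulus = quotient_modulus[OF bounded_bilinear_matrix_mult matrix_matrix_mult_norm_le order_refl order_refl E_deriv1 forward_growth]

lemma backward_quotient_modulus:
  assumes t0: "t0 \<le> T" and t: "t \<in> {0..t0}" and e: "0 < e"
  shows "\<forall>\<^sub>F r in at t within {0..t0}. \<forall>\<xi>. norm ((E (cvec \<xi>) t0 r - E (cvec \<xi>) t0 t) /\<^sub>R (r - t) - (- (E (cvec \<xi>) t0 t ** L (cvec \<xi>) t))) \<le> e * exp ((C0 + 2) * weight s \<xi>)"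
proof (rule quotient_modulus[OF bounded_bilinear_minus_flip _ order_refl t0 _ _ t e])
  show "norm (- (Q ** P)) \<le> norm P * norm Q" for P Q :: "complex ^ 'm ^ 'm"
    using matrix_matrix_mult_norm_le[of Q P] by (simp add: mult.commute)
  show "(E (cvec \<xi>) t0 has_vector_derivative - (E (cvec \<xi>) t0 \<sigma> ** L (cvec \<xi>) \<sigma>)) (at \<sigma> within {0..t0})" if "\<sigma> \<in> {0..t0}" for \<xi> \<sigma>
    using E_deriv2[of \<sigma> "cvec \<xi>" t0] that t0 by (auto intro: has_vector_derivative_within_subset)
  show "norm (E (cvec \<xi>) t0 \<sigma>) \<le> exp (C0 * (1 + weight s \<xi>))" if "\<sigma> \<in> {0..t0}" for \<xi> \<sigma>
    using E_growth that t0 by simp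
qed

definition "cube R = {x :: real ^ 'n. \<forall>k. \<bar>x $ k\<bar> \<le> R}"

lemma compact_cube: "compact (cube R)"
proof -
  have "cube R = cbox (\<chi> k. - R) (\<chi> k. R)" by (auto simp: cube_def mem_box_cart abs_le_iff minus_le_iff)
  then show ?thesis by simp
qed

text \<open>Exponential types add: \<open>2 * D * T\<close> comes from \<open>E\<close> and
  \<open>r\<close> from the Fourier transform of \<open>\<psi>\<close>. The factor 4 is that of
  \<open>osc_eq_0_outside\<close>, applied to each coordinate. The cube depends on neither
  time.\<close>

lemma osc_E_gevrey_in:
  fixes \<psi> :: "real ^ 'n \<Rightarrow> complex"
  assumes \<psi>: "\<psi> \<in> gevrey_c s" and \<tau>: "0 \<le> \<tau>" "\<tau> \<le> t" "t \<le> T" and r: "0 < r" "\<And>(x :: real ^ 'n) k. \<psi> x \<noteq> 0 \<Longrightarrow> \<bar>x $ k\<bar> \<le> r"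
  shows "osc (\<lambda>\<xi>. (c *\<^sub>R E (cvec \<xi>) t \<tau> $ i) $ j * ft \<psi> \<xi>) \<in> gevrey_in s (cube (4 * (2 * D * T + r)))"
proof -
  let ?h = "\<lambda>\<xi>. (c *\<^sub>R E (cvec \<xi>) t \<tau> $ i) $ j * ft \<psi> \<xi>" and ?a = "2 * D * T + r"
  have tT: "t \<in> {0..T}" "\<tau> \<in> {0..T}" using \<tau> by auto
  have a: "0 < ?a" using D(1) T r(1) by (intro add_nonneg_pos mult_nonneg_nonneg) auto
  have h: "decaying s ?h"
  proof (rule mult_row_decaying[OF s _ _ decaying_ft[OF s \<psi>]])
    show "continuous_on UNIV (\<lambda>\<xi>. c *\<^sub>R E (cvec \<xi>) t \<tau> $ i)" by (intro continuous_intros E_continuous tT)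
    fix \<xi> :: "real ^ 'n"
    have "norm (c *\<^sub>R E (cvec \<xi>) t \<tau> $ i) \<le> \<bar>c\<bar> * exp (C0 * (1 + weight s \<xi>))"
      using order_trans[OF Finite_Cartesian_Product.norm_nth_le E_growth[OF \<tau>]] by (simp add: mult_left_mono)
    then show "norm (c *\<^sub>R E (cvec \<xi>) t \<tau> $ i) \<le> \<bar>c\<bar> * exp C0 * exp (C0 * weight s \<xi>)"
      unfolding exp_split by (simp add: mult.assoc)
  qed
  have \<psi>c: "continuous_on UNIV \<psi>"
    using \<psi> C_infinity_partial_deriv_continuous(2)[of \<psi> "[]"] by (simp add: gevrey_c_def gevrey_def)
  have supp: "\<bar>x $ k\<bar> \<le> r" if "x \<in> closure {x. \<psi> x \<noteq> 0}" for x :: "real ^ 'n" and k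
  proof -
    have "closure {x. \<psi> x \<noteq> 0} \<subseteq> {x. \<bar>x $ k\<bar> \<le> r}"
    proof (rule closure_minimal)
      show "closed {x :: real ^ 'n. \<bar>x $ k\<bar> \<le> r}" by (intro closed_Collect_le continuous_intros)
    qed (use r(2) in auto)
    then show ?thesis using that by blast
  qed
  have zero: "osc ?h x = 0" if x: "4 * ?a \<le> \<bar>x $ k\<bar>" for x :: "real ^ 'n" and k
  proof (rule osc_eq_0_outside[OF s h a _ x])
    fix \<xi> :: "real ^ 'n"
    obtain f C where f: "f holomorphic_on UNIV" "\<And>z. norm (f z) \<le> C * exp (r * norm z)"
      "\<And>\<tau>. f (complex_of_real \<tau>) = ft \<psi> (\<xi> + \<tau> *\<^sub>R axis k 1)"
      using ft_entire_extension[OF \<psi>c, of "closure {x. \<psi> x \<noteq> 0}" k r \<xi>] supp \<psi> closure_subset[of "{x. \<psi> x \<noteq> 0}"]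
      unfolding gevrey_c_def by blast
    let ?F = "\<lambda>z. complex_of_real c * E (cvec \<xi> + z *s axis k 1) t \<tau> $ i $ j * f z"
    have C: "0 \<le> C" using order_trans[OF norm_ge_zero f(2)[of 0]] by simp
    have "norm (?F z) \<le> \<bar>c\<bar> * (G 0 ^ 2 * exp (2 * D * T * norm \<xi>)) * C * exp (?a * norm z)" for z
    proof -
      have "norm (cvec \<xi> + z *s axis k 1 :: complex ^ 'n) \<le> norm \<xi> + norm z"
        using norm_triangle_ineq[of "cvec \<xi>" "z *s axis k 1 :: complex ^ 'n"] by (simp add: norm_cvec norm_smult_vec)
      then have "2 * D * T * norm (cvec \<xi> + z *s axis k 1 :: complex ^ 'n) \<le> 2 * D * T * (norm \<xi> + norm z)"
        using D(1) T by (intro mult_left_mono) auto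
      then have "norm (E (cvec \<xi> + z *s axis k 1) t \<tau> $ i $ j) \<le> G 0 ^ 2 * exp (2 * D * T * (norm \<xi> + norm z))"
        using order_trans[OF norm_entry_le E_le[OF tT, of "cvec \<xi> + z *s axis k 1"]]
        by (smt (verit, ccfv_SIG) exp_le_cancel_iff mult_left_mono zero_le_power2)
      then have "norm (?F z) \<le> \<bar>c\<bar> * (G 0 ^ 2 * exp (2 * D * T * (norm \<xi> + norm z))) * (C * exp (r * norm z))"
        using f(2)[of z] unfolding norm_mult norm_of_real by (intro mult_mono) auto
      also have "\<dots> = \<bar>c\<bar> * (G 0 ^ 2 * exp (2 * D * T * norm \<xi>)) * C * exp (?a * norm z)"
        by (simp add: algebra_simps exp_add)
      finally show ?thesis .
    qed
    moreover have "?F holomorphic_on UNIV" by (intro holomorphic_intros E_holomorphic tT f(1))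
    moreover have "?F (complex_of_real \<sigma>) = ?h (\<xi> + \<sigma> *\<^sub>R axis k 1)" for \<sigma>
      by (simp add: f(3) cvec_add_axis scaleR_conv_of_real[of c "_ :: complex"])
    ultimately show "\<exists>f C. f holomorphic_on UNIV \<and> (\<forall>z. norm (f z) \<le> C * exp (?a * norm z)) \<and>
      (\<forall>\<tau>. f (complex_of_real \<tau>) = ?h (\<xi> + \<tau> *\<^sub>R axis k 1))" by blast
  qed
  have "{x. osc ?h x \<noteq> 0} \<subseteq> cube (4 * ?a)"
  proof
    fix x assume "x \<in> {x. osc ?h x \<noteq> 0}"
    then have "\<not> 4 * ?a \<le> \<bar>x $ k\<bar>" for k using zero[of x k] by blast
    then show "x \<in> cube (4 * ?a)" unfolding cube_def by (simp add: not_le less_imp_le)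
  qed
  then have "closure {x. osc ?h x \<noteq> 0} \<subseteq> cube (4 * ?a)"
    using compact_cube compact_imp_closed closure_minimal by blast
  then show ?thesis using osc_in_gevrey[OF s h] by (simp add: gevrey_in_def)
qed

end

text \<open>The sums have the shape of an entry of the product of \<open>L\<close> with another
  matrix, see \<open>L_E_nth\<close> and \<open>E_L_nth\<close>; the factor
  \<open>\<i> * \<xi> $ k\<close> becomes a derivative.\<close>

lemma osc_first_order_combination:
  fixes H :: "'m::finite \<Rightarrow> real ^ 'n::finite \<Rightarrow> complex"
  assumes s: "0 < s" and H: "\<And>l. decaying s (H l)"
  shows "osc (\<lambda>\<xi>. (\<Sum>l\<in>UNIV. b l * H l \<xi>) + (\<Sum>l\<in>UNIV. \<Sum>k\<in>UNIV. a l k * (\<i> * complex_of_real (\<xi> $ k) * H l \<xi>)))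
    = (\<lambda>x. (\<Sum>l\<in>UNIV. b l * osc (H l) x) + (\<Sum>l\<in>UNIV. \<Sum>k\<in>UNIV. a l k * partial_deriv k (osc (H l)) x))"
proof
  fix x :: "real ^ 'n"
  note d = decaying_cmult[OF H] decaying_cmult[OF decaying_component[OF s H]]
  show "osc (\<lambda>\<xi>. (\<Sum>l\<in>UNIV. b l * H l \<xi>) + (\<Sum>l\<in>UNIV. \<Sum>k\<in>UNIV. a l k * (\<i> * complex_of_real (\<xi> $ k) * H l \<xi>))) x
    = (\<Sum>l\<in>UNIV. b l * osc (H l) x) + (\<Sum>l\<in>UNIV. \<Sum>k\<in>UNIV. a l k * partial_deriv k (osc (H l)) x)"
    unfolding partial_deriv_osc[OF s H]
    by (subst osc_add[OF s]) (simp_all only: decaying_sum d osc_sum[OF s] osc_cmult)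
qed

lemma dual_space_first_order_combination:
  fixes f :: "'m::finite \<Rightarrow> 'a \<Rightarrow> complex" and f' :: "'m \<Rightarrow> 'n::finite \<Rightarrow> 'a \<Rightarrow> complex"
  assumes V: "lin_space V" and u: "u \<in> dual_space (lc_topology V P)"
    and f: "\<And>l. f l \<in> V" and f': "\<And>l k. f' l k \<in> V"
  shows "u (\<lambda>x. (\<Sum>l\<in>UNIV. b l * f l x) + (\<Sum>l\<in>UNIV. \<Sum>k\<in>UNIV. a l k * f' l k x))
    = (\<Sum>l\<in>UNIV. b l * u (f l)) + (\<Sum>l\<in>UNIV. \<Sum>k\<in>UNIV. a l k * u (f' l k))"
proof -
  have 1: "(\<lambda>x. b l * f l x) \<in> V" for l by (intro lin_spaceD(3)[OF V] f)
  have 2: "(\<lambda>x. a l k * f' l k x) \<in> V" for l k by (intro lin_spaceD(3)[OF V] f')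
  have 3: "(\<lambda>x. \<Sum>k\<in>UNIV. a l k * f' l k x) \<in> V" for l by (intro lin_space_sum[OF V] 2)
  have 4: "(\<lambda>x. \<Sum>l\<in>UNIV. b l * f l x) \<in> V" by (intro lin_space_sum[OF V] 1)
  have 5: "(\<lambda>x. \<Sum>l\<in>UNIV. \<Sum>k\<in>UNIV. a l k * f' l k x) \<in> V" by (intro lin_space_sum[OF V] 3)
  show ?thesis
    unfolding dual_spaceD(1)[OF u 4 5] dual_space_sum[OF V u 1] dual_space_sum[OF V u 3] dual_space_sum[OF V u 2]
      dual_spaceD(2)[OF u f] dual_spaceD(2)[OF u f'] ..
qed

lemma gevrey_c_eq_osc:
  fixes \<phi> :: "real ^ 'n::finite \<Rightarrow> complex"
  assumes s: "0 < s" and \<phi>: "\<phi> \<in> gevrey_c s"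
  shows "osc (\<lambda>\<xi>. complex_of_real (1 / (2 * pi) ^ CARD('n)) * ft \<phi> \<xi>) = \<phi>"
proof
  fix x
  obtain K where K: "compact K" "K \<noteq> {}" "\<phi> \<in> gevrey_in s K" using gevrey_c_imp_gevrey_in[OF \<phi>] by blast
  have "C_infinity \<phi>" using \<phi> by (auto simp: gevrey_c_def gevrey_def)
  then have "continuous_on UNIV \<phi>" using C_infinity_partial_deriv_continuous(2)[of \<phi> "[]"] by simp
  from fourier_inversion[OF this K(1) gevrey_in_zero_outside[OF K(3)] s decaying_ft[OF s \<phi>], of x]
  show "osc (\<lambda>\<xi>. complex_of_real (1 / (2 * pi) ^ CARD('n)) * ft \<phi> \<xi>) x = \<phi> x"
    unfolding osc_cmult by simp
qed

text \<open>The Gevrey bounds of the derivative come from Fourier inversion, since multiplication by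
  \<open>\<i> * \<xi> $ k\<close> preserves \<open>decaying\<close>. The support does not
  grow.\<close>

lemma gevrey_c_partial_deriv:
  fixes \<phi> :: "real ^ 'n::finite \<Rightarrow> complex"
  assumes s: "0 < s" and \<phi>: "\<phi> \<in> gevrey_c s"
  shows "partial_deriv k \<phi> \<in> gevrey_c s" "ft (partial_deriv k \<phi>) \<xi> = \<i> * complex_of_real (\<xi> $ k) * ft \<phi> \<xi>"
proof -
  note d = decaying_cmult[OF decaying_ft[OF s \<phi>], of "complex_of_real (1 / (2 * pi) ^ CARD('n))"]
  have "partial_deriv k \<phi> \<in> gevrey s"
    using osc_in_gevrey[OF s decaying_component[OF s d, of k]] partial_deriv_osc[OF s d, of k]
    unfolding gevrey_c_eq_osc[OF s \<phi>] by simp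
  moreover have "{x. partial_deriv k \<phi> x \<noteq> 0} \<subseteq> closure {x. \<phi> x \<noteq> 0}"
  proof -
    have "\<phi> x = 0" if "x \<notin> closure {x. \<phi> x \<noteq> 0}" for x using that closure_subset[of "{x. \<phi> x \<noteq> 0}"] by blast
    then show ?thesis using partial_deriv_eq_0_outside[OF closed_closure, of "{x. \<phi> x \<noteq> 0}" \<phi> _ k] by blast
  qed
  ultimately show "partial_deriv k \<phi> \<in> gevrey_c s"
    using \<phi> bounded_subset unfolding gevrey_c_iff gevrey_c_def compact_eq_bounded_closed by blast
  obtain K where K: "compact K" "K \<noteq> {}" "\<phi> \<in> gevrey_in s K" using gevrey_c_imp_gevrey_in[OF \<phi>] by blast
  have C: "C_infinity \<phi>" using \<phi> by (auto simp: gevrey_c_def gevrey_def)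
  show "ft (partial_deriv k \<phi>) \<xi> = \<i> * complex_of_real (\<xi> $ k) * ft \<phi> \<xi>"
  proof (rule ft_partial_deriv[OF _ _ K(1) gevrey_in_zero_outside[OF K(3)]])
    show "\<phi> differentiable (at x)" for x using C_infinity_partial_deriv_continuous(1)[OF C, of "[]" x] by simp
    show "continuous_on UNIV (partial_deriv k \<phi>)" using C_infinity_partial_deriv_continuous(2)[OF C, of "[k]"] by simp
  qed
qed

lemma Dx_eq: "\<phi> \<in> gevrey_c s \<Longrightarrow> Dx s k u \<phi> = \<i> * u (partial_deriv k \<phi>)"
  by (simp add: Dx_def restrict_functional_def)

lemma equation_solved_for_derivative:
  fixes u v a b c d :: complex
  shows "- \<i> * u - (\<Sum>k\<in>K. \<Sum>j\<in>J. A k j * (\<i> * V k j)) - (\<Sum>j\<in>J. (B j * W j :: complex)) = 0 \<longleftrightarrow>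
    u = \<i> * (\<Sum>j\<in>J. B j * W j) - (\<Sum>k\<in>K. \<Sum>j\<in>J. A k j * V k j)"
proof -
  have "(\<Sum>k\<in>K. \<Sum>j\<in>J. A k j * (\<i> * V k j)) = \<i> * (\<Sum>k\<in>K. \<Sum>j\<in>J. A k j * V k j)"
    by (simp add: sum_distrib_left mult.left_commute)
  moreover have "- \<i> * u - \<i> * x - y = 0 \<longleftrightarrow> u = \<i> * y - x" for x y :: complex
  proof -
    have "- \<i> * u - \<i> * x - y = - \<i> * (u - (\<i> * y - x))" by (simp add: algebra_simps)
    then show ?thesis by simp
  qed
  ultimately show ?thesis by simp
qed

section \<open>The solution and its time derivative\<close>

context evolution
begin

text \<open>The constant of Fourier inversion. It is put into the multiplier, so that
  \<open>E = mat 1\<close> at time 0 returns the initial value itself.\<close>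

definition "kappa = 1 / (2 * pi) ^ CARD('n)"

text \<open>The rate \<open>C0 + 2\<close> is the one at which the difference quotients of
  \<open>E\<close> converge; all multipliers are estimated at this common rate.\<close>

lemma row_bound:
  assumes "0 \<le> \<tau>" "\<tau> \<le> t" "t \<le> T"
  shows "norm (c *\<^sub>R E (cvec \<xi>) t \<tau> $ i) \<le> (\<bar>c\<bar> * exp C0) * exp ((C0 + 2) * weight s \<xi>)"
proof -
  have "norm (c *\<^sub>R E (cvec \<xi>) t \<tau> $ i) \<le> \<bar>c\<bar> * (exp C0 * exp (C0 * weight s \<xi>))"
    using order_trans[OF Finite_Cartesian_Product.norm_nth_le E_growth[OF assms]] unfolding exp_split
    by (simp add: mult_left_mono)
  also have "\<dots> \<le> \<bar>c\<bar> * (exp C0 * exp ((C0 + 2) * weight s \<xi>))"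
    by (intro mult_left_mono) (auto intro!: mult_right_mono)
  finally show ?thesis by (simp add: mult.assoc)
qed

lemma row_continuous:
  assumes "0 \<le> \<tau>" "\<tau> \<le> t" "t \<le> T"
  shows "continuous_on UNIV (\<lambda>\<xi>. c *\<^sub>R E (cvec \<xi>) t \<tau> $ i)"
  using assms by (intro continuous_intros E_continuous) auto

lemma L_E_nth:
  "(L \<zeta> t ** X) $ i $ j = (\<Sum>l\<in>UNIV. \<i> * B t $ i $ l * X $ l $ j) + (\<Sum>l\<in>UNIV. \<Sum>k\<in>UNIV. - A k t $ i $ l * (\<i> * \<zeta> $ k * X $ l $ j))"
  by (simp add: matrix_matrix_mult_def L_nth algebra_simps sum_distrib_left sum_subtractf sum_negf)

lemma E_L_nth:
  "(- (X ** L \<zeta> t)) $ i $ j = (\<Sum>l\<in>UNIV. - (\<i> * B t $ l $ j) * X $ i $ l) + (\<Sum>l\<in>UNIV. \<Sum>k\<in>UNIV. A k t $ l $ j * (\<i> * \<zeta> $ k * X $ i $ l))"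
  by (simp add: matrix_matrix_mult_def L_nth algebra_simps sum_distrib_left sum_subtractf sum_negf)

text \<open>On the Fourier side, the component \<open>j\<close> of the test function which has to be
  paired with a solution at time \<tau> in order to obtain
  \<open>u\<^sub>i(t)(\<phi>)\<close>.\<close>

definition "W t \<tau> i j \<phi> = (\<lambda>\<xi>. (kappa *\<^sub>R E (cvec \<xi>) t \<tau> $ i) $ j * ft \<phi> \<xi>)"

lemma W_decaying:
  assumes "0 \<le> \<tau>" "\<tau> \<le> t" "t \<le> T" "\<phi> \<in> gevrey_c s"
  shows "decaying s (W t \<tau> i j \<phi>)"
  unfolding W_def
  by (rule mult_row_decaying[OF s row_continuous[OF assms(1-3)] row_bound[OF assms(1-3)] decaying_ft[OF s assms(4)]])

lemma W_partial_deriv: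
  assumes "\<phi> \<in> gevrey_c s"
  shows "W t \<tau> i j (partial_deriv k \<phi>) = (\<lambda>\<xi>. \<i> * complex_of_real (\<xi> $ k) * W t \<tau> i j \<phi> \<xi>)"
  by (simp add: W_def gevrey_c_partial_deriv(2)[OF s assms] fun_eq_iff mult.left_commute)

lemma W_refl:
  assumes "t \<in> {0..T}" "\<phi> \<in> gevrey_c s"
  shows "osc (W t t i j \<phi>) = (if i = j then \<phi> else (\<lambda>x. 0))"
proof -
  have "W t t i j \<phi> = (if i = j then \<lambda>\<xi>. complex_of_real kappa * ft \<phi> \<xi> else (\<lambda>\<xi>. 0))"
    by (simp add: W_def E_refl[OF assms(1)] mat_def fun_eq_iff scaleR_conv_of_real[of _ "_ :: complex"])
  then show ?thesis using gevrey_c_eq_osc[OF s assms(2)] by (simp add: kappa_def osc_zero_fun)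
qed

lemma generator_row_bound:
  assumes t: "t \<in> {0..T}"
  shows "norm (c *\<^sub>R (L (cvec \<xi>) t ** E (cvec \<xi>) t 0) $ i) \<le> (\<bar>c\<bar> * (D * c1 * exp C0)) * exp ((C0 + 2) * weight s \<xi>)"
proof -
  have "norm ((L (cvec \<xi>) t ** E (cvec \<xi>) t 0) $ i) \<le> D * c1 * exp C0 * exp ((C0 + 1) * weight s \<xi>)"
    by (rule order_trans[OF Finite_Cartesian_Product.norm_nth_le forward_generator_le[OF _ _ t]])
  also have "\<dots> \<le> D * c1 * exp C0 * exp ((C0 + 2) * weight s \<xi>)"
    using D(1) c1 by (intro mult_left_mono) (auto intro!: mult_right_mono)
  finally show ?thesis by (simp add: mult_left_mono mult.assoc)
qed

lemma generator_row_continuous: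
  assumes "t \<in> {0..T}"
  shows "continuous_on UNIV (\<lambda>\<xi>. c *\<^sub>R (L (cvec \<xi>) t ** E (cvec \<xi>) t 0) $ i)"
  using assms T
  by (intro continuous_intros bounded_bilinear.continuous_on[OF bounded_bilinear_matrix_mult] E_continuous L_continuous) auto

lemma kappa_nonneg: "0 < kappa" "kappa \<le> 1"
proof -
  have "1 \<le> (2 * pi) ^ CARD('n)" by (rule one_le_power) (use pi_gt3 in simp)
  then show "0 < kappa" "kappa \<le> 1" 
    unfolding kappa_def by (auto simp only: zero_less_divide_1_iff divide_le_eq_1)
qed

context
  fixes g :: "'n functional ^ 'm"
  assumes g: "\<And>j. g $ j \<in> ultradistr_compact s"
begin

definition "U t i = mult_functional s g (\<lambda>\<xi>. kappa *\<^sub>R E (cvec \<xi>) t 0 $ i)"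
text \<open>\<open>L ** E\<close> is the derivative of \<open>E\<close> in its first time variable,
  so this is the candidate for the derivative of \<open>U\<close>.\<close>

definition "U' t i = mult_functional s g (\<lambda>\<xi>. kappa *\<^sub>R (L (cvec \<xi>) t ** E (cvec \<xi>) t 0) $ i)"

lemma U_apply: "\<phi> \<in> gevrey_c s \<Longrightarrow> U t i \<phi> = (\<Sum>j\<in>UNIV. (g $ j) (osc (W t 0 i j \<phi>)))"
  by (simp add: U_def mult_functional_def W_def)

lemma U_0: "U 0 i = restrict_functional (gevrey_c s) (g $ i)"
proof
  fix \<phi>
  show "U 0 i \<phi> = restrict_functional (gevrey_c s) (g $ i) \<phi>"
  proof (cases "\<phi> \<in> gevrey_c s")
    case True
    have 0: "(g $ j) (\<lambda>x. 0) = 0" for j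
      using ultradistr_compact_linear(2)[OF s g decaying_0 decaying_0, of j 0] by (simp add: osc_zero_fun)
    have "0 \<in> {0..T}" using T by simp
    then have "U 0 i \<phi> = (\<Sum>j\<in>UNIV. if i = j then (g $ j) \<phi> else 0)"
      unfolding U_apply[OF True] using True by (intro sum.cong) (simp_all add: W_refl 0)
    then show ?thesis using True by (simp add: restrict_functional_def)
  qed (simp add: U_def mult_functional_def restrict_functional_def)
qed

text \<open>The entries of \<open>L ** E\<close> are expanded. Under \<open>osc\<close> each factor
  \<open>\<i> * \<xi> $ k\<close> becomes a derivative of the test function, the functionals
  \<open>g $ j\<close> are linear, and exchanging the sums collects the components of
  \<open>U\<close>.\<close>

lemma U'_equation:
  assumes t: "t \<in> {0..T}" and \<phi>: "\<phi> \<in> gevrey_c s"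
  shows "U' t i \<phi> = \<i> * (\<Sum>l\<in>UNIV. B t $ i $ l * U t l \<phi>) - (\<Sum>k\<in>UNIV. \<Sum>l\<in>UNIV. A k t $ i $ l * U t l (partial_deriv k \<phi>))"
proof -
  have t': "0 \<le> t" "t \<le> T" using t by auto
  have W: "decaying s (W t 0 l j \<phi>)" for l j by (rule W_decaying[OF order_refl t' \<phi>])
  have "(g $ j) (osc (\<lambda>\<xi>. (kappa *\<^sub>R (L (cvec \<xi>) t ** E (cvec \<xi>) t 0) $ i) $ j * ft \<phi> \<xi>))
      = (\<Sum>l\<in>UNIV. \<i> * B t $ i $ l * (g $ j) (osc (W t 0 l j \<phi>)))
      + (\<Sum>l\<in>UNIV. \<Sum>k\<in>UNIV. - A k t $ i $ l * (g $ j) (osc (W t 0 l j (partial_deriv k \<phi>))))" for j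
  proof -
    have "(\<lambda>\<xi>. (kappa *\<^sub>R (L (cvec \<xi>) t ** E (cvec \<xi>) t 0) $ i) $ j * ft \<phi> \<xi>)
        = (\<lambda>\<xi>. (\<Sum>l\<in>UNIV. (\<i> * B t $ i $ l) * W t 0 l j \<phi> \<xi>)
            + (\<Sum>l\<in>UNIV. \<Sum>k\<in>UNIV. (- A k t $ i $ l) * (\<i> * complex_of_real (\<xi> $ k) * W t 0 l j \<phi> \<xi>)))"
    proof
      fix \<xi>
      have "(kappa *\<^sub>R (L (cvec \<xi>) t ** E (cvec \<xi>) t 0) $ i) $ j * ft \<phi> \<xi> = of_real kappa * (L (cvec \<xi>) t ** E (cvec \<xi>) t 0) $ i $ j * ft \<phi> \<xi>"
        by (simp add: scaleR_conv_of_real[of _ "_ :: complex"])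
      also have "\<dots> = (\<Sum>l\<in>UNIV. (\<i> * B t $ i $ l) * W t 0 l j \<phi> \<xi>)
            + (\<Sum>l\<in>UNIV. \<Sum>k\<in>UNIV. (- A k t $ i $ l) * (\<i> * complex_of_real (\<xi> $ k) * W t 0 l j \<phi> \<xi>))"
        unfolding L_E_nth W_def distrib_left distrib_right sum_distrib_left sum_distrib_right
        by (intro arg_cong2[of _ _ _ _ "(+)"] sum.cong refl)
           (simp_all add: cvec_def scaleR_conv_of_real[of _ "_ :: complex"])
      finally show "(kappa *\<^sub>R (L (cvec \<xi>) t ** E (cvec \<xi>) t 0) $ i) $ j * ft \<phi> \<xi>
        = (\<Sum>l\<in>UNIV. (\<i> * B t $ i $ l) * W t 0 l j \<phi> \<xi>)
            + (\<Sum>l\<in>UNIV. \<Sum>k\<in>UNIV. (- A k t $ i $ l) * (\<i> * complex_of_real (\<xi> $ k) * W t 0 l j \<phi> \<xi>))" .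
    qed
    then have "osc (\<lambda>\<xi>. (kappa *\<^sub>R (L (cvec \<xi>) t ** E (cvec \<xi>) t 0) $ i) $ j * ft \<phi> \<xi>)
        = (\<lambda>x. (\<Sum>l\<in>UNIV. (\<i> * B t $ i $ l) * osc (W t 0 l j \<phi>) x)
            + (\<Sum>l\<in>UNIV. \<Sum>k\<in>UNIV. (- A k t $ i $ l) * osc (W t 0 l j (partial_deriv k \<phi>)) x))"
      unfolding W_partial_deriv[OF \<phi>] by (simp only: osc_first_order_combination[OF s W] partial_deriv_osc[OF s W])
    note eq = this
    have in_gevrey: "osc (W t 0 l j \<psi>) \<in> gevrey s" if "\<psi> \<in> gevrey_c s" for l \<psi>
      by (intro osc_in_gevrey[OF s] W_decaying order_refl t' that)
    show ?thesis
      unfolding eq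
      by (rule dual_space_first_order_combination[OF lin_space_gevrey[OF s] g[unfolded ultradistr_compact_def gevrey_top_eq]])
         (intro in_gevrey \<phi> gevrey_c_partial_deriv(1)[OF s])+
  qed
  then have "U' t i \<phi> = (\<Sum>j\<in>UNIV. (\<Sum>l\<in>UNIV. \<i> * B t $ i $ l * (g $ j) (osc (W t 0 l j \<phi>))))
      + (\<Sum>j\<in>UNIV. (\<Sum>l\<in>UNIV. \<Sum>k\<in>UNIV. - A k t $ i $ l * (g $ j) (osc (W t 0 l j (partial_deriv k \<phi>)))))"
    using \<phi> unfolding U'_def mult_functional_def sum.distrib[symmetric] by simp
  also have "(\<Sum>j\<in>UNIV. (\<Sum>l\<in>UNIV. \<i> * B t $ i $ l * (g $ j) (osc (W t 0 l j \<phi>)))) = \<i> * (\<Sum>l\<in>UNIV. B t $ i $ l * U t l \<phi>)"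
    by (subst sum.swap) (simp add: U_apply[OF \<phi>] sum_distrib_left mult.assoc)
  also have "(\<Sum>j\<in>UNIV. (\<Sum>l\<in>UNIV. \<Sum>k\<in>UNIV. - A k t $ i $ l * (g $ j) (osc (W t 0 l j (partial_deriv k \<phi>)))))
      = - (\<Sum>k\<in>UNIV. \<Sum>l\<in>UNIV. A k t $ i $ l * U t l (partial_deriv k \<phi>))"
  proof -
    have "(\<Sum>j\<in>UNIV. (\<Sum>l\<in>UNIV. \<Sum>k\<in>UNIV. - A k t $ i $ l * (g $ j) (osc (W t 0 l j (partial_deriv k \<phi>)))))
      = (\<Sum>l\<in>UNIV. \<Sum>k\<in>UNIV. \<Sum>j\<in>UNIV. - A k t $ i $ l * (g $ j) (osc (W t 0 l j (partial_deriv k \<phi>))))"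
      by (subst sum.swap, intro sum.cong refl, rule sum.swap)
    also have "\<dots> = (\<Sum>k\<in>UNIV. \<Sum>l\<in>UNIV. \<Sum>j\<in>UNIV. - A k t $ i $ l * (g $ j) (osc (W t 0 l j (partial_deriv k \<phi>))))"
      by (rule sum.swap)
    finally show ?thesis
      by (simp add: U_apply[OF gevrey_c_partial_deriv(1)[OF s \<phi>]] sum_distrib_left sum_negf)
  qed
  finally show ?thesis by simp
qed

lemma U_dual: "t \<in> {0..T} \<Longrightarrow> U t i \<in> dual_space (gevrey_c_top s)"
  unfolding U_def by (rule mult_functional_dual[OF s g row_continuous row_bound]) auto

text \<open>Limit of the quotients and continuity of the derivative are both instances of
  \<open>mult_functional_limit\<close>, with the uniform estimates
  \<open>forward_quotient_modulus\<close> and \<open>forward_derivative_modulus\<close> for the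
  multipliers.\<close>

lemma U_C1: "C1_with_deriv (ultradistr_top s) {0..T} (\<lambda>t. U t i) (\<lambda>t. U' t i)"
  unfolding C1_with_deriv_def topspace_ultradistr_top
proof (intro conjI ballI U_dual)
  fix t assume t: "t \<in> {0..T}"
  have S: "\<forall>\<^sub>F r in at t within {0..T}. r \<in> {0..T}" by (simp add: eventually_at_filter)
  have t': "0 \<le> t" "t \<le> T" using t by auto
  define M where "M r = (\<lambda>\<xi>. inverse (r - t) *\<^sub>R (kappa *\<^sub>R E (cvec \<xi>) r 0 $ i) + (- inverse (r - t)) *\<^sub>R (kappa *\<^sub>R E (cvec \<xi>) t 0 $ i))" for r
  have "limitin (ultradistr_top s) (\<lambda>r. mult_functional s g (M r)) (U' t i) (at t within {0..T})"
    unfolding U'_def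
  proof (rule mult_functional_limit[OF s g _ generator_row_continuous[OF t] generator_row_bound[OF t]])
    show "\<forall>\<^sub>F r in at t within {0..T}. continuous_on UNIV (M r) \<and> (\<exists>D. \<forall>\<xi>. norm (M r \<xi>) \<le> D * exp ((C0 + 2) * weight s \<xi>))"
      using S
    proof eventually_elim
      case (elim r)
      then have r: "0 \<le> r" "r \<le> T" by auto
      let ?b = "\<bar>inverse (r - t)\<bar> * (\<bar>kappa\<bar> * exp C0)"
      have "norm (M r \<xi>) \<le> (?b + ?b) * exp ((C0 + 2) * weight s \<xi>)" for \<xi>
      proof -
        have "norm (M r \<xi>) \<le> norm (inverse (r - t) *\<^sub>R (kappa *\<^sub>R E (cvec \<xi>) r 0 $ i)) + norm ((- inverse (r - t)) *\<^sub>R (kappa *\<^sub>R E (cvec \<xi>) t 0 $ i))"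
          unfolding M_def by (rule norm_triangle_ineq)
        also have "\<dots> \<le> \<bar>inverse (r - t)\<bar> * ((\<bar>kappa\<bar> * exp C0) * exp ((C0 + 2) * weight s \<xi>))
            + \<bar>inverse (r - t)\<bar> * ((\<bar>kappa\<bar> * exp C0) * exp ((C0 + 2) * weight s \<xi>))"
          unfolding norm_scaleR[of "inverse (r - t)"] norm_scaleR[of "- inverse (r - t)"] abs_minus
          by (intro add_mono mult_left_mono row_bound r t' order_refl abs_ge_zero)
        finally show ?thesis by (simp only: distrib_right mult.assoc)
      qed
      moreover have "continuous_on UNIV (M r)"
        unfolding M_def using r t' by (intro continuous_intros E_continuous) auto
      ultimately show ?case by blast
    qed
    fix e :: real assume e: "0 < e"
    show "\<forall>\<^sub>F r in at t within {0..T}. \<forall>\<xi>. norm (M r \<xi> - kappa *\<^sub>R (L (cvec \<xi>) t ** E (cvec \<xi>) t 0) $ i) \<le> e * exp ((C0 + 2) * weight s \<xi>)"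
    proof (rule eventually_mono[OF forward_quotient_modulus[OF _ _ t e]], assumption, assumption, intro allI)
      fix r \<xi>
      let ?Q = "(E (cvec \<xi>) r 0 - E (cvec \<xi>) t 0) /\<^sub>R (r - t) - L (cvec \<xi>) t ** E (cvec \<xi>) t 0"
      assume "\<forall>\<xi>. norm ((E (cvec \<xi>) r 0 - E (cvec \<xi>) t 0) /\<^sub>R (r - t) - L (cvec \<xi>) t ** E (cvec \<xi>) t 0) \<le> e * exp ((C0 + 2) * weight s \<xi>)"
      then have Q: "norm ?Q \<le> e * exp ((C0 + 2) * weight s \<xi>)" by blast
      have "M r \<xi> - kappa *\<^sub>R (L (cvec \<xi>) t ** E (cvec \<xi>) t 0) $ i = kappa *\<^sub>R ?Q $ i"
        by (simp add: M_def vec_eq_iff algebra_simps)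
      also have "norm \<dots> \<le> 1 * norm ?Q"
        unfolding norm_scaleR using kappa_nonneg by (intro mult_mono Finite_Cartesian_Product.norm_nth_le) auto
      finally show "norm (M r \<xi> - kappa *\<^sub>R (L (cvec \<xi>) t ** E (cvec \<xi>) t 0) $ i) \<le> e * exp ((C0 + 2) * weight s \<xi>)"
        using Q by simp
    qed
  qed
  then show "limitin (ultradistr_top s) (\<lambda>r \<phi>. (U r i \<phi> - U t i \<phi>) / complex_of_real (r - t)) (U' t i) (at t within {0..T})"
  proof (rule limitin_transform_eventually[rotated])
    show "\<forall>\<^sub>F r in at t within {0..T}. mult_functional s g (M r) = (\<lambda>\<phi>. (U r i \<phi> - U t i \<phi>) / complex_of_real (r - t))"
      using S
    proof eventually_elim
      case (elim r)
      then have r: "0 \<le> r" "r \<le> T" by auto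
      show ?case
      proof
        fix \<phi>
        show "mult_functional s g (M r) \<phi> = (U r i \<phi> - U t i \<phi>) / complex_of_real (r - t)"
          unfolding M_def U_def
          by (subst mult_functional_lin_comb[OF s g row_continuous[OF order_refl r] row_bound[OF order_refl r] row_continuous[OF order_refl t'] row_bound[OF order_refl t']])
             (simp add: divide_inverse algebra_simps)
      qed
    qed
  qed
next
  have "limitin (ultradistr_top s) (\<lambda>t. U' t i) (U' t i) (at t within {0..T})" if t: "t \<in> {0..T}" for t
    unfolding U'_def
  proof (rule mult_functional_limit[OF s g _ generator_row_continuous[OF t] generator_row_bound[OF t]])
    have S: "\<forall>\<^sub>F r in at t within {0..T}. r \<in> {0..T}" by (simp add: eventually_at_filter)
    show "\<forall>\<^sub>F r in at t within {0..T}. continuous_on UNIV (\<lambda>\<xi>. kappa *\<^sub>R (L (cvec \<xi>) r ** E (cvec \<xi>) r 0) $ i) \<and>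
        (\<exists>D. \<forall>\<xi>. norm (kappa *\<^sub>R (L (cvec \<xi>) r ** E (cvec \<xi>) r 0) $ i) \<le> D * exp ((C0 + 2) * weight s \<xi>))"
      using S by eventually_elim (use generator_row_continuous generator_row_bound in blast)
    fix e :: real assume e: "0 < e"
    show "\<forall>\<^sub>F r in at t within {0..T}. \<forall>\<xi>. norm (kappa *\<^sub>R (L (cvec \<xi>) r ** E (cvec \<xi>) r 0) $ i - kappa *\<^sub>R (L (cvec \<xi>) t ** E (cvec \<xi>) t 0) $ i) \<le> e * exp ((C0 + 2) * weight s \<xi>)"
    proof (rule eventually_mono[OF forward_derivative_modulus[OF _ _ t e]], assumption, assumption, intro allI)
      fix r \<xi>
      let ?Q = "L (cvec \<xi>) r ** E (cvec \<xi>) r 0 - L (cvec \<xi>) t ** E (cvec \<xi>) t 0"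
      assume "\<forall>\<xi>. norm (L (cvec \<xi>) r ** E (cvec \<xi>) r 0 - L (cvec \<xi>) t ** E (cvec \<xi>) t 0) \<le> e * exp ((C0 + 2) * weight s \<xi>)"
      then have Q: "norm ?Q \<le> e * exp ((C0 + 2) * weight s \<xi>)" by blast
      have "kappa *\<^sub>R (L (cvec \<xi>) r ** E (cvec \<xi>) r 0) $ i - kappa *\<^sub>R (L (cvec \<xi>) t ** E (cvec \<xi>) t 0) $ i = kappa *\<^sub>R ?Q $ i"
        by (simp add: scaleR_right_diff_distrib)
      also have "norm \<dots> \<le> 1 * norm ?Q"
        unfolding norm_scaleR using kappa_nonneg by (intro mult_mono Finite_Cartesian_Product.norm_nth_le) auto
      finally show "norm (kappa *\<^sub>R (L (cvec \<xi>) r ** E (cvec \<xi>) r 0) $ i - kappa *\<^sub>R (L (cvec \<xi>) t ** E (cvec \<xi>) t 0) $ i) \<le> e * exp ((C0 + 2) * weight s \<xi>)"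
        using Q by simp
    qed
  qed
  then show "continuous_map (top_of_set {0..T}) (ultradistr_top s) (\<lambda>t. U' t i)"
    unfolding ultradistr_top_def strong_dual_def by (rule continuous_map_lc_topologyI)
qed

end

lemma gevrey_in_partial_deriv_osc:
  assumes h: "decaying s h" "osc h \<in> gevrey_in s K" and K: "closed K"
  shows "partial_deriv k (osc h) \<in> gevrey_in s K"
proof -
  have "partial_deriv k (osc h) \<in> gevrey s"
    unfolding partial_deriv_osc[OF s h(1)] by (rule osc_in_gevrey[OF s decaying_component[OF s h(1)]])
  moreover have "{x. partial_deriv k (osc h) x \<noteq> 0} \<subseteq> K"
  proof
    fix x assume "x \<in> {x. partial_deriv k (osc h) x \<noteq> 0}"
    then show "x \<in> K" using partial_deriv_eq_0_outside[of K "osc h" x k] K gevrey_in_zero_outside[OF h(2)] by blast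
  qed
  ultimately show ?thesis using K by (simp add: gevrey_in_def closure_minimal)
qed

lemma osc_W_gevrey_in:
  assumes \<psi>: "\<psi> \<in> gevrey_c s" and t: "t \<le> T"
  shows "\<exists>K. compact K \<and> (\<forall>\<tau>\<in>{0..t}. \<forall>i j. osc (W t \<tau> i j \<psi>) \<in> gevrey_in s K)"
proof -
  obtain r where r: "0 < r" "\<And>(x :: real ^ 'n) k. \<psi> x \<noteq> 0 \<Longrightarrow> \<bar>x $ k\<bar> \<le> r"
  proof -
    obtain r where "\<And>x. x \<in> {x. \<psi> x \<noteq> 0} \<Longrightarrow> norm x \<le> r" using \<psi> unfolding gevrey_c_iff bounded_iff by blast
    then have "\<bar>x $ k\<bar> \<le> max r 1" if "\<psi> x \<noteq> 0" for x :: "real ^ 'n" and k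
      using component_le_norm_cart[of x k] that by fastforce
    then show thesis by (intro that[of "max r 1"]) auto
  qed
  have "osc (W t \<tau> i j \<psi>) \<in> gevrey_in s (cube (4 * (2 * D * T + r)))" if "\<tau> \<in> {0..t}" for \<tau> i j
    unfolding W_def using that by (intro osc_E_gevrey_in[OF \<psi> _ _ t r]) auto
  then show ?thesis using compact_cube by blast
qed

lemma osc_W_gevrey_c:
  assumes "0 \<le> \<tau>" "\<tau> \<le> t" "t \<le> T" "\<psi> \<in> gevrey_c s"
  shows "osc (W t \<tau> i j \<psi>) \<in> gevrey_c s"
proof -
  obtain K where "compact K" "\<forall>\<tau>\<in>{0..t}. \<forall>i j. osc (W t \<tau> i j \<psi>) \<in> gevrey_in s K"
    using osc_W_gevrey_in[OF assms(4,3)] by blast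
  then show ?thesis using gevrey_in_subset_gevrey_c assms(1,2) by (metis atLeastAtMost_iff subsetD)
qed

text \<open>
  The derivative of the pairing in \<open>\<tau>\<close> vanishes, as \<open>\<tau> \<mapsto> E t \<tau>\<close> solves the adjoint equation.
\<close>

lemma pairing_constant:
  fixes u u' :: "real \<Rightarrow> 'n functional ^ 'm"
  assumes C1: "\<And>i. C1_with_deriv (ultradistr_top s) {0..T} (\<lambda>t. u t $ i) (\<lambda>t. u' t $ i)"
    and eq: "\<And>t i \<phi>. t \<in> {0..T} \<Longrightarrow> \<phi> \<in> gevrey_c s \<Longrightarrow>
      (u' t $ i) \<phi> = \<i> * (\<Sum>l\<in>UNIV. B t $ i $ l * (u t $ l) \<phi>) - (\<Sum>k\<in>UNIV. \<Sum>l\<in>UNIV. A k t $ i $ l * (u t $ l) (partial_deriv k \<phi>))"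
    and t0: "t0 \<in> {0..T}" and \<psi>: "\<psi> \<in> gevrey_c s"
  shows "(\<Sum>j\<in>UNIV. (u t0 $ j) (osc (W t0 t0 i j \<psi>))) = (\<Sum>j\<in>UNIV. (u 0 $ j) (osc (W t0 0 i j \<psi>)))"
proof -
  obtain K where Kc: "compact K" and KW: "\<And>\<tau> j. \<tau> \<in> {0..t0} \<Longrightarrow> osc (W t0 \<tau> i j \<psi>) \<in> gevrey_in s K"
    using osc_W_gevrey_in[OF \<psi>, of t0] t0 by auto
  have K: "compact K" "closed K" using Kc compact_imp_closed by auto
  have t0': "t0 \<le> T" "{0..t0} \<subseteq> {0..T}" using t0 by auto
  have dec: "decaying s (W t0 \<tau> i l \<psi>)" and inK: "osc (W t0 \<tau> i l \<psi>) \<in> gevrey_in s K" if "\<tau> \<in> {0..t0}" for \<tau> l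
  proof -
    have \<tau>: "0 \<le> \<tau>" "\<tau> \<le> t0" using that by auto
    show "decaying s (W t0 \<tau> i l \<psi>)" by (rule W_decaying[OF \<tau> t0'(1) \<psi>])
    show "osc (W t0 \<tau> i l \<psi>) \<in> gevrey_in s K" by (rule KW[OF that])
  qed
  have inK': "partial_deriv k (osc (W t0 \<tau> i l \<psi>)) \<in> gevrey_in s K" if "\<tau> \<in> {0..t0}" for \<tau> l k
    by (rule gevrey_in_partial_deriv_osc[OF dec[OF that] inK[OF that] K(2)])
  have inc: "f \<in> gevrey_c s" if "f \<in> gevrey_in s K" for f
    using that gevrey_in_subset_gevrey_c[OF K(1)] by blast
  \<comment> \<open>The derivative of \<open>W t0 \<tau> i j \<psi>\<close> in \<tau>, given by the
    adjoint equation for \<open>E\<close>.\<close>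
  define h' where "h' j \<tau> = (\<lambda>\<xi>. (kappa *\<^sub>R (- (E (cvec \<xi>) t0 \<tau> ** L (cvec \<xi>) \<tau>)) $ i) $ j * ft \<psi> \<xi>)" for j \<tau>
  have h'_eq: "h' j \<tau> = (\<lambda>\<xi>. (\<Sum>l\<in>UNIV. (- (\<i> * B \<tau> $ l $ j)) * W t0 \<tau> i l \<psi> \<xi>)
      + (\<Sum>l\<in>UNIV. \<Sum>k\<in>UNIV. A k \<tau> $ l $ j * (\<i> * complex_of_real (\<xi> $ k) * W t0 \<tau> i l \<psi> \<xi>)))" for j \<tau>
  proof
    fix \<xi>
    have "h' j \<tau> \<xi> = of_real kappa * (- (E (cvec \<xi>) t0 \<tau> ** L (cvec \<xi>) \<tau>)) $ i $ j * ft \<psi> \<xi>"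
      by (simp add: h'_def scaleR_conv_of_real[of _ "_ :: complex"])
    also have "\<dots> = (\<Sum>l\<in>UNIV. (- (\<i> * B \<tau> $ l $ j)) * W t0 \<tau> i l \<psi> \<xi>)
      + (\<Sum>l\<in>UNIV. \<Sum>k\<in>UNIV. A k \<tau> $ l $ j * (\<i> * complex_of_real (\<xi> $ k) * W t0 \<tau> i l \<psi> \<xi>))"
      unfolding E_L_nth W_def distrib_left distrib_right sum_distrib_left sum_distrib_right
      by (intro arg_cong2[of _ _ _ _ "(+)"] sum.cong refl)
         (simp_all add: cvec_def scaleR_conv_of_real[of _ "_ :: complex"])
    finally show "h' j \<tau> \<xi> = (\<Sum>l\<in>UNIV. (- (\<i> * B \<tau> $ l $ j)) * W t0 \<tau> i l \<psi> \<xi>)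
      + (\<Sum>l\<in>UNIV. \<Sum>k\<in>UNIV. A k \<tau> $ l $ j * (\<i> * complex_of_real (\<xi> $ k) * W t0 \<tau> i l \<psi> \<xi>))" .
  qed
  have h'_osc: "osc (h' j \<tau>) = (\<lambda>x. (\<Sum>l\<in>UNIV. (- (\<i> * B \<tau> $ l $ j)) * osc (W t0 \<tau> i l \<psi>) x)
      + (\<Sum>l\<in>UNIV. \<Sum>k\<in>UNIV. A k \<tau> $ l $ j * partial_deriv k (osc (W t0 \<tau> i l \<psi>)) x))" if "\<tau> \<in> {0..t0}" for j \<tau>
    unfolding h'_eq by (rule osc_first_order_combination[OF s dec[OF that]])
  have h'_dec: "decaying s (h' j \<tau>)" if "\<tau> \<in> {0..t0}" for j \<tau>
    unfolding h'_eq by (intro decaying_add decaying_sum decaying_cmult decaying_component[OF s] dec that)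
  have h'_in: "osc (h' j \<tau>) \<in> gevrey_in s K" if "\<tau> \<in> {0..t0}" for j \<tau>
    unfolding h'_osc[OF that]
    by (intro lin_spaceD(2,3)[OF lin_space_gevrey_in[OF s]] lin_space_sum[OF lin_space_gevrey_in[OF s]] inK inK' that)
  have u: "u r $ j \<in> dual_space (gevrey_c_top s)" if "r \<in> {0..T}" for r j
    using C1[of j] that unfolding C1_with_deriv_def topspace_ultradistr_top by blast
  have lim: "limitin (ultradistr_top s) (\<lambda>r \<phi>. ((u r $ j) \<phi> - (u \<tau> $ j) \<phi>) / complex_of_real (r - \<tau>)) (u' \<tau> $ j) (at \<tau> within {0..t0})"
    if "\<tau> \<in> {0..t0}" for \<tau> j
  proof -
    have "limitin (ultradistr_top s) (\<lambda>r \<phi>. ((u r $ j) \<phi> - (u \<tau> $ j) \<phi>) / complex_of_real (r - \<tau>)) (u' \<tau> $ j) (at \<tau> within {0..T})"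
      using C1[of j] that t0' unfolding C1_with_deriv_def by blast
    then show ?thesis unfolding atin_within_euclidean[symmetric] by (rule limit_within_subset) (rule t0'(2))
  qed
  have u': "u' \<tau> $ j \<in> dual_space (gevrey_c_top s)" if "\<tau> \<in> {0..t0}" for \<tau> j
    using lim[OF that, of j] unfolding limitin_def topspace_ultradistr_top by blast
  have ft_le: "\<exists>M. \<forall>\<xi>. norm (ft \<psi> \<xi>) \<le> M * exp (- N * weight s \<xi>)" for N
    by (rule decaying_bound[OF decaying_ft[OF s \<psi>]])
  have deriv: "((\<lambda>r. (u r $ j) (osc (W t0 r i j \<psi>))) has_vector_derivative (u' \<tau> $ j) (osc (W t0 \<tau> i j \<psi>)) + (u \<tau> $ j) (osc (h' j \<tau>))) (at \<tau> within {0..t0})"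
    if \<tau>: "\<tau> \<in> {0..t0}" for \<tau> j
  proof (rule pairing_has_vector_derivative[OF s K(1) _ u'[OF \<tau>] lim[OF \<tau>] \<tau> dec inK _ h'_dec[OF \<tau>] h'_in[OF \<tau>]])
    show "u r $ j \<in> dual_space (gevrey_c_top s)" if "r \<in> {0..t0}" for r using u that t0'(2) by blast
    fix N :: real
    \<comment> \<open>The decay beyond \<open>N\<close> is reserved for the growth of the
      multiplier.\<close>
    obtain M where M: "\<And>\<xi>. norm (ft \<psi> \<xi>) \<le> M * exp (- (N + (C0 + 2)) * weight s \<xi>)" using ft_le by blast
    show "\<exists>D. \<forall>r\<in>{0..t0}. \<forall>\<xi>. norm (W t0 r i j \<psi> \<xi>) \<le> D * exp (- N * weight s \<xi>)"
    proof (intro exI ballI allI)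
      fix r \<xi> assume "r \<in> {0..t0}"
      then have r: "0 \<le> r" "r \<le> t0" by auto
      show "norm (W t0 r i j \<psi> \<xi>) \<le> (\<bar>kappa\<bar> * exp C0) * M * exp (- N * weight s \<xi>)"
        using exp_weight_combine[OF order_trans[OF Finite_Cartesian_Product.norm_nth_le row_bound[OF r t0'(1)]] M]
        by (simp add: W_def)
    qed
    fix e :: real assume e: "0 < e"
    have M0: "0 \<le> M" using order_trans[OF norm_ge_zero M[of 0]] by (simp add: zero_le_mult_iff)
    define d where "d = e / (M + 1)"
    have d: "0 < d" "d * M \<le> e" using e M0 by (auto simp: d_def field_simps)
    show "\<forall>\<^sub>F r in at \<tau> within {0..t0}. \<forall>\<xi>. norm ((W t0 r i j \<psi> \<xi> - W t0 \<tau> i j \<psi> \<xi>) / complex_of_real (r - \<tau>) - h' j \<tau> \<xi>) \<le> e * exp (- N * weight s \<xi>)"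
    proof (rule eventually_mono[OF backward_quotient_modulus[OF t0'(1) \<tau> d(1)]], intro allI)
      fix r \<xi>
      let ?Q = "(E (cvec \<xi>) t0 r - E (cvec \<xi>) t0 \<tau>) /\<^sub>R (r - \<tau>) - (- (E (cvec \<xi>) t0 \<tau> ** L (cvec \<xi>) \<tau>))"
      assume "\<forall>\<xi>. norm ((E (cvec \<xi>) t0 r - E (cvec \<xi>) t0 \<tau>) /\<^sub>R (r - \<tau>) - (- (E (cvec \<xi>) t0 \<tau> ** L (cvec \<xi>) \<tau>))) \<le> d * exp ((C0 + 2) * weight s \<xi>)"
      then have Q: "norm ?Q \<le> d * exp ((C0 + 2) * weight s \<xi>)" by blast
      have "(W t0 r i j \<psi> \<xi> - W t0 \<tau> i j \<psi> \<xi>) / complex_of_real (r - \<tau>) - h' j \<tau> \<xi> = (complex_of_real kappa * ?Q $ i $ j) * ft \<psi> \<xi>"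
        by (simp add: W_def h'_def scaleR_conv_of_real[of _ "_ :: complex"] divide_inverse algebra_simps)
      also have "norm \<dots> \<le> d * M * exp (- (N + (C0 + 2) - (C0 + 2)) * weight s \<xi>)"
      proof (rule exp_weight_combine[OF _ M less_imp_le[OF d(1)]])
        have "norm (complex_of_real kappa * ?Q $ i $ j) \<le> 1 * norm ?Q"
          unfolding norm_mult norm_of_real using kappa_nonneg by (intro mult_mono norm_entry_le) auto
        then show "norm (complex_of_real kappa * ?Q $ i $ j) \<le> d * exp ((C0 + 2) * weight s \<xi>)" using Q by linarith
      qed
      also have "\<dots> \<le> e * exp (- N * weight s \<xi>)" using d(2) by (simp add: mult_right_mono)
      finally show "norm ((W t0 r i j \<psi> \<xi> - W t0 \<tau> i j \<psi> \<xi>) / complex_of_real (r - \<tau>) - h' j \<tau> \<xi>) \<le> e * exp (- N * weight s \<xi>)" .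
    qed
  qed
  define F where "F r = (\<Sum>j\<in>UNIV. (u r $ j) (osc (W t0 r i j \<psi>)))" for r
  have "(F has_vector_derivative 0) (at \<tau> within {0..t0})" if \<tau>: "\<tau> \<in> {0..t0}" for \<tau>
  proof -
    have \<tau>T: "\<tau> \<in> {0..T}" using \<tau> t0'(2) by blast
    let ?v = "\<lambda>l. osc (W t0 \<tau> i l \<psi>)"
    have 1: "(u' \<tau> $ j) (?v j) = (\<Sum>l\<in>UNIV. \<i> * B \<tau> $ j $ l * (u \<tau> $ l) (?v j)) - (\<Sum>l\<in>UNIV. \<Sum>k\<in>UNIV. A k \<tau> $ j $ l * (u \<tau> $ l) (partial_deriv k (?v j)))" for j
      unfolding eq[OF \<tau>T inc[OF inK[OF \<tau>]]] by (subst (2) sum.swap) (simp add: sum_distrib_left mult.assoc)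
    have 2: "(u \<tau> $ j) (osc (h' j \<tau>)) = (\<Sum>l\<in>UNIV. (- (\<i> * B \<tau> $ l $ j)) * (u \<tau> $ j) (?v l)) + (\<Sum>l\<in>UNIV. \<Sum>k\<in>UNIV. A k \<tau> $ l $ j * (u \<tau> $ j) (partial_deriv k (?v l)))" for j
      unfolding h'_osc[OF \<tau>]
      by (rule dual_space_first_order_combination[OF lin_space_gevrey_c[OF s] u[OF \<tau>T, unfolded gevrey_c_top_eq]])
         (intro inc inK inK' \<tau>)+
    \<comment> \<open>\<open>L\<close> acts from the left in the system and from the right, with a
      minus sign, in the adjoint one. So the two contributions agree up to sign after an exchange of
      the indices \<open>j\<close> and \<open>l\<close>.\<close>
    have "(\<Sum>j\<in>UNIV. (u' \<tau> $ j) (?v j)) + (\<Sum>j\<in>UNIV. (u \<tau> $ j) (osc (h' j \<tau>))) = 0"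
    proof -
      have a: "(\<Sum>j\<in>UNIV. \<Sum>l\<in>UNIV. (- (\<i> * B \<tau> $ l $ j)) * (u \<tau> $ j) (?v l)) = - (\<Sum>j\<in>UNIV. \<Sum>l\<in>UNIV. \<i> * B \<tau> $ j $ l * (u \<tau> $ l) (?v j))"
        by (subst sum.swap) (simp add: sum_negf)
      have b: "(\<Sum>j\<in>UNIV. \<Sum>l\<in>UNIV. \<Sum>k\<in>UNIV. A k \<tau> $ l $ j * (u \<tau> $ j) (partial_deriv k (?v l))) = (\<Sum>j\<in>UNIV. \<Sum>l\<in>UNIV. \<Sum>k\<in>UNIV. A k \<tau> $ j $ l * (u \<tau> $ l) (partial_deriv k (?v j)))"
        by (rule sum.swap)
      show ?thesis unfolding 1 2 sum.distrib sum_subtractf a b by simp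
    qed
    then have "(\<Sum>j\<in>UNIV. (u' \<tau> $ j) (?v j) + (u \<tau> $ j) (osc (h' j \<tau>))) = 0" by (simp only: sum.distrib)
    moreover have "(F has_vector_derivative (\<Sum>j\<in>UNIV. (u' \<tau> $ j) (?v j) + (u \<tau> $ j) (osc (h' j \<tau>)))) (at \<tau> within {0..t0})"
      unfolding F_def by (intro has_vector_derivative_sum deriv \<tau>)
    ultimately show ?thesis by simp
  qed
  then obtain c where c: "\<And>\<tau>. \<tau> \<in> {0..t0} \<Longrightarrow> F \<tau> = c"
    using has_vector_derivative_zero_constant[of "{0..t0}" F] by auto
  have "F t0 = F 0" using c[of t0] c[of 0] t0 by simp
  then show ?thesis by (simp add: F_def)
qed

end

section \<open>Existence and uniqueness\<close>

lemma C1_with_deriv_cong: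
  assumes C1: "C1_with_deriv X S u u'" and eq: "\<And>t. t \<in> S \<Longrightarrow> v t = u t"
  shows "C1_with_deriv X S v u'"
  unfolding C1_with_deriv_def
proof (intro conjI ballI)
  fix t assume t: "t \<in> S"
  show "v t \<in> topspace X" using C1 t by (simp add: C1_with_deriv_def eq)
  have "limitin X (\<lambda>r \<phi>. (u r \<phi> - u t \<phi>) / complex_of_real (r - t)) (u' t) (at t within S)"
    using C1 t by (simp add: C1_with_deriv_def)
  then show "limitin X (\<lambda>r \<phi>. (v r \<phi> - v t \<phi>) / complex_of_real (r - t)) (u' t) (at t within S)"
  proof (rule limitin_transform_eventually[rotated])
    have "\<forall>\<^sub>F r in at t within S. r \<in> S" by (simp add: eventually_at_filter)
    then show "\<forall>\<^sub>F r in at t within S. (\<lambda>\<phi>. (u r \<phi> - u t \<phi>) / complex_of_real (r - t)) = (\<lambda>\<phi>. (v r \<phi> - v t \<phi>) / complex_of_real (r - t))"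
      by eventually_elim (simp add: eq t)
  qed
qed (use C1 in \<open>simp add: C1_with_deriv_def\<close>)

text \<open>Membership in \<open>extensional {0..T}\<close> fixes the values off the interval, so
  that uniqueness becomes an equality of functions. \<open>pairing_constant\<close> expresses a
  solution at time \<open>t\<close> by its initial value, as \<open>E\<close> is the identity at
  \<tau> = t.\<close>

lemma (in evolution) cauchy_problem_well_posed:
  fixes g :: "'n functional ^ 'm"
  assumes g: "\<And>j. g $ j \<in> ultradistr_compact s"
  shows "\<exists>!u. u \<in> extensional {0..T} \<and> solves_cauchy_problem s T A B g u"
proof
  let ?u = "restrict (\<lambda>t. \<chi> i. U g t i) {0..T}"
  have zero: "0 \<in> {0..T}" using T by simp
  show "?u \<in> extensional {0..T} \<and> solves_cauchy_problem s T A B g ?u"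
    unfolding solves_cauchy_problem_def
  proof (intro conjI restrict_extensional exI[of _ "\<lambda>t. \<chi> i. U' g t i"] allI ballI)
    show "C1_with_deriv (ultradistr_top s) {0..T} (\<lambda>t. ?u t $ i) (\<lambda>t. (\<chi> i. U' g t i) $ i)" for i
      unfolding vec_lambda_beta by (rule C1_with_deriv_cong[OF U_C1[OF g]]) simp
    show "?u 0 $ i = restrict_functional (gevrey_c s) (g $ i)" for i
      using U_0[OF g] zero by simp
    show "- \<i> * ((\<chi> i. U' g t i) $ i) \<phi> - (\<Sum>k\<in>UNIV. \<Sum>j\<in>UNIV. A k t $ i $ j * Dx s k (?u t $ j) \<phi>)
        - (\<Sum>j\<in>UNIV. B t $ i $ j * (?u t $ j) \<phi>) = 0"
      if t: "t \<in> {0..T}" and \<phi>: "\<phi> \<in> gevrey_c s" for t i \<phi>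
      unfolding Dx_eq[OF \<phi>] equation_solved_for_derivative using U'_equation[OF g t \<phi>] t by simp
  qed
  fix v :: "real \<Rightarrow> 'n functional ^ 'm" assume v: "v \<in> extensional {0..T} \<and> solves_cauchy_problem s T A B g v"
  then obtain v' where C1: "\<And>i. C1_with_deriv (ultradistr_top s) {0..T} (\<lambda>t. v t $ i) (\<lambda>t. v' t $ i)"
    and eq: "\<And>t i \<phi>. t \<in> {0..T} \<Longrightarrow> \<phi> \<in> gevrey_c s \<Longrightarrow>
           - \<i> * (v' t $ i) \<phi>
           - (\<Sum>k\<in>UNIV. \<Sum>j\<in>UNIV. A k t $ i $ j * Dx s k (v t $ j) \<phi>)
           - (\<Sum>j\<in>UNIV. B t $ i $ j * (v t $ j) \<phi>) = 0"
    and init: "\<And>i. v 0 $ i = restrict_functional (gevrey_c s) (g $ i)"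
    unfolding solves_cauchy_problem_def by blast
  have eq': "(v' t $ i) \<phi> = \<i> * (\<Sum>l\<in>UNIV. B t $ i $ l * (v t $ l) \<phi>) - (\<Sum>k\<in>UNIV. \<Sum>l\<in>UNIV. A k t $ i $ l * (v t $ l) (partial_deriv k \<phi>))"
    if "t \<in> {0..T}" "\<phi> \<in> gevrey_c s" for t i \<phi>
    using eq[OF that, of i] unfolding Dx_eq[OF that(2)] equation_solved_for_derivative .
  have vt: "v t $ i = U g t i" if t: "t \<in> {0..T}" for t i
  proof
    fix \<psi> :: "real ^ 'n \<Rightarrow> complex"
    have dual: "v t $ j \<in> dual_space (gevrey_c_top s)" for j
      using C1[of j] t unfolding C1_with_deriv_def topspace_ultradistr_top by blast
    show "(v t $ i) \<psi> = U g t i \<psi>"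
    proof (cases "\<psi> \<in> gevrey_c s")
      case True
      have t': "0 \<le> t" "t \<le> T" using t by auto
      have "(v t $ j) (\<lambda>x. 0) = 0" for j
        using dual_spaceD(2)[OF dual[unfolded gevrey_c_top_eq] True, of j 0] by simp
      then have "(v t $ i) \<psi> = (\<Sum>j\<in>UNIV. if i = j then (v t $ j) \<psi> else 0)" by simp
      also have "\<dots> = (\<Sum>j\<in>UNIV. (v t $ j) (osc (W t t i j \<psi>)))"
        using \<open>\<And>j. (v t $ j) (\<lambda>x. 0) = 0\<close> by (intro sum.cong) (simp_all add: W_refl[OF t True])
      also have "\<dots> = (\<Sum>j\<in>UNIV. (v 0 $ j) (osc (W t 0 i j \<psi>)))"
        by (rule pairing_constant[OF C1 eq' t True])
      also have "\<dots> = U g t i \<psi>"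
        unfolding U_apply[OF g True] init
        using osc_W_gevrey_c[OF order_refl t' True] by (simp add: restrict_functional_def)
      finally show ?thesis .
    next
      case False
      then show ?thesis
        using dual_spaceD(3)[OF dual[unfolded gevrey_c_top_eq] False] dual_spaceD(3)[OF U_dual[OF g t, unfolded gevrey_c_top_eq] False]
        by simp
    qed
  qed
  show "v = ?u"
    by (rule extensionalityI[of _ "{0..T}"]) (use v vt in \<open>auto simp: vec_eq_iff\<close>)
qed

lemma norm_matrix_le_columns:
  fixes X :: "complex ^ 'm::finite ^ 'm"
  assumes "\<And>j. norm (X *v axis j 1) \<le> b"
  shows "norm X \<le> (real CARD('m))\<^sup>2 * b"
proof -
  have "norm X \<le> (\<Sum>i\<in>UNIV. norm (X $ i))" by (simp add: norm_vec_def L2_set_le_sum)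
  also have "\<dots> \<le> (\<Sum>i\<in>UNIV. \<Sum>j\<in>UNIV. norm (X $ i $ j))" by (intro sum_mono) (simp add: norm_vec_def L2_set_le_sum)
  also have "\<dots> \<le> (\<Sum>i\<in>(UNIV :: 'm set). \<Sum>j\<in>(UNIV :: 'm set). b)"
  proof (intro sum_mono)
    fix i j :: 'm
    have "X $ i $ j = (X *v axis j 1) $ i" by (simp add: matrix_vector_mult_def axis_def if_distrib[of "(*) _"] cong: if_cong)
    then show "norm (X $ i $ j) \<le> b" using order_trans[OF Finite_Cartesian_Product.norm_nth_le assms[of j]] by simp
  qed
  finally show ?thesis by (simp add: power2_eq_square mult.assoc)
qed

text \<open>For \<open>CARD('m) = 1\<close> the quotient in the bound for \<open>s\<close> would be
  \<open>1 / 0 = 0\<close> rather than infinity, hence the case distinction.\<close>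

theorem theorem1p2:
  fixes A :: "'n::finite \<Rightarrow> real \<Rightarrow> complex ^ 'm::finite ^ 'm"
    and B :: "real \<Rightarrow> complex ^ 'm ^ 'm"
    and lam :: "nat \<Rightarrow> real \<Rightarrow> real ^ 'n \<Rightarrow> real"
    and T \<alpha> M c s :: real
    and g0 :: "'n functional ^ 'm"
  assumes T: "0 < T"
    and A_regular: "\<And>k i j. C_k_on (CARD('m) - 1) {0..T} (\<lambda>t. A k t $ i $ j)"
    and B_regular: "\<And>i j. C_k_on (CARD('m) - 1) {0..T} (\<lambda>t. B t $ i $ j)"
    and eigenvalues: "\<And>t \<xi>. t \<in> {0..T} \<Longrightarrow>
      charpoly (symbol A t \<xi>) = (\<Prod>j\<in>{1..CARD('m)}. [:- complex_of_real (lam j t \<xi>), 1:])"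
    and ordered: "\<And>t \<xi> i j. t \<in> {0..T} \<Longrightarrow> 1 \<le> i \<Longrightarrow> i \<le> j \<Longrightarrow> j \<le> CARD('m) \<Longrightarrow>
      lam i t \<xi> \<le> lam j t \<xi>"
    and alpha: "0 < \<alpha>" "\<alpha> \<le> 1"
    and M: "0 < M"
    and hoelder: "\<And>j t t' \<xi>. j \<in> {1..CARD('m)} \<Longrightarrow> t \<in> {0..T} \<Longrightarrow> t' \<in> {0..T} \<Longrightarrow>
      \<bar>lam j t \<xi> - lam j t' \<xi>\<bar> \<le> M * norm \<xi> * \<bar>t - t'\<bar> powr \<alpha>"
    and c: "0 < c"
    and separation: "\<And>i j k t \<xi>. i \<in> {1..CARD('m)} \<Longrightarrow> j \<in> {1..CARD('m)} \<Longrightarrow>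
      k \<in> {2..CARD('m)} \<Longrightarrow> t \<in> {0..T} \<Longrightarrow>
      \<bar>lam i t \<xi> - lam j t \<xi>\<bar> \<le> c * \<bar>lam k t \<xi> - lam (k - 1) t \<xi>\<bar>"
    and s: "1 < s"
      "s \<le> 1 + (if CARD('m) = 1 then \<alpha> else min \<alpha> (1 / (real CARD('m) - 1)))"
    and g0: "\<And>i. g0 $ i \<in> ultradistr_compact s"
  shows "\<exists>!u. u \<in> extensional {0..T} \<and> solves_cauchy_problem s T A B g0 u"
proof -
  have cont: "continuous_on {0..T} (\<lambda>t. B t $ i $ j)" "continuous_on {0..T} (\<lambda>t. A k t $ i $ j)" for i j k
    using A_regular B_regular C_k_on_continuous by blast+
  interpret cauchy_system A B T
    by unfold_locales (use T cont in \<open>auto intro: continuous_on_matrixI\<close>)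
  have s': "s - 1 \<le> \<alpha>" "(s - 1) * (real CARD('m) - 1) \<le> 1"
  proof -
    show "s - 1 \<le> \<alpha>" using s(2) by (auto split: if_splits)
    show "(s - 1) * (real CARD('m) - 1) \<le> 1"
    proof (cases "CARD('m) = 1")
      case False
      then have "1 < real CARD('m)" using zero_less_card_finite[where 'a='m] by linarith
      moreover have "s - 1 \<le> 1 / (real CARD('m) - 1)" using s(2) False by auto
      ultimately show ?thesis by (simp add: pos_le_divide_eq)
    qed simp
  qed
  obtain C where C: "0 \<le> C" "\<And>\<xi> V t1 t2. 0 \<le> t1 \<Longrightarrow> t1 \<le> t2 \<Longrightarrow> t2 \<le> T \<Longrightarrow>
    (\<And>t. t \<in> {0..T} \<Longrightarrow> (V has_vector_derivative (\<i> *s (symbol A t \<xi> *v V t + B t *v V t))) (at t within {0..T})) \<Longrightarrow>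
    norm (V t2) \<le> exp (C * (1 + norm \<xi> powr (1 / s))) * norm (V t1)"
    using hyperbolic_system_growth[OF T A_regular cont(1) eigenvalues ordered M hoelder separation s(1) s'] by blast
  define m2 where "m2 = (real CARD('m))\<^sup>2"
  have "evolution A B T s (C + m2)"
  proof unfold_locales
    show "0 < s" "0 \<le> C + m2" using s(1) C(1) by (auto simp: m2_def)
    fix \<xi> :: "real ^ 'n" and t \<tau> :: real assume \<tau>: "0 \<le> \<tau>" "\<tau> \<le> t" "t \<le> T"
    have "norm (E (cvec \<xi>) t \<tau> *v axis j 1) \<le> exp (C * (1 + weight s \<xi>))" for j
    proof -
      \<comment> \<open>Each column of \<open>E\<close> solves the system with the symbol at
        \<open>- \<xi>\<close>; this is the sign in the definition of \<open>L\<close>, and the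
        weight does not see it.\<close>
      have "norm (E (cvec \<xi>) t \<tau> *v axis j 1) \<le> exp (C * (1 + norm (- \<xi>) powr (1 / s))) * norm (E (cvec \<xi>) \<tau> \<tau> *v axis j (1 :: complex))"
      proof (rule C(2)[OF \<tau>])
        fix r assume r: "r \<in> {0..T}"
        have "((\<lambda>t. E (cvec \<xi>) t \<tau> *v axis j 1) has_vector_derivative (L (cvec \<xi>) r ** E (cvec \<xi>) r \<tau>) *v axis j 1) (at r within {0..T})"
          by (rule bounded_linear.has_vector_derivative[OF bounded_bilinear.bounded_linear_left[OF bounded_bilinear_matrix_vector_mult] E_deriv1[OF r]])
        then show "((\<lambda>t. E (cvec \<xi>) t \<tau> *v axis j 1) has_vector_derivative
            \<i> *s (symbol A r (- \<xi>) *v (E (cvec \<xi>) r \<tau> *v axis j 1) + B r *v (E (cvec \<xi>) r \<tau> *v axis j 1))) (at r within {0..T})"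
          unfolding matrix_vector_mul_assoc[symmetric, of "L (cvec \<xi>) r"] L_cvec .
      qed
      moreover have "E (cvec \<xi>) \<tau> \<tau> *v axis j 1 = (axis j 1 :: complex ^ 'm)" using \<tau> by (simp add: E_refl)
      ultimately show ?thesis by (simp add: weight_def norm_axis_1)
    qed
    then have "norm (E (cvec \<xi>) t \<tau>) \<le> m2 * exp (C * (1 + weight s \<xi>))"
      unfolding m2_def by (rule norm_matrix_le_columns)
    \<comment> \<open>The factor lost in passing from columns to the matrix is absorbed by adding
      \<open>m2\<close> to the growth constant.\<close>
    also have "m2 \<le> exp (m2 * (1 + weight s \<xi>))"
    proof -
      have "m2 * 1 \<le> m2 * (1 + weight s \<xi>)" by (intro mult_left_mono) (auto simp: m2_def)
      then show ?thesis using exp_ge_add_one_self[of "m2 * (1 + weight s \<xi>)"] by linarith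
    qed
    then have "m2 * exp (C * (1 + weight s \<xi>)) \<le> exp (m2 * (1 + weight s \<xi>)) * exp (C * (1 + weight s \<xi>))"
      by (rule mult_right_mono) simp
    finally show "norm (E (cvec \<xi>) t \<tau>) \<le> exp ((C + m2) * (1 + weight s \<xi>))"
      by (simp only: distrib_right exp_add mult.commute)
  qed
  then interpret evolution A B T s "C + m2" .
  show ?thesis by (rule cauchy_problem_well_posed[OF g0])
qed

end
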